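(* Let $\Delta$ be a simple integral polytope in $\mathbb{R}^n$, let $k \ge 1$ be an integer, and let $f \in C^{nk}_c(\mathbb{R}^n)$ be a compactly supported function on $\mathbb{R}^n$ of class $C^{nk}$. Choose a polarizing vector $\xi$ for $\Delta$. Then $$\sum_{\Delta \cap \mathbb{Z}^n}{}^{'} f \;=\; \left.\sum_F \sum_{\gamma \in \Gamma_F^\flat} \mathbf{M}_{\gamma,F}^k \int_{\Delta(h)} f(x)\, dx \right|_{h=0} + R^\Delta_k(f),$$ where the outer sum runs over all faces $F$ of $\Delta$, and the differential operators $\mathbf{M}_{\gamma,F}^k$ and the remainder $R_k^\Delta(f)$ are those defined in the context. Moreover, the differential operators $\mathbf{M}_{\gamma,F}^k$ are of order $\le k$ in each of the variables $h_1,\ldots,h_d$. Also, the remainder $R_k^\Delta(f)$ is a sum of integrals over orthants (the polarized tangent cones $\mathbf{C}_v^\sharp$) of bounded periodic functions times various partial derivatives of $f$ of order no less than $k$ and no more than $kn$. Finally, this remainder is independent of the choice of the polarizing vector and is a distribution supported on the polytope $\Delta$ (in particular it vanishes on every $f$ whose support is disjoint from $\Delta$).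
   Context: **Polytope.** A compact convex polytope $\Delta\subset\mathbb{R}^n$ is integral if its vertices lie in $\mathbb{Z}^n$, and simple if exactly $n$ edges emanate from each vertex (equivalently each vertex is the intersection of exactly $n$ facets). Write $\Delta = \bigcap_{i=1}^d \{x : \langle u_i,x\rangle+\mu_i\ge 0\}$ where $d$ is the number of facets and $u_i\in(\mathbb{Z}^n)^*$ is the inward normal to the $i$th facet, normalized to be a primitive element of the dual lattice $(\mathbb{Z}^n)^*$. For $h=(h_1,\dots,h_d)\in\mathbb{R}^d$ near $0$ put $\Delta(h)=\bigcap_{i=1}^d\{x: \langle u_i,x\rangle+\mu_i+h_i\ge 0\}$. Faces are non-empty, and $\Delta$ itself counts as a face. For a face $F$ let $I_F\subset\{1,\dots,d\}$ be the set of (indices of) facets containing $F$; for a vertex $v$ write $I_v$. For a vertex $v$, let $\alpha_{i,v}\in\mathbb{R}^n$, $i\in I_v$, be the basis of $\mathbb{R}^n$ dual to the basis $u_i$, $i\in I_v$, of $(\mathbb{R}^n)^*$. **Weighted sum.** $\sum'_{\Delta\cap\mathbb{Z}^n}f=\sum_{x\in\Delta\cap\mathbb{Z}^n}\mathbf{1}^w_\Delta(x)f(x)$, where $\mathbf{1}^w_\Delta(x)=2^{-c}$ if $x$ lies in the relative interior of a face of $\Delta$ of codimension $c$. **Finite groups.** For a face $F$ let $N_F=\operatorname{span}\{u_i: i\in I_F\}\subseteq(\mathbb{R}^n)^*$ and $\Gamma_F=(N_F\cap(\mathbb{Z}^n)^* )/\sum_{i\in I_F}\mathbb{Z}u_i$,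 a finite abelian group. If $F\subseteq E$ are faces, the natural map $\Gamma_E\to\Gamma_F$ is injective, and we regard $\Gamma_E\subseteq\Gamma_F$. Put $\Gamma_F^\flat=\Gamma_F\setminus\bigcup_{E\supsetneq F}\Gamma_E$, the union over faces $E$ strictly containing $F$. **Roots of unity.** For a vertex $v$, $\gamma\in\Gamma_v$, $j\in I_v$, put $\lambda_{\gamma,j,v}=e^{2\pi i\langle\gamma,\alpha_{j,v}\rangle}$ (well defined, a root of unity). For $\gamma\in\Gamma_F$ and $j\in I_F$ put $\lambda_{\gamma,j,F}=\lambda_{\gamma,j,v}$ for any vertex $v\in F$ (independent of $v$); for $j\in\{1,\dots,d\}\setminus I_F$ put $\lambda_{\gamma,j,F}=1$. **Functions $Q_{m,\lambda}$ and polynomials $\mathbf{M}^{k,\lambda}$.** Let $\lambda\ne1$ be a root of unity of order $N$. Set $Q_{0,\lambda}(x)=-\sum_{n\in\mathbb{Z}}\lambda^n\delta(x-n)$ and, for $m\ge1$, define the $N$-periodic $Q_{m,\lambda}$ by $\frac{d}{dx}Q_{m,\lambda}=Q_{m-1,\lambda}$ (as distributions) and $\int_0^NQ_{m,\lambda}(x)\,dx=0$. ($Q_{1,\lambda}$ is the bounded function equal to $\frac{\lambda}{1-\lambda}\lambda^{n}$ on $(n,n+1)$; $Q_{m,\lambda}$ is continuous for $m\ge2$.) For $k\ge1$, $$\mathbf{M}^{k,\lambda}(S)=\Big(\tfrac12+\tfrac{\lambda}{1-\lambda}\Big)S+Q_{2,\lambda}(0)S^2+\cdots+Q_{k,\lambda}(0)S^k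 .$$ For $\lambda=1$: $Q_{k,1}(x)=B_k(\{x\})/k!$ where $B_k$ is the $k$th Bernoulli polynomial and $\{x\}=x-\lfloor x\rfloor$, and $\mathbf{M}^{k,1}(S)$ is the truncation at degree $2\lfloor k/2\rfloor$ of the power series $\mathbf{L}(S)=\frac{S/2}{\tanh(S/2)}=1+\sum_{l\ge1}\frac{b_{2l}}{(2l)!}S^{2l}$. **Operators.** For a face $F$ and $\gamma\in\Gamma_F$, $\mathbf{M}^k_{\gamma,F}=\prod_{j=1}^d\mathbf{M}^{k,\lambda_{\gamma,j,F}}\big(\frac{\partial}{\partial h_j}\big)$. **Polarization.** A polarizing vector is $\xi\in(\mathbb{R}^n)^*$ with $\langle\xi,\alpha_{j,v}\rangle\ne0$ for all vertices $v$ and $j\in I_v$. If $\langle\xi,\alpha_{j,v}\rangle<0$ put $\alpha^\sharp_{j,v}=\alpha_{j,v}$, $u^\sharp_{j,v}=u_j$, $\lambda^\sharp_{\gamma,j,v}=\lambda_{\gamma,j,v}$; if $\langle\xi,\alpha_{j,v}\rangle>0$ put $\alpha^\sharp_{j,v}=-\alpha_{j,v}$, $u^\sharp_{j,v}=-u_j$, $\lambda^\sharp_{\gamma,j,v}=\lambda_{\gamma,j,v}^{-1}$. Let $\#v$ be the number of $j\in I_v$ with $\alpha^\sharp_{j,v}=-\alpha_{j,v}$, and $\mathbf{C}_v^\sharp=v+\sum_{j\in I_v}\mathbb{R}_{\ge0}\alpha^\sharp_{j,v}$ (the polarized tangent cone). **Remainder.** With $D_\alpha$ the directional derivative along $\alpha$,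 $$R_k^\Delta(f)=\sum_v(-1)^{\#v}\sum_{\gamma\in\Gamma_v}\sum_{I\subsetneq I_v}(-1)^{(k-1)(n-|I|)}\int_{\mathbf{C}_v^\sharp}\prod_{j\in I}\mathbf{M}^{k,\lambda^\sharp_{\gamma,j,v}}(-D_{\alpha^\sharp_{j,v}})\prod_{j\in I_v\setminus I}Q_{k,\lambda^\sharp_{\gamma,j,v}}(\langle u^\sharp_{j,v},x-v\rangle)\prod_{j\in I_v\setminus I}(D_{\alpha^\sharp_{j,v}})^kf(x)\,dx,$$ the outer sum being over the vertices $v$ of $\Delta$. *)

theory Defs
  imports
    "HOL-Analysis.Analysis"
    "HOL-Computational_Algebra.Computational_Algebra"
    "HOL-Algebra.Generated_Groups"
begin

text \<open>
  The dual space of \<open>real^'n\<close> is identified with \<open>real^'n\<close> itself through the standard inner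
  product; this identifies the dual of the lattice of integer vectors with that lattice.
\<close>

section \<open>Derivatives, function spaces and distributions\<close>

definition dir_deriv :: "'a::real_normed_vector \<Rightarrow> ('a \<Rightarrow> complex) \<Rightarrow> 'a \<Rightarrow> complex" where
  "dir_deriv w f x = vector_derivative (\<lambda>t. f (x + t *\<^sub>R w)) (at 0)"

primrec iter_deriv :: "'a::real_normed_vector list \<Rightarrow> ('a \<Rightarrow> complex) \<Rightarrow> 'a \<Rightarrow> complex" where
  "iter_deriv [] f = f"
| "iter_deriv (w # ws) f = dir_deriv w (iter_deriv ws f)"

text \<open>
  The mixed derivative that differentiates \<open>a j\<close> times along \<open>e j\<close>, for every \<open>j\<close>. The order of
  the differentiations is left unspecified; it is irrelevant when mixed partial derivatives
  of \<open>f\<close> commute.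
\<close>

definition multi_deriv ::
    "('i::finite \<Rightarrow> 'a::real_normed_vector) \<Rightarrow> ('i \<Rightarrow> nat) \<Rightarrow> ('a \<Rightarrow> complex) \<Rightarrow> 'a \<Rightarrow> complex" where
  "multi_deriv e a f = iter_deriv (map e (SOME js. \<forall>j. count_list js j = a j)) f"

abbreviation unit_vec :: "'i::finite \<Rightarrow> real ^ 'i" where
  "unit_vec j \<equiv> axis j 1"

text \<open>
  A differential operator with constant coefficients is represented by its symbol, a finitely
  supported family \<open>c\<close> of coefficients indexed by multi-indices. The product of the operators
  \<open>p j\<close> evaluated at the \<open>j\<close>-th derivative has the coefficients \<open>prod_symbol p\<close>.
\<close>

definition prod_symbol :: "('i::finite \<Rightarrow> complex poly) \<Rightarrow> ('i \<Rightarrow> nat) \<Rightarrow> complex" where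
  "prod_symbol p a = (\<Prod>j\<in>UNIV. coeff (p j) (a j))"

definition diff_op ::
    "('i::finite \<Rightarrow> 'a::real_normed_vector) \<Rightarrow> (('i \<Rightarrow> nat) \<Rightarrow> complex)
      \<Rightarrow> ('a \<Rightarrow> complex) \<Rightarrow> 'a \<Rightarrow> complex" where
  "diff_op e c f x = (\<Sum>a | c a \<noteq> 0. c a * multi_deriv e a f x)"

definition order_le_each :: "nat \<Rightarrow> (('i::finite \<Rightarrow> nat) \<Rightarrow> complex) \<Rightarrow> bool" where
  "order_le_each k c \<longleftrightarrow> (\<forall>a. c a \<noteq> 0 \<longrightarrow> (\<forall>j. a j \<le> k))"

primrec C_class :: "nat \<Rightarrow> ('a::euclidean_space \<Rightarrow> complex) \<Rightarrow> bool" where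
  "C_class 0 f \<longleftrightarrow> continuous_on UNIV f"
| "C_class (Suc m) f \<longleftrightarrow>
     (\<forall>x. f differentiable (at x)) \<and> (\<forall>b\<in>Basis. C_class m (dir_deriv b f))"

definition tsupport :: "('a::euclidean_space \<Rightarrow> complex) \<Rightarrow> 'a set" where
  "tsupport f = closure {x. f x \<noteq> 0}"

definition C_compact :: "nat \<Rightarrow> ('a::euclidean_space \<Rightarrow> complex) \<Rightarrow> bool" where
  "C_compact m f \<longleftrightarrow> C_class m f \<and> compact (tsupport f)"

definition test_function :: "('a::euclidean_space \<Rightarrow> complex) \<Rightarrow> bool" where
  "test_function \<phi> \<longleftrightarrow> (\<forall>m. C_compact m \<phi>)"

definition distribution :: "((real ^ 'n \<Rightarrow> complex) \<Rightarrow> complex) \<Rightarrow> bool" where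
  "distribution T \<longleftrightarrow>
     (\<forall>\<phi> \<psi>. test_function \<phi> \<longrightarrow> test_function \<psi> \<longrightarrow> T (\<lambda>x. \<phi> x + \<psi> x) = T \<phi> + T \<psi>) \<and>
     (\<forall>c \<phi>. test_function \<phi> \<longrightarrow> T (\<lambda>x. c * \<phi> x) = c * T \<phi>) \<and>
     (\<forall>K. compact K \<longrightarrow>
        (\<exists>C m. \<forall>\<phi>. test_function \<phi> \<longrightarrow> tsupport \<phi> \<subseteq> K \<longrightarrow>
           norm (T \<phi>) \<le> C * (\<Sum>a | (\<Sum>i\<in>UNIV. a i) \<le> m.
                                (SUP x. norm (multi_deriv unit_vec a \<phi> x)))))"

definition distribution_support :: "((real ^ 'n \<Rightarrow> complex) \<Rightarrow> complex) \<Rightarrow> (real ^ 'n) set" where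
  "distribution_support T =
     - \<Union>{U. open U \<and> (\<forall>\<phi>. test_function \<phi> \<longrightarrow> tsupport \<phi> \<subseteq> U \<longrightarrow> T \<phi> = 0)}"

text \<open>Invariance under translation by the lattice generated by some basis.\<close>

definition lattice_periodic :: "('a::euclidean_space \<Rightarrow> 'b) \<Rightarrow> bool" where
  "lattice_periodic p \<longleftrightarrow>
     (\<exists>B. independent B \<and> span B = UNIV \<and> (\<forall>b\<in>B. \<forall>x. p (x + b) = p x))"

section \<open>Simple integral polytopes\<close>

definition int_lattice :: "(real ^ 'n) set" where
  "int_lattice = {x. \<forall>i. x $ i \<in> \<int>}"

definition vertices :: "(real ^ 'n) set \<Rightarrow> (real ^ 'n) set" where
  "vertices \<Delta> = {v. v extreme_point_of \<Delta>}"

definition faces :: "(real ^ 'n) set \<Rightarrow> (real ^ 'n) set set" where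
  "faces \<Delta> = {F. F face_of \<Delta> \<and> F \<noteq> {}}"

definition integral_polytope :: "(real ^ 'n) set \<Rightarrow> bool" where
  "integral_polytope \<Delta> \<longleftrightarrow> polytope \<Delta> \<and> vertices \<Delta> \<subseteq> int_lattice"

definition simple_polytope :: "(real ^ 'n) set \<Rightarrow> bool" where
  "simple_polytope \<Delta> \<longleftrightarrow> polytope \<Delta> \<and> aff_dim \<Delta> = int CARD('n) \<and>
     (\<forall>v\<in>vertices \<Delta>. card {E. E edge_of \<Delta> \<and> v \<in> E} = CARD('n))"

definition primitive_vec :: "real ^ 'n \<Rightarrow> bool" where
  "primitive_vec w \<longleftrightarrow> w \<in> int_lattice \<and> w \<noteq> 0 \<and>
     (\<forall>z\<in>int_lattice. \<forall>m::int. w = of_int m *\<^sub>R z \<longrightarrow> \<bar>m\<bar> = 1)"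

definition hpoly :: "('d::finite \<Rightarrow> real ^ 'n) \<Rightarrow> real ^ 'd \<Rightarrow> (real ^ 'n) set" where
  "hpoly u \<mu> = {x. \<forall>i. u i \<bullet> x + \<mu> $ i \<ge> 0}"

definition wall :: "('d::finite \<Rightarrow> real ^ 'n) \<Rightarrow> real ^ 'd \<Rightarrow> 'd \<Rightarrow> (real ^ 'n) set" where
  "wall u \<mu> i = {x. u i \<bullet> x + \<mu> $ i = 0}"

text \<open>
  The index type \<open>'d\<close> enumerates the facets without repetition, so \<open>CARD('d)\<close> is their number.
  The inequalities defining \<open>hpoly\<close> make the normals \<open>u i\<close> inward.
\<close>

definition facet_presentation ::
    "(real ^ 'n) set \<Rightarrow> ('d::finite \<Rightarrow> real ^ 'n) \<Rightarrow> real ^ 'd \<Rightarrow> bool" where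
  "facet_presentation \<Delta> u \<mu> \<longleftrightarrow> \<Delta> = hpoly u \<mu> \<and> (\<forall>i. primitive_vec (u i)) \<and>
     bij_betw (\<lambda>i. \<Delta> \<inter> wall u \<mu> i) UNIV {G. G facet_of \<Delta>}"

text \<open>
  The facets containing a face \<open>F\<close>. Here and below, a vertex \<open>v\<close> is treated as the face \<open>{v}\<close>.
\<close>

definition facets_at :: "('d::finite \<Rightarrow> real ^ 'n) \<Rightarrow> real ^ 'd \<Rightarrow> (real ^ 'n) set \<Rightarrow> 'd set" where
  "facets_at u \<mu> F = {i. F \<subseteq> wall u \<mu> i}"

definition edge_vec ::
    "('d::finite \<Rightarrow> real ^ 'n) \<Rightarrow> real ^ 'd \<Rightarrow> real ^ 'n \<Rightarrow> 'd \<Rightarrow> real ^ 'n" where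
  "edge_vec u \<mu> v i =
     (THE \<alpha>. \<forall>j\<in>facets_at u \<mu> {v}. u j \<bullet> \<alpha> = (if j = i then 1 else 0))"

definition weight :: "(real ^ 'n) set \<Rightarrow> real ^ 'n \<Rightarrow> real" where
  "weight \<Delta> x =
     (1 / 2) ^ nat (int CARD('n) - aff_dim (THE F. F face_of \<Delta> \<and> x \<in> rel_interior F))"

definition weighted_sum :: "(real ^ 'n) set \<Rightarrow> (real ^ 'n \<Rightarrow> complex) \<Rightarrow> complex" where
  "weighted_sum \<Delta> f = (\<Sum>x\<in>\<Delta> \<inter> int_lattice. of_real (weight \<Delta> x) * f x)"

section \<open>The finite groups and their characters\<close>

definition normal_lattice ::
    "('d::finite \<Rightarrow> real ^ 'n) \<Rightarrow> real ^ 'd \<Rightarrow> (real ^ 'n) set \<Rightarrow> (real ^ 'n) monoid" where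
  "normal_lattice u \<mu> F =
     \<lparr>carrier = span (u ` facets_at u \<mu> F) \<inter> int_lattice, monoid.mult = (+), one = 0\<rparr>"

definition normal_sublattice ::
    "('d::finite \<Rightarrow> real ^ 'n) \<Rightarrow> real ^ 'd \<Rightarrow> (real ^ 'n) set \<Rightarrow> (real ^ 'n) set" where
  "normal_sublattice u \<mu> F = generate (normal_lattice u \<mu> F) (u ` facets_at u \<mu> F)"

definition \<Gamma> ::
    "('d::finite \<Rightarrow> real ^ 'n) \<Rightarrow> real ^ 'd \<Rightarrow> (real ^ 'n) set \<Rightarrow> (real ^ 'n) set monoid" where
  "\<Gamma> u \<mu> F = normal_lattice u \<mu> F Mod normal_sublattice u \<mu> F"

text \<open>
  The natural map into \<open>\<Gamma> u \<mu> F\<close> from the group of a face containing \<open>F\<close>: it sends a coset of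
  the smaller sublattice to the coset of \<open>normal_sublattice u \<mu> F\<close> that contains it.
\<close>

definition \<Gamma>_incl ::
    "('d::finite \<Rightarrow> real ^ 'n) \<Rightarrow> real ^ 'd \<Rightarrow> (real ^ 'n) set \<Rightarrow> (real ^ 'n) set \<Rightarrow> (real ^ 'n) set"
  where "\<Gamma>_incl u \<mu> F \<gamma> = normal_sublattice u \<mu> F <#>\<^bsub>normal_lattice u \<mu> F\<^esub> \<gamma>"

definition \<Gamma>_flat ::
    "(real ^ 'n) set \<Rightarrow> ('d::finite \<Rightarrow> real ^ 'n) \<Rightarrow> real ^ 'd \<Rightarrow> (real ^ 'n) set
      \<Rightarrow> (real ^ 'n) set set" where
  "\<Gamma>_flat \<Delta> u \<mu> F =
     carrier (\<Gamma> u \<mu> F) - (\<Union>E\<in>{E \<in> faces \<Delta>. F \<subset> E}. \<Gamma>_incl u \<mu> F ` carrier (\<Gamma> u \<mu> E))"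

text \<open>
  The exponential does not depend on the representative of the coset \<open>\<gamma>\<close>, because \<open>edge_vec u \<mu> v j\<close>
  has integral inner products with the elements of \<open>normal_sublattice u \<mu> {v}\<close>.
\<close>

definition root_vertex ::
    "('d::finite \<Rightarrow> real ^ 'n) \<Rightarrow> real ^ 'd \<Rightarrow> (real ^ 'n) set \<Rightarrow> 'd \<Rightarrow> real ^ 'n \<Rightarrow> complex" where
  "root_vertex u \<mu> \<gamma> j v =
     exp (2 * of_real pi * \<i> * of_real ((SOME g. g \<in> \<gamma>) \<bullet> edge_vec u \<mu> v j))"

definition root_face ::
    "(real ^ 'n) set \<Rightarrow> ('d::finite \<Rightarrow> real ^ 'n) \<Rightarrow> real ^ 'd \<Rightarrow> (real ^ 'n) set \<Rightarrow> 'd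
      \<Rightarrow> (real ^ 'n) set \<Rightarrow> complex" where
  "root_face \<Delta> u \<mu> \<gamma> j F =
     (if j \<in> facets_at u \<mu> F
      then let v = (SOME v. v \<in> vertices \<Delta> \<and> v \<in> F) in root_vertex u \<mu> (\<Gamma>_incl u \<mu> {v} \<gamma>) j v
      else 1)"

section \<open>The periodic functions and the operators\<close>

definition bernoulli_poly :: "nat \<Rightarrow> real \<Rightarrow> real" where
  "bernoulli_poly k x = fact k * fps_nth (fps_X / (fps_exp 1 - 1) * fps_exp x) k"

definition root_order :: "complex \<Rightarrow> nat" where
  "root_order \<omega> = (LEAST N. 0 < N \<and> \<omega> ^ N = 1)"

text \<open>
  The case \<open>\<omega> \<noteq> 1\<close>. The distribution with index 0 is minus the sum over all integers \<open>n\<close> of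
  \<open>\<omega>\<^sup>n\<close> times the point mass at \<open>n\<close>; it is not a function, and the value at index 0 below is a
  dummy. The function with index 1 has mean zero over a period, since the powers of \<open>\<omega>\<close> sum to 0,
  and jumps by \<open>- \<omega>\<^sup>n\<close> at \<open>n\<close>, so it is the required primitive; its values at the integers
  are immaterial. From index 2 on, that the distributional derivative of \<open>q\<close> is the preceding
  bounded function is expressed by \<open>q\<close> being an indefinite integral of it.
\<close>

fun Q_twisted :: "nat \<Rightarrow> complex \<Rightarrow> real \<Rightarrow> complex" where
  "Q_twisted 0 \<omega> = (\<lambda>x. 0)"
| "Q_twisted (Suc 0) \<omega> = (\<lambda>x. \<omega> / (1 - \<omega>) * \<omega> powi \<lfloor>x\<rfloor>)"
| "Q_twisted (Suc (Suc m)) \<omega> =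
     (THE q. (\<forall>x. q (x + real (root_order \<omega>)) = q x) \<and>
             (\<forall>a b. a \<le> b \<longrightarrow> (Q_twisted (Suc m) \<omega> has_integral (q b - q a)) {a..b}) \<and>
             (q has_integral 0) {0..real (root_order \<omega>)})"

definition Q_fun :: "nat \<Rightarrow> complex \<Rightarrow> real \<Rightarrow> complex" where
  "Q_fun k \<omega> x =
     (if \<omega> = 1 then of_real (bernoulli_poly k (frac x) / fact k) else Q_twisted k \<omega> x)"

definition tanh_half_fps :: "complex fps" where
  "tanh_half_fps = (fps_exp (1/2) - fps_exp (-1/2)) / (fps_exp (1/2) + fps_exp (-1/2))"

definition L_fps :: "complex fps" where
  "L_fps = fps_const (1/2) * fps_X / tanh_half_fps"

text \<open>Note that \<open>truncate_fps n\<close> keeps the terms of degree less than \<open>n\<close>.\<close>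

definition M_poly :: "nat \<Rightarrow> complex \<Rightarrow> complex poly" where
  "M_poly k \<omega> =
     (if \<omega> = 1 then truncate_fps (Suc (2 * (k div 2))) L_fps
      else monom (1/2 + \<omega> / (1 - \<omega>)) 1 + (\<Sum>m=2..k. monom (Q_fun m \<omega> 0) m))"

definition M_symbol ::
    "(real ^ 'n) set \<Rightarrow> ('d::finite \<Rightarrow> real ^ 'n) \<Rightarrow> real ^ 'd \<Rightarrow> nat \<Rightarrow> (real ^ 'n) set
      \<Rightarrow> (real ^ 'n) set \<Rightarrow> ('d \<Rightarrow> nat) \<Rightarrow> complex" where
  "M_symbol \<Delta> u \<mu> k \<gamma> F = prod_symbol (\<lambda>j. M_poly k (root_face \<Delta> u \<mu> \<gamma> j F))"

abbreviation M_op ::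
    "(real ^ 'n) set \<Rightarrow> ('d::finite \<Rightarrow> real ^ 'n) \<Rightarrow> real ^ 'd \<Rightarrow> nat \<Rightarrow> (real ^ 'n) set
      \<Rightarrow> (real ^ 'n) set \<Rightarrow> (real ^ 'd \<Rightarrow> complex) \<Rightarrow> real ^ 'd \<Rightarrow> complex" where
  "M_op \<Delta> u \<mu> k \<gamma> F \<equiv> diff_op unit_vec (M_symbol \<Delta> u \<mu> k \<gamma> F)"

section \<open>Polarization and the remainder\<close>

definition polarizing ::
    "(real ^ 'n) set \<Rightarrow> ('d::finite \<Rightarrow> real ^ 'n) \<Rightarrow> real ^ 'd \<Rightarrow> real ^ 'n \<Rightarrow> bool" where
  "polarizing \<Delta> u \<mu> \<xi> \<longleftrightarrow>
     (\<forall>v\<in>vertices \<Delta>. \<forall>j\<in>facets_at u \<mu> {v}. \<xi> \<bullet> edge_vec u \<mu> v j \<noteq> 0)"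

definition flipped ::
    "('d::finite \<Rightarrow> real ^ 'n) \<Rightarrow> real ^ 'd \<Rightarrow> real ^ 'n \<Rightarrow> real ^ 'n \<Rightarrow> 'd set" where
  "flipped u \<mu> \<xi> v = {j \<in> facets_at u \<mu> {v}. \<xi> \<bullet> edge_vec u \<mu> v j > 0}"

definition edge_vec_pol ::
    "('d::finite \<Rightarrow> real ^ 'n) \<Rightarrow> real ^ 'd \<Rightarrow> real ^ 'n \<Rightarrow> real ^ 'n \<Rightarrow> 'd \<Rightarrow> real ^ 'n" where
  "edge_vec_pol u \<mu> \<xi> v j =
     (if j \<in> flipped u \<mu> \<xi> v then - edge_vec u \<mu> v j else edge_vec u \<mu> v j)"

definition normal_pol ::
    "('d::finite \<Rightarrow> real ^ 'n) \<Rightarrow> real ^ 'd \<Rightarrow> real ^ 'n \<Rightarrow> real ^ 'n \<Rightarrow> 'd \<Rightarrow> real ^ 'n" where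
  "normal_pol u \<mu> \<xi> v j = (if j \<in> flipped u \<mu> \<xi> v then - u j else u j)"

definition root_pol ::
    "('d::finite \<Rightarrow> real ^ 'n) \<Rightarrow> real ^ 'd \<Rightarrow> real ^ 'n \<Rightarrow> (real ^ 'n) set \<Rightarrow> 'd \<Rightarrow> real ^ 'n
      \<Rightarrow> complex" where
  "root_pol u \<mu> \<xi> \<gamma> j v =
     (if j \<in> flipped u \<mu> \<xi> v then inverse (root_vertex u \<mu> \<gamma> j v) else root_vertex u \<mu> \<gamma> j v)"

definition cone_pol ::
    "('d::finite \<Rightarrow> real ^ 'n) \<Rightarrow> real ^ 'd \<Rightarrow> real ^ 'n \<Rightarrow> real ^ 'n \<Rightarrow> (real ^ 'n) set" where
  "cone_pol u \<mu> \<xi> v =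
     {v + (\<Sum>j\<in>facets_at u \<mu> {v}. t j *\<^sub>R edge_vec_pol u \<mu> \<xi> v j) | t.
        \<forall>j\<in>facets_at u \<mu> {v}. 0 \<le> t j}"

text \<open>
  The operator in the integrand: the product of the \<open>M_poly k \<lambda>\<^sub>j\<close> at minus the derivative along the
  \<open>j\<close>-th polarized edge vector over \<open>j \<in> I\<close>, and of the \<open>k\<close>-th powers of the derivatives along the
  remaining polarized edge vectors at \<open>v\<close>. Indices of facets not containing \<open>v\<close> do not contribute.
\<close>

definition remainder_symbol ::
    "('d::finite \<Rightarrow> real ^ 'n) \<Rightarrow> real ^ 'd \<Rightarrow> nat \<Rightarrow> real ^ 'n \<Rightarrow> real ^ 'n \<Rightarrow> (real ^ 'n) set
      \<Rightarrow> 'd set \<Rightarrow> ('d \<Rightarrow> nat) \<Rightarrow> complex" where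
  "remainder_symbol u \<mu> k \<xi> v \<gamma> I = prod_symbol (\<lambda>j.
     if j \<in> I then pcompose (M_poly k (root_pol u \<mu> \<xi> \<gamma> j v)) [:0, -1:]
     else if j \<in> facets_at u \<mu> {v} then monom 1 k
     else 1)"

definition remainder ::
    "(real ^ 'n) set \<Rightarrow> ('d::finite \<Rightarrow> real ^ 'n) \<Rightarrow> real ^ 'd \<Rightarrow> nat \<Rightarrow> real ^ 'n
      \<Rightarrow> (real ^ 'n \<Rightarrow> complex) \<Rightarrow> complex" where
  "remainder \<Delta> u \<mu> k \<xi> f =
     (\<Sum>v\<in>vertices \<Delta>. (-1) ^ card (flipped u \<mu> \<xi> v) *
       (\<Sum>\<gamma>\<in>carrier (\<Gamma> u \<mu> {v}). \<Sum>I | I \<subset> facets_at u \<mu> {v}.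
         (-1) ^ ((k - 1) * (CARD('n) - card I)) *
         integral (cone_pol u \<mu> \<xi> v) (\<lambda>x.
           (\<Prod>j\<in>facets_at u \<mu> {v} - I.
              Q_fun k (root_pol u \<mu> \<xi> \<gamma> j v) (normal_pol u \<mu> \<xi> v j \<bullet> (x - v))) *
           diff_op (edge_vec_pol u \<mu> \<xi> v) (remainder_symbol u \<mu> k \<xi> v \<gamma> I) f x)))"

end

theory Submission
  imports Defs
begin

text \<open>
  The formula is proved on the cones at the vertices. In one variable, integrating by parts against
  the functions \<open>periodic_Q \<omega> m\<close> expresses the sum of the \<open>\<omega>\<^sup>n G(n)\<close> over the natural numbers, with
  weight one half at 0, as an integral of derivatives of \<open>G\<close>: those of order at most \<open>k\<close> with constant
  coefficients, and that of order \<open>k\<close> also with a bounded periodic coefficient (\<open>Euler_Maclaurin\<close>).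
  Applied in each variable, this gives a formula on an orthant (\<open>Euler_Maclaurin_product\<close>). At a vertex \<open>v\<close>, the coordinates with
  respect to the edge vectors turn the tangent cone into an orthant, and the lattice into a subset of
  the standard lattice, whose indicator function is the average of the characters given by \<open>\<Gamma> u \<mu> {v}\<close>
  (\<open>sum_character_Box\<close>). So the sum over the lattice points of a cone is a sum of twisted sums over
  an orthant, one for each element of the group (\<open>cone_Euler_Maclaurin\<close>). Multiplying out constant and
  periodic coefficients gives a leading term and the terms of the remainder.

  The passage from the polytope to the cones is the pointwise identity \<open>polar_decomposition\<close>. The
  product over all facets of the Heaviside functions, with value one half at 0, is the sum over the vertices of
  the signed products for the polarized cones. It holds for all small displacements \<open>h\<close> of the facets.
  At \<open>h = 0\<close> the product is the weight, and summation over the lattice points decomposes the weighted sum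
  (\<open>weighted_sum_eq_cones\<close>); near \<open>h = 0\<close> it decomposes the integral over \<open>\<Delta>(h)\<close>
  (\<open>integral_hpoly_eq_cones\<close>). The identity is shown by moving a point to infinity, where both sides vanish, in a
  direction along which \<open>\<xi>\<close> increases: at each wall that is crossed, the difference of the two sides
  changes by a multiple of the same difference for a smaller face, which is zero by induction.

  It remains to identify the leading terms. Displacing the facets at \<open>v\<close> translates the cone along
  its edges, so the derivative with respect to \<open>h j\<close> acts on the integral over the cone as minus the derivative
  of \<open>f\<close> along the \<open>j\<close>-th edge vector; the reversal of an edge is compensated by the symmetry \<open>M_fps_inverse\<close>.
  The facets that do not contain \<open>v\<close> do not move the cone, while an operator with a root other than 1 has
  no constant term. Hence an element of \<open>\<Gamma>_flat \<Delta> u \<mu> F\<close> contributes only at the vertices of \<open>F\<close>, and as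
  the group of a vertex is the disjoint union of the flat parts of the groups of its faces, all the leading
  terms are accounted for (\<open>sum_faces_eq_sum_vertices\<close>).

  The remaining assertions follow from the shape of the remainder, which is a combination of integrals over cones
  of bounded periodic functions times derivatives of \<open>f\<close> (\<open>representable_remainder\<close>), and from the formula
  itself, in which the other two members do not involve \<open>\<xi>\<close> and vanish if the support of \<open>f\<close> avoids
  \<open>\<Delta>\<close>.
\<close>

unbundle no fps_syntax

section \<open>Iterated directional derivatives\<close>

lemma differentiable_along_line:
  fixes f :: "'a::real_normed_vector \<Rightarrow> 'b::real_normed_vector"
  assumes "(f has_derivative f') (at (x + t *\<^sub>R w))"
  shows "((\<lambda>t. f (x + t *\<^sub>R w)) has_vector_derivative f' w) (at t)"
proof -
  have "((\<lambda>t. x + t *\<^sub>R w) has_derivative (\<lambda>t. t *\<^sub>R w)) (at t)"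
    by (auto intro!: derivative_eq_intros)
  from diff_chain_at[OF this assms]
  have "((\<lambda>t. f (x + t *\<^sub>R w)) has_derivative (\<lambda>t. f' (t *\<^sub>R w))) (at t)"
    by (simp add: o_def)
  moreover have "f' (t *\<^sub>R w) = t *\<^sub>R f' w" for t
    using assms has_derivative_linear linear_cmul by blast
  ultimately show ?thesis by (simp add: has_vector_derivative_def)
qed

lemma dir_deriv_eq:
  assumes "(f has_derivative f') (at x)"
  shows "dir_deriv w f x = f' w"
  using differentiable_along_line[of f f' x 0 w] assms
  by (simp add: dir_deriv_def vector_derivative_at)

lemma dir_deriv_frechet:
  assumes "f differentiable (at x)"
  shows "dir_deriv w f x = frechet_derivative f (at x) w"
  using assms dir_deriv_eq frechet_derivative_works by blast

lemma has_vector_derivative_dir_deriv: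
  assumes "f differentiable (at (x + t *\<^sub>R w))"
  shows "((\<lambda>t. f (x + t *\<^sub>R w)) has_vector_derivative dir_deriv w f (x + t *\<^sub>R w)) (at t)"
  using differentiable_along_line dir_deriv_frechet[OF assms] assms frechet_derivative_works by metis

lemma C_class_continuous: "C_class m f \<Longrightarrow> continuous_on S f"
proof (cases m)
  case 0
  moreover assume "C_class m f"
  ultimately show ?thesis using continuous_on_subset by auto
next
  case (Suc j)
  moreover assume "C_class m f"
  ultimately show ?thesis
    by (auto intro!: continuous_at_imp_continuous_on differentiable_imp_continuous_within)
qed

lemma C_class_Suc_imp: "C_class (Suc m) f \<Longrightarrow> C_class m f"
proof (induction m arbitrary: f)
  case 0
  then show ?case using C_class_continuous[of "Suc 0"] by simp
next
  case (Suc m)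
  then show ?case by (metis C_class.simps(2))
qed

lemma C_class_mono: "m \<le> l \<Longrightarrow> C_class l f \<Longrightarrow> C_class m f"
  by (induction l rule: dec_induct) (auto intro: C_class_Suc_imp simp del: C_class.simps)

lemma dir_deriv_lincomb:
  assumes "f differentiable (at x)" "g differentiable (at x)"
  shows "dir_deriv w (\<lambda>x. a * f x + b * g x) x = a * dir_deriv w f x + b * dir_deriv w g x"
proof -
  have "((\<lambda>x. a * f x + b * g x) has_derivative
      (\<lambda>h. a * frechet_derivative f (at x) h + b * frechet_derivative g (at x) h)) (at x)"
    using assms by (auto intro!: derivative_eq_intros simp: frechet_derivative_works)
  from dir_deriv_eq[OF this] show ?thesis using assms by (simp add: dir_deriv_frechet)
qed

lemma C_class_lincomb:
  "C_class m f \<Longrightarrow> C_class m g \<Longrightarrow> C_class m (\<lambda>x. a * f x + b * g x)"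
proof (induction m arbitrary: f g)
  case 0
  then show ?case by (auto intro!: continuous_intros)
next
  case (Suc m)
  then have "dir_deriv w (\<lambda>x. a * f x + b * g x) = (\<lambda>x. a * dir_deriv w f x + b * dir_deriv w g x)" for w
    by (intro ext dir_deriv_lincomb) auto
  with Suc show ?case by (auto intro!: derivative_intros)
qed

lemma C_class_zero: "C_class m (\<lambda>x. 0)"
proof (induction m)
  case (Suc m)
  have "dir_deriv w (\<lambda>x::'a. 0) = (\<lambda>x. 0)" for w
    by (intro ext) (simp add: dir_deriv_def)
  with Suc show ?case by simp
qed simp

lemma C_class_sum:
  assumes "finite A" "\<And>i. i \<in> A \<Longrightarrow> C_class m (g i)"
  shows "C_class m (\<lambda>x. \<Sum>i\<in>A. c i * g i x)"
  using assms
proof (induction A)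
  case empty
  then show ?case by (simp add: C_class_zero)
next
  case (insert i A)
  then have "C_class m (\<lambda>x. c i * g i x + 1 * (\<Sum>i\<in>A. c i * g i x))"
    by (intro C_class_lincomb) auto
  with insert show ?case by simp
qed

text \<open>
  The class of a function is defined through the basis vectors; this extends its control to the
  derivatives along all vectors.
\<close>

lemma dir_deriv_Basis:
  fixes f :: "'a::euclidean_space \<Rightarrow> complex"
  assumes "f differentiable (at x)"
  shows "dir_deriv w f x = (\<Sum>b\<in>Basis. of_real (w \<bullet> b) * dir_deriv b f x)"
proof -
  let ?D = "frechet_derivative f (at x)"
  have lin: "linear ?D" using assms linear_frechet_derivative by blast
  have "?D w = ?D (\<Sum>b\<in>Basis. (w \<bullet> b) *\<^sub>R b)" by (simp add: euclidean_representation)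
  also have "\<dots> = (\<Sum>b\<in>Basis. (w \<bullet> b) *\<^sub>R ?D b)"
    using lin by (simp add: linear_sum linear_cmul)
  finally show ?thesis using assms by (simp add: dir_deriv_frechet scaleR_conv_of_real)
qed

lemma C_class_dir_deriv:
  assumes "C_class (Suc m) f"
  shows "C_class m (dir_deriv w f)"
proof -
  have "dir_deriv w f = (\<lambda>x. \<Sum>b\<in>Basis. of_real (w \<bullet> b) * dir_deriv b f x)"
    using assms by (intro ext dir_deriv_Basis) auto
  then show ?thesis using assms C_class_sum[of Basis m "\<lambda>b. dir_deriv b f"] by simp
qed

lemma dir_deriv_inner:
  assumes "f differentiable (at (x + t *\<^sub>R w))"
  shows "((\<lambda>t. f (x + t *\<^sub>R w) \<bullet> c) has_real_derivative dir_deriv w f (x + t *\<^sub>R w) \<bullet> c) (at t)"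
  unfolding has_real_derivative_iff_has_vector_derivative
  by (rule bounded_linear.has_vector_derivative[OF bounded_linear_inner_left has_vector_derivative_dir_deriv[OF assms]])

text \<open>
  Two applications of the mean value theorem to the second difference of \<open>f\<close>. The mean value
  theorem is a statement on real functions, whence the inner product with \<open>c\<close>.
\<close>

lemma second_difference_mean_value:
  assumes f: "C_class 2 f" and "s > 0"
  obtains \<sigma> \<tau> where "0 < \<sigma>" "\<sigma> < s" "0 < \<tau>" "\<tau> < s"
    "(f (x + s *\<^sub>R v + s *\<^sub>R w) - f (x + s *\<^sub>R v) - f (x + s *\<^sub>R w) + f x) \<bullet> c
      = s\<^sup>2 * (dir_deriv w (dir_deriv v f) (x + \<sigma> *\<^sub>R v + \<tau> *\<^sub>R w) \<bullet> c)"
proof -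
  have d1: "f differentiable (at y)" for y using f by (auto simp: numeral_2_eq_2)
  have "C_class 1 (dir_deriv v f)" using f C_class_dir_deriv[of 1] by (simp add: numeral_2_eq_2)
  then have d2: "dir_deriv v f differentiable (at y)" for y by auto
  define \<phi> where "\<phi> = (\<lambda>t. f (x + s *\<^sub>R w + t *\<^sub>R v) \<bullet> c - f (x + t *\<^sub>R v) \<bullet> c)"
  have "\<exists>\<sigma>. 0 < \<sigma> \<and> \<sigma> < s \<and> \<phi> s - \<phi> 0 = (s - 0) *
     (dir_deriv v f (x + s *\<^sub>R w + \<sigma> *\<^sub>R v) \<bullet> c - dir_deriv v f (x + \<sigma> *\<^sub>R v) \<bullet> c)"
    unfolding \<phi>_def using d1 \<open>s > 0\<close>
    by (intro MVT2 DERIV_diff dir_deriv_inner) auto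
  then obtain \<sigma> where \<sigma>: "0 < \<sigma>" "\<sigma> < s" "\<phi> s - \<phi> 0 = s *
     (dir_deriv v f (x + s *\<^sub>R w + \<sigma> *\<^sub>R v) \<bullet> c - dir_deriv v f (x + \<sigma> *\<^sub>R v) \<bullet> c)" by auto
  have "\<exists>\<tau>. 0 < \<tau> \<and> \<tau> < s \<and> dir_deriv v f (x + \<sigma> *\<^sub>R v + s *\<^sub>R w) \<bullet> c - dir_deriv v f (x + \<sigma> *\<^sub>R v + 0 *\<^sub>R w) \<bullet> c
     = (s - 0) * (dir_deriv w (dir_deriv v f) (x + \<sigma> *\<^sub>R v + \<tau> *\<^sub>R w) \<bullet> c)"
    using d2 \<open>s > 0\<close> by (intro MVT2 dir_deriv_inner) auto
  then obtain \<tau> where \<tau>: "0 < \<tau>" "\<tau> < s" "dir_deriv v f (x + \<sigma> *\<^sub>R v + s *\<^sub>R w) \<bullet> c - dir_deriv v f (x + \<sigma> *\<^sub>R v) \<bullet> c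
     = s * (dir_deriv w (dir_deriv v f) (x + \<sigma> *\<^sub>R v + \<tau> *\<^sub>R w) \<bullet> c)" by auto
  have "(f (x + s *\<^sub>R v + s *\<^sub>R w) - f (x + s *\<^sub>R v) - f (x + s *\<^sub>R w) + f x) \<bullet> c = \<phi> s - \<phi> 0"
    by (simp add: \<phi>_def inner_diff_left inner_add_left algebra_simps)
  also have "\<dots> = s\<^sup>2 * (dir_deriv w (dir_deriv v f) (x + \<sigma> *\<^sub>R v + \<tau> *\<^sub>R w) \<bullet> c)"
    using \<sigma>(3) \<tau>(3) by (simp add: power2_eq_square algebra_simps)
  finally show ?thesis using \<sigma> \<tau> by (intro that) auto
qed

lemma second_difference_limit:
  fixes f :: "'a::euclidean_space \<Rightarrow> complex"
  assumes f: "C_class 2 f"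
  shows "((\<lambda>s. (f (x + s *\<^sub>R v + s *\<^sub>R w) - f (x + s *\<^sub>R v) - f (x + s *\<^sub>R w) + f x) \<bullet> c / s\<^sup>2)
      \<longlongrightarrow> dir_deriv w (dir_deriv v f) x \<bullet> c) (at_right 0)"
proof -
  let ?D = "dir_deriv w (dir_deriv v f)"
  let ?S = "\<lambda>s. (f (x + s *\<^sub>R v + s *\<^sub>R w) - f (x + s *\<^sub>R v) - f (x + s *\<^sub>R w) + f x) \<bullet> c"
  have "C_class 0 ?D" using f by (intro C_class_dir_deriv) (simp add: numeral_2_eq_2)
  then have cont: "isCont ?D x" by (simp add: continuous_on_eq_continuous_at)
  have "\<forall>s. \<exists>\<sigma> \<tau>. s > 0 \<longrightarrow> 0 < \<sigma> \<and> \<sigma> < s \<and> 0 < \<tau> \<and> \<tau> < s \<and>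
     ?S s = s\<^sup>2 * (?D (x + \<sigma> *\<^sub>R v + \<tau> *\<^sub>R w) \<bullet> c)"
    using second_difference_mean_value[OF f, of _ x v w c] by metis
  then obtain \<sigma> \<tau> where *: "\<And>s. s > 0 \<Longrightarrow> 0 < \<sigma> s \<and> \<sigma> s < s \<and> 0 < \<tau> s \<and> \<tau> s < s \<and>
     ?S s = s\<^sup>2 * (?D (x + \<sigma> s *\<^sub>R v + \<tau> s *\<^sub>R w) \<bullet> c)"
    by metis
  have small: "(g \<longlongrightarrow> 0) (at_right 0)" if "\<And>s. s > 0 \<Longrightarrow> 0 < g s \<and> g s < s" for g :: "real \<Rightarrow> real"
  proof (rule tendsto_sandwich)
    show "\<forall>\<^sub>F s in at_right 0. 0 \<le> g s" "\<forall>\<^sub>F s in at_right 0. g s \<le> s"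
      using that by (auto simp: eventually_at_right_field intro!: exI[of _ 1] less_imp_le)
  qed (auto intro!: tendsto_intros)
  have "((\<lambda>s. x + \<sigma> s *\<^sub>R v + \<tau> s *\<^sub>R w) \<longlongrightarrow> x + 0 *\<^sub>R v + 0 *\<^sub>R w) (at_right 0)"
    using * by (intro tendsto_intros small) auto
  then have "((\<lambda>s. ?D (x + \<sigma> s *\<^sub>R v + \<tau> s *\<^sub>R w) \<bullet> c) \<longlongrightarrow> ?D x \<bullet> c) (at_right 0)"
    by (intro tendsto_intros isCont_tendsto_compose[OF cont]) auto
  then show ?thesis
  proof (rule Lim_transform_eventually)
    show "\<forall>\<^sub>F s in at_right 0. ?D (x + \<sigma> s *\<^sub>R v + \<tau> s *\<^sub>R w) \<bullet> c = ?S s / s\<^sup>2"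
      using * by (auto simp: eventually_at_right_field intro!: exI[of _ 1])
  qed
qed

text \<open>
  The second difference is symmetric in \<open>v\<close> and \<open>w\<close>, and divided by \<open>s\<^sup>2\<close> it tends to either of
  the two mixed derivatives.
\<close>

lemma dir_deriv_commute:
  fixes f :: "'a::euclidean_space \<Rightarrow> complex"
  assumes f: "C_class 2 f"
  shows "dir_deriv v (dir_deriv w f) x = dir_deriv w (dir_deriv v f) x"
proof -
  have "dir_deriv v (dir_deriv w f) x \<bullet> c = dir_deriv w (dir_deriv v f) x \<bullet> c" for c
  proof (rule tendsto_unique)
    show "((\<lambda>s. (f (x + s *\<^sub>R v + s *\<^sub>R w) - f (x + s *\<^sub>R v) - f (x + s *\<^sub>R w) + f x) \<bullet> c / s\<^sup>2)
      \<longlongrightarrow> dir_deriv w (dir_deriv v f) x \<bullet> c) (at_right 0)"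
      using f by (rule second_difference_limit)
    show "((\<lambda>s. (f (x + s *\<^sub>R v + s *\<^sub>R w) - f (x + s *\<^sub>R v) - f (x + s *\<^sub>R w) + f x) \<bullet> c / s\<^sup>2)
      \<longlongrightarrow> dir_deriv v (dir_deriv w f) x \<bullet> c) (at_right 0)"
      using second_difference_limit[OF f, of x w v c] by (simp add: algebra_simps)
  qed simp
  then show ?thesis using vector_eq_rdot by blast
qed

lemma C_class_iter_deriv:
  "C_class (m + length ws) f \<Longrightarrow> C_class m (iter_deriv ws f)"
proof (induction ws arbitrary: m)
  case (Cons w ws)
  then show ?case by (simp add: C_class_dir_deriv del: C_class.simps)
qed simp

lemma iter_deriv_append: "iter_deriv (xs @ ys) f = iter_deriv xs (iter_deriv ys f)"
  by (induction xs) auto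

lemma iter_deriv_move_to_front:
  assumes "C_class (Suc (length xs)) f"
  shows "iter_deriv (xs @ [w]) f = iter_deriv (w # xs) f"
  using assms
proof (induction xs)
  case (Cons x xs)
  have "C_class (2 + length xs) f" using Cons.prems by (simp del: C_class.simps)
  then have "C_class 2 (iter_deriv xs f)" by (rule C_class_iter_deriv)
  moreover have "C_class (Suc (length xs)) f" using Cons.prems C_class_Suc_imp by (simp del: C_class.simps)
  ultimately show ?case using Cons.IH by (auto intro!: ext dir_deriv_commute)
qed simp

lemma iter_deriv_permute:
  assumes "mset xs = mset ys" "C_class (length xs) f"
  shows "iter_deriv xs f = iter_deriv ys f"
  using assms
proof (induction xs arbitrary: ys)
  case (Cons x xs)
  have "x \<in> set ys" using mset_eq_setD[OF Cons.prems(1)] by auto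
  then obtain as bs where ys: "ys = as @ x # bs" by (auto dest: split_list)
  have ms: "mset xs = mset (as @ bs)" using Cons.prems by (simp add: ys)
  have len: "length xs = length as + length bs" using mset_eq_length[OF ms] by simp
  have "C_class (Suc (length as) + length bs) f" using Cons.prems len by (simp del: C_class.simps)
  then have "iter_deriv (as @ [x]) (iter_deriv bs f) = iter_deriv (x # as) (iter_deriv bs f)"
    by (intro iter_deriv_move_to_front C_class_iter_deriv)
  then have "iter_deriv ys f = iter_deriv (x # (as @ bs)) f"
    by (simp add: ys iter_deriv_append)
  moreover have "iter_deriv xs f = iter_deriv (as @ bs) f"
    using Cons.prems ms C_class_Suc_imp by (intro Cons.IH) (auto simp del: C_class.simps)
  ultimately show ?case by simp
qed simp

lemma ex_list_count:
  fixes a :: "'i::finite \<Rightarrow> nat"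
  shows "\<exists>js. \<forall>j. count_list js j = a j"
proof -
  obtain js where "mset js = Abs_multiset a" using ex_mset by blast
  then have "count (mset js) = a" by (simp add: Abs_multiset_inverse)
  then show ?thesis by (metis count_mset)
qed

lemma length_eq_sum_count:
  fixes js :: "'i::finite list"
  shows "length js = (\<Sum>j\<in>UNIV. count_list js j)"
  using sum_count_set[of js UNIV] by simp

text \<open>
  Mixed derivatives commute, so the arbitrary list in the definition of \<open>multi_deriv\<close> can be
  replaced by any list with the same multiplicities.
\<close>

lemma multi_deriv_eq_iter_deriv:
  fixes e :: "'i::finite \<Rightarrow> 'a::euclidean_space"
  assumes "\<And>j. count_list js j = a j" "C_class (\<Sum>j\<in>UNIV. a j) f"
  shows "multi_deriv e a f = iter_deriv (map e js) f"
proof -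
  define js' where "js' = (SOME js. \<forall>j. count_list js j = a j)"
  have *: "count_list js' j = a j" for j
    unfolding js'_def using someI_ex[OF ex_list_count[of a]] by blast
  have "mset js' = mset js"
    by (rule multiset_eqI) (simp add: count_mset * assms)
  then have "mset (map e js') = mset (map e js)" by simp
  moreover have "length js' = (\<Sum>j\<in>UNIV. a j)" unfolding length_eq_sum_count by (simp add: *)
  ultimately show ?thesis unfolding multi_deriv_def js'_def[symmetric]
    using assms by (intro iter_deriv_permute) auto
qed

lemma C_class_multi_deriv:
  fixes e :: "'i::finite \<Rightarrow> 'a::euclidean_space"
  assumes "C_class (m + (\<Sum>j\<in>UNIV. a j)) f"
  shows "C_class m (multi_deriv e a f)"
proof -
  obtain js where js: "\<And>j. count_list js j = a j" using ex_list_count by blast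
  then have "multi_deriv e a f = iter_deriv (map e js) f"
    using C_class_mono[OF _ assms] by (intro multi_deriv_eq_iter_deriv) (auto simp del: C_class.simps)
  with assms js show ?thesis
    by (auto intro!: C_class_iter_deriv simp: length_eq_sum_count simp del: C_class.simps)
qed

lemma dir_deriv_multi_deriv:
  fixes e :: "'i::finite \<Rightarrow> 'a::euclidean_space"
  assumes "C_class (Suc (\<Sum>j\<in>UNIV. a j)) f"
  shows "dir_deriv (e j) (multi_deriv e a f) = multi_deriv e (a(j := Suc (a j))) f"
proof -
  obtain js where js: "\<And>j. count_list js j = a j" using ex_list_count by blast
  have "multi_deriv e a f = iter_deriv (map e js) f"
    using assms js C_class_Suc_imp by (intro multi_deriv_eq_iter_deriv) (auto simp del: C_class.simps)
  moreover have "multi_deriv e (a(j := Suc (a j))) f = iter_deriv (map e (j # js)) f"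
  proof (rule multi_deriv_eq_iter_deriv)
    have "(\<Sum>i\<in>UNIV. (a(j := Suc (a j))) i) = Suc (\<Sum>i\<in>UNIV. a i)"
      by (simp add: sum.remove[of UNIV j])
    with assms show "C_class (\<Sum>i\<in>UNIV. (a(j := Suc (a j))) i) f" by (simp del: C_class.simps)
  qed (use js in auto)
  ultimately show ?thesis by simp
qed

lemma dir_deriv_zero_outside:
  assumes "x \<notin> tsupport f"
  shows "dir_deriv w f x = 0"
proof -
  have "((\<lambda>t. f (x + t *\<^sub>R w)) has_vector_derivative 0) (at 0)"
  proof (rule has_vector_derivative_transform_within_open)
    show "((\<lambda>t. 0) has_vector_derivative 0) (at (0::real))" by simp
    have "open ((\<lambda>t. x + t *\<^sub>R w) -` (- tsupport f))"
      unfolding tsupport_def by (intro open_vimage continuous_intros) auto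
    then show "open ((\<lambda>t. x + t *\<^sub>R w) -` (- tsupport f))" .
    show "0 \<in> (\<lambda>t. x + t *\<^sub>R w) -` (- tsupport f)" using assms by simp
    show "0 = f (x + t *\<^sub>R w)" if "t \<in> (\<lambda>t. x + t *\<^sub>R w) -` (- tsupport f)" for t
      using that closure_subset[of "{x. f x \<noteq> 0}"] unfolding tsupport_def by auto
  qed
  then show ?thesis by (simp add: dir_deriv_def vector_derivative_at)
qed

lemma tsupport_dir_deriv: "tsupport (dir_deriv w f) \<subseteq> tsupport f"
proof -
  have "{x. dir_deriv w f x \<noteq> 0} \<subseteq> tsupport f" using dir_deriv_zero_outside by blast
  then show ?thesis unfolding tsupport_def[of "dir_deriv w f"]
    by (rule closure_minimal) (simp add: tsupport_def)
qed

lemma tsupport_iter_deriv: "tsupport (iter_deriv ws f) \<subseteq> tsupport f"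
  by (induction ws) (use tsupport_dir_deriv in auto)

lemma zero_outside_tsupport: "x \<notin> tsupport f \<Longrightarrow> f x = 0"
  using closure_subset[of "{x. f x \<noteq> 0}"] unfolding tsupport_def by auto

lemma tsupport_multi_deriv: "tsupport (multi_deriv e a f) \<subseteq> tsupport f"
  unfolding multi_deriv_def by (rule tsupport_iter_deriv)

lemma multi_deriv_zero_outside: "x \<notin> tsupport f \<Longrightarrow> multi_deriv e a f x = 0"
  using tsupport_multi_deriv[of e a f] zero_outside_tsupport[of x "multi_deriv e a f"] by auto

lemma C_compact_multi_deriv:
  fixes e :: "'i::finite \<Rightarrow> 'a::euclidean_space"
  assumes "C_compact (m + (\<Sum>j\<in>UNIV. a j)) f"
  shows "C_compact m (multi_deriv e a f)"
  unfolding C_compact_def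
proof
  show "C_class m (multi_deriv e a f)"
    using assms by (intro C_class_multi_deriv) (simp add: C_compact_def)
  have "compact (tsupport f \<inter> tsupport (multi_deriv e a f))"
    using assms by (intro compact_Int_closed) (auto simp: C_compact_def tsupport_def)
  then show "compact (tsupport (multi_deriv e a f))"
    using tsupport_multi_deriv[of e a f] by (simp add: Int_absorb1)
qed

lemma C_compact_mono: "m \<le> l \<Longrightarrow> C_compact l f \<Longrightarrow> C_compact m f"
  unfolding C_compact_def using C_class_mono by blast

lemma dir_deriv_scale:
  assumes "f differentiable (at x)"
  shows "dir_deriv (c *\<^sub>R w) f x = of_real c * dir_deriv w f x"
proof -
  have "linear (frechet_derivative f (at x))" using assms linear_frechet_derivative by blast
  then show ?thesis using assms by (simp add: dir_deriv_frechet linear_cmul scaleR_conv_of_real)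
qed

lemma iter_deriv_scale:
  assumes "C_class (length js) f"
  shows "iter_deriv (map (\<lambda>j. c j *\<^sub>R e j) js) f = (\<lambda>x. of_real (\<Prod>j\<leftarrow>js. c j) * iter_deriv (map e js) f x)"
  using assms
proof (induction js)
  case (Cons j js)
  let ?g = "iter_deriv (map e js) f" and ?p = "complex_of_real (\<Prod>j\<leftarrow>js. c j)"
  have "C_class (Suc 0) ?g" by (rule C_class_iter_deriv) (use Cons.prems in \<open>simp del: C_class.simps\<close>)
  then have d: "?g differentiable (at x)" for x by simp
  have "dir_deriv w (\<lambda>x. ?p * ?g x) x = ?p * dir_deriv w ?g x" for w x
    using dir_deriv_lincomb[OF d d, of w ?p 0 x] by simp
  note D = this
  have ih: "iter_deriv (map (\<lambda>j. c j *\<^sub>R e j) js) f = (\<lambda>x. ?p * ?g x)"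
    using Cons.IH Cons.prems C_class_Suc_imp[of "length js" f] by (simp del: C_class.simps)
  show ?case by (rule ext) (simp add: ih D dir_deriv_scale[OF d])
qed simp

lemma prod_list_count:
  fixes js :: "'i::finite list" and c :: "'i \<Rightarrow> 'b::comm_monoid_mult"
  shows "(\<Prod>j\<leftarrow>js. c j) = (\<Prod>j\<in>UNIV. c j ^ count_list js j)"
proof (induction js)
  case (Cons i js)
  have "(\<Prod>j\<in>UNIV. c j ^ count_list (i # js) j) = (\<Prod>j\<in>UNIV. (if j = i then c j else 1) * c j ^ count_list js j)"
    by (intro prod.cong) auto
  also have "\<dots> = c i * (\<Prod>j\<in>UNIV. c j ^ count_list js j)" by (simp add: prod.distrib)
  finally show ?case using Cons by simp
qed simp

text \<open>
  This transfers derivatives along an edge vector to its negative, at the cost of a sign.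
\<close>

lemma multi_deriv_scale:
  fixes e :: "'i::finite \<Rightarrow> 'a::euclidean_space"
  assumes "C_class (\<Sum>j\<in>UNIV. a j) f"
  shows "multi_deriv (\<lambda>j. c j *\<^sub>R e j) a f x = of_real (\<Prod>j\<in>UNIV. c j ^ a j) * multi_deriv e a f x"
proof -
  obtain js where js: "\<And>j. count_list js j = a j" using ex_list_count by blast
  have len: "length js = (\<Sum>j\<in>UNIV. a j)" by (simp add: length_eq_sum_count js)
  have "multi_deriv (\<lambda>j. c j *\<^sub>R e j) a f = iter_deriv (map (\<lambda>j. c j *\<^sub>R e j) js) f"
       "multi_deriv e a f = iter_deriv (map e js) f"
    using assms js by (intro multi_deriv_eq_iter_deriv; simp del: C_class.simps)+
  then show ?thesis using assms len
    by (simp add: iter_deriv_scale prod_list_count js del: C_class.simps)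
qed

lemma axis_Basis_range: "(Basis :: (real ^ 'n) set) = range (\<lambda>j. axis j 1)"
  by (auto simp: Basis_vec_def)

text \<open>
  A derivative along arbitrary directions is a combination of partial derivatives of the same
  order. The coefficients must not depend on the function: this is what turns the remainder into
  one fixed combination of integrals.
\<close>

lemma iter_deriv_expand:
  fixes ws :: "(real ^ 'n) list"
  shows "\<exists>(S :: ('n \<Rightarrow> nat) set) c. finite S \<and> (\<forall>a\<in>S. (\<Sum>j\<in>UNIV. a j) = length ws) \<and>
    (\<forall>f. C_class (length ws) f \<longrightarrow> iter_deriv ws f = (\<lambda>x. \<Sum>a\<in>S. c a * multi_deriv unit_vec a f x))"
proof (induction ws)
  case Nil
  have "multi_deriv unit_vec (\<lambda>_::'n. 0) f = f" if "C_class 0 f" for f :: "real ^ 'n \<Rightarrow> complex"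
    using multi_deriv_eq_iter_deriv[of "[]" "\<lambda>_::'n. 0" f unit_vec] that by simp
  then show ?case
    by (intro exI[of _ "{\<lambda>_. 0}"] exI[of _ "\<lambda>_. 1"]) auto
next
  case (Cons w ws)
  then obtain S :: "('n \<Rightarrow> nat) set" and c where S: "finite S" "\<And>a. a \<in> S \<Longrightarrow> (\<Sum>j\<in>UNIV. a j) = length ws"
    and eq: "\<And>f. C_class (length ws) f \<Longrightarrow> iter_deriv ws f = (\<lambda>x. \<Sum>a\<in>S. c a * multi_deriv unit_vec a f x)"
    by blast
  define up where "up = (\<lambda>(a :: 'n \<Rightarrow> nat, j). a(j := Suc (a j)))"
  define T where "T = up ` (S \<times> UNIV)"
  define d where "d = (\<lambda>b. \<Sum>p\<in>{p \<in> S \<times> UNIV. up p = b}. c (fst p) * of_real (w $ snd p))"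
  have finT: "finite T" unfolding T_def using S by simp
  have "(\<Sum>j\<in>UNIV. b j) = length (w # ws)" if b: "b \<in> T" for b
  proof -
    obtain a i where "a \<in> S" and b: "b = a(i := Suc (a i))" using b by (auto simp: T_def up_def)
    have "(\<Sum>j\<in>UNIV. b j) = Suc (\<Sum>j\<in>UNIV. a j)" unfolding b by (simp add: sum.remove[of UNIV i])
    then show ?thesis using S(2)[OF \<open>a \<in> S\<close>] by simp
  qed
  moreover have "iter_deriv (w # ws) f = (\<lambda>x. \<Sum>b\<in>T. d b * multi_deriv unit_vec b f x)" if f: "C_class (length (w # ws)) f" for f
  proof
    fix x
    have C1: "C_class (Suc 0) (multi_deriv unit_vec a f)" if "a \<in> S" for a
      using f S(2)[OF that] by (intro C_class_multi_deriv) (simp del: C_class.simps)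
    have diff: "C_class (Suc 0) (\<lambda>x. \<Sum>a\<in>A. c a * multi_deriv unit_vec a f x)" if "A \<subseteq> S" for A
      using that S(1) C1 by (intro C_class_sum) (auto simp del: C_class.simps intro: finite_subset)
    have sum: "dir_deriv w (\<lambda>x. \<Sum>a\<in>A. c a * multi_deriv unit_vec a f x) x = (\<Sum>a\<in>A. c a * dir_deriv w (multi_deriv unit_vec a f) x)"
      if "A \<subseteq> S" for A
      using finite_subset[OF that S(1)] that
    proof (induction A)
      case empty
      then show ?case by (simp add: dir_deriv_def)
    next
      case (insert a A)
      have "dir_deriv w (\<lambda>x. c a * multi_deriv unit_vec a f x + 1 * (\<Sum>a\<in>A. c a * multi_deriv unit_vec a f x)) x
        = c a * dir_deriv w (multi_deriv unit_vec a f) x + 1 * dir_deriv w (\<lambda>x. \<Sum>a\<in>A. c a * multi_deriv unit_vec a f x) x"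
        using C1[of a] diff[of A] insert.prems by (intro dir_deriv_lincomb) auto
      with insert show ?case by simp
    qed
    have one: "dir_deriv w (multi_deriv unit_vec a f) x = (\<Sum>j\<in>UNIV. of_real (w $ j) * multi_deriv unit_vec (up (a, j)) f x)"
      if a: "a \<in> S" for a
    proof -
      have "multi_deriv unit_vec a f differentiable (at x)" using C1[OF a] by simp
      from dir_deriv_Basis[OF this, of w]
      have "dir_deriv w (multi_deriv unit_vec a f) x
        = (\<Sum>b\<in>range (\<lambda>j::'n. axis j 1). of_real (w \<bullet> b) * dir_deriv b (multi_deriv unit_vec a f) x)"
        unfolding axis_Basis_range .
      also have "\<dots> = (\<Sum>j\<in>UNIV. of_real (w \<bullet> axis j 1) * dir_deriv (axis j 1) (multi_deriv unit_vec a f) x)"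
        by (subst sum.reindex) (auto simp: inj_on_def axis_eq_axis)
      also have "\<dots> = (\<Sum>j\<in>UNIV. of_real (w $ j) * multi_deriv unit_vec (up (a, j)) f x)"
      proof (intro sum.cong refl)
        fix j
        have "C_class (Suc (\<Sum>j\<in>UNIV. a j)) f" using f S(2)[OF a] by (simp del: C_class.simps)
        from dir_deriv_multi_deriv[OF this, of unit_vec j]
        show "of_real (w \<bullet> axis j 1) * dir_deriv (axis j 1) (multi_deriv unit_vec a f) x = of_real (w $ j) * multi_deriv unit_vec (up (a, j)) f x"
          by (simp add: inner_axis up_def)
      qed
      finally show ?thesis .
    qed
    have "iter_deriv (w # ws) f x = (\<Sum>a\<in>S. c a * dir_deriv w (multi_deriv unit_vec a f) x)"
      using eq[of f] f C_class_Suc_imp[of "length ws" f] sum[of S] by (simp del: C_class.simps)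
    also have "\<dots> = (\<Sum>a\<in>S. \<Sum>j\<in>UNIV. c a * of_real (w $ j) * multi_deriv unit_vec (up (a, j)) f x)"
      by (intro sum.cong refl) (simp add: one sum_distrib_left mult.assoc)
    also have "\<dots> = (\<Sum>p\<in>S \<times> UNIV. c (fst p) * of_real (w $ snd p) * multi_deriv unit_vec (up p) f x)"
      by (simp add: sum.cartesian_product case_prod_unfold)
    also have "\<dots> = (\<Sum>b\<in>T. \<Sum>p\<in>{p \<in> S \<times> UNIV. up p = b}. c (fst p) * of_real (w $ snd p) * multi_deriv unit_vec (up p) f x)"
      unfolding T_def using S(1) by (intro sum.image_gen) auto
    also have "\<dots> = (\<Sum>b\<in>T. d b * multi_deriv unit_vec b f x)"
      unfolding d_def sum_distrib_right by (intro sum.cong) auto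
    finally show "iter_deriv (w # ws) f x = (\<Sum>b\<in>T. d b * multi_deriv unit_vec b f x)" .
  qed
  ultimately show ?case using finT by blast
qed

section \<open>Twisted Bernoulli functions and the formula on a half-line\<close>

text \<open>
  The generating function of the Apostol-Bernoulli numbers divided by factorials: for \<open>\<omega> = 1\<close> it
  is the series \<open>X / (exp X - 1)\<close> of the Bernoulli numbers, and for \<open>\<omega> \<noteq> 1\<close> it has no constant
  term. The same formulas thus cover both cases in the definitions of the periodic functions and
  of the operators.
\<close>

definition apostol_fps :: "complex \<Rightarrow> complex fps" where
  "apostol_fps \<omega> = fps_const \<omega> * fps_X / (fps_exp 1 - fps_const \<omega>)"

definition apostol_poly :: "complex \<Rightarrow> nat \<Rightarrow> real \<Rightarrow> complex" where
  "apostol_poly \<omega> m x = fps_nth (apostol_fps \<omega> * fps_exp (of_real x)) m"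

text \<open>
  The polynomial on the unit interval, continued so that a shift by one multiplies by \<open>\<omega>\<close>. For a
  root of unity it is the function \<open>Q_fun\<close>; unlike that function it is given by a formula.
\<close>

definition periodic_Q :: "complex \<Rightarrow> nat \<Rightarrow> real \<Rightarrow> complex" where
  "periodic_Q \<omega> m x = \<omega> powi \<lfloor>x\<rfloor> * apostol_poly \<omega> m (frac x)"

text \<open>
  The series of which the polynomials \<open>M_poly k \<omega>\<close> are the truncations. The summand \<open>X/2\<close> comes
  from the weight one half of the end point.
\<close>

definition M_fps :: "complex \<Rightarrow> complex fps" where
  "M_fps \<omega> = apostol_fps \<omega> + fps_const (1/2) * fps_X"

lemma fps_exp_minus_const_nonzero: "fps_exp 1 - fps_const \<omega> \<noteq> (0::complex fps)"
proof
  assume "fps_exp 1 - fps_const \<omega> = (0::complex fps)"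
  then have "fps_nth (fps_exp 1 - fps_const \<omega>) 1 = (0::complex)" by simp
  then show False by simp
qed

text \<open>
  For \<open>\<omega> \<noteq> 1\<close> the denominator is a unit; for \<open>\<omega> = 1\<close> it has a simple zero, which the numerator
  cancels.
\<close>

lemma apostol_fps_mult:
  "apostol_fps \<omega> * (fps_exp 1 - fps_const \<omega>) = fps_const \<omega> * fps_X"
proof -
  let ?d = "fps_exp 1 - fps_const \<omega>"
  have "?d dvd fps_const \<omega> * fps_X"
  proof (cases "\<omega> = 1")
    case False
    then have "?d dvd 1" by simp
    then show ?thesis by (rule unit_imp_dvd)
  next
    case True
    have "subdegree ?d = 1" using True by (intro subdegreeI) auto
    then have "?d dvd fps_X"
      using fps_dvd_iff[of ?d fps_X] fps_exp_minus_const_nonzero by simp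
    then show ?thesis by simp
  qed
  then show ?thesis unfolding apostol_fps_def by (rule dvd_div_mult_self)
qed

lemma apostol_fps_mult_exp:
  "apostol_fps \<omega> * fps_exp 1 = fps_const \<omega> * apostol_fps \<omega> + fps_const \<omega> * fps_X"
  using apostol_fps_mult[of \<omega>] by (simp add: algebra_simps)

lemma apostol_fps_unique:
  assumes "A * (fps_exp 1 - fps_const \<omega>) = fps_const \<omega> * fps_X"
  shows "A = apostol_fps \<omega>"
  using assms apostol_fps_mult[of \<omega>] fps_exp_minus_const_nonzero[of \<omega>]
  by (metis mult_right_cancel)

lemma M_fps_unique:
  assumes "A * (fps_exp 1 - fps_const \<omega>) = fps_const (1/2) * fps_X * (fps_exp 1 + fps_const \<omega>)"
  shows "A = M_fps \<omega>"
proof -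
  have "(A - fps_const (1/2) * fps_X) * (fps_exp 1 - fps_const \<omega>)
      = A * (fps_exp 1 - fps_const \<omega>) - fps_const (1/2) * fps_X * (fps_exp 1 - fps_const \<omega>)"
    by (simp add: algebra_simps)
  also have "\<dots> = fps_const (1/2) * fps_X * (fps_const \<omega> + fps_const \<omega>)"
    unfolding assms by (simp add: algebra_simps)
  also have "\<dots> = fps_const (1/2 * (\<omega> + \<omega>)) * fps_X"
    by (simp add: algebra_simps flip: fps_const_mult fps_const_add)
  also have "\<dots> = fps_const \<omega> * fps_X" by simp
  finally have "A - fps_const (1/2) * fps_X = apostol_fps \<omega>" by (rule apostol_fps_unique)
  then show ?thesis by (simp add: M_fps_def algebra_simps)
qed

lemma M_fps_mult:
  "M_fps \<omega> * (fps_exp 1 - fps_const \<omega>) = fps_const (1/2) * fps_X * (fps_exp 1 + fps_const \<omega>)"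
proof -
  have *: "fps_const \<omega> * fps_X = fps_const (1/2) * fps_X * (fps_const \<omega> + fps_const \<omega>)"
    by (simp add: mult.commute mult.left_commute)
  show ?thesis unfolding M_fps_def distrib_right apostol_fps_mult *
    by (simp add: algebra_simps)
qed

text \<open>
  Replacing \<open>\<omega>\<close> by its inverse is the substitution \<open>X \<mapsto> - X\<close>, since the defining equation
  \<open>M (exp X - \<omega>) = X/2 (exp X + \<omega>)\<close> is invariant under the two together. By this symmetry the
  leading terms do not depend on the polarization.
\<close>

lemma M_fps_inverse:
  assumes "\<omega> \<noteq> 0"
  shows "fps_nth (M_fps (inverse \<omega>)) m = (-1) ^ m * fps_nth (M_fps \<omega>) m"
proof -
  let ?A = "fps_compose (M_fps (inverse \<omega>)) (- fps_X)"
  have e: "fps_exp (-1) * fps_exp (1::complex) = 1"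
    by (simp flip: fps_exp_add_mult)
  have c: "fps_const \<omega> * fps_const (inverse \<omega>) = 1" using assms by simp
  have "?A * (fps_exp (-1) - fps_const (inverse \<omega>))
      = fps_compose (M_fps (inverse \<omega>) * (fps_exp 1 - fps_const (inverse \<omega>))) (- fps_X)"
    by (simp add: fps_compose_mult_distrib fps_compose_sub_distrib fps_compose_uminus[of "fps_exp 1"] flip: fps_exp_compose_linear)
  also have "\<dots> = - (fps_const (1/2) * fps_X) * (fps_exp (-1) + fps_const (inverse \<omega>))"
    unfolding M_fps_mult
    by (simp add: fps_compose_mult_distrib fps_compose_add_distrib flip: fps_exp_compose_linear)
  finally have "?A * (fps_exp (-1) - fps_const (inverse \<omega>)) * (fps_exp 1 * fps_const \<omega>)
    = - (fps_const (1/2) * fps_X) * (fps_exp (-1) + fps_const (inverse \<omega>)) * (fps_exp 1 * fps_const \<omega>)"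
    by simp
  moreover have "(fps_exp (-1) - fps_const (inverse \<omega>)) * (fps_exp 1 * fps_const \<omega>) = fps_const \<omega> - fps_exp 1"
  proof -
    have "(fps_exp (-1) - fps_const (inverse \<omega>)) * (fps_exp 1 * fps_const \<omega>)
      = (fps_exp (-1) * fps_exp 1) * fps_const \<omega> - (fps_const \<omega> * fps_const (inverse \<omega>)) * fps_exp 1"
      by (simp only: algebra_simps)
    then show ?thesis unfolding e c by simp
  qed
  moreover have "(fps_exp (-1) + fps_const (inverse \<omega>)) * (fps_exp 1 * fps_const \<omega>) = fps_const \<omega> + fps_exp 1"
  proof -
    have "(fps_exp (-1) + fps_const (inverse \<omega>)) * (fps_exp 1 * fps_const \<omega>)
      = (fps_exp (-1) * fps_exp 1) * fps_const \<omega> + (fps_const \<omega> * fps_const (inverse \<omega>)) * fps_exp 1"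
      by (simp only: algebra_simps)
    then show ?thesis unfolding e c by simp
  qed
  ultimately have "?A * (fps_const \<omega> - fps_exp 1) = - (fps_const (1/2) * fps_X) * (fps_const \<omega> + fps_exp 1)"
    by (simp only: mult.assoc)
  then have "?A * (fps_exp 1 - fps_const \<omega>) = fps_const (1/2) * fps_X * (fps_exp 1 + fps_const \<omega>)"
    by (metis (no_types, lifting) add.commute minus_diff_eq mult_minus_left mult_minus_right minus_minus)
  then have "?A = M_fps \<omega>" by (rule M_fps_unique)
  then have "fps_nth (M_fps \<omega>) m = (-1)^m * fps_nth (M_fps (inverse \<omega>)) m"
    using fps_compose_linear[of "M_fps (inverse \<omega>)" "-1"]
    by (metis fps_nth_Abs_fps fps_const_neg fps_const_1_eq_1 mult_minus1)
  then show ?thesis by (simp flip: power_add mult.assoc)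
qed

lemma apostol_poly_0: "apostol_poly \<omega> m 0 = fps_nth (apostol_fps \<omega>) m"
  by (simp add: apostol_poly_def)

text \<open>
  The values at the two end points of the unit interval match up to the factor \<open>\<omega>\<close>, except for a
  jump of the function with index 1.
\<close>

lemma apostol_poly_1:
  "apostol_poly \<omega> m 1 = \<omega> * apostol_poly \<omega> m 0 + (if m = 1 then \<omega> else 0)"
  by (simp add: apostol_poly_def apostol_fps_mult_exp)

lemma apostol_poly_expand:
  "apostol_poly \<omega> m x = (\<Sum>i\<le>m. fps_nth (apostol_fps \<omega>) i * (of_real x ^ (m - i) / fact (m - i)))"
  by (simp add: apostol_poly_def fps_mult_nth atLeast0AtMost)

lemma has_vector_derivative_apostol_poly:
  "(apostol_poly \<omega> (Suc m) has_vector_derivative apostol_poly \<omega> m x) (at x within S)"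
proof -
  have "((\<lambda>z::complex. z ^ Suc j / fact (Suc j)) has_field_derivative (z ^ j / fact j)) (at z)" for j z
  proof -
    have "((\<lambda>z::complex. z ^ Suc j / fact (Suc j)) has_field_derivative (of_nat (Suc j) * z ^ j / fact (Suc j))) (at z)"
      by (auto intro!: derivative_eq_intros simp del: fact_Suc power_Suc of_nat_Suc)
    moreover have "of_nat (Suc j) * z ^ j / fact (Suc j) = z ^ j / (fact j :: complex)"
      by (simp add: fact_Suc[where 'a=complex] del: of_nat_Suc)
    ultimately show ?thesis by simp
  qed
  then have d: "((\<lambda>x. of_real x ^ Suc j / fact (Suc j)) has_vector_derivative (of_real x ^ j / fact j :: complex)) (at x within S)" for j
    using has_vector_derivative_real_field field_differentiable_def by blast
  have eq: "apostol_poly \<omega> (Suc m) = (\<lambda>x. (\<Sum>i\<le>m. fps_nth (apostol_fps \<omega>) i * (of_real x ^ Suc (m - i) / fact (Suc (m - i))))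
     + fps_nth (apostol_fps \<omega>) (Suc m))"
    by (rule ext) (auto simp: apostol_poly_expand Suc_diff_le simp del: fact_Suc power_Suc intro!: sum.cong)
  have "((\<lambda>x. (\<Sum>i\<le>m. fps_nth (apostol_fps \<omega>) i * (of_real x ^ Suc (m - i) / fact (Suc (m - i))))
     + fps_nth (apostol_fps \<omega>) (Suc m)) has_vector_derivative
      (\<Sum>i\<le>m. fps_nth (apostol_fps \<omega>) i * (of_real x ^ (m - i) / fact (m - i))) + 0) (at x within S)"
    by (intro has_vector_derivative_add has_vector_derivative_sum has_vector_derivative_mult_right d has_vector_derivative_const)
  then show ?thesis unfolding eq by (simp add: apostol_poly_expand)
qed

lemma has_vector_derivative_apostol_poly_shift:
  "((\<lambda>x. apostol_poly \<omega> (Suc m) (x - c)) has_vector_derivative apostol_poly \<omega> m (x - c)) (at x)"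
proof -
  have "((\<lambda>x. x - c) has_vector_derivative 1) (at x)"
    by (auto intro!: derivative_eq_intros)
  from vector_diff_chain_at[OF this has_vector_derivative_apostol_poly[of \<omega> m "x - c" UNIV]]
  show ?thesis by (simp add: o_def)
qed

lemma continuous_on_apostol_poly [continuous_intros]:
  "continuous_on S f \<Longrightarrow> continuous_on S (\<lambda>x. apostol_poly \<omega> m (f x))"
  unfolding apostol_poly_expand by (intro continuous_intros) auto

lemma periodic_Q_eq:
  assumes "of_int n \<le> x" "x < of_int n + 1"
  shows "periodic_Q \<omega> m x = \<omega> powi n * apostol_poly \<omega> m (x - of_int n)"
proof -
  have "\<lfloor>x\<rfloor> = n" using assms by (simp add: floor_eq_iff)
  then show ?thesis by (simp add: periodic_Q_def frac_def)
qed

lemma periodic_Q_eq_closed: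
  assumes "of_int n \<le> x" "x \<le> of_int n + 1" "m \<noteq> 1" "\<omega> \<noteq> 0"
  shows "periodic_Q \<omega> m x = \<omega> powi n * apostol_poly \<omega> m (x - of_int n)"
proof (cases "x = of_int n + 1")
  case True
  then have "periodic_Q \<omega> m x = \<omega> powi (n + 1) * apostol_poly \<omega> m 0"
    using periodic_Q_eq[of "n + 1" x \<omega> m] by simp
  with True assms show ?thesis by (simp add: apostol_poly_1 power_int_add)
qed (use assms periodic_Q_eq in auto)

lemma periodic_Q_0: "periodic_Q \<omega> m 0 = fps_nth (apostol_fps \<omega>) m"
  by (simp add: periodic_Q_def apostol_poly_0)

lemma periodic_Q_add_of_nat:
  assumes "\<omega> \<noteq> 0"
  shows "periodic_Q \<omega> m (x + of_nat n) = \<omega> ^ n * periodic_Q \<omega> m x"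
proof -
  have "\<lfloor>x + of_nat n\<rfloor> = \<lfloor>x\<rfloor> + int n" "frac (x + of_nat n) = frac x"
    by (simp_all add: frac_def)
  then show ?thesis using assms by (simp add: periodic_Q_def power_int_add)
qed

lemma has_vector_derivative_periodic_Q:
  assumes "x \<notin> \<int>"
  shows "(periodic_Q \<omega> (Suc m) has_vector_derivative periodic_Q \<omega> m x) (at x)"
proof -
  define n where "n = \<lfloor>x\<rfloor>"
  have x: "x \<in> {of_int n<..<of_int n + 1}"
    using assms floor_correct[of x] Ints_of_int[of n] by (auto simp: n_def less_le)
  have "((\<lambda>x. \<omega> powi n * apostol_poly \<omega> (Suc m) (x - of_int n)) has_vector_derivative
         \<omega> powi n * apostol_poly \<omega> m (x - of_int n)) (at x)"
    by (intro has_vector_derivative_mult_right has_vector_derivative_apostol_poly_shift)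
  then have "(periodic_Q \<omega> (Suc m) has_vector_derivative
         \<omega> powi n * apostol_poly \<omega> m (x - of_int n)) (at x)"
    by (rule has_vector_derivative_transform_within_open[where S = "{of_int n<..<of_int n + 1}"])
       (use x periodic_Q_eq[of n _ \<omega> "Suc m"] in auto)
  moreover have "periodic_Q \<omega> m x = \<omega> powi n * apostol_poly \<omega> m (x - of_int n)"
    using x by (intro periodic_Q_eq) auto
  ultimately show ?thesis by simp
qed

lemma continuous_on_periodic_Q:
  assumes "m \<noteq> 1" "\<omega> \<noteq> 0"
  shows "continuous_on S (periodic_Q \<omega> m)"
proof -
  have *: "continuous_on {of_int n..of_int n + 1} (periodic_Q \<omega> m)" for n :: int
  proof (rule continuous_on_eq)
    show "continuous_on {of_int n..of_int n + 1} (\<lambda>x. \<omega> powi n * apostol_poly \<omega> m (x - of_int n))"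
      by (intro continuous_intros)
  qed (use assms periodic_Q_eq_closed in auto)
  have "isCont (periodic_Q \<omega> m) x" for x
  proof -
    define n where "n = \<lfloor>x\<rfloor>"
    have "continuous_on ({of_int (n - 1)..of_int (n - 1) + 1} \<union> {of_int n..of_int n + 1}) (periodic_Q \<omega> m)"
      by (intro continuous_on_closed_Un *) auto
    moreover have "{of_int n - 1<..<of_int n + 1} \<subseteq> {of_int (n - 1)..of_int (n - 1) + 1} \<union> {of_int n..of_int n + 1::real}"
      by auto
    ultimately have "continuous_on {of_int n - 1<..<of_int n + 1} (periodic_Q \<omega> m)"
      by (rule continuous_on_subset)
    moreover have "x \<in> {of_int n - 1<..<of_int n + 1}"
      using floor_correct[of x] unfolding n_def greaterThanLessThan_iff by linarith
    ultimately show ?thesis by (simp add: continuous_on_eq_continuous_at)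
  qed
  then show ?thesis by (simp add: continuous_at_imp_continuous_on)
qed

lemma finite_Ints_interval: "finite ({a..b::real} \<inter> \<int>)"
proof (rule finite_subset)
  show "{a..b::real} \<inter> \<int> \<subseteq> of_int ` {\<lfloor>a\<rfloor>..\<lceil>b\<rceil>}"
    by (auto elim!: Ints_cases simp: floor_le_iff le_ceiling_iff)
qed simp

lemma has_integral_periodic_Q:
  assumes "\<omega> \<noteq> 0" "a \<le> b" "m \<ge> 1"
  shows "(periodic_Q \<omega> m has_integral (periodic_Q \<omega> (Suc m) b - periodic_Q \<omega> (Suc m) a)) {a..b}"
proof (rule fundamental_theorem_of_calculus_strong[OF finite_Ints_interval])
  show "(periodic_Q \<omega> (Suc m) has_vector_derivative periodic_Q \<omega> m x) (at x)"
    if "x \<in> {a..b} - {a..b} \<inter> \<int>" for x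
    using that by (intro has_vector_derivative_periodic_Q) auto
qed (use assms continuous_on_periodic_Q in auto)

lemma root_order:
  assumes "N > 0" "\<omega> ^ N = 1"
  shows "root_order \<omega> > 0" "\<omega> ^ root_order \<omega> = 1"
  unfolding root_order_def using LeastI[of "\<lambda>N. 0 < N \<and> \<omega> ^ N = 1" N] assms by auto

lemma apostol_fps_1:
  assumes "\<omega> \<noteq> 1"
  shows "fps_nth (apostol_fps \<omega>) 0 = 0" "fps_nth (apostol_fps \<omega>) (Suc 0) = \<omega> / (1 - \<omega>)"
proof -
  have "fps_nth (apostol_fps \<omega> * (fps_exp 1 - fps_const \<omega>)) 0 = 0"
    unfolding apostol_fps_mult by simp
  then show 0: "fps_nth (apostol_fps \<omega>) 0 = 0" using assms by simp
  have "fps_nth (apostol_fps \<omega> * (fps_exp 1 - fps_const \<omega>)) 1 = \<omega>"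
    unfolding apostol_fps_mult by simp
  then show "fps_nth (apostol_fps \<omega>) (Suc 0) = \<omega> / (1 - \<omega>)"
    using assms 0 by (simp add: fps_mult_nth field_simps)
qed

text \<open>
  Each \<open>Q_twisted\<close> is the primitive of the preceding one with mean zero over a period; being
  periodic, \<open>periodic_Q\<close> has mean zero because it is itself the derivative of a periodic function.
\<close>

lemma Q_twisted_eq_periodic_Q:
  assumes "N > 0" "\<omega> ^ N = 1" "\<omega> \<noteq> 1"
  shows "Q_twisted (Suc m) \<omega> = periodic_Q \<omega> (Suc m)"
proof (induction m)
  case 0
  show ?case
    by (rule ext) (simp add: periodic_Q_def apostol_poly_expand apostol_fps_1 assms)
next
  case (Suc m)
  let ?N = "root_order \<omega>"
  have N: "?N > 0" "\<omega> ^ ?N = 1" using root_order assms by auto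
  have nz: "\<omega> \<noteq> 0" using assms by (auto simp: power_0_left)
  let ?P = "\<lambda>q. (\<forall>x. q (x + real ?N) = q x) \<and>
             (\<forall>a b. a \<le> b \<longrightarrow> (Q_twisted (Suc m) \<omega> has_integral (q b - q a)) {a..b}) \<and>
             (q has_integral 0) {0..real ?N}"
  have per: "periodic_Q \<omega> j (real ?N) = periodic_Q \<omega> j 0" for j
    using periodic_Q_add_of_nat[OF nz, of j 0 ?N] N by simp
  have P: "?P (periodic_Q \<omega> (Suc (Suc m)))"
  proof (intro conjI allI impI)
    show "periodic_Q \<omega> (Suc (Suc m)) (x + real ?N) = periodic_Q \<omega> (Suc (Suc m)) x" for x
      using periodic_Q_add_of_nat[OF nz] N by simp
    show "(Q_twisted (Suc m) \<omega> has_integral (periodic_Q \<omega> (Suc (Suc m)) b - periodic_Q \<omega> (Suc (Suc m)) a)) {a..b}"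
      if "a \<le> b" for a b
      unfolding Suc.IH using that nz by (intro has_integral_periodic_Q) auto
    show "(periodic_Q \<omega> (Suc (Suc m)) has_integral 0) {0..real ?N}"
      using has_integral_periodic_Q[OF nz, of 0 "real ?N" "Suc (Suc m)"] per by simp
  qed
  have "(THE q. ?P q) = periodic_Q \<omega> (Suc (Suc m))"
  proof (rule the_equality)
    fix q assume q: "?P q"
    let ?p = "periodic_Q \<omega> (Suc (Suc m))"
    (* Two primitives of the same function differ by a constant, which the mean value zero
       forces to vanish. *)
    define c where "c = q 0 - ?p 0"
    have const: "q x = ?p x + c" for x
    proof (cases "0 \<le> x")
      case True
      then have "q x - q 0 = ?p x - ?p 0"
        using P q has_integral_unique by blast
      then show ?thesis by (simp add: c_def algebra_simps)
    next
      case False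
      then have "q 0 - q x = ?p 0 - ?p x"
        using P q has_integral_unique by (meson linear)
      then show ?thesis by (simp add: c_def algebra_simps)
    qed
    have "((\<lambda>x. q x - ?p x) has_integral (0 - 0)) {0..real ?N}"
      using P q by (intro has_integral_diff) blast+
    then have "((\<lambda>x. c) has_integral 0) {0..real ?N}" by (simp add: const)
    moreover have "((\<lambda>x. c) has_integral (real ?N *\<^sub>R c)) {0..real ?N}"
      using has_integral_const_real[of c 0 "real ?N"] by simp
    ultimately have "real ?N *\<^sub>R c = 0" by (metis has_integral_unique)
    then have "c = 0" using N by simp
    with const show "q = ?p" by (intro ext) simp
  qed (rule P)
  then show ?case by simp
qed

lemma Q_fun_eq_periodic_Q:
  assumes "N > 0" "\<omega> ^ N = 1" "m \<ge> 1"
  shows "Q_fun m \<omega> x = periodic_Q \<omega> m x"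
proof (cases "\<omega> = 1")
  case True
  have map: "complex_of_real (fps_nth (A * B) j) = fps_nth (Abs_fps (\<lambda>i. of_real (fps_nth A i)) * Abs_fps (\<lambda>i. of_real (fps_nth B i))) j"
    for A B :: "real fps" and j by (simp add: fps_mult_nth)
  let ?h = "\<lambda>A. Abs_fps (\<lambda>i. complex_of_real (fps_nth A i))"
  have h_mult: "?h (A * B) = ?h A * ?h B" for A B by (rule fps_ext) (simp add: map)
  let ?b = "fps_X / (fps_exp 1 - 1) :: real fps"
  have "fps_exp 1 - 1 dvd (fps_X :: real fps)"
  proof -
    have "subdegree (fps_exp 1 - 1 :: real fps) = 1" by (intro subdegreeI) auto
    then show ?thesis using fps_dvd_iff[of "fps_exp 1 - 1" "fps_X :: real fps"] by force
  qed
  then have "?b * (fps_exp 1 - 1) = fps_X" by (rule dvd_div_mult_self)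
  then have "?h ?b * ?h (fps_exp 1 - 1) = ?h fps_X" by (metis h_mult)
  moreover have "?h (fps_exp 1 - 1) = fps_exp 1 - 1" "?h fps_X = fps_X"
    by (rule fps_ext; simp add: fps_X_def)+
  ultimately have "?h ?b = apostol_fps 1"
    by (intro apostol_fps_unique) simp
  moreover have "?h (fps_exp y) = fps_exp (of_real y)" for y
    by (rule fps_ext) simp
  ultimately have "complex_of_real (fps_nth (?b * fps_exp y) m) = apostol_poly 1 m y" for y
    by (simp add: map apostol_poly_def)
  with True show ?thesis by (simp add: Q_fun_def bernoulli_poly_def periodic_Q_def)
next
  case False
  then obtain j where "m = Suc j" using assms by (cases m) auto
  with False assms show ?thesis by (simp add: Q_fun_def Q_twisted_eq_periodic_Q del: Q_twisted.simps)
qed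

lemma L_fps_eq: "L_fps = M_fps 1"
proof (rule M_fps_unique)
  let ?s = "fps_exp (1/2) - fps_exp (-1/2) :: complex fps" and ?c = "fps_exp (1/2) + fps_exp (-1/2) :: complex fps"
  have c0: "fps_nth ?c 0 \<noteq> 0" by simp
  have tc: "tanh_half_fps * ?c = ?s"
    unfolding tanh_half_fps_def by (rule dvd_div_mult_self) (use c0 in \<open>simp add: unit_imp_dvd\<close>)
  have "subdegree tanh_half_fps = 1"
  proof -
    have "subdegree ?s = 1" by (intro subdegreeI) auto
    moreover have "subdegree ?c = 0" using c0 by (simp add: subdegree_eq_0_iff)
    moreover have "?s \<noteq> 0" using \<open>subdegree ?s = 1\<close> by auto
    ultimately show ?thesis using tc subdegree_mult[of tanh_half_fps ?c]
      by (metis add.right_neutral mult_zero_left mult_zero_right)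
  qed
  then have "tanh_half_fps dvd fps_const (1/2) * fps_X"
    using fps_dvd_iff[of tanh_half_fps "fps_X"] by force
  then have "L_fps * tanh_half_fps = fps_const (1/2) * fps_X"
    unfolding L_fps_def by (rule dvd_div_mult_self)
  then have "L_fps * ?s = fps_const (1/2) * fps_X * ?c"
    using tc by (metis mult.assoc)
  then have "L_fps * ?s * fps_exp (1/2) = fps_const (1/2) * fps_X * ?c * fps_exp (1/2)" by simp
  moreover have "?s * fps_exp (1/2) = fps_exp 1 - fps_const 1" "?c * fps_exp (1/2) = fps_exp 1 + fps_const 1"
    by (simp_all add: algebra_simps flip: fps_exp_add_mult)
  ultimately show "L_fps * (fps_exp 1 - fps_const 1) = fps_const (1/2) * fps_X * (fps_exp 1 + fps_const 1)"
    by (simp only: mult.assoc)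
qed

text \<open>
  The untruncated series for \<open>\<omega> = 1\<close> is even, so that truncation at the even number
  \<open>2 * (k div 2)\<close> is truncation at \<open>k\<close>.
\<close>

lemma M_poly_coeff:
  assumes "N > 0" "\<omega> ^ N = 1" "k \<ge> 1"
  shows "coeff (M_poly k \<omega>) m = (if m \<le> k then fps_nth (M_fps \<omega>) m else 0)"
proof (cases "\<omega> = 1")
  case True
  have odd0: "fps_nth (M_fps 1) m = 0" if "odd m" for m
    using M_fps_inverse[of 1 m] that by simp
  have "coeff (M_poly k 1) m = (if m < Suc (2 * (k div 2)) then fps_nth (M_fps 1) m else 0)"
    by (simp add: M_poly_def L_fps_eq coeff_truncate_fps)
  moreover have "odd m" if "m \<le> k" "\<not> m < Suc (2 * (k div 2))"
    using that by presburger
  ultimately show ?thesis using odd0 True by auto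
next
  case False
  have "coeff (M_poly k \<omega>) m = (if m = 1 then 1/2 + \<omega> / (1 - \<omega>) else 0) + (if m \<in> {2..k} then Q_fun m \<omega> 0 else 0)"
    using False by (simp add: M_poly_def coeff_sum)
  moreover have "Q_fun m \<omega> 0 = fps_nth (apostol_fps \<omega>) m" if "m \<in> {2..k}"
    using that assms by (simp add: Q_fun_eq_periodic_Q periodic_Q_0)
  moreover have "m = 0 \<or> m = 1 \<or> m \<ge> 2" by linarith
  ultimately show ?thesis using False assms(3) apostol_fps_1[of \<omega>] by (auto simp: M_fps_def)
qed

lemma periodic_Q_measurable [measurable]: "periodic_Q \<omega> m \<in> borel_measurable borel"
proof -
  have "(\<lambda>x::real. \<omega> powi \<lfloor>x\<rfloor>) \<in> borel_measurable borel"
    by (rule measurable_compose[where g = "\<lambda>n. \<omega> powi n" and N = "count_space UNIV"]) auto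
  moreover have "(\<lambda>x. apostol_poly \<omega> m (frac x)) \<in> borel_measurable borel"
    unfolding apostol_poly_expand frac_def by measurable
  ultimately show ?thesis unfolding periodic_Q_def[abs_def] by (rule borel_measurable_times)
qed

lemma bounded_periodic_Q:
  assumes "norm \<omega> = 1"
  shows "bounded (range (periodic_Q \<omega> m))"
proof -
  have "compact (apostol_poly \<omega> m ` {0..1})"
    by (intro compact_continuous_image continuous_intros compact_Icc)
  then have "bounded (apostol_poly \<omega> m ` {0..1})" by (rule compact_imp_bounded)
  then obtain C where C: "\<forall>y\<in>apostol_poly \<omega> m ` {0..1}. norm y \<le> C"
    unfolding bounded_iff by blast
  have "norm (periodic_Q \<omega> m x) \<le> C" for x
  proof -
    have "frac x \<in> {0..1}" using frac_ge_0[of x] frac_lt_1[of x] by simp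
    then have "norm (apostol_poly \<omega> m (frac x)) \<le> C" using C by blast
    then show ?thesis using assms by (simp add: periodic_Q_def norm_mult norm_power_int)
  qed
  then show ?thesis by (auto intro!: boundedI)
qed

text \<open>
  The coefficient of the \<open>m\<close>-th derivative in the formula of order \<open>k\<close>: a constant, and for
  \<open>m = k\<close> also the periodic function of the remainder. The sign of the constant is that of the
  operator at \<open>- d/ds\<close>.
\<close>

definition EM_coeff :: "nat \<Rightarrow> complex \<Rightarrow> nat \<Rightarrow> real \<Rightarrow> complex" where
  "EM_coeff k \<omega> m s = (-1) ^ m * fps_nth (M_fps \<omega>) m + (if m = k then (-1) ^ (k - 1) * periodic_Q \<omega> k s else 0)"

text \<open>
  Integration by parts on each interval between consecutive integers. The jumps of the periodic
  function with index 1 produce the sum of the values of \<open>G 0\<close>.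
\<close>

lemma Euler_Maclaurin_order_1:
  fixes G :: "nat \<Rightarrow> real \<Rightarrow> complex"
  assumes der: "\<And>t. (G 0 has_vector_derivative G 1 t) (at t)"
    and vanish: "G 0 (real B) = 0" and nz: "\<omega> \<noteq> 0"
  shows "((\<lambda>s. \<Sum>m\<le>1. EM_coeff 1 \<omega> m s * G m s) has_integral
          (\<Sum>n\<le>B. (if n = 0 then 1/2 else 1) * \<omega> ^ n * G 0 (real n))) {0..real B}"
proof -
  let ?a = "\<lambda>m. fps_nth (apostol_fps \<omega>) m"
  let ?q = "periodic_Q \<omega>"
  have contG: "continuous_on S (G 0)" for S
    using der by (meson continuous_at_imp_continuous_on has_vector_derivative_continuous)
  have "fps_nth (apostol_fps \<omega> * (fps_exp 1 - fps_const \<omega>)) 0 = 0"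
    unfolding apostol_fps_mult by simp
  then have a0: "?a 0 * (1 - \<omega>) = 0" by simp
  have q0: "?q 0 s = ?a 0" for s
    using a0 by (cases "\<omega> = 1") (auto simp: periodic_Q_def apostol_poly_expand)
  have step: "((\<lambda>s. ?q 1 s * G 1 s + ?a 0 * G 0 s) has_integral
      (\<omega> ^ Suc n * (?a 1 + 1) * G 0 (real (Suc n)) - \<omega> ^ n * ?a 1 * G 0 (real n))) {real n..real (Suc n)}" for n
  proof -
    have "((\<lambda>s. \<omega> ^ n * apostol_poly \<omega> 1 (s - real n) * G 1 s + \<omega> ^ n * apostol_poly \<omega> 0 (s - real n) * G 0 s) has_integral
      ((\<omega> ^ n * apostol_poly \<omega> 1 (real (Suc n) - real n)) * G 0 (real (Suc n)) -
       (\<omega> ^ n * apostol_poly \<omega> 1 (real n - real n)) * G 0 (real n))) {real n..real (Suc n)}"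
    proof (rule fundamental_theorem_of_calculus)
      fix s assume "s \<in> {real n..real (Suc n)}"
      have "((\<lambda>x. \<omega> ^ n * apostol_poly \<omega> (Suc 0) (x - real n)) has_vector_derivative
         \<omega> ^ n * apostol_poly \<omega> 0 (s - real n)) (at s)"
        by (intro has_vector_derivative_mult_right has_vector_derivative_apostol_poly_shift)
      then have "((\<lambda>x. \<omega> ^ n * apostol_poly \<omega> 1 (x - real n)) has_vector_derivative
         \<omega> ^ n * apostol_poly \<omega> 0 (s - real n)) (at s)" by simp
      from has_vector_derivative_mult[OF this der[of s]]
      show "((\<lambda>s. \<omega> ^ n * apostol_poly \<omega> 1 (s - real n) * G 0 s) has_vector_derivative
        \<omega> ^ n * apostol_poly \<omega> 1 (s - real n) * G 1 s + \<omega> ^ n * apostol_poly \<omega> 0 (s - real n) * G 0 s)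
        (at s within {real n..real (Suc n)})"
        by (rule has_vector_derivative_at_within)
    qed simp
    moreover have "\<omega> ^ n * apostol_poly \<omega> m (s - real n) = ?q m s" if "s \<in> {real n..real (Suc n)} - {real (Suc n)}" for s m
      using that periodic_Q_eq[of "int n" s \<omega> m] by auto
    ultimately have "((\<lambda>s. ?q 1 s * G 1 s + ?q 0 s * G 0 s) has_integral
      ((\<omega> ^ n * apostol_poly \<omega> 1 (real (Suc n) - real n)) * G 0 (real (Suc n)) -
       (\<omega> ^ n * apostol_poly \<omega> 1 (real n - real n)) * G 0 (real n))) {real n..real (Suc n)}"
      by (elim has_integral_spike_finite[of "{real (Suc n)}", rotated 2]) auto
    then show ?thesis using apostol_poly_1[of \<omega> 1] by (simp add: q0 apostol_poly_0 algebra_simps)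
  qed
  have A: "((\<lambda>s. ?q 1 s * G 1 s + ?a 0 * G 0 s) has_integral
      ((\<Sum>n\<in>{1..N}. \<omega> ^ n * G 0 (real n)) + \<omega> ^ N * ?a 1 * G 0 (real N) - ?a 1 * G 0 0)) {0..real N}" for N
  proof (induction N)
    case 0
    then show ?case using has_integral_refl(1)[of _ "0::real"] by simp
  next
    case (Suc N)
    have "((\<lambda>s. ?q 1 s * G 1 s + ?a 0 * G 0 s) has_integral
      (((\<Sum>n\<in>{1..N}. \<omega> ^ n * G 0 (real n)) + \<omega> ^ N * ?a 1 * G 0 (real N) - ?a 1 * G 0 0) +
       (\<omega> ^ Suc N * (?a 1 + 1) * G 0 (real (Suc N)) - \<omega> ^ N * ?a 1 * G 0 (real N)))) {0..real (Suc N)}"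
      by (rule has_integral_combine[OF _ _ Suc step]) auto
    then show ?case by (simp add: algebra_simps)
  qed
  have "(G 1 has_integral (G 0 (real B) - G 0 0)) {0..real B}"
    using der by (intro fundamental_theorem_of_calculus) (auto intro: has_vector_derivative_at_within)
  then have "((\<lambda>s. (?a 1 + 1/2) * G 1 s) has_integral ((?a 1 + 1/2) * (- G 0 0))) {0..real B}"
    using vanish by (intro has_integral_mult_right) simp
  from has_integral_diff[OF A[of B] this]
  have "((\<lambda>s. ?q 1 s * G 1 s + ?a 0 * G 0 s - (?a 1 + 1/2) * G 1 s) has_integral
     ((\<Sum>n\<in>{1..B}. \<omega> ^ n * G 0 (real n)) + 1/2 * G 0 0)) {0..real B}"
    using vanish by (simp add: algebra_simps)
  moreover have "(\<Sum>n\<le>B. (if n = 0 then 1/2 else 1) * \<omega> ^ n * G 0 (real n)) = (\<Sum>n\<in>{1..B}. \<omega> ^ n * G 0 (real n)) + 1/2 * G 0 0"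
  proof -
    have "{..B} = insert 0 {1..B}" by auto
    then show ?thesis by simp
  qed
  moreover have "?q 1 s * G 1 s + ?a 0 * G 0 s - (?a 1 + 1/2) * G 1 s = (\<Sum>m\<le>1. EM_coeff 1 \<omega> m s * G m s)" for s
    by (simp add: EM_coeff_def M_fps_def algebra_simps)
  ultimately show ?thesis by simp
qed

text \<open>
  The twisted Euler-Maclaurin formula for a function that vanishes to order \<open>k\<close> at the far end.
  The order is raised by integrating the last term by parts; from index 2 on the periodic
  functions are continuous, so this gives no terms at the interior integers.
\<close>

lemma Euler_Maclaurin:
  fixes G :: "nat \<Rightarrow> real \<Rightarrow> complex"
  assumes "k \<ge> 1" and nz: "\<omega> \<noteq> 0"
    and der: "\<And>m t. m < k \<Longrightarrow> (G m has_vector_derivative G (Suc m) t) (at t)"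
    and vanish: "\<And>m. m < k \<Longrightarrow> G m (real B) = 0"
  shows "((\<lambda>s. \<Sum>m\<le>k. EM_coeff k \<omega> m s * G m s) has_integral
          (\<Sum>n\<le>B. (if n = 0 then 1/2 else 1) * \<omega> ^ n * G 0 (real n))) {0..real B}"
  using assms(1) der vanish
proof (induction k rule: nat_induct_at_least)
  case base
  show ?case
    using base.prems(1)[of 0] base.prems(2)[of 0] nz by (intro Euler_Maclaurin_order_1) auto
next
  case (Suc k)
  let ?a = "\<lambda>m. fps_nth (apostol_fps \<omega>) m"
  let ?q = "periodic_Q \<omega>"
  have contG: "continuous_on S (G k)" for S
    using Suc.prems(1) by (meson continuous_at_imp_continuous_on has_vector_derivative_continuous lessI)
  (* The constant subtracted from the primitive is its value at 0; it removes the boundary term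
     there and reappears as the new constant coefficient. *)
  have "((\<lambda>s. (?q (Suc k) s - ?a (Suc k)) * G (Suc k) s + ?q k s * G k s) has_integral
        ((?q (Suc k) (real B) - ?a (Suc k)) * G k (real B) - (?q (Suc k) 0 - ?a (Suc k)) * G k 0)) {0..real B}"
  proof (rule fundamental_theorem_of_calculus_strong[OF finite_Ints_interval])
    fix s assume "s \<in> {0..real B} - {0..real B} \<inter> \<int>"
    then have "((\<lambda>s. ?q (Suc k) s - ?a (Suc k)) has_vector_derivative (?q k s - 0)) (at s)"
      by (intro has_vector_derivative_diff has_vector_derivative_periodic_Q has_vector_derivative_const) auto
    from has_vector_derivative_mult[OF this Suc.prems(1)[of k s]]
    show "((\<lambda>s. (?q (Suc k) s - ?a (Suc k)) * G k s) has_vector_derivative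
        (?q (Suc k) s - ?a (Suc k)) * G (Suc k) s + ?q k s * G k s) (at s)" by simp
  next
    show "continuous_on {0..real B} (\<lambda>s. (?q (Suc k) s - ?a (Suc k)) * G k s)"
      using Suc.hyps nz by (intro continuous_intros contG continuous_on_periodic_Q) auto
  qed simp
  then have "((\<lambda>s. (?q (Suc k) s - ?a (Suc k)) * G (Suc k) s + ?q k s * G k s) has_integral 0) {0..real B}"
    using Suc.prems(2)[of k] by (simp add: periodic_Q_0)
  from has_integral_mult_right[OF this, of "(-1)^k"]
  have "((\<lambda>s. (-1)^k * ((?q (Suc k) s - ?a (Suc k)) * G (Suc k) s + ?q k s * G k s)) has_integral 0) {0..real B}"
    by simp
  from has_integral_add[OF Suc.IH[OF Suc.prems] this]
  have "((\<lambda>s. (\<Sum>m\<le>k. EM_coeff k \<omega> m s * G m s) + (-1)^k * ((?q (Suc k) s - ?a (Suc k)) * G (Suc k) s + ?q k s * G k s))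
    has_integral (\<Sum>n\<le>B. (if n = 0 then 1/2 else 1) * \<omega> ^ n * G 0 (real n))) {0..real B}"
    by simp
  moreover have "(\<Sum>m\<le>k. EM_coeff k \<omega> m s * G m s) + (-1)^k * ((?q (Suc k) s - ?a (Suc k)) * G (Suc k) s + ?q k s * G k s)
    = (\<Sum>m\<le>Suc k. EM_coeff (Suc k) \<omega> m s * G m s)" for s
  proof -
    have k: "(-1) ^ k = - ((-1::complex) ^ (k - 1))" using Suc.hyps by (cases k) auto
    have s: "(\<Sum>m\<le>k. F m) = (\<Sum>m<k. F m) + F k" for F :: "nat \<Rightarrow> complex"
      by (simp flip: lessThan_Suc_atMost)
    have "(\<Sum>m<k. EM_coeff k \<omega> m s * G m s) = (\<Sum>m<k. EM_coeff (Suc k) \<omega> m s * G m s)"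
      by (intro sum.cong) (auto simp: EM_coeff_def)
    then show ?thesis using Suc.hyps
      by (simp add: s EM_coeff_def M_fps_def k algebra_simps)
  qed
  ultimately show ?case by simp
qed

section \<open>The polar decomposition of a simple polytope\<close>

text \<open>
  The value one half at 0 makes the product over all facets the weight of a point of the polytope.
\<close>

definition heaviside :: "real \<Rightarrow> real" where
  "heaviside t = (if t > 0 then 1 else if t = 0 then 1/2 else 0)"

text \<open>
  The combinatorial data of a simple polytope: its vertices \<open>V\<close>, the walls \<open>act v\<close> through a
  vertex and the dual bases \<open>\<alpha> v\<close> of their normals. The last two conditions say that every face
  has a vertex and that the polytope is bounded.
\<close>

locale simple_arrangement =
  fixes u :: "'d::finite \<Rightarrow> real ^ 'n" and \<mu> :: "real ^ 'd" and V :: "(real ^ 'n) set"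
    and \<alpha> :: "real ^ 'n \<Rightarrow> 'd \<Rightarrow> real ^ 'n" and act :: "real ^ 'n \<Rightarrow> 'd set"
  assumes finite_V: "finite V"
    and V_nonempty: "V \<noteq> {}"
    and active: "v \<in> V \<Longrightarrow> i \<in> act v \<longleftrightarrow> u i \<bullet> v + \<mu> $ i = 0"
    and feasible: "v \<in> V \<Longrightarrow> u i \<bullet> v + \<mu> $ i \<ge> 0"
    and dual: "v \<in> V \<Longrightarrow> i \<in> act v \<Longrightarrow> j \<in> act v \<Longrightarrow> u i \<bullet> \<alpha> v j = (if i = j then 1 else 0)"
    and expand: "v \<in> V \<Longrightarrow> x = (\<Sum>j\<in>act v. (u j \<bullet> x) *\<^sub>R \<alpha> v j)"
    and face_has_vertex: "(\<And>i. u i \<bullet> x + \<mu> $ i \<ge> 0) \<Longrightarrow> \<exists>v\<in>V. {i. u i \<bullet> x + \<mu> $ i = 0} \<subseteq> act v"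
    and no_recession: "(\<And>i. u i \<bullet> \<eta> \<ge> 0) \<Longrightarrow> \<eta> = 0"
begin

definition slack :: "real ^ 'n \<Rightarrow> real ^ 'd \<Rightarrow> 'd \<Rightarrow> real" where
  "slack x h i = u i \<bullet> x + \<mu> $ i + h $ i"

text \<open>
  The sum of the negative parts of the \<open>u i \<bullet> \<eta>\<close> is positive on the unit sphere, hence bounded
  below there by a positive constant, and by homogeneity grows at least linearly.
\<close>

lemma relaxation_bounded: "bounded {x. \<forall>i. slack x 0 i \<ge> - 1}"
proof -
  define \<phi> where "\<phi> = (\<lambda>\<eta>. \<Sum>i\<in>UNIV. max 0 (- (u i \<bullet> \<eta>)))"
  have cont: "continuous_on S \<phi>" for S
    unfolding \<phi>_def by (intro continuous_intros)
  have "sphere (0::real^'n) 1 \<noteq> {}" by simp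
  then obtain e where e: "e \<in> sphere 0 1" "\<And>\<eta>. \<eta> \<in> sphere 0 1 \<Longrightarrow> \<phi> e \<le> \<phi> \<eta>"
    using continuous_attains_inf[OF compact_sphere _ cont] by blast
  have "\<phi> e > 0"
  proof (rule ccontr)
    assume "\<not> \<phi> e > 0"
    moreover have "\<phi> e \<ge> 0" unfolding \<phi>_def by (intro sum_nonneg) simp
    ultimately have "\<phi> e = 0" by simp
    then have "\<forall>i\<in>UNIV. max 0 (- (u i \<bullet> e)) = 0"
      unfolding \<phi>_def by (subst (asm) sum_nonneg_eq_0_iff) auto
    then have "e = 0" by (intro no_recession) (metis UNIV_I max.cobounded2 neg_le_0_iff_le)
    with e(1) show False by simp
  qed
  have "norm x \<le> (\<Sum>i\<in>UNIV. 1 + \<bar>\<mu> $ i\<bar>) / \<phi> e" if x: "\<forall>i. slack x 0 i \<ge> - 1" for x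
  proof (cases "x = 0")
    case True
    then show ?thesis using \<open>\<phi> e > 0\<close> by (simp add: sum_nonneg)
  next
    case False
    have "\<phi> e \<le> \<phi> (x /\<^sub>R norm x)" using False by (intro e(2)) simp
    also have "\<dots> = \<phi> x / norm x"
      unfolding \<phi>_def sum_divide_distrib
      using False by (intro sum.cong refl) (simp add: max_def field_simps)
    finally have "\<phi> e * norm x \<le> \<phi> x" using False by (simp add: field_simps)
    also have "\<phi> x \<le> (\<Sum>i\<in>UNIV. 1 + \<bar>\<mu> $ i\<bar>)"
      unfolding \<phi>_def
    proof (rule sum_mono)
      fix i show "max 0 (- (u i \<bullet> x)) \<le> 1 + \<bar>\<mu> $ i\<bar>"
        using x[rule_format, of i] by (simp add: slack_def)
    qed
    finally show ?thesis using \<open>\<phi> e > 0\<close> by (simp add: field_simps)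
  qed
  then show ?thesis unfolding bounded_iff by blast
qed

lemma relaxation_compact: "compact {x. \<forall>i. slack x 0 i \<ge> - 1}"
proof -
  have "closed {x. \<forall>i. slack x 0 i \<ge> - 1}"
    unfolding slack_def by (intro closed_Collect_all closed_Collect_le continuous_intros)
  with relaxation_bounded show ?thesis by (simp add: compact_eq_bounded_closed)
qed

text \<open>
  A small parallel displacement of the walls creates no new incidences: if the walls in \<open>Z\<close>
  have no common point in the polytope, then by compactness they miss it by a positive distance.
\<close>

lemma stable_incidence:
  assumes "\<not> (\<exists>v\<in>V. Z \<subseteq> act v)"
  shows "\<exists>r>0. \<forall>(h :: real ^ 'd) x. (\<forall>i. \<bar>h $ i\<bar> < r) \<longrightarrow> (\<forall>i. slack x h i \<ge> 0) \<longrightarrow> (\<exists>i\<in>Z. slack x h i \<noteq> 0)"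
proof -
  define K where "K = {x. \<forall>i. slack x 0 i \<ge> - 1}"
  define g where "g = (\<lambda>x. (\<Sum>i\<in>UNIV. max 0 (- slack x 0 i)) + (\<Sum>i\<in>Z. \<bar>slack x 0 i\<bar>))"
  define N where "N = 1 + 2 * real CARD('d)"
  have cont: "continuous_on S g" for S
    unfolding g_def slack_def by (intro continuous_intros)
  have pos: "g x > 0" for x
  proof (rule ccontr)
    assume "\<not> g x > 0"
    moreover have nn: "(\<Sum>i\<in>UNIV. max 0 (- slack x 0 i)) \<ge> 0" "(\<Sum>i\<in>Z. \<bar>slack x 0 i\<bar>) \<ge> 0"
      by (intro sum_nonneg; simp)+
    ultimately have "(\<Sum>i\<in>UNIV. max 0 (- slack x 0 i)) = 0" "(\<Sum>i\<in>Z. \<bar>slack x 0 i\<bar>) = 0"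
      unfolding g_def by linarith+
    then have 0: "\<forall>i\<in>UNIV. max 0 (- slack x 0 i) = 0" "\<forall>i\<in>Z. \<bar>slack x 0 i\<bar> = 0"
      by (subst (asm) sum_nonneg_eq_0_iff; simp)+
    have "slack x 0 i \<ge> 0" for i using 0(1)[rule_format, of i, OF UNIV_I] by (simp add: max_def split: if_splits)
    then obtain v where "v \<in> V" "{i. u i \<bullet> x + \<mu> $ i = 0} \<subseteq> act v"
      using face_has_vertex[of x] by (auto simp: slack_def)
    moreover have "Z \<subseteq> {i. u i \<bullet> x + \<mu> $ i = 0}" using 0(2) by (auto simp: slack_def)
    ultimately show False using assms by blast
  qed
  obtain \<delta> where \<delta>: "\<delta> > 0" "\<And>x. x \<in> K \<Longrightarrow> \<delta> \<le> g x"
  proof (cases "K = {}")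
    case False
    then obtain e where "e \<in> K" "\<And>x. x \<in> K \<Longrightarrow> g e \<le> g x"
      using continuous_attains_inf[OF _ _ cont, of K] relaxation_compact unfolding K_def by blast
    then show ?thesis using pos that by blast
  qed (use that[of 1] in auto)
  define r where "r = min 1 (\<delta> / N)"
  have N: "N > 0" unfolding N_def by simp
  show ?thesis
  proof (intro exI[of _ r] conjI allI impI)
    show "r > 0" using \<delta>(1) N by (simp add: r_def)
    fix h :: "real ^ 'd" and x assume h: "\<forall>i. \<bar>h $ i\<bar> < r" and x: "\<forall>i. slack x h i \<ge> 0"
    show "\<exists>i\<in>Z. slack x h i \<noteq> 0"
    proof (rule ccontr)
      assume "\<not> (\<exists>i\<in>Z. slack x h i \<noteq> 0)"
      then have Z: "\<bar>slack x 0 i\<bar> \<le> r" if "i \<in> Z" for i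
        using that h[rule_format, of i] by (auto simp: slack_def)
      have low: "slack x 0 i \<ge> - r" for i
        using x[rule_format, of i] h[rule_format, of i] by (simp add: slack_def)
      have "r \<le> 1" by (simp add: r_def)
      then have "- 1 \<le> slack x 0 i" for i using low[of i] by linarith
      then have "x \<in> K" unfolding K_def by blast
      have "g x \<le> (\<Sum>i\<in>(UNIV::'d set). r) + (\<Sum>i\<in>Z. r)"
        unfolding g_def
      proof (intro add_mono sum_mono)
        show "max 0 (- slack x 0 i) \<le> r" for i using low[of i] \<open>r > 0\<close> by simp
      qed (use Z in auto)
      also have "\<dots> = (real CARD('d) + real (card Z)) * r" by (simp add: algebra_simps)
      also have "\<dots> < N * r"
        using card_mono[of UNIV Z] \<open>r > 0\<close> unfolding N_def by (intro mult_strict_right_mono) auto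
      also have "\<dots> \<le> \<delta>" using N unfolding r_def by (simp add: min_def field_simps)
      finally show False using \<delta>(2)[OF \<open>x \<in> K\<close>] by simp
    qed
  qed
qed

text \<open>
  Displacements by less than \<open>r\<close> do not change the combinatorial type of the polytope.
\<close>

definition small :: "real \<Rightarrow> bool" where
  "small r \<longleftrightarrow> r > 0 \<and>
     (\<forall>h x. (\<forall>i. \<bar>h $ i\<bar> < r) \<longrightarrow> (\<forall>i. slack x h i \<ge> 0) \<longrightarrow> (\<exists>v\<in>V. {i. slack x h i = 0} \<subseteq> act v)) \<and>
     (\<forall>h x. \<forall>v\<in>V. (\<forall>i. \<bar>h $ i\<bar> < r) \<longrightarrow> (\<forall>i\<in>act v. slack x h i = 0) \<longrightarrow> (\<forall>i. i \<notin> act v \<longrightarrow> slack x h i > 0))"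

text \<open>
  The displaced vertex depends continuously on \<open>h\<close>; the bound is explicit in the dual basis.
\<close>

lemma vertex_displacement:
  assumes v: "v \<in> V" and i: "i \<notin> act v"
  shows "\<exists>r>0. \<forall>(h :: real ^ 'd) x. (\<forall>i. \<bar>h $ i\<bar> < r) \<longrightarrow> (\<forall>i\<in>act v. slack x h i = 0) \<longrightarrow> slack x h i > 0"
proof -
  define s where "s = u i \<bullet> v + \<mu> $ i"
  have s: "s > 0" using active[OF v, of i] feasible[OF v, of i] i by (simp add: s_def)
  define N where "N = 1 + (\<Sum>j\<in>act v. \<bar>u i \<bullet> \<alpha> v j\<bar>)"
  have N: "N \<ge> 1" unfolding N_def by (simp add: sum_nonneg)
  show ?thesis
  proof (intro exI[of _ "s / N"] conjI allI impI)
    show "s / N > 0" using s N by simp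
    fix h :: "real ^ 'd" and x assume h: "\<forall>i. \<bar>h $ i\<bar> < s / N" and x: "\<forall>i\<in>act v. slack x h i = 0"
    have *: "u j \<bullet> (x - v) = - h $ j" if "j \<in> act v" for j
      using x that active[OF v, of j] by (auto simp: slack_def inner_diff_right)
    have "u i \<bullet> (x - v) = u i \<bullet> (\<Sum>j\<in>act v. (u j \<bullet> (x - v)) *\<^sub>R \<alpha> v j)"
      using expand[OF v, of "x - v"] by simp
    also have "\<dots> = (\<Sum>j\<in>act v. - h $ j * (u i \<bullet> \<alpha> v j))"
      by (simp add: inner_sum_right * cong: sum.cong)
    finally have eq: "slack x h i = s + h $ i + (\<Sum>j\<in>act v. - h $ j * (u i \<bullet> \<alpha> v j))"
      by (simp add: slack_def s_def inner_diff_right)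
    have "\<bar>\<Sum>j\<in>act v. - h $ j * (u i \<bullet> \<alpha> v j)\<bar> \<le> (\<Sum>j\<in>act v. (s / N) * \<bar>u i \<bullet> \<alpha> v j\<bar>)"
    proof (rule order_trans[OF sum_abs sum_mono])
      fix j show "\<bar>- h $ j * (u i \<bullet> \<alpha> v j)\<bar> \<le> s / N * \<bar>u i \<bullet> \<alpha> v j\<bar>"
        using h[rule_format, of j] unfolding abs_mult by (intro mult_right_mono) auto
    qed
    also have "\<dots> = (s / N) * (N - 1)" by (simp add: N_def sum_distrib_left)
    also have "\<dots> = s - s / N" using N by (simp add: field_simps)
    finally show "slack x h i > 0"
      using h[rule_format, of i] unfolding eq by linarith
  qed
qed

lemma ex_small: "\<exists>r. small r"
proof -
  define P1 where "P1 = (\<lambda>Z r. r > 0 \<and> (\<forall>(h :: real ^ 'd) x. (\<forall>i. \<bar>h $ i\<bar> < r) \<longrightarrow> (\<forall>i. slack x h i \<ge> 0) \<longrightarrow> (\<exists>i\<in>Z. slack x h i \<noteq> 0)))"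
  define P2 where "P2 = (\<lambda>(v, i) r. r > 0 \<and> (\<forall>(h :: real ^ 'd) x. (\<forall>i. \<bar>h $ i\<bar> < r) \<longrightarrow> (\<forall>i\<in>act v. slack x h i = 0) \<longrightarrow> slack x h i > 0))"
  define r1 where "r1 = (\<lambda>Z. SOME r. P1 Z r)"
  define r2 where "r2 = (\<lambda>p. SOME r. P2 p r)"
  have P1: "P1 Z (r1 Z)" if Z: "\<not> (\<exists>v\<in>V. Z \<subseteq> act v)" for Z
  proof -
    have "\<exists>r. P1 Z r" unfolding P1_def using stable_incidence[OF Z] .
    then show ?thesis unfolding r1_def by (rule someI_ex)
  qed
  have P2: "P2 (v, i) (r2 (v, i))" if vi: "v \<in> V" "i \<notin> act v" for v i
  proof -
    have "\<exists>r. P2 (v, i) r" unfolding P2_def prod.case using vertex_displacement[OF vi] .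
    then show ?thesis unfolding r2_def by (rule someI_ex)
  qed
  have r1: "r1 Z > 0" if "\<not> (\<exists>v\<in>V. Z \<subseteq> act v)" for Z
    using P1[OF that] by (simp add: P1_def)
  have r2: "r2 (v, i) > 0" if "v \<in> V" "i \<notin> act v" for v i
    using P2[OF that] by (simp add: P2_def)
  define S where "S = insert 1 (r1 ` {Z. \<not> (\<exists>v\<in>V. Z \<subseteq> act v)} \<union> r2 ` {(v, i). v \<in> V \<and> i \<notin> act v})"
  have "finite {(v, i). v \<in> V \<and> i \<notin> act v}"
    by (rule finite_subset[of _ "V \<times> UNIV"]) (use finite_V in auto)
  then have fin: "finite S" unfolding S_def by simp
  have "Min S > 0" using fin r1 r2 by (subst Min_gr_iff) (auto simp: S_def)
  have le: "Min S \<le> s" if "s \<in> S" for s using fin that by simp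
  have "small (Min S)"
    unfolding small_def
  proof (intro conjI allI impI ballI)
    fix h :: "real ^ 'd" and x assume h: "\<forall>i. \<bar>h $ i\<bar> < Min S" and x: "\<forall>i. slack x h i \<ge> 0"
    show "\<exists>v\<in>V. {i. slack x h i = 0} \<subseteq> act v"
    proof (rule ccontr)
      assume c: "\<not> ?thesis"
      then have "r1 {i. slack x h i = 0} \<in> S" unfolding S_def by blast
      then have "\<exists>i\<in>{i. slack x h i = 0}. slack x h i \<noteq> 0"
        using le h x P1[OF c] unfolding P1_def by (metis (no_types, lifting) less_le_trans)
      then show False by simp
    qed
  next
    fix h :: "real ^ 'd" and x v i assume "v \<in> V" "i \<notin> act v" and h: "\<forall>i. \<bar>h $ i\<bar> < Min S" and x: "\<forall>i\<in>act v. slack x h i = 0"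
    then have "r2 (v, i) \<in> S" unfolding S_def by auto
    then show "slack x h i > 0"
      using le h x P2[OF \<open>v \<in> V\<close> \<open>i \<notin> act v\<close>] unfolding P2_def by (simp, meson less_le_trans)
  qed fact
  then show ?thesis by blast
qed

end

locale polarized_arrangement = simple_arrangement u \<mu> V \<alpha> act
  for u :: "'d::finite \<Rightarrow> real ^ 'n" and \<mu> V \<alpha> act +
  fixes \<xi> :: "real ^ 'n"
  assumes polarizing: "v \<in> V \<Longrightarrow> j \<in> act v \<Longrightarrow> \<xi> \<bullet> \<alpha> v j \<noteq> 0"
begin

text \<open>
  As \<open>heaviside t - 1 = - heaviside (- t)\<close>, subtracting \<open>eps\<close> reverses, up to a sign, the edges
  along which \<open>\<xi>\<close> increases.
\<close>

definition eps :: "real ^ 'n \<Rightarrow> 'd \<Rightarrow> real" where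
  "eps v j = (if \<xi> \<bullet> \<alpha> v j > 0 then 1 else 0)"

text \<open>
  The difference of the two sides of the polar decomposition for the face cut out by the walls in
  \<open>J\<close>, as a function of the values \<open>c\<close> of the remaining affine forms.
\<close>

definition defect :: "'d set \<Rightarrow> ('d \<Rightarrow> real) \<Rightarrow> real" where
  "defect J c = (\<Prod>i\<in>- J. heaviside (c i))
     - (\<Sum>v | v \<in> V \<and> J \<subseteq> act v. \<Prod>j\<in>act v - J. heaviside (c j) - eps v j)"

text \<open>
  Both sides are affine in the single value \<open>heaviside (c i)\<close>, and its coefficient is the defect
  of the face with one more wall.
\<close>

lemma defect_diff:
  assumes i: "i \<notin> J" and same: "\<And>j. j \<notin> J \<Longrightarrow> j \<noteq> i \<Longrightarrow> heaviside (c j) = heaviside (c' j)"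
  shows "defect J c - defect J c' = (heaviside (c i) - heaviside (c' i)) * defect (insert i J) c"
proof -
  have L: "(\<Prod>j\<in>- J. heaviside (b j)) = heaviside (b i) * (\<Prod>j\<in>- insert i J. heaviside (b j))" for b
  proof -
    have "- J = insert i (- insert i J)" using i by auto
    then show ?thesis by (metis ComplD finite_code insertI1 prod.insert)
  qed
  have Lsame: "(\<Prod>j\<in>- insert i J. heaviside (c j)) = (\<Prod>j\<in>- insert i J. heaviside (c' j))"
    using same by (intro prod.cong) auto
  let ?T = "\<lambda>J b v. \<Prod>j\<in>act v - J. heaviside (b j) - eps v j"
  have R: "(\<Sum>v | v \<in> V \<and> J \<subseteq> act v. ?T J b v)
    = (\<Sum>v | v \<in> V \<and> J \<subseteq> act v \<and> i \<notin> act v. ?T J b v) +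
      (\<Sum>v | v \<in> V \<and> insert i J \<subseteq> act v. (heaviside (b i) - eps v i) * ?T (insert i J) b v)" for b
  proof -
    have "(\<Sum>v | v \<in> V \<and> J \<subseteq> act v. ?T J b v) =
      (\<Sum>v\<in>{v \<in> V. J \<subseteq> act v \<and> i \<notin> act v} \<union> {v \<in> V. insert i J \<subseteq> act v}. ?T J b v)"
      by (intro sum.cong) auto
    also have "\<dots> = (\<Sum>v | v \<in> V \<and> J \<subseteq> act v \<and> i \<notin> act v. ?T J b v) +
      (\<Sum>v | v \<in> V \<and> insert i J \<subseteq> act v. ?T J b v)"
      using finite_V by (intro sum.union_disjoint) auto
    also have "(\<Sum>v | v \<in> V \<and> insert i J \<subseteq> act v. ?T J b v) =
      (\<Sum>v | v \<in> V \<and> insert i J \<subseteq> act v. (heaviside (b i) - eps v i) * ?T (insert i J) b v)"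
    proof (intro sum.cong refl)
      fix v assume "v \<in> {v. v \<in> V \<and> insert i J \<subseteq> act v}"
      then have "act v - J = insert i (act v - insert i J)" using i by auto
      then show "?T J b v = (heaviside (b i) - eps v i) * ?T (insert i J) b v"
        by (metis (no_types, lifting) DiffD2 finite_code insertI1 prod.insert)
    qed
    finally show ?thesis .
  qed
  have Rsame1: "(\<Sum>v | v \<in> V \<and> J \<subseteq> act v \<and> i \<notin> act v. ?T J c v) = (\<Sum>v | v \<in> V \<and> J \<subseteq> act v \<and> i \<notin> act v. ?T J c' v)"
    using same by (intro sum.cong prod.cong refl) auto
  have Rsame2: "?T (insert i J) c v = ?T (insert i J) c' v" for v
    using same by (intro prod.cong) auto
  have diff: "(\<Sum>v\<in>A. (s - eps v i) * g v) - (\<Sum>v\<in>A. (t - eps v i) * g v) = (s - t) * (\<Sum>v\<in>A. g v)"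
    for A s t and g :: "real^'n \<Rightarrow> real"
    by (simp add: sum_distrib_left algebra_simps flip: sum_subtractf)
  show ?thesis
    unfolding defect_def[of J] L[of c] L[of c'] R[of c] R[of c'] Lsame Rsame1
    using diff[of "heaviside (c i)" "?T (insert i J) c" "{v \<in> V. insert i J \<subseteq> act v}" "heaviside (c' i)"]
    unfolding defect_def[of "insert i J"] Lsame Rsame2
    by (simp add: algebra_simps)
qed

lemma heaviside_average:
  assumes "0 < \<delta>" "t = 0 \<or> \<delta> < \<bar>t\<bar>"
  shows "2 * heaviside t = heaviside (t + \<delta>) + heaviside (t - \<delta>)"
  using assms by (auto simp: heaviside_def split: if_splits)

text \<open>
  At 0 the Heaviside function is the mean of its values on both sides, so a defect at a point on
  some walls is a mean of defects at displacements off these walls.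
\<close>

lemma defect_average:
  assumes pos: "\<And>i. 0 < \<delta> i" and small: "\<And>i. i \<notin> J \<Longrightarrow> c i = 0 \<or> \<delta> i < \<bar>c i\<bar>"
    and zero: "\<And>b. (\<And>i. i \<in> J \<Longrightarrow> b i = c i) \<Longrightarrow> (\<And>i. i \<notin> J \<Longrightarrow> b i = c i + \<delta> i \<or> b i = c i - \<delta> i) \<Longrightarrow> defect J b = 0"
  shows "defect J c = 0"
proof -
  have "defect J b = 0" if "S \<subseteq> - J" "\<And>i. i \<in> J \<union> S \<Longrightarrow> b i = c i"
    "\<And>i. i \<notin> J \<union> S \<Longrightarrow> b i = c i + \<delta> i \<or> b i = c i - \<delta> i" for S b
    using finite[of S] that
  proof (induction S arbitrary: b)
    case empty
    then show ?case by (intro zero) auto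
  next
    case (insert i S)
    have i: "i \<notin> J" "b i = c i" using insert.prems by auto
    let ?p = "b(i := c i + \<delta> i)" and ?m = "b(i := c i - \<delta> i)"
    have "defect J ?p = 0" "defect J ?m = 0"
      using insert.prems insert.hyps by (intro insert.IH; force)+
    moreover have "defect J b - defect J ?p = (heaviside (b i) - heaviside (c i + \<delta> i)) * defect (insert i J) b"
      using defect_diff[of i J b ?p] i by simp
    moreover have "defect J b - defect J ?m = (heaviside (b i) - heaviside (c i - \<delta> i)) * defect (insert i J) b"
      using defect_diff[of i J b ?m] i by simp
    ultimately have "2 * defect J b = (2 * heaviside (b i) - (heaviside (c i + \<delta> i) + heaviside (c i - \<delta> i))) * defect (insert i J) b"
      by (simp add: algebra_simps)
    also have "\<dots> = 0" using heaviside_average[of "\<delta> i" "c i"] pos[of i] small[of i] i by simp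
    finally show ?case by simp
  qed
  from this[of "- J" c] show ?thesis by auto
qed

lemma slack_line: "slack (x + s *\<^sub>R \<eta>) h i = slack x h i + s * (u i \<bullet> \<eta>)"
  by (simp add: slack_def inner_add_right)

lemma heaviside_pos_mult: "0 < s \<Longrightarrow> heaviside (s * t) = heaviside t"
  by (auto simp: heaviside_def zero_less_mult_iff)

lemma heaviside_same_side:
  assumes "s \<noteq> \<tau>" "s' \<noteq> \<tau>" "s < \<tau> \<longleftrightarrow> s' < \<tau>"
  shows "heaviside (a * (s - \<tau>)) = heaviside (a * (s' - \<tau>))"
proof (cases "s < \<tau>")
  case True
  then show ?thesis
    using heaviside_pos_mult[of "\<tau> - s" "-a"] heaviside_pos_mult[of "\<tau> - s'" "-a"] assms
    by (simp add: algebra_simps)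
next
  case False
  then show ?thesis
    using heaviside_pos_mult[of "s - \<tau>" "a"] heaviside_pos_mult[of "s' - \<tau>" "a"] assms
    by (simp add: algebra_simps)
qed

text \<open>
  Move the point along a direction \<open>\<eta>\<close> that is parallel to the walls in \<open>J\<close> and along which \<open>\<xi>\<close>
  increases. The defect changes only when another wall \<open>i\<close> is crossed, and then by a multiple of
  the defect for \<open>insert i J\<close> at the crossing point, which is zero by hypothesis. Far out on the
  line both sides vanish. The parameters \<open>\<tau> i\<close> of the crossings are distinct, so that the walls
  are crossed one at a time; the induction is on their number.
\<close>

lemma defect_on_generic_line:
  fixes h :: "real ^ 'd"
  assumes r: "small r" and h: "\<forall>i. \<bar>h $ i\<bar> < r"
    and IH: "\<And>i x. i \<notin> J \<Longrightarrow> \<exists>v\<in>V. insert i J \<subseteq> act v \<Longrightarrow> \<forall>j\<in>insert i J. slack x h j = 0 \<Longrightarrow>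
      defect (insert i J) (slack x h) = 0"
    and x: "\<forall>i\<in>J. slack x h i = 0"
    and \<eta>: "\<forall>i\<in>J. u i \<bullet> \<eta> = 0" "\<xi> \<bullet> \<eta> > 0"
    and distinct: "\<And>i j. i \<notin> J \<Longrightarrow> j \<notin> J \<Longrightarrow> i \<noteq> j \<Longrightarrow> u i \<bullet> \<eta> \<noteq> 0 \<Longrightarrow> u j \<bullet> \<eta> \<noteq> 0 \<Longrightarrow>
      slack x h i / (u i \<bullet> \<eta>) \<noteq> slack x h j / (u j \<bullet> \<eta>)"
    and s: "\<And>i. i \<notin> J \<Longrightarrow> slack x h i + s * (u i \<bullet> \<eta>) \<noteq> 0"
  shows "defect J (slack (x + s *\<^sub>R \<eta>) h) = 0"
proof -
  define a where "a = (\<lambda>i. u i \<bullet> \<eta>)"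
  (* The parameter at which the line meets the i-th wall. *)
  define \<tau> where "\<tau> = (\<lambda>i. - slack x h i / a i)"
  define A where "A = {i. i \<notin> J \<and> a i \<noteq> 0}"
  define y where "y = (\<lambda>s. slack (x + s *\<^sub>R \<eta>) h)"
  have y: "y s i = (if a i = 0 then slack x h i else a i * (s - \<tau> i))" for s i
    by (simp add: y_def slack_line a_def \<tau>_def field_simps)
  have \<tau>_inj: "i \<in> A \<Longrightarrow> j \<in> A \<Longrightarrow> i \<noteq> j \<Longrightarrow> \<tau> i \<noteq> \<tau> j" for i j
    using distinct[of i j] by (auto simp: \<tau>_def A_def a_def)
  have yJ: "y s i = 0" if "i \<in> J" for s i using that x \<eta>(1) by (simp add: y_def slack_line)
  have "defect J (y s) = 0" if "\<And>i. i \<notin> J \<Longrightarrow> y s i \<noteq> 0" for s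
    using that
  proof (induction "card {i \<in> A. \<tau> i > s}" arbitrary: s rule: less_induct)
    case less
    show ?case
    proof (cases "{i \<in> A. \<tau> i > s} = {}")
      case True
      then have late: "s > \<tau> i" if "i \<in> A" for i
        using less.prems[of i] that y[of s i] by (force simp: A_def)
      have sgn: "heaviside (y s i) = heaviside (a i)" if "i \<in> A" for i
        using late[OF that] that heaviside_pos_mult[of "s - \<tau> i" "a i"] by (simp add: y A_def mult.commute)
      have "\<not> (\<forall>i. a i \<ge> 0)"
      proof
        assume "\<forall>i. a i \<ge> 0"
        then have "\<eta> = 0" by (intro no_recession) (simp add: a_def)
        with \<eta>(2) show False by simp
      qed
      then obtain i where i: "a i < 0" by (auto simp: not_le)
      then have "i \<in> A" using \<eta>(1) by (auto simp: A_def a_def)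
      (* No wall lies ahead. The polytope contains no ray, so some form decreases along the
         line and is negative by now; and at each vertex some edge coordinate of the
         direction has the sign for which the factor is zero, because the linear form of
         the polarization increases. *)
      then have L: "(\<Prod>i\<in>- J. heaviside (y s i)) = 0"
        using i sgn[of i] by (intro prod_zero) (auto simp: A_def heaviside_def intro!: bexI[of _ i])
      have R: "(\<Prod>j\<in>act v - J. heaviside (y s j) - eps v j) = 0" if v: "v \<in> V" for v
      proof -
        have "\<xi> \<bullet> \<eta> = \<xi> \<bullet> (\<Sum>j\<in>act v. (u j \<bullet> \<eta>) *\<^sub>R \<alpha> v j)"
          using expand[OF v, of \<eta>] by simp
        also have "\<dots> = (\<Sum>j\<in>act v. a j * (\<xi> \<bullet> \<alpha> v j))"
          by (simp add: inner_sum_right a_def)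
        finally have "\<not> (\<forall>j\<in>act v. a j * (\<xi> \<bullet> \<alpha> v j) \<le> 0)"
          using \<eta>(2) sum_nonpos[of "act v" "\<lambda>j. a j * (\<xi> \<bullet> \<alpha> v j)"] by auto
        then obtain j where j: "j \<in> act v" "a j * (\<xi> \<bullet> \<alpha> v j) > 0" by force
        then have "j \<in> A" using \<eta>(1) by (auto simp: A_def a_def)
        moreover have "heaviside (a j) - eps v j = 0"
          using j(2) by (auto simp: heaviside_def eps_def zero_less_mult_iff)
        ultimately show ?thesis
          using j(1) sgn[of j] by (intro prod_zero) (auto simp: A_def)
      qed
      have "(\<Sum>v | v \<in> V \<and> J \<subseteq> act v. \<Prod>j\<in>act v - J. heaviside (y s j) - eps v j) = 0"
        using R by (intro sum.neutral) blast
      then show ?thesis unfolding defect_def L by simp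
    next
      case False
      let ?B = "{i \<in> A. \<tau> i > s}"
      have "Min (\<tau> ` ?B) \<in> \<tau> ` ?B" using False by (intro Min_in) auto
      then obtain i where i: "Min (\<tau> ` ?B) = \<tau> i" "i \<in> ?B" by (rule imageE)
      have first: "\<tau> i \<le> \<tau> j" if "j \<in> ?B" for j
        unfolding i(1)[symmetric] using that by (intro Min_le) auto
      have iA: "i \<in> A" "i \<notin> J" "a i \<noteq> 0" "\<tau> i > s" using i(2) by (auto simp: A_def)
      define C where "C = \<tau> ` {j \<in> A. \<tau> j > \<tau> i}"
      obtain s' where s': "s' > \<tau> i" "\<And>j. j \<in> A \<Longrightarrow> \<tau> j > \<tau> i \<Longrightarrow> \<tau> j > s'"
      proof (cases "C = {}")
        case True
        then show ?thesis using that[of "\<tau> i + 1"] by (auto simp: C_def)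
      next
        case nonempty: False
        then have "Min C > \<tau> i" by (subst Min_gr_iff) (auto simp: C_def)
        then obtain z where "\<tau> i < z" "z < Min C" using dense by blast
        moreover have "Min C \<le> \<tau> j" if "j \<in> A" "\<tau> j > \<tau> i" for j
          using that by (intro Min_le) (auto simp: C_def)
        ultimately show ?thesis by (intro that[of z]) force+
      qed
      have side: "(\<tau> j < s \<and> \<tau> j < \<tau> i \<and> \<tau> j < s') \<or> (\<tau> j > s \<and> \<tau> j > \<tau> i \<and> \<tau> j > s')"
        if j: "j \<in> A" "j \<noteq> i" for j
      proof -
        have "\<tau> j \<noteq> s" using less.prems[of j] j y[of s j] by (auto simp: A_def)
        moreover have "\<tau> j \<noteq> \<tau> i" using \<tau>_inj[of j i] j iA by auto
        ultimately show ?thesis using first[of j] j s' iA(4) by force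
      qed
      have same: "heaviside (y s j) = heaviside (y t j)" if "j \<notin> J" "j \<noteq> i" "t = \<tau> i \<or> t = s'" for j t
      proof (cases "a j = 0")
        case False
        then have "j \<in> A" using that by (simp add: A_def)
        then show ?thesis using side[of j] that False
          by (auto simp: y intro!: heaviside_same_side)
      qed (simp add: y)
      have nz: "y t j \<noteq> 0" if "j \<notin> J" "j \<noteq> i" "t = \<tau> i \<or> t = s'" for j t
        using same[OF that] less.prems[OF that(1)] by (auto simp: heaviside_def split: if_splits)
      have "defect J (y s') = 0"
      proof (rule less.hyps)
        have "i \<notin> {j \<in> A. \<tau> j > s'}" using s'(1) by simp
        moreover have "{j \<in> A. \<tau> j > s'} \<subseteq> ?B" using s'(1) iA(4) by auto
        ultimately have "{j \<in> A. \<tau> j > s'} \<subset> ?B" using i(2) by blast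
        then show "card {j \<in> A. \<tau> j > s'} < card ?B" by (intro psubset_card_mono) auto
        show "y s' j \<noteq> 0" if "j \<notin> J" for j
          using nz[of j s'] that s'(1) iA(3) y[of s' j] by (cases "j = i") auto
      qed
      moreover have "defect (insert i J) (y (\<tau> i)) = 0"
      proof (cases "\<exists>v\<in>V. insert i J \<subseteq> act v")
        case True
        then show ?thesis
          unfolding y_def using iA(2,3) yJ y[of "\<tau> i" i] by (intro IH) (auto simp: y_def)
      next
        case False
        (* Without a common vertex the walls meet only outside the displaced polytope,
           where both sides are zero. *)
        have "\<exists>j\<in>- insert i J. y (\<tau> i) j < 0"
        proof (rule ccontr)
          assume "\<not> ?thesis"
          then have "y (\<tau> i) j \<ge> 0" for j
            using yJ[of j "\<tau> i"] y[of "\<tau> i" i] iA(3) by (cases "j \<in> insert i J") (auto simp: not_less)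
          then obtain v where "v \<in> V" "{j. y (\<tau> i) j = 0} \<subseteq> act v"
            using r h unfolding small_def y_def by blast
          moreover have "insert i J \<subseteq> {j. y (\<tau> i) j = 0}"
            using yJ y[of "\<tau> i" i] iA(3) by auto
          ultimately show False using False by blast
        qed
        then obtain j where "j \<in> - insert i J" "y (\<tau> i) j < 0" by blast
        then have "(\<Prod>j\<in>- insert i J. heaviside (y (\<tau> i) j)) = 0"
          by (intro prod_zero bexI[of _ j]) (auto simp: heaviside_def)
        moreover have "{v. v \<in> V \<and> insert i J \<subseteq> act v} = {}" using False by blast
        ultimately show ?thesis unfolding defect_def by (simp only: sum.empty diff_zero)
      qed
      moreover have "defect (insert i J) (y (\<tau> i)) = defect (insert i J) (y s)"
      proof -
        have "heaviside (y (\<tau> i) j) = heaviside (y s j)" if "j \<notin> J" "j \<noteq> i" for j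
          using same[of j "\<tau> i"] that by simp
        then show ?thesis
          unfolding defect_def by (intro arg_cong2[of _ _ _ _ "(-)"] sum.cong prod.cong refl) auto
      qed
      moreover have "defect J (y s) - defect J (y s') = (heaviside (y s i) - heaviside (y s' i)) * defect (insert i J) (y s)"
        using same iA(2) by (intro defect_diff) auto
      ultimately show ?thesis by simp
    qed
  qed
  from this[of s] s show ?thesis by (simp add: y_def slack_line)
qed

text \<open>
  Perturb the \<open>i\<close>-th value by \<open>t * p i\<close> for a single small \<open>t\<close>. The weights \<open>p i\<close> are chosen with
  distinct quotients \<open>p i / \<bar>a i\<bar>\<close>, so that each coincidence between two walls excludes at most
  one \<open>t\<close>.
\<close>

lemma ex_generic_perturbation:
  fixes a c :: "'d \<Rightarrow> real"
  assumes "e > 0"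
  obtains \<delta> where "\<And>i. 0 < \<delta> i" "\<And>i. \<delta> i < e" "\<And>i. c i \<noteq> 0 \<Longrightarrow> \<delta> i < \<bar>c i\<bar>"
    "\<And>b i j. (\<And>i. b i = c i + \<delta> i \<or> b i = c i - \<delta> i) \<Longrightarrow> i \<noteq> j \<Longrightarrow> a i \<noteq> 0 \<Longrightarrow> a j \<noteq> 0 \<Longrightarrow> b i / a i \<noteq> b j / a j"
proof -
  obtain q :: "'d \<Rightarrow> nat" where q: "inj q" using finite_imp_inj_to_nat_seg[of "UNIV :: 'd set"] by auto
  define p where "p = (\<lambda>i. if a i = 0 then 1 else \<bar>a i\<bar> * (1 + real (q i)))"
  have p: "p i > 0" for i by (simp add: p_def add_pos_nonneg)
  define bad where "bad = (\<lambda>(i, j, \<sigma>, \<sigma>'). (c j / a j - c i / a i) / (\<sigma> * p i / a i - \<sigma>' * p j / a j))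
     ` (UNIV \<times> UNIV \<times> {1, -1} \<times> {1, -1})"
  define S where "S = insert e ((\<lambda>i. \<bar>c i\<bar>) ` {i. c i \<noteq> 0})"
  define T where "T = (\<lambda>(s, i). s / p i) ` (S \<times> UNIV)"
  have finS: "finite S" "finite T" "finite bad" by (auto simp: S_def T_def bad_def)
  have "T \<noteq> {}" by (simp add: T_def S_def)
  have "Min T > 0" using finS \<open>T \<noteq> {}\<close> p \<open>e > 0\<close> by (subst Min_gr_iff) (auto simp: T_def S_def)
  then have "infinite ({0<..<Min T} - bad)" using finS by (simp add: infinite_Ioo)
  then obtain t where t: "0 < t" "t < Min T" "t \<notin> bad"
    by (metis DiffE ex_in_conv finite.emptyI greaterThanLessThan_iff)
  have lt: "t * p i < s" if "s \<in> S" for s i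
  proof -
    have "Min T \<le> s / p i" using that finS by (intro Min_le) (auto simp: T_def)
    then show ?thesis using t(2) p[of i] by (simp add: pos_less_divide_eq[symmetric])
  qed
  show ?thesis
  proof (rule that[of "\<lambda>i. t * p i"])
    show "0 < t * p i" for i using t p by simp
    show "t * p i < e" for i by (rule lt) (simp add: S_def)
    show "t * p i < \<bar>c i\<bar>" if "c i \<noteq> 0" for i by (rule lt) (use that in \<open>simp add: S_def\<close>)
    fix b i j assume b: "\<And>i. b i = c i + t * p i \<or> b i = c i - t * p i" and ij: "i \<noteq> j" "a i \<noteq> 0" "a j \<noteq> 0"
    obtain \<sigma> where \<sigma>: "\<sigma> \<in> {1, -1}" "b i = c i + \<sigma> * (t * p i)" using b[of i] by force
    obtain \<sigma>' where \<sigma>': "\<sigma>' \<in> {1, -1}" "b j = c j + \<sigma>' * (t * p j)" using b[of j] by force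
    define D where "D = \<sigma> * p i / a i - \<sigma>' * p j / a j"
    have "\<bar>\<sigma> * p i / a i\<bar> = 1 + real (q i)" "\<bar>\<sigma>' * p j / a j\<bar> = 1 + real (q j)"
      using \<sigma>(1) \<sigma>'(1) ij by (auto simp: p_def abs_mult)
    moreover have "q i \<noteq> q j" using q ij(1) by (auto dest: injD)
    ultimately have "D \<noteq> 0" unfolding D_def by force
    show "b i / a i \<noteq> b j / a j"
    proof
      assume "b i / a i = b j / a j"
      then have "t * D = c j / a j - c i / a i"
        unfolding \<sigma>(2) \<sigma>'(2) D_def by (simp add: add_divide_distrib algebra_simps)
      then have "t = (c j / a j - c i / a i) / D" using \<open>D \<noteq> 0\<close> by (simp add: field_simps)
      then have "t \<in> bad" unfolding bad_def D_def using \<sigma>(1) \<sigma>'(1)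
        by (intro image_eqI[of _ _ "(i, j, \<sigma>, \<sigma>')"]) auto
      with t show False by simp
    qed
  qed
qed

text \<open>
  Downward induction on \<open>J\<close>, beginning with the sets of walls through a vertex, for which both
  sides are 1. If \<open>J\<close> is smaller, some edge at a vertex of the face lies in the face and gives a
  direction for the preceding argument; the displacement of the walls is first perturbed to make
  the line along this direction generic.
\<close>

lemma defect_zero:
  fixes h :: "real ^ 'd"
  assumes r: "small r" and "\<forall>i. \<bar>h $ i\<bar> < r" "\<exists>v\<in>V. J \<subseteq> act v" "\<forall>i\<in>J. slack x h i = 0"
  shows "defect J (slack x h) = 0"
  using assms(2-)
proof (induction "card (- J)" arbitrary: J x h rule: less_induct)
  case less
  show ?case
  proof (cases "\<exists>v\<in>V. J = act v")
    case True
    then obtain v where v: "v \<in> V" "J = act v" by blast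
    have "w = v" if w: "w \<in> V" "act v \<subseteq> act w" for w
    proof -
      have "u j \<bullet> (w - v) = 0" if "j \<in> act v" for j
        using active[OF v(1), of j] active[OF w(1), of j] that w(2) by (auto simp: inner_diff_right)
      then have "w - v = 0" using expand[OF v(1), of "w - v"] by simp
      then show ?thesis by simp
    qed
    then have "{w. w \<in> V \<and> J \<subseteq> act w} = {v}" using v by auto
    moreover have "slack x h i > 0" if "i \<notin> J" for i
      using r less.prems v that unfolding small_def by blast
    then have "(\<Prod>i\<in>- J. heaviside (slack x h i)) = 1"
      by (intro prod.neutral) (simp add: heaviside_def)
    ultimately show ?thesis unfolding defect_def by (simp add: v(2))
  next
    case False
    obtain v where v: "v \<in> V" "J \<subseteq> act v" using less.prems by blast
    then obtain j where j: "j \<in> act v" "j \<notin> J" using False by blast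
    define \<eta> where "\<eta> = (if \<xi> \<bullet> \<alpha> v j > 0 then \<alpha> v j else - \<alpha> v j)"
    have \<eta>: "\<xi> \<bullet> \<eta> > 0" using polarizing[OF v(1) j(1)] by (auto simp: \<eta>_def)
    have \<eta>J: "\<forall>i\<in>J. u i \<bullet> \<eta> = 0"
      using dual[OF v(1) _ j(1)] v(2) j by (auto simp: \<eta>_def)
    (* The room that is left for the perturbation of h. *)
    define m where "m = Max (range (\<lambda>i. \<bar>h $ i\<bar>))"
    have hm: "\<bar>h $ i\<bar> \<le> m" for i unfolding m_def by (rule Max_ge) auto
    have "m < r" unfolding m_def using less.prems(1) by (subst Max_less_iff) auto
    then have "r - m > 0" by simp
    then obtain \<delta> where \<delta>: "\<And>i. 0 < \<delta> i" "\<And>i. \<delta> i < r - m" "\<And>i. slack x h i \<noteq> 0 \<Longrightarrow> \<delta> i < \<bar>slack x h i\<bar>"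
      and generic: "\<And>b i j. (\<And>i. b i = slack x h i + \<delta> i \<or> b i = slack x h i - \<delta> i) \<Longrightarrow> i \<noteq> j \<Longrightarrow>
         u i \<bullet> \<eta> \<noteq> 0 \<Longrightarrow> u j \<bullet> \<eta> \<noteq> 0 \<Longrightarrow> b i / (u i \<bullet> \<eta>) \<noteq> b j / (u j \<bullet> \<eta>)"
      by (rule ex_generic_perturbation[where c = "slack x h" and a = "\<lambda>i. u i \<bullet> \<eta>"]) blast
    show ?thesis
    proof (rule defect_average[where \<delta> = \<delta>])
      fix b assume bJ: "\<And>i. i \<in> J \<Longrightarrow> b i = slack x h i"
        and b: "\<And>i. i \<notin> J \<Longrightarrow> b i = slack x h i + \<delta> i \<or> b i = slack x h i - \<delta> i"
      (* The perturbed values are those of the same point for another small displacement. *)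
      define h' where "h' = (\<chi> i. h $ i + (b i - slack x h i))"
      have sl: "slack x h' = b" by (rule ext) (simp add: h'_def slack_def)
      have h': "\<forall>i. \<bar>h' $ i\<bar> < r"
      proof
        fix i
        have "\<bar>b i - slack x h i\<bar> < r - m"
          using \<delta>(1)[of i] \<delta>(2)[of i] b[of i] bJ[of i] \<open>r - m > 0\<close> by (cases "i \<in> J") auto
        then show "\<bar>h' $ i\<bar> < r" using hm[of i] by (simp add: h'_def)
      qed
      have nz: "b i \<noteq> 0" if "i \<notin> J" for i
        using b[OF that] \<delta>(1)[of i] \<delta>(3)[of i] by (cases "slack x h i = 0") auto
      have "defect J (slack (x + 0 *\<^sub>R \<eta>) h') = 0"
      proof (rule defect_on_generic_line[OF r h'])
        fix i y assume i: "i \<notin> J" and "\<exists>v\<in>V. insert i J \<subseteq> act v" "\<forall>j\<in>insert i J. slack y h' j = 0"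
        moreover have "- insert i J \<subset> - J" using i by auto
        then have "card (- insert i J) < card (- J)" by (intro psubset_card_mono) auto
        ultimately show "defect (insert i J) (slack y h') = 0" using h' by (intro less.hyps) auto
      next
        fix i j assume ij: "i \<notin> J" "j \<notin> J" "i \<noteq> j" "u i \<bullet> \<eta> \<noteq> 0" "u j \<bullet> \<eta> \<noteq> 0"
        let ?b = "\<lambda>i. if i \<in> J then slack x h i + \<delta> i else b i"
        have "?b i / (u i \<bullet> \<eta>) \<noteq> ?b j / (u j \<bullet> \<eta>)"
          using b ij by (intro generic) auto
        then show "slack x h' i / (u i \<bullet> \<eta>) \<noteq> slack x h' j / (u j \<bullet> \<eta>)" using ij by (simp add: sl)
      qed (use \<eta> \<eta>J nz less.prems(3) bJ in \<open>auto simp: sl\<close>)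
      then show "defect J b = 0" by (simp add: sl)
    qed (use \<delta> in auto)
  qed
qed

text \<open>
  The polar decomposition holds at every point, including the points on the walls, and for all
  small displacements with the same signs. At displacement 0 it relates lattice sums; near 0, up
  to null sets, it relates integrals.
\<close>

theorem polar_decomposition:
  fixes h :: "real ^ 'd"
  assumes "small r" "\<forall>i. \<bar>h $ i\<bar> < r"
  shows "(\<Prod>i\<in>UNIV. heaviside (slack x h i)) = (\<Sum>v\<in>V. \<Prod>j\<in>act v. heaviside (slack x h j) - eps v j)"
  using defect_zero[OF assms, of "{}" x] V_nonempty by (auto simp: defect_def)

end

section \<open>The formula on orthants\<close>

definition multi_idx :: "nat \<Rightarrow> 'i set \<Rightarrow> ('i \<Rightarrow> nat) set" where
  "multi_idx k I = {a. (\<forall>i\<in>I. a i \<le> k) \<and> (\<forall>i. i \<notin> I \<longrightarrow> a i = 0)}"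

lemma multi_idx_empty: "multi_idx k {} = {\<lambda>_. 0}"
  by (auto simp: multi_idx_def)

lemma multi_idx_insert:
  assumes "i \<notin> I"
  shows "bij_betw (\<lambda>(a, m). a(i := m)) (multi_idx k I \<times> {..k}) (multi_idx k (insert i I))"
  unfolding bij_betw_def
proof
  show "inj_on (\<lambda>(a, m). a(i := m)) (multi_idx k I \<times> {..k})"
  proof (rule inj_onI, clarify)
    fix a m b n assume ab: "a \<in> multi_idx k I" "b \<in> multi_idx k I" and eq: "a(i := m) = b(i := n)"
    have "a j = b j" for j
      using ab assms fun_cong[OF eq, of j] by (cases "j = i") (auto simp: multi_idx_def)
    moreover have "m = n" using fun_cong[OF eq, of i] by simp
    ultimately show "a = b \<and> m = n" by auto
  qed
  show "(\<lambda>(a, m). a(i := m)) ` (multi_idx k I \<times> {..k}) = multi_idx k (insert i I)"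
  proof (intro equalityI subsetI)
    fix b assume "b \<in> multi_idx k (insert i I)"
    then have "b = (b(i := 0))(i := b i)" "b(i := 0) \<in> multi_idx k I" "b i \<in> {..k}"
      using assms by (auto simp: multi_idx_def)
    then show "b \<in> (\<lambda>(a, m). a(i := m)) ` (multi_idx k I \<times> {..k})"
      by (intro image_eqI[of _ _ "(b(i := 0), b i)"]) auto
  qed (auto simp: multi_idx_def)
qed

lemma finite_multi_idx: "finite I \<Longrightarrow> finite (multi_idx k I)"
proof (induction I rule: finite_induct)
  case (insert i I)
  then show ?case using bij_betw_finite[OF multi_idx_insert[of i I k]] by simp
qed (simp add: multi_idx_empty)

lemma sum_multi_idx_insert:
  assumes "i \<notin> I"
  shows "(\<Sum>a\<in>multi_idx k (insert i I). F a) = (\<Sum>a\<in>multi_idx k I. \<Sum>m\<le>k. F (a(i := m)))"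
  using sum.reindex_bij_betw[OF multi_idx_insert[OF assms], of F k, symmetric]
  by (simp add: sum.cartesian_product case_prod_unfold)

lemma sum_PiE_insert:
  assumes "i \<notin> I"
  shows "(\<Sum>n\<in>PiE (insert i I) (\<lambda>_. T). F n) = (\<Sum>n\<in>PiE I (\<lambda>_. T). \<Sum>s\<in>T. F (n(i := s)))"
proof -
  have "(\<Sum>n\<in>PiE (insert i I) (\<lambda>_. T). F n) = (\<Sum>p\<in>T \<times> PiE I (\<lambda>_. T). F ((snd p)(i := fst p)))"
    unfolding PiE_insert_eq
    using inj_combinator[OF assms, of "\<lambda>_. T"] by (subst sum.reindex) (auto simp: case_prod_unfold)
  also have "\<dots> = (\<Sum>s\<in>T. \<Sum>n\<in>PiE I (\<lambda>_. T). F (n(i := s)))"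
    by (simp add: sum.cartesian_product case_prod_unfold)
  finally show ?thesis by (simp add: sum.swap[of _ _ T])
qed

interpretation lborel_product: product_sigma_finite "\<lambda>_::'i. lborel :: real measure"
  by standard

lemma integrable_PiM_bounded_support:
  fixes F :: "('i \<Rightarrow> real) \<Rightarrow> complex"
  assumes I: "finite I" and meas: "F \<in> borel_measurable (PiM I (\<lambda>_. lborel))"
    and bound: "\<And>t. norm (F t) \<le> C" and supp: "\<And>t j. j \<in> I \<Longrightarrow> t j \<notin> {a..b} \<Longrightarrow> F t = 0"
  shows "integrable (PiM I (\<lambda>_. lborel)) F"
proof (rule Bochner_Integration.integrable_bound)
  have "integrable lborel (indicat_real {a..b})" by (simp add: emeasure_lborel_Icc_eq)
  then have "integrable (PiM I (\<lambda>_. lborel)) (\<lambda>t. \<Prod>j\<in>I. indicat_real {a..b} (t j))"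
    using I by (intro lborel_product.product_integrable_prod) auto
  then show "integrable (PiM I (\<lambda>_. lborel)) (\<lambda>t. C * (\<Prod>j\<in>I. indicat_real {a..b} (t j)))"
    by (rule integrable_mult_right)
  show "AE t in PiM I (\<lambda>_. lborel). norm (F t) \<le> norm (C * (\<Prod>j\<in>I. indicat_real {a..b} (t j)))"
  proof (intro AE_I2)
    fix t
    have "C \<ge> 0" using bound[of t] norm_ge_zero order_trans by blast
    show "norm (F t) \<le> norm (C * (\<Prod>j\<in>I. indicat_real {a..b} (t j)))"
    proof (cases "\<forall>j\<in>I. t j \<in> {a..b}")
      case True
      then have "(\<Prod>j\<in>I. indicat_real {a..b} (t j)) = 1" by (intro prod.neutral) auto
      then show ?thesis using bound[of t] \<open>C \<ge> 0\<close> by simp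
    next
      case False
      then have "F t = 0" using supp by blast
      then show ?thesis by simp
    qed
  qed
qed (rule meas)

text \<open>
  Cut off at \<open>B\<close>, where the functions to which the formula is applied vanish, so that the kernel
  is bounded with bounded support and all integrals converge absolutely.
\<close>

definition EM_kernel :: "nat \<Rightarrow> real \<Rightarrow> complex \<Rightarrow> nat \<Rightarrow> real \<Rightarrow> complex" where
  "EM_kernel k B \<omega> m s = (if 0 \<le> s \<and> s \<le> B then EM_coeff k \<omega> m s else 0)"

lemma EM_kernel_measurable [measurable]: "EM_kernel k B \<omega> m \<in> borel_measurable borel"
  unfolding EM_kernel_def[abs_def] EM_coeff_def[abs_def] by measurable

lemma EM_kernel_bounded:
  assumes "norm \<omega> = 1"
  shows "\<exists>C. \<forall>s. norm (EM_kernel k B \<omega> m s) \<le> C"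
proof -
  obtain C where C: "\<forall>y\<in>range (periodic_Q \<omega> k). norm y \<le> C"
    using bounded_periodic_Q[OF assms, of k] unfolding bounded_iff by blast
  define D where "D = norm (fps_nth (M_fps \<omega>) m) + C"
  have C0: "0 \<le> C" using C norm_ge_zero order_trans by blast
  have "norm (EM_kernel k B \<omega> m s) \<le> D" for s
  proof -
    have "norm (EM_coeff k \<omega> m s) \<le> norm ((-1) ^ m * fps_nth (M_fps \<omega>) m) + norm (if m = k then (-1) ^ (k - 1) * periodic_Q \<omega> k s else 0)"
      unfolding EM_coeff_def by (rule norm_triangle_ineq)
    also have "\<dots> \<le> D" using C C0 unfolding D_def by (simp add: norm_mult norm_power)
    finally show ?thesis using C0 by (simp add: EM_kernel_def D_def)
  qed
  then show ?thesis by blast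
qed

lemma Euler_Maclaurin_lborel:
  fixes G :: "nat \<Rightarrow> real \<Rightarrow> complex"
  assumes "k \<ge> 1" and \<omega>: "norm \<omega> = 1"
    and der: "\<And>m t. m < k \<Longrightarrow> (G m has_vector_derivative G (Suc m) t) (at t)"
    and meas: "\<And>m. m \<le> k \<Longrightarrow> G m \<in> borel_measurable borel"
    and bound: "\<And>m t. m \<le> k \<Longrightarrow> norm (G m t) \<le> C"
    and vanish: "\<And>m. m < k \<Longrightarrow> G m (real B) = 0"
  shows "(LINT s|lborel. (\<Sum>m\<le>k. EM_kernel k (real B) \<omega> m s * G m s)) =
          (\<Sum>n\<le>B. (if n = 0 then 1/2 else 1) * \<omega> ^ n * G 0 (real n))"
    and "\<And>m. m \<le> k \<Longrightarrow> integrable lborel (\<lambda>s. EM_kernel k (real B) \<omega> m s * G m s)"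
proof -
  show int: "integrable lborel (\<lambda>s. EM_kernel k (real B) \<omega> m s * G m s)" if m: "m \<le> k" for m
  proof -
    obtain D where D: "\<And>s. norm (EM_kernel k (real B) \<omega> m s) \<le> D" using EM_kernel_bounded[OF \<omega>] by blast
    have D0: "D \<ge> 0" using D norm_ge_zero order_trans by blast
    show ?thesis
    proof (rule Bochner_Integration.integrable_bound[where f = "\<lambda>s. (D * C) * indicat_real {0..real B} s"])
      show "integrable lborel (\<lambda>s. (D * C) * indicat_real {0..real B} s)"
        by (simp add: emeasure_lborel_Icc_eq)
      show "(\<lambda>s. EM_kernel k (real B) \<omega> m s * G m s) \<in> borel_measurable lborel"
        using meas[OF m] by measurable
      show "AE s in lborel. norm (EM_kernel k (real B) \<omega> m s * G m s) \<le> norm (D * C * indicat_real {0..real B} s)"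
      proof (intro AE_I2)
        fix s
        have C0: "C \<ge> 0" using bound[OF m] norm_ge_zero order_trans by blast
        have "norm (EM_kernel k (real B) \<omega> m s * G m s) \<le> D * C"
          unfolding norm_mult using D bound[OF m] D0 by (intro mult_mono) auto
        then show "norm (EM_kernel k (real B) \<omega> m s * G m s) \<le> norm (D * C * indicat_real {0..real B} s)"
          using D0 C0 by (auto simp: EM_kernel_def indicator_def)
      qed
    qed
  qed
  let ?S = "(\<Sum>n\<le>B. (if n = 0 then 1/2 else 1) * \<omega> ^ n * G 0 (real n))"
  have "((\<lambda>s. \<Sum>m\<le>k. EM_coeff k \<omega> m s * G m s) has_integral ?S) {0..real B}"
    using assms by (intro Euler_Maclaurin) auto
  then have "((\<lambda>s. if s \<in> {0..real B} then \<Sum>m\<le>k. EM_coeff k \<omega> m s * G m s else 0) has_integral ?S) UNIV"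
    by (simp only: has_integral_restrict_UNIV)
  moreover have eq: "(\<lambda>s. if s \<in> {0..real B} then \<Sum>m\<le>k. EM_coeff k \<omega> m s * G m s else 0)
      = (\<lambda>s. \<Sum>m\<le>k. EM_kernel k (real B) \<omega> m s * G m s)"
    by (auto simp: EM_kernel_def fun_eq_iff)
  ultimately have A: "((\<lambda>s. \<Sum>m\<le>k. EM_kernel k (real B) \<omega> m s * G m s) has_integral ?S) UNIV"
    by (simp only: eq)
  have "integrable lborel (\<lambda>s. \<Sum>m\<le>k. EM_kernel k (real B) \<omega> m s * G m s)"
    using int by (intro Bochner_Integration.integrable_sum) auto
  then have "((\<lambda>s. \<Sum>m\<le>k. EM_kernel k (real B) \<omega> m s * G m s) has_integral
      (LINT s|lborel. (\<Sum>m\<le>k. EM_kernel k (real B) \<omega> m s * G m s))) UNIV"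
    by (rule has_integral_integral_lborel)
  then show "(LINT s|lborel. (\<Sum>m\<le>k. EM_kernel k (real B) \<omega> m s * G m s)) = ?S"
    using A by (rule has_integral_unique)
qed

text \<open>
  The formula in several variables, by induction on the number of variables and Fubini. The
  function \<open>G a\<close> stands for the mixed partial derivative of order \<open>a\<close> of \<open>G (\<lambda>_. 0)\<close>.
\<close>

lemma Euler_Maclaurin_product:
  fixes G :: "('i \<Rightarrow> nat) \<Rightarrow> ('i \<Rightarrow> real) \<Rightarrow> complex"
  assumes I: "finite I" and k: "k \<ge> 1" and \<omega>: "\<And>j. j \<in> I \<Longrightarrow> norm (\<omega> j) = 1"
    and der: "\<And>a t j s. a \<in> multi_idx k I \<Longrightarrow> j \<in> I \<Longrightarrow> a j < k \<Longrightarrow>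
      ((\<lambda>s. G a (t(j := s))) has_vector_derivative G (a(j := Suc (a j))) (t(j := s))) (at s)"
    and meas: "\<And>a. a \<in> multi_idx k I \<Longrightarrow> G a \<in> borel_measurable (PiM I (\<lambda>_. lborel))"
    and bound: "\<And>a t. a \<in> multi_idx k I \<Longrightarrow> norm (G a t) \<le> C"
    and vanish: "\<And>a t j. a \<in> multi_idx k I \<Longrightarrow> j \<in> I \<Longrightarrow> t j = real B \<Longrightarrow> G a t = 0"
  shows "(LINT t|PiM I (\<lambda>_. lborel). (\<Sum>a\<in>multi_idx k I. (\<Prod>j\<in>I. EM_kernel k (real B) (\<omega> j) (a j) (t j)) * G a t)) =
     (\<Sum>n\<in>PiE I (\<lambda>_. {..B}). (\<Prod>j\<in>I. (if n j = 0 then 1/2 else 1) * \<omega> j ^ n j) * G (\<lambda>_. 0) (\<lambda>j\<in>I. real (n j)))"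
  using assms
proof (induction I arbitrary: G rule: finite_induct)
  case empty
  then show ?case
    by (simp add: multi_idx_empty PiM_empty lebesgue_integral_count_space_finite restrict_def)
next
  case (insert i I)
  let ?M = "\<lambda>I. PiM I (\<lambda>_. lborel :: real measure)"
  let ?K = "\<lambda>j. EM_kernel k (real B) (\<omega> j)"
  let ?w = "\<lambda>j n. (if n = (0::nat) then 1/2 else 1) * \<omega> j ^ n"
  let ?F = "\<lambda>t. \<Sum>a\<in>multi_idx k (insert i I). (\<Prod>j\<in>insert i I. ?K j (a j) (t j)) * G a t"
  have upd: "a(i := m) \<in> multi_idx k (insert i I)" if "a \<in> multi_idx k I" "m \<le> k" for a m
    using that by (auto simp: multi_idx_def)
  have zero: "a i = 0" if "a \<in> multi_idx k I" for a
    using that insert.hyps by (auto simp: multi_idx_def)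
  have same: "a(i := 0) = a" if "a \<in> multi_idx k I" for a
    using zero[OF that] by auto
  have updI: "a \<in> multi_idx k (insert i I)" if "a \<in> multi_idx k I" for a
    using upd[OF that, of 0] same[OF that] by simp
  have fin: "finite (insert i I)" using insert.hyps by simp
  have meas_term: "(\<lambda>t. (\<Prod>j\<in>insert i I. ?K j (a j) (t j)) * G a t) \<in> borel_measurable (?M (insert i I))"
    if "a \<in> multi_idx k (insert i I)" for a
  proof -
    have "(\<lambda>t. ?K j (a j) (t j)) \<in> borel_measurable (?M (insert i I))" if "j \<in> insert i I" for j
      using that by (intro measurable_compose[OF measurable_component_singleton[OF that] ]) auto
    then show ?thesis using insert.prems(4)[OF that] by (intro borel_measurable_times borel_measurable_prod) auto
  qed
  have int: "integrable (?M (insert i I)) (\<lambda>t. (\<Prod>j\<in>insert i I. ?K j (a j) (t j)) * G a t)"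
    if a: "a \<in> multi_idx k (insert i I)" for a
  proof -
    have "\<forall>j. \<exists>D. j \<in> insert i I \<longrightarrow> (\<forall>s. norm (?K j (a j) s) \<le> D)"
      using EM_kernel_bounded[OF insert.prems(2)] by blast
    then obtain D where D: "\<And>j s. j \<in> insert i I \<Longrightarrow> norm (?K j (a j) s) \<le> D j" by metis
    show ?thesis
    proof (rule integrable_PiM_bounded_support[OF fin meas_term[OF a], where a = 0 and b = "real B"])
      fix t
      have "norm (\<Prod>j\<in>insert i I. ?K j (a j) (t j)) \<le> (\<Prod>j\<in>insert i I. D j)"
        unfolding prod_norm[symmetric] using D by (intro prod_mono) auto
      then show "norm ((\<Prod>j\<in>insert i I. ?K j (a j) (t j)) * G a t) \<le> (\<Prod>j\<in>insert i I. D j) * C"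
        unfolding norm_mult using insert.prems(5)[OF a, of t]
        by (intro mult_mono) (auto intro: order_trans[OF norm_ge_zero])
    next
      fix t j assume j: "j \<in> insert i I" "t j \<notin> {0..real B}"
      then have "(\<Prod>j\<in>insert i I. ?K j (a j) (t j)) = 0"
        using fin by (intro prod_zero bexI[of _ j]) (auto simp: EM_kernel_def)
      then show "(\<Prod>j\<in>insert i I. ?K j (a j) (t j)) * G a t = 0" by simp
    qed
  qed
  have meas_slice: "(\<lambda>s. G a (t(i := s))) \<in> borel_measurable borel" if a: "a \<in> multi_idx k (insert i I)" and t: "t \<in> space (?M I)" for a t
    using measurable_compose[OF measurable_component_update[OF t insert.hyps(2)] insert.prems(4)[OF a]] by (simp add: fun_upd_def)
  have slice: "(LINT s|lborel. ?F (t(i := s))) =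
      (\<Sum>n\<le>B. ?w i n * (\<Sum>a\<in>multi_idx k I. (\<Prod>j\<in>I. ?K j (a j) (t j)) * G a (t(i := real n))))"
    if t: "t \<in> space (?M I)" for t
  proof -
    have one: "(LINT s|lborel. (\<Sum>m\<le>k. ?K i m s * G (a(i := m)) (t(i := s)))) = (\<Sum>n\<le>B. ?w i n * G a (t(i := real n)))"
      "\<And>m. m \<le> k \<Longrightarrow> integrable lborel (\<lambda>s. ?K i m s * G (a(i := m)) (t(i := s)))"
      if a: "a \<in> multi_idx k I" for a
    proof -
      have der: "((\<lambda>s. G (a(i := m)) (t(i := s))) has_vector_derivative G (a(i := Suc m)) (t(i := s))) (at s)" if "m < k" for m s
      proof -
        have 1: "(a(i := m)) i < k" using that by simp
        have 2: "(a(i := m))(i := Suc ((a(i := m)) i)) = a(i := Suc m)" by simp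
        show ?thesis
          using insert.prems(3)[OF upd[OF a less_imp_le[OF that]] insertI1 1, of t s] unfolding 2 .
      qed
      have b: "norm (G (a(i := m)) (t(i := s))) \<le> C" if "m \<le> k" for m s
        using insert.prems(5)[OF upd[OF a that]] .
      have vn: "G (a(i := m)) (t(i := real B)) = 0" if "m < k" for m
        by (rule insert.prems(6)[OF upd[OF a less_imp_le[OF that]] insertI1]) simp
      have ms: "(\<lambda>s. G (a(i := m)) (t(i := s))) \<in> borel_measurable borel" if "m \<le> k" for m
        using meas_slice[OF upd[OF a that] t] .
      note EM = Euler_Maclaurin_lborel[where G = "\<lambda>m s. G (a(i := m)) (t(i := s))",
          OF k insert.prems(2)[OF insertI1] der ms b vn]
      show "(LINT s|lborel. (\<Sum>m\<le>k. ?K i m s * G (a(i := m)) (t(i := s)))) = (\<Sum>n\<le>B. ?w i n * G a (t(i := real n)))"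
        using EM(1) unfolding same[OF a] .
      show "\<And>m. m \<le> k \<Longrightarrow> integrable lborel (\<lambda>s. ?K i m s * G (a(i := m)) (t(i := s)))" by (rule EM(2))
    qed
    have "?F (t(i := s)) = (\<Sum>a\<in>multi_idx k I. (\<Prod>j\<in>I. ?K j (a j) (t j)) * (\<Sum>m\<le>k. ?K i m s * G (a(i := m)) (t(i := s))))" for s
      unfolding sum_multi_idx_insert[OF insert.hyps(2)] sum_distrib_left
    proof (intro sum.cong refl)
      fix a m
      have "(\<Prod>j\<in>I. ?K j ((a(i := m)) j) ((t(i := s)) j)) = (\<Prod>j\<in>I. ?K j (a j) (t j))"
        using insert.hyps(2) by (intro prod.cong) auto
      then show "(\<Prod>j\<in>insert i I. ?K j ((a(i := m)) j) ((t(i := s)) j)) * G (a(i := m)) (t(i := s))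
         = (\<Prod>j\<in>I. ?K j (a j) (t j)) * (?K i m s * G (a(i := m)) (t(i := s)))"
        using insert.hyps by simp
    qed
    then have "(LINT s|lborel. ?F (t(i := s))) = (LINT s|lborel. (\<Sum>a\<in>multi_idx k I. (\<Prod>j\<in>I. ?K j (a j) (t j)) * (\<Sum>m\<le>k. ?K i m s * G (a(i := m)) (t(i := s)))))"
      by simp
    also have "\<dots> = (\<Sum>a\<in>multi_idx k I. (\<Prod>j\<in>I. ?K j (a j) (t j)) * (LINT s|lborel. (\<Sum>m\<le>k. ?K i m s * G (a(i := m)) (t(i := s)))))"
      using one(2) by (subst Bochner_Integration.integral_sum) (auto intro!: integrable_mult_right Bochner_Integration.integrable_sum)
    also have "\<dots> = (\<Sum>a\<in>multi_idx k I. \<Sum>n\<le>B. (\<Prod>j\<in>I. ?K j (a j) (t j)) * (?w i n * G a (t(i := real n))))"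
      by (intro sum.cong refl) (simp only: one(1) sum_distrib_left)
    also have "\<dots> = (\<Sum>n\<le>B. \<Sum>a\<in>multi_idx k I. (\<Prod>j\<in>I. ?K j (a j) (t j)) * (?w i n * G a (t(i := real n))))"
      by (rule sum.swap)
    also have "\<dots> = (\<Sum>n\<le>B. ?w i n * (\<Sum>a\<in>multi_idx k I. (\<Prod>j\<in>I. ?K j (a j) (t j)) * G a (t(i := real n))))"
      by (simp add: sum_distrib_left mult_ac)
    finally show ?thesis .
  qed
  have meas': "(\<lambda>t. G a (t(i := s))) \<in> borel_measurable (?M I)" if a: "a \<in> multi_idx k I" for a s
  proof -
    have "(\<lambda>t. t(i := s)) \<in> measurable (?M I) (?M (insert i I))" by measurable
    then show ?thesis using insert.prems(4)[OF updI[OF a]] by (rule measurable_compose)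
  qed
  have IH: "(LINT t|?M I. (\<Sum>a\<in>multi_idx k I. (\<Prod>j\<in>I. ?K j (a j) (t j)) * G a (t(i := s)))) =
     (\<Sum>n\<in>PiE I (\<lambda>_. {..B}). (\<Prod>j\<in>I. ?w j (n j)) * G (\<lambda>_. 0) ((\<lambda>j\<in>I. real (n j))(i := s)))" for s
  proof (rule insert.IH[where G = "\<lambda>a t. G a (t(i := s))"])
    fix a t j s' assume a: "a \<in> multi_idx k I" "j \<in> I" "a j < k"
    then have ne: "j \<noteq> i" using insert.hyps by auto
    show "((\<lambda>s'. G a (t(j := s', i := s))) has_vector_derivative G (a(j := Suc (a j))) (t(j := s', i := s))) (at s')"
      unfolding fun_upd_twist[OF ne]
      by (rule insert.prems(3)[OF updI[OF a(1)] insertI2[OF a(2)] a(3)])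
  next
    fix a t j assume a: "a \<in> multi_idx k I" and j: "j \<in> I" "t j = real B"
    then have "j \<noteq> i" using insert.hyps by auto
    then have "(t(i := s)) j = real B" using j by simp
    then show "G a (t(i := s)) = 0" by (rule insert.prems(6)[OF updI[OF a] insertI2[OF j(1)]])
  next
    show "norm (G a (t(i := s))) \<le> C" if "a \<in> multi_idx k I" for a t
      by (rule insert.prems(5)[OF updI[OF that]])
    show "norm (\<omega> j) = 1" if "j \<in> I" for j by (rule insert.prems(2)[OF insertI2[OF that]])
  qed (fact k, rule meas')
  have int': "integrable (?M I) (\<lambda>t. (\<Prod>j\<in>I. ?K j (a j) (t j)) * G a (t(i := s)))" if a: "a \<in> multi_idx k I" for a s
  proof -
    have "\<forall>j. \<exists>D. j \<in> I \<longrightarrow> (\<forall>s. norm (?K j (a j) s) \<le> D)"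
      using EM_kernel_bounded insert.prems(2) by blast
    then obtain D where D: "\<And>j s. j \<in> I \<Longrightarrow> norm (?K j (a j) s) \<le> D j" by metis
    have "(\<lambda>t. ?K j (a j) (t j)) \<in> borel_measurable (?M I)" if "j \<in> I" for j
      using that by (intro measurable_compose[OF measurable_component_singleton[OF that] ]) auto
    then have m: "(\<lambda>t. (\<Prod>j\<in>I. ?K j (a j) (t j)) * G a (t(i := s))) \<in> borel_measurable (?M I)"
      using meas'[OF a] by (intro borel_measurable_times borel_measurable_prod) auto
    show ?thesis
    proof (rule integrable_PiM_bounded_support[OF insert.hyps(1) m, where a = 0 and b = "real B"])
      fix t
      have p: "norm (\<Prod>j\<in>I. ?K j (a j) (t j)) \<le> (\<Prod>j\<in>I. D j)"
        unfolding prod_norm[symmetric] using D by (intro prod_mono) auto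
      show "norm ((\<Prod>j\<in>I. ?K j (a j) (t j)) * G a (t(i := s))) \<le> (\<Prod>j\<in>I. D j) * C"
        unfolding norm_mult using order_trans[OF norm_ge_zero p]
        by (intro mult_mono[OF p insert.prems(5)[OF updI[OF a]]] norm_ge_zero)
    next
      fix t j assume j: "j \<in> I" "t j \<notin> {0..real B}"
      then have "(\<Prod>j\<in>I. ?K j (a j) (t j)) = 0"
        using insert.hyps(1) by (intro prod_zero bexI[of _ j]) (auto simp: EM_kernel_def)
      then show "(\<Prod>j\<in>I. ?K j (a j) (t j)) * G a (t(i := s)) = 0" by simp
    qed
  qed
  have "(LINT t|?M (insert i I). ?F t) = (LINT t|?M I. LINT s|lborel. ?F (t(i := s)))"
    using insert.hyps int
    by (intro lborel_product.product_integral_insert Bochner_Integration.integrable_sum) auto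
  also have "\<dots> = (LINT t|?M I. (\<Sum>n\<le>B. ?w i n * (\<Sum>a\<in>multi_idx k I. (\<Prod>j\<in>I. ?K j (a j) (t j)) * G a (t(i := real n)))))"
    using slice by (intro Bochner_Integration.integral_cong refl) auto
  also have "\<dots> = (\<Sum>n\<le>B. ?w i n * (LINT t|?M I. (\<Sum>a\<in>multi_idx k I. (\<Prod>j\<in>I. ?K j (a j) (t j)) * G a (t(i := real n)))))"
    using int' by (subst Bochner_Integration.integral_sum) (auto intro!: integrable_mult_right Bochner_Integration.integrable_sum)
  also have "\<dots> = (\<Sum>n\<in>PiE I (\<lambda>_. {..B}). \<Sum>m\<le>B. ?w i m * ((\<Prod>j\<in>I. ?w j (n j)) * G (\<lambda>_. 0) ((\<lambda>j\<in>I. real (n j))(i := real m))))"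
    unfolding IH sum_distrib_left by (rule sum.swap)
  also have "\<dots> = (\<Sum>n\<in>PiE (insert i I) (\<lambda>_. {..B}). (\<Prod>j\<in>insert i I. ?w j (n j)) * G (\<lambda>_. 0) (\<lambda>j\<in>insert i I. real (n j)))"
    unfolding sum_PiE_insert[OF insert.hyps(2)]
  proof (intro sum.cong refl)
    fix n m
    have "(\<lambda>j\<in>insert i I. real ((n(i := m)) j)) = (\<lambda>j\<in>I. real (n j))(i := real m)"
      using insert.hyps(2) by (auto simp: restrict_def)
    moreover have "(\<Prod>j\<in>I. ?w j ((n(i := m)) j)) = (\<Prod>j\<in>I. ?w j (n j))"
      using insert.hyps(2) by (intro prod.cong) auto
    ultimately show "?w i m * ((\<Prod>j\<in>I. ?w j (n j)) * G (\<lambda>_. 0) ((\<lambda>j\<in>I. real (n j))(i := real m)))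
      = (\<Prod>j\<in>insert i I. ?w j ((n(i := m)) j)) * G (\<lambda>_. 0) (\<lambda>j\<in>insert i I. real ((n(i := m)) j))"
      using insert.hyps by simp
  qed
  finally show ?case .
qed

section \<open>Lattices, characters and volumes\<close>

lemma axis_int_lattice: "axis m 1 \<in> int_lattice"
  by (auto simp: int_lattice_def axis_def)

lemma int_lattice_add: "x \<in> int_lattice \<Longrightarrow> y \<in> int_lattice \<Longrightarrow> x + y \<in> int_lattice"
  and int_lattice_diff: "x \<in> int_lattice \<Longrightarrow> y \<in> int_lattice \<Longrightarrow> x - y \<in> int_lattice"
  and int_lattice_0: "0 \<in> int_lattice"
  and int_lattice_uminus: "x \<in> int_lattice \<Longrightarrow> - x \<in> int_lattice"
  by (auto simp: int_lattice_def)

lemma int_lattice_scale: "x \<in> int_lattice \<Longrightarrow> of_int k *\<^sub>R x \<in> int_lattice"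
  by (auto simp: int_lattice_def)

lemma int_lattice_sum: "(\<And>i. i \<in> A \<Longrightarrow> f i \<in> int_lattice) \<Longrightarrow> (\<Sum>i\<in>A. f i) \<in> int_lattice"
  by (auto simp: int_lattice_def intro: Ints_sum)

lemma int_lattice_inner:
  assumes "x \<in> int_lattice" "y \<in> int_lattice"
  shows "x \<bullet> y \<in> \<int>"
  using assms unfolding int_lattice_def inner_vec_def by (auto intro!: Ints_sum Ints_mult)

lemma finite_int_lattice_bounded:
  fixes S :: "(real ^ 'n) set"
  assumes "bounded S"
  shows "finite (S \<inter> int_lattice)"
proof -
  obtain C where C: "\<And>x. x \<in> S \<Longrightarrow> norm x \<le> C" using assms unfolding bounded_iff by blast
  have "(\<lambda>x i. \<lfloor>x $ i\<rfloor>) ` (S \<inter> int_lattice) \<subseteq> PiE UNIV (\<lambda>_. {- \<lceil>C\<rceil>..\<lceil>C\<rceil>})"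
  proof (clarify, intro PiE_I)
    fix x i assume x: "x \<in> S" "x \<in> int_lattice"
    have "\<bar>x $ i\<bar> \<le> C" using component_le_norm_cart[of x i] C[OF x(1)] by linarith
    then show "\<lfloor>x $ i\<rfloor> \<in> {- \<lceil>C\<rceil>..\<lceil>C\<rceil>}" by (simp, linarith)
  qed simp
  moreover have "finite (PiE (UNIV :: 'n set) (\<lambda>_. {- \<lceil>C\<rceil>..\<lceil>C\<rceil>}))" by (intro finite_PiE) auto
  ultimately have "finite ((\<lambda>x i. \<lfloor>x $ i\<rfloor>) ` (S \<inter> int_lattice))" by (rule finite_subset)
  moreover have "inj_on (\<lambda>x i. \<lfloor>x $ i\<rfloor>) (S \<inter> int_lattice)"
  proof (rule inj_onI)
    fix x y :: "real ^ 'n" assume xy: "x \<in> S \<inter> int_lattice" "y \<in> S \<inter> int_lattice" "(\<lambda>i. \<lfloor>x $ i\<rfloor>) = (\<lambda>i. \<lfloor>y $ i\<rfloor>)"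
    have "x $ i = y $ i" for i
    proof -
      have "x $ i \<in> \<int>" "y $ i \<in> \<int>" using xy by (auto simp: int_lattice_def)
      then have "x $ i = of_int \<lfloor>x $ i\<rfloor>" "y $ i = of_int \<lfloor>y $ i\<rfloor>" by (simp_all add: of_int_floor)
      then show ?thesis using fun_cong[OF xy(3), of i] by simp
    qed
    then show "x = y" by (simp add: vec_eq_iff)
  qed
  ultimately show ?thesis by (rule finite_imageD)
qed

text \<open>
  Permuting the summands by \<open>\<sigma>\<close> multiplies the sum by \<open>\<zeta> \<noteq> 1\<close>. This is the usual proof of the
  orthogonality of characters; here \<open>\<sigma>\<close> will be a translation followed by reduction to a
  fundamental domain.
\<close>

lemma sum_zero_if_twisted_invariant:
  fixes \<phi> :: "'a \<Rightarrow> complex"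
  assumes "finite X" "\<sigma> ` X \<subseteq> X" "inj_on \<sigma> X" "\<And>x. x \<in> X \<Longrightarrow> \<phi> (\<sigma> x) = \<zeta> * \<phi> x" "\<zeta> \<noteq> 1"
  shows "(\<Sum>x\<in>X. \<phi> x) = 0"
proof -
  have "bij_betw \<sigma> X X"
    using assms by (simp add: bij_betw_def endo_inj_surj)
  then have "(\<Sum>x\<in>X. \<phi> x) = (\<Sum>x\<in>X. \<phi> (\<sigma> x))" by (simp add: sum.reindex_bij_betw)
  also have "\<dots> = \<zeta> * (\<Sum>x\<in>X. \<phi> x)" using assms by (simp add: sum_distrib_left)
  finally have "(1 - \<zeta>) * (\<Sum>x\<in>X. \<phi> x) = 0" by (simp add: algebra_simps)
  then show ?thesis using assms by simp
qed

definition character :: "real ^ 'n \<Rightarrow> real ^ 'n \<Rightarrow> complex" where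
  "character g y = cis (2 * pi * (g \<bullet> y))"

lemma character_add_left: "character (g + g') y = character g y * character g' y"
  and character_add_right: "character g (y + y') = character g y * character g y'"
  by (simp_all add: character_def inner_add_left inner_add_right distrib_left cis_mult)

lemma cis_2pi_eq_1_iff: "cis (2 * pi * x) = 1 \<longleftrightarrow> x \<in> \<int>"
proof
  assume "cis (2 * pi * x) = 1"
  then have "cos (2 * pi * x) = 1" by (simp add: complex_eq_iff)
  then obtain n :: int where "2 * pi * x = n * 2 * pi" using cos_one_2pi_int by auto
  then have "x = of_int n" by simp
  then show "x \<in> \<int>" by simp
next
  assume "x \<in> \<int>"
  then obtain n where "x = of_int n" by (auto elim: Ints_cases)
  then show "cis (2 * pi * x) = 1" by simp
qed

lemma character_eq_1_iff: "character g y = 1 \<longleftrightarrow> g \<bullet> y \<in> \<int>"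
  unfolding character_def by (rule cis_2pi_eq_1_iff)

lemma norm_character: "norm (character g y) = 1"
  by (simp add: character_def)

definition unit_cube :: "(real ^ 'n) set" where
  "unit_cube = {x. \<forall>i. 0 \<le> x $ i \<and> x $ i < 1}"

lemma unit_cube_floor:
  fixes y :: "real ^ 'n"
  shows "\<exists>!m. m \<in> int_lattice \<and> y - m \<in> unit_cube"
proof (rule ex1I[of _ "\<chi> i. of_int \<lfloor>y $ i\<rfloor>"])
  show "(\<chi> i. of_int \<lfloor>y $ i\<rfloor>) \<in> int_lattice \<and> y - (\<chi> i. of_int \<lfloor>y $ i\<rfloor>) \<in> unit_cube"
    by (auto simp: int_lattice_def unit_cube_def) (linarith)+
  fix m assume m: "m \<in> int_lattice \<and> y - m \<in> unit_cube"
  show "m = (\<chi> i. of_int \<lfloor>y $ i\<rfloor>)"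
  proof (simp add: vec_eq_iff, rule allI)
    fix i
    obtain z where z: "m $ i = of_int z" using m by (auto simp: int_lattice_def elim: Ints_cases)
    have "0 \<le> y $ i - m $ i" "y $ i - m $ i < 1" using m by (auto simp: unit_cube_def)
    then have "\<lfloor>y $ i\<rfloor> = z" using z by (simp add: floor_eq_iff)
    then show "m $ i = of_int \<lfloor>y $ i\<rfloor>" using z by simp
  qed
qed

lemma unit_cube_measurable [measurable]: "unit_cube \<in> sets borel"
  unfolding unit_cube_def by measurable

lemma bounded_unit_cube: "bounded (unit_cube :: (real ^ 'n) set)"
proof (rule bounded_subset)
  show "bounded (cbox (0 :: real ^ 'n) (\<chi> i. 1))" by (rule bounded_cbox)
qed (auto simp: unit_cube_def mem_box_cart less_imp_le)

lemma emeasure_unit_cube: "emeasure lborel (unit_cube :: (real ^ 'n) set) = 1"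
proof -
  have one: "(\<chi> i. 1) \<bullet> b = 1" if "b \<in> Basis" for b :: "real ^ 'n"
    using that by (auto simp: Basis_vec_def inner_axis)
  have b: "emeasure lborel (box (0 :: real ^ 'n) (\<chi> i. 1)) = 1"
    by (subst emeasure_lborel_box) (auto simp: one)
  have c: "emeasure lborel (cbox (0 :: real ^ 'n) (\<chi> i. 1)) = 1"
    by (subst emeasure_lborel_cbox) (auto simp: one)
  have "emeasure lborel (box (0 :: real ^ 'n) (\<chi> i. 1)) \<le> emeasure lborel (unit_cube :: (real ^ 'n) set)"
    by (intro emeasure_mono) (auto simp: unit_cube_def mem_box_cart less_imp_le)
  moreover have "emeasure lborel (unit_cube :: (real ^ 'n) set) \<le> emeasure lborel (cbox (0 :: real ^ 'n) (\<chi> i. 1))"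
    by (intro emeasure_mono) (auto simp: unit_cube_def mem_box_cart less_imp_le)
  ultimately show ?thesis using b c by simp
qed

text \<open>
  Integral vectors \<open>u j\<close> that form a basis, with dual basis \<open>\<alpha>\<close>. They generate a sublattice of
  finite index.
\<close>

locale lattice_basis =
  fixes I :: "'d set" and u \<alpha> :: "'d \<Rightarrow> real ^ 'n"
  assumes finite_I: "finite I" and card_I: "card I = CARD('n)"
    and integral: "i \<in> I \<Longrightarrow> u i \<in> int_lattice"
    and dual: "i \<in> I \<Longrightarrow> j \<in> I \<Longrightarrow> u i \<bullet> \<alpha> j = (if i = j then 1 else 0)"
    and expand: "x = (\<Sum>j\<in>I. (u j \<bullet> x) *\<^sub>R \<alpha> j)"
begin

lemma coexpand: "x = (\<Sum>j\<in>I. (x \<bullet> \<alpha> j) *\<^sub>R u j)"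
proof -
  have "x \<bullet> y = (\<Sum>j\<in>I. (x \<bullet> \<alpha> j) *\<^sub>R u j) \<bullet> y" for y
    by (subst expand[of y]) (simp add: inner_sum_right inner_sum_left mult.commute)
  then show ?thesis using vector_eq_rdot by blast
qed

text \<open>
  Representatives of the lattice modulo the sublattice generated by the \<open>u j\<close>, in a half-open
  parallelepiped.
\<close>

definition Box :: "(real ^ 'n) set" where
  "Box = {g \<in> int_lattice. \<forall>j\<in>I. 0 \<le> g \<bullet> \<alpha> j \<and> g \<bullet> \<alpha> j < 1}"

definition reduce :: "real ^ 'n \<Rightarrow> real ^ 'n" where
  "reduce g = g - (\<Sum>j\<in>I. of_int \<lfloor>g \<bullet> \<alpha> j\<rfloor> *\<^sub>R u j)"

lemma inner_sum_normals: "j \<in> I \<Longrightarrow> (\<Sum>i\<in>I. c i *\<^sub>R u i) \<bullet> \<alpha> j = c j"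
proof -
  assume j: "j \<in> I"
  have "(\<Sum>i\<in>I. c i *\<^sub>R u i) \<bullet> \<alpha> j = (\<Sum>i\<in>I. c i * (if i = j then 1 else 0))"
    using j dual by (simp add: inner_sum_left)
  also have "\<dots> = c j" using j finite_I by (simp add: if_distrib cong: if_cong)
  finally show ?thesis .
qed

lemma reduce_coord: "j \<in> I \<Longrightarrow> reduce g \<bullet> \<alpha> j = frac (g \<bullet> \<alpha> j)"
  by (simp add: reduce_def inner_diff_left inner_sum_normals frac_def)

lemma reduce_Box:
  assumes "g \<in> int_lattice"
  shows "reduce g \<in> Box"
proof -
  have "reduce g \<in> int_lattice"
    unfolding reduce_def by (intro int_lattice_diff int_lattice_sum int_lattice_scale integral assms)
  then show ?thesis by (simp add: Box_def reduce_coord frac_lt_1)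
qed

lemma finite_Box: "finite Box"
proof -
  have "bounded {g. \<forall>j\<in>I. 0 \<le> g \<bullet> \<alpha> j \<and> g \<bullet> \<alpha> j < 1}"
    unfolding bounded_iff
  proof (intro exI ballI)
    fix g assume g: "g \<in> {g. \<forall>j\<in>I. 0 \<le> g \<bullet> \<alpha> j \<and> g \<bullet> \<alpha> j < 1}"
    have "norm g \<le> (\<Sum>j\<in>I. norm ((g \<bullet> \<alpha> j) *\<^sub>R u j))"
      by (subst coexpand[of g]) (rule norm_sum)
    also have "\<dots> \<le> (\<Sum>j\<in>I. norm (u j))"
      using g by (intro sum_mono) (auto intro!: mult_left_le_one_le)
    finally show "norm g \<le> (\<Sum>j\<in>I. norm (u j))" .
  qed
  from finite_int_lattice_bounded[OF this] show ?thesis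
    by (simp add: Box_def Int_def conj_commute)
qed

lemma character_reduce:
  assumes "\<And>j. j \<in> I \<Longrightarrow> u j \<bullet> y \<in> \<int>"
  shows "character (reduce g) y = character g y"
proof -
  have "character (\<Sum>j\<in>I. of_int \<lfloor>g \<bullet> \<alpha> j\<rfloor> *\<^sub>R u j) y = 1"
    unfolding character_eq_1_iff using assms by (simp add: inner_sum_left Ints_sum)
  moreover have "character (reduce g + (\<Sum>j\<in>I. of_int \<lfloor>g \<bullet> \<alpha> j\<rfloor> *\<^sub>R u j)) y = character g y"
    by (simp add: reduce_def)
  ultimately show ?thesis by (simp add: character_add_left)
qed

lemma reduce_eq_imp:
  assumes "reduce g = reduce g'" "j \<in> I"
  shows "(g - g') \<bullet> \<alpha> j \<in> \<int>"
proof -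
  have "frac (g \<bullet> \<alpha> j) = frac (g' \<bullet> \<alpha> j)" using assms by (metis reduce_coord)
  then have "(g - g') \<bullet> \<alpha> j = of_int (\<lfloor>g \<bullet> \<alpha> j\<rfloor> - \<lfloor>g' \<bullet> \<alpha> j\<rfloor>)" by (simp add: inner_diff_left frac_def)
  then show ?thesis by (metis Ints_of_int)
qed

lemma Box_unique:
  assumes "g \<in> Box" "g' \<in> Box" "\<And>j. j \<in> I \<Longrightarrow> (g - g') \<bullet> \<alpha> j \<in> \<int>"
  shows "g = g'"
proof -
  have "g \<bullet> \<alpha> j = g' \<bullet> \<alpha> j" if j: "j \<in> I" for j
  proof -
    obtain z where z: "g \<bullet> \<alpha> j - g' \<bullet> \<alpha> j = of_int z"
      using assms(3)[OF j] by (auto simp: inner_diff_left elim: Ints_cases)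
    have "- 1 < g \<bullet> \<alpha> j - g' \<bullet> \<alpha> j" "g \<bullet> \<alpha> j - g' \<bullet> \<alpha> j < 1" using assms(1,2) j by (auto simp: Box_def) force+
    then have "z = 0" unfolding z by linarith
    then show ?thesis using z by simp
  qed
  then show ?thesis by (subst coexpand[of g], subst coexpand[of g']) simp
qed

text \<open>
  Orthogonality: the characters in \<open>Box\<close> detect the lattice inside the dual lattice of the \<open>u j\<close>.
  If a coordinate of \<open>y\<close> is not an integer, translation by the corresponding unit vector permutes
  \<open>Box\<close> and multiplies by a factor other than 1.
\<close>

lemma sum_character_Box:
  assumes y: "\<And>j. j \<in> I \<Longrightarrow> u j \<bullet> y \<in> \<int>"
  shows "(\<Sum>g\<in>Box. character g y) = (if y \<in> int_lattice then of_nat (card Box) else 0)"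
proof (cases "y \<in> int_lattice")
  case True
  then have "character g y = 1" if "g \<in> Box" for g
    using that by (simp add: character_eq_1_iff int_lattice_inner Box_def)
  with True show ?thesis by simp
next
  case False
  then obtain m where m: "y $ m \<notin> \<int>" by (auto simp: int_lattice_def)
  have "(\<Sum>g\<in>Box. character g y) = 0"
  proof (rule sum_zero_if_twisted_invariant[OF finite_Box, where \<sigma> = "\<lambda>g. reduce (g + axis m 1)" and \<zeta> = "character (axis m 1) y"])
    show "(\<lambda>g. reduce (g + axis m 1)) ` Box \<subseteq> Box"
    proof clarify
      fix g assume "g \<in> Box"
      then have "g \<in> int_lattice" by (simp add: Box_def)
      then show "reduce (g + axis m 1) \<in> Box" by (intro reduce_Box int_lattice_add axis_int_lattice)
    qed
    show "inj_on (\<lambda>g. reduce (g + axis m 1)) Box"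
    proof (rule inj_onI)
      fix g g' assume "g \<in> Box" "g' \<in> Box" "reduce (g + axis m 1) = reduce (g' + axis m 1)"
      then show "g = g'" using reduce_eq_imp[of "g + axis m 1" "g' + axis m 1"] by (intro Box_unique) auto
    qed
    show "character (reduce (g + axis m 1)) y = character (axis m 1) y * character g y" for g
      using y by (simp add: character_reduce character_add_left mult.commute)
    show "character (axis m 1) y \<noteq> 1"
      using m by (simp add: character_eq_1_iff inner_axis' )
  qed
  with False show ?thesis by simp
qed

definition dual_lattice :: "(real ^ 'n) set" where
  "dual_lattice = {y. \<forall>j\<in>I. u j \<bullet> y \<in> \<int>}"

lemma int_lattice_subset_dual: "int_lattice \<subseteq> dual_lattice"
  using int_lattice_inner integral by (auto simp: dual_lattice_def)

text \<open>
  Every translate of the unit cube contains as many points of the dual lattice as \<open>Box\<close> has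
  elements; this index computation is the orthogonality relation read in both variables.
\<close>

lemma card_dual_lattice_cube:
  "finite {l \<in> dual_lattice. w - l \<in> unit_cube}" "card {l \<in> dual_lattice. w - l \<in> unit_cube} = card Box"
proof -
  let ?X = "{l \<in> dual_lattice. w - l \<in> unit_cube}"
  obtain C where C: "\<And>x. x \<in> (unit_cube :: (real ^ 'n) set) \<Longrightarrow> norm x \<le> C"
    using bounded_unit_cube unfolding bounded_iff by blast
  define D where "D = norm w + C"
  have D: "norm l \<le> D" if "l \<in> ?X" for l
    using C[of "w - l"] that norm_triangle_ineq4[of w "w - l"] by (auto simp: D_def)
  show fin: "finite ?X"
  proof (rule finite_imageD)
    let ?T = "\<lambda>j. {- \<lceil>norm (u j) * D\<rceil>..\<lceil>norm (u j) * D\<rceil>}"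
    have "(\<lambda>l. \<lambda>j\<in>I. \<lfloor>u j \<bullet> l\<rfloor>) ` ?X \<subseteq> PiE I ?T"
    proof (clarify, intro PiE_I)
      fix l j assume l: "l \<in> dual_lattice" "w - l \<in> unit_cube" "j \<in> I"
      have "\<bar>u j \<bullet> l\<bar> \<le> norm (u j) * norm l" by (rule Cauchy_Schwarz_ineq2)
      also have "\<dots> \<le> norm (u j) * D" using D[of l] l by (intro mult_left_mono) auto
      finally show "(\<lambda>j\<in>I. \<lfloor>u j \<bullet> l\<rfloor>) j \<in> ?T j" using l(3) by (simp, linarith)
    qed simp
    moreover have "finite (PiE I ?T)" using finite_I by (intro finite_PiE) auto
    ultimately show "finite ((\<lambda>l. \<lambda>j\<in>I. \<lfloor>u j \<bullet> l\<rfloor>) ` ?X)" by (rule finite_subset)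
    show "inj_on (\<lambda>l. \<lambda>j\<in>I. \<lfloor>u j \<bullet> l\<rfloor>) ?X"
    proof (rule inj_onI)
      fix l l' assume l: "l \<in> ?X" "l' \<in> ?X" "(\<lambda>j\<in>I. \<lfloor>u j \<bullet> l\<rfloor>) = (\<lambda>j\<in>I. \<lfloor>u j \<bullet> l'\<rfloor>)"
      have "u j \<bullet> l = u j \<bullet> l'" if j: "j \<in> I" for j
      proof -
        have "u j \<bullet> l \<in> \<int>" "u j \<bullet> l' \<in> \<int>" using l j by (auto simp: dual_lattice_def)
        then have "u j \<bullet> l = of_int \<lfloor>u j \<bullet> l\<rfloor>" "u j \<bullet> l' = of_int \<lfloor>u j \<bullet> l'\<rfloor>" by (simp_all add: of_int_floor)
        then show ?thesis using fun_cong[OF l(3), of j] j by simp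
      qed
      then show "l = l'" by (subst expand[of l], subst expand[of l']) simp
    qed
  qed
  (* The representative in the translated cube of a point modulo the standard lattice. *)
  define rep where "rep = (\<lambda>l. l + (THE m. m \<in> int_lattice \<and> (w - l) - m \<in> unit_cube))"
  have rep: "rep l - l \<in> int_lattice" "w - rep l \<in> unit_cube" for l
    using theI'[OF unit_cube_floor[of "w - l"]] by (auto simp: rep_def diff_diff_eq)
  have rep_dual: "rep l \<in> ?X" if "l \<in> dual_lattice" for l
  proof -
    have "u j \<bullet> rep l \<in> \<int>" if j: "j \<in> I" for j
    proof -
      have "u j \<bullet> (rep l - l) \<in> \<int>" using rep(1) j integral int_lattice_inner by blast
      moreover have "u j \<bullet> l \<in> \<int>" using that \<open>l \<in> dual_lattice\<close> j by (auto simp: dual_lattice_def)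
      ultimately have "u j \<bullet> (rep l - l) + u j \<bullet> l \<in> \<int>" by (rule Ints_add)
      then show ?thesis by (simp add: inner_diff_right)
    qed
    then show ?thesis using rep(2) by (simp add: dual_lattice_def)
  qed
  have character_rep: "character g (rep l) = character g l" if "g \<in> int_lattice" for g l
  proof -
    have "character g (rep l - l) = 1"
      using that rep(1) by (simp add: character_eq_1_iff int_lattice_inner)
    then show ?thesis using character_add_right[of g "rep l - l" l] by simp
  qed
  obtain l0 where l0: "\<And>m. m \<in> int_lattice \<and> w - m \<in> unit_cube \<longleftrightarrow> m = l0"
    using unit_cube_floor[of w] by (metis (no_types, lifting))
  have "(\<Sum>l\<in>?X. \<Sum>g\<in>Box. character g l) = (\<Sum>l\<in>?X. if l = l0 then of_nat (card Box) else 0)"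
  proof (intro sum.cong refl)
    fix l assume l: "l \<in> ?X"
    then have "(\<Sum>g\<in>Box. character g l) = (if l \<in> int_lattice then of_nat (card Box) else 0)"
      by (intro sum_character_Box) (auto simp: dual_lattice_def)
    moreover have "l \<in> int_lattice \<longleftrightarrow> l = l0" using l0[of l] l by auto
    ultimately show "(\<Sum>g\<in>Box. character g l) = (if l = l0 then of_nat (card Box) else 0)" by simp
  qed
  moreover have "l0 \<in> ?X" using l0[of l0] int_lattice_subset_dual by auto
  (* Summing first over the characters leaves the only point of the standard lattice in the
     cube. *)
  ultimately have 1: "(\<Sum>l\<in>?X. \<Sum>g\<in>Box. character g l) = of_nat (card Box)"
    using fin by simp
  (* Summing first over the dual lattice leaves the trivial character. *)
  have "(\<Sum>g\<in>Box. \<Sum>l\<in>?X. character g l) = (\<Sum>g\<in>Box. if g = 0 then of_nat (card ?X) else 0)"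
  proof (intro sum.cong refl)
    fix g assume g: "g \<in> Box"
    then have gi: "g \<in> int_lattice" by (simp add: Box_def)
    show "(\<Sum>l\<in>?X. character g l) = (if g = 0 then of_nat (card ?X) else 0)"
    proof (cases "g = 0")
      case False
      have "\<exists>j\<in>I. g \<bullet> \<alpha> j \<noteq> 0"
      proof (rule ccontr)
        assume "\<not> ?thesis"
        then have "g = 0" using coexpand[of g] by simp
        with False show False by simp
      qed
      then obtain j where j: "j \<in> I" "g \<bullet> \<alpha> j \<noteq> 0" by blast
      have nz: "g \<bullet> \<alpha> j \<notin> \<int>"
      proof
        assume "g \<bullet> \<alpha> j \<in> \<int>"
        then obtain z where "g \<bullet> \<alpha> j = of_int z" by (auto elim: Ints_cases)
        moreover have "0 \<le> g \<bullet> \<alpha> j" "g \<bullet> \<alpha> j < 1" using g j by (auto simp: Box_def)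
        ultimately show False using j(2) by simp
      qed
      have \<alpha>: "\<alpha> j \<in> dual_lattice" using j dual by (auto simp: dual_lattice_def)
      have add: "l + \<alpha> j \<in> dual_lattice" if "l \<in> dual_lattice" for l
        using that \<alpha> by (auto simp: dual_lattice_def inner_add_right)
      have "(\<Sum>l\<in>?X. character g l) = 0"
      proof (rule sum_zero_if_twisted_invariant[OF fin, where \<sigma> = "\<lambda>l. rep (l + \<alpha> j)" and \<zeta> = "character g (\<alpha> j)"])
        show "(\<lambda>l. rep (l + \<alpha> j)) ` ?X \<subseteq> ?X" using rep_dual add by blast
        show "inj_on (\<lambda>l. rep (l + \<alpha> j)) ?X"
        proof (rule inj_onI)
          fix l l' assume l: "l \<in> ?X" "l' \<in> ?X" "rep (l + \<alpha> j) = rep (l' + \<alpha> j)"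
          have "(rep (l' + \<alpha> j) - (l' + \<alpha> j)) - (rep (l + \<alpha> j) - (l + \<alpha> j)) \<in> int_lattice"
            by (intro int_lattice_diff rep)
          then have "l - l' \<in> int_lattice" using l(3) by simp
          moreover have "w - l' - (l - l') \<in> unit_cube" "w - l' - 0 \<in> unit_cube" using l by auto
          ultimately have "l - l' = 0"
            using unit_cube_floor[of "w - l'"] int_lattice_0 by blast
          then show "l = l'" by simp
        qed
        show "character g (rep (l + \<alpha> j)) = character g (\<alpha> j) * character g l" for l
          using gi by (simp add: character_rep character_add_right)
        show "character g (\<alpha> j) \<noteq> 1" using nz by (simp add: character_eq_1_iff)
      qed
      with False show ?thesis by simp
    qed (simp add: character_def)
  qed
  moreover have "0 \<in> Box" by (simp add: Box_def int_lattice_0)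
  ultimately have 2: "(\<Sum>g\<in>Box. \<Sum>l\<in>?X. character g l) = of_nat (card ?X)"
    using finite_Box by simp
  have "of_nat (card ?X) = (of_nat (card Box) :: complex)"
    using 1 2 sum.swap[of "\<lambda>g l. character g l" ?X Box] by simp
  then show "card ?X = card Box" by (simp only: of_nat_eq_iff)
qed

text \<open>
  The linear map that takes the standard lattice to the dual lattice, for a fixed enumeration of
  \<open>I\<close>.
\<close>

definition coord_map :: "('n \<Rightarrow> 'd) \<Rightarrow> real ^ 'n \<Rightarrow> real ^ 'n" where
  "coord_map b y = (\<Sum>i\<in>UNIV. (y $ i) *\<^sub>R \<alpha> (b i))"

lemma coord_map_add: "coord_map b (y + z) = coord_map b y + coord_map b z"
  by (simp add: coord_map_def scaleR_add_left sum.distrib)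

lemma coord_map_measurable [measurable]: "coord_map b \<in> borel_measurable borel"
  unfolding coord_map_def[abs_def]
  by (intro borel_measurable_continuous_onI continuous_intros)

lemma coord_map_coord:
  assumes b: "bij_betw b UNIV I"
  shows "u (b i) \<bullet> coord_map b y = y $ i"
proof -
  have "b j \<in> I" for j using b by (auto simp: bij_betw_def)
  moreover have "b i = b j \<longleftrightarrow> i = j" for j using b by (auto simp: bij_betw_def inj_on_def)
  ultimately have "u (b i) \<bullet> coord_map b y = (\<Sum>j\<in>UNIV. (y $ j) * (if i = j then 1 else 0))"
    unfolding coord_map_def inner_sum_right by (intro sum.cong refl) (simp add: dual)
  also have "\<dots> = y $ i" by (simp add: if_distrib cong: if_cong)
  finally show ?thesis .
qed

lemma coord_map_expand:
  assumes b: "bij_betw b UNIV I"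
  shows "coord_map b (\<chi> i. u (b i) \<bullet> x) = x"
proof -
  have "coord_map b (\<chi> i. u (b i) \<bullet> x) = (\<Sum>i\<in>UNIV. (u (b i) \<bullet> x) *\<^sub>R \<alpha> (b i))"
    by (simp add: coord_map_def)
  also have "\<dots> = (\<Sum>j\<in>I. (u j \<bullet> x) *\<^sub>R \<alpha> j)"
    using sum.reindex_bij_betw[OF b, of "\<lambda>j. (u j \<bullet> x) *\<^sub>R \<alpha> j"] .
  also have "\<dots> = x" by (rule expand[symmetric])
  finally show ?thesis .
qed

lemma card_int_lattice_preimage:
  assumes b: "bij_betw b UNIV I"
  shows "finite {m \<in> int_lattice. w - coord_map b m \<in> unit_cube}" "card {m \<in> int_lattice. w - coord_map b m \<in> unit_cube} = card Box"
proof -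
  let ?X = "{m \<in> int_lattice. w - coord_map b m \<in> unit_cube}" and ?Y = "{l \<in> dual_lattice. w - l \<in> unit_cube}"
  have inI: "b i \<in> I" for i using b by (auto simp: bij_betw_def)
  have bij: "bij_betw (coord_map b) ?X ?Y"
    unfolding bij_betw_def
  proof
    show "inj_on (coord_map b) ?X"
    proof (rule inj_onI)
      fix m m' assume "coord_map b m = coord_map b m'"
      then have "m $ i = m' $ i" for i using coord_map_coord[OF b, of i] by metis
      then show "m = m'" by (simp add: vec_eq_iff)
    qed
    have "coord_map b m \<in> dual_lattice" if "m \<in> int_lattice" for m
      unfolding dual_lattice_def
    proof (clarify)
      fix j assume "j \<in> I"
      then obtain i where "j = b i" using b by (auto simp: bij_betw_def)
      then show "u j \<bullet> coord_map b m \<in> \<int>" using that by (simp add: coord_map_coord[OF b] int_lattice_def)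
    qed
    moreover have "\<exists>m\<in>int_lattice. l = coord_map b m" if "l \<in> dual_lattice" for l
    proof (rule bexI)
      show "l = coord_map b (\<chi> i. u (b i) \<bullet> l)" by (simp add: coord_map_expand[OF b])
      show "(\<chi> i. u (b i) \<bullet> l) \<in> int_lattice" using that inI by (simp add: int_lattice_def dual_lattice_def)
    qed
    ultimately show "coord_map b ` ?X = ?Y" by fastforce
  qed
  show "finite ?X" "card ?X = card Box"
    using card_dual_lattice_cube[of w] bij_betw_finite[OF bij] bij_betw_same_card[OF bij] by simp_all
qed

end

lemma countable_int_lattice: "countable (int_lattice :: (real ^ 'n) set)"
proof -
  have "int_lattice = (\<Union>n::nat. cball 0 (real n) \<inter> int_lattice :: (real ^ 'n) set)"
    using real_arch_simple by auto
  also have "countable \<dots>"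
  proof (rule countable_UN)
    show "countable (cball 0 (real n) \<inter> int_lattice :: (real ^ 'n) set)" for n
      by (intro countable_finite finite_int_lattice_bounded) simp
  qed simp
  finally show ?thesis .
qed

lemma nn_integral_lborel_translate:
  fixes f :: "'a::euclidean_space \<Rightarrow> ennreal"
  assumes [measurable]: "f \<in> borel_measurable borel"
  shows "(\<integral>\<^sup>+x. f (x + c) \<partial>lborel) = (\<integral>\<^sup>+x. f x \<partial>lborel)"
proof -
  have "(\<integral>\<^sup>+x. f x \<partial>lborel) = (\<integral>\<^sup>+x. f x \<partial>(distr lborel borel ((+) c)))"
    by (simp add: lborel_distr_plus)
  also have "\<dots> = (\<integral>\<^sup>+x. f (c + x) \<partial>lborel)" by (rule nn_integral_distr) auto
  finally show ?thesis by (simp add: add.commute)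
qed

text \<open>The translates of the unit cube by lattice vectors tile the space.\<close>

lemma nn_integral_unit_cube_tiling:
  fixes g :: "real ^ 'n \<Rightarrow> ennreal"
  assumes [measurable]: "g \<in> borel_measurable borel"
  shows "(\<integral>\<^sup>+y. g y \<partial>lborel) = (\<integral>\<^sup>+y. indicator unit_cube y * (\<integral>\<^sup>+m. g (y + m) \<partial>count_space int_lattice) \<partial>lborel)"
proof -
  have one: "(\<integral>\<^sup>+m. g y * indicator unit_cube (y - m) \<partial>count_space int_lattice) = g y" for y
  proof -
    obtain m0 where m0: "\<And>m. m \<in> int_lattice \<and> y - m \<in> unit_cube \<longleftrightarrow> m = m0"
      using unit_cube_floor[of y] by (metis (no_types, lifting))
    have "(\<integral>\<^sup>+m. g y * indicator unit_cube (y - m) \<partial>count_space int_lattice)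
      = (\<integral>\<^sup>+m. g y * indicator {m0} m \<partial>count_space int_lattice)"
      using m0 by (intro nn_integral_cong) (auto simp: indicator_def)
    also have "\<dots> = g y * emeasure (count_space int_lattice) {m0}"
      using m0[of m0] by (intro nn_integral_cmult_indicator) auto
    also have "\<dots> = g y" using m0[of m0] by (simp add: emeasure_count_space_finite)
    finally show ?thesis .
  qed
  have "(\<integral>\<^sup>+y. g y \<partial>lborel) = (\<integral>\<^sup>+y. (\<integral>\<^sup>+m. g y * indicator unit_cube (y - m) \<partial>count_space int_lattice) \<partial>lborel)"
    by (simp add: one)
  also have "\<dots> = (\<integral>\<^sup>+m. (\<integral>\<^sup>+y. g y * indicator unit_cube (y - m) \<partial>lborel) \<partial>count_space int_lattice)"
    by (intro nn_integral_count_space_nn_integral countable_int_lattice) measurable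
  also have "\<dots> = (\<integral>\<^sup>+m. (\<integral>\<^sup>+y. indicator unit_cube y * g (y + m) \<partial>lborel) \<partial>count_space int_lattice)"
  proof (rule nn_integral_cong)
    fix m :: "real ^ 'n"
    have "(\<integral>\<^sup>+y. g y * indicator unit_cube (y - m) \<partial>lborel) = (\<integral>\<^sup>+y. g (y + m) * indicator unit_cube (y + m - m) \<partial>lborel)"
      by (intro nn_integral_lborel_translate[symmetric]) measurable
    then show "(\<integral>\<^sup>+y. g y * indicator unit_cube (y - m) \<partial>lborel) = (\<integral>\<^sup>+y. indicator unit_cube y * g (y + m) \<partial>lborel)"
      by (simp add: mult.commute)
  qed
  also have "\<dots> = (\<integral>\<^sup>+y. (\<integral>\<^sup>+m. indicator unit_cube y * g (y + m) \<partial>count_space int_lattice) \<partial>lborel)"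
    by (intro nn_integral_count_space_nn_integral[symmetric] countable_int_lattice) measurable
  also have "\<dots> = (\<integral>\<^sup>+y. indicator unit_cube y * (\<integral>\<^sup>+m. g (y + m) \<partial>count_space int_lattice) \<partial>lborel)"
    by (simp add: nn_integral_cmult)
  finally show ?thesis .
qed

lemma lborel_vec_eq_distr:
  fixes b :: "'n::finite \<Rightarrow> 'd"
  assumes b: "bij_betw b UNIV I" and I: "finite I"
  shows "(lborel :: (real ^ 'n) measure) = distr (PiM I (\<lambda>_. lborel)) borel (\<lambda>t. \<chi> i. t (b i))"
proof -
  let ?c = "the_inv_into UNIV b"
  have inI: "b i \<in> I" for i using b by (auto simp: bij_betw_def)
  have c: "?c (b i) = i" for i using b by (auto simp: bij_betw_def the_inv_into_f_f)
  have bc: "b (?c j) = j" if "j \<in> I" for j using b that by (auto simp: bij_betw_def f_the_inv_into_f)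
  have eq: "(\<lambda>t :: 'd \<Rightarrow> real. \<chi> i. t (b i)) = (\<lambda>t. \<Sum>i\<in>UNIV. t (b i) *\<^sub>R axis i 1)"
    by (rule ext) (simp add: vec_eq_iff axis_def if_distrib cong: if_cong)
  have meas: "(\<lambda>t :: 'd \<Rightarrow> real. \<chi> i. t (b i)) \<in> measurable (PiM I (\<lambda>_. lborel)) borel"
    unfolding eq
  proof (intro borel_measurable_sum borel_measurable_scaleR)
    fix i show "(\<lambda>t :: 'd \<Rightarrow> real. t (b i)) \<in> borel_measurable (PiM I (\<lambda>_. lborel))"
      using measurable_component_singleton[OF inI[of i], of "\<lambda>_. lborel :: real measure"] by simp
  qed simp
  show ?thesis
  proof (rule lborel_eqI)
    fix l h :: "real ^ 'n" assume lh: "\<And>e. e \<in> Basis \<Longrightarrow> l \<bullet> e \<le> h \<bullet> e"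
    have le: "l $ i \<le> h $ i" for i using lh[of "axis i 1"] by (simp add: axis_Basis_range inner_axis)
    have "emeasure (distr (PiM I (\<lambda>_. lborel)) borel (\<lambda>t. \<chi> i. t (b i))) (box l h)
       = emeasure (PiM I (\<lambda>_. lborel)) ((\<lambda>t. \<chi> i. t (b i)) -` box l h \<inter> space (PiM I (\<lambda>_. lborel)))"
      by (rule emeasure_distr[OF meas]) simp
    also have "(\<lambda>t. \<chi> i. t (b i)) -` box l h \<inter> space (PiM I (\<lambda>_. lborel)) = PiE I (\<lambda>j. {l $ ?c j<..<h $ ?c j})"
    proof (intro equalityI subsetI)
      fix t assume "t \<in> (\<lambda>t. \<chi> i. t (b i)) -` box l h \<inter> space (PiM I (\<lambda>_. lborel))"
      then have t: "t \<in> extensional I" "\<And>i. l $ i < t (b i) \<and> t (b i) < h $ i"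
        by (auto simp: mem_box_cart space_PiM PiE_def)
      show "t \<in> PiE I (\<lambda>j. {l $ ?c j<..<h $ ?c j})"
        using t(1) t(2)[of "?c _"] bc by (auto simp: PiE_def) metis+
    next
      fix t assume t: "t \<in> PiE I (\<lambda>j. {l $ ?c j<..<h $ ?c j})"
      then have "l $ i < t (b i) \<and> t (b i) < h $ i" for i
        using PiE_mem[OF t inI[of i]] by (simp add: c)
      then show "t \<in> (\<lambda>t. \<chi> i. t (b i)) -` box l h \<inter> space (PiM I (\<lambda>_. lborel))"
        using t by (auto simp: mem_box_cart space_PiM PiE_def)
    qed
    also have "emeasure (PiM I (\<lambda>_. lborel)) (PiE I (\<lambda>j. {l $ ?c j<..<h $ ?c j})) = (\<Prod>j\<in>I. emeasure lborel {l $ ?c j<..<h $ ?c j})"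
      by (rule lborel_product.emeasure_PiM[OF I]) auto
    also have "\<dots> = (\<Prod>i\<in>UNIV. emeasure lborel {l $ ?c (b i)<..<h $ ?c (b i)})"
      using prod.reindex_bij_betw[OF b, of "\<lambda>j. emeasure lborel {l $ ?c j<..<h $ ?c j}"] by simp
    also have "\<dots> = (\<Prod>i\<in>UNIV. ennreal (h $ i - l $ i))"
      using le by (simp add: c)
    also have "\<dots> = ennreal (\<Prod>i\<in>UNIV. h $ i - l $ i)" using le by (intro prod_ennreal) auto
    also have "(\<Prod>i\<in>UNIV. h $ i - l $ i) = (\<Prod>e\<in>Basis. (h - l) \<bullet> e)"
      unfolding axis_Basis_range by (subst prod.reindex) (auto simp: inj_on_def axis_eq_axis inner_axis)
    finally show "emeasure (distr (PiM I (\<lambda>_. lborel)) borel (\<lambda>t. \<chi> i. t (b i))) (box l h) = (\<Prod>e\<in>Basis. (h - l) \<bullet> e)" .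
  qed simp
qed

context lattice_basis
begin

text \<open>
  The determinant of the coordinates is the number of points of \<open>Box\<close>: the preimage of a translate
  of the unit cube under \<open>coord_map\<close> has this volume, since tiling by the standard lattice reduces
  it to counting points of the dual lattice in a cube. The volume of one test set suffices by
  translation invariance and Fubini.
\<close>

lemma nn_integral_coord_map:
  fixes f :: "real ^ 'n \<Rightarrow> ennreal"
  assumes b: "bij_betw b UNIV I" and [measurable]: "f \<in> borel_measurable borel"
  shows "(\<integral>\<^sup>+y. f (coord_map b y) \<partial>lborel) = of_nat (card Box) * (\<integral>\<^sup>+x. f x \<partial>lborel)"
proof -
  let ?S = "coord_map b"
  let ?Q = "indicator unit_cube :: real ^ 'n \<Rightarrow> ennreal"
  have shift: "(\<integral>\<^sup>+y. f (x + ?S y) \<partial>lborel) = (\<integral>\<^sup>+y. f (?S y) \<partial>lborel)" for x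
  proof -
    have "(\<integral>\<^sup>+y. f (?S (y + (\<chi> i. u (b i) \<bullet> x))) \<partial>lborel) = (\<integral>\<^sup>+y. f (?S y) \<partial>lborel)"
      by (intro nn_integral_lborel_translate) measurable
    then show ?thesis by (simp add: coord_map_add coord_map_expand[OF b] add.commute)
  qed
  have count: "(\<integral>\<^sup>+y. ?Q (x - ?S y) \<partial>lborel) = of_nat (card Box)" for x
  proof -
    have inner: "(\<integral>\<^sup>+m. ?Q (x - ?S (y + m)) \<partial>count_space int_lattice) = of_nat (card Box)" for y
    proof -
      let ?A = "{m \<in> int_lattice. (x - ?S y) - ?S m \<in> unit_cube}"
      have "(\<integral>\<^sup>+m. ?Q (x - ?S (y + m)) \<partial>count_space int_lattice) = (\<integral>\<^sup>+m. indicator ?A m \<partial>count_space int_lattice)"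
        by (intro nn_integral_cong) (auto simp: indicator_def coord_map_add diff_diff_eq)
      also have "\<dots> = emeasure (count_space int_lattice) ?A" by (intro nn_integral_indicator) auto
      also have "\<dots> = of_nat (card ?A)"
        using card_int_lattice_preimage(1)[OF b, of "x - ?S y"] by (intro emeasure_count_space_finite) auto
      finally show ?thesis
        using card_int_lattice_preimage(2)[OF b, of "x - ?S y"] by simp
    qed
    have "(\<integral>\<^sup>+y. ?Q (x - ?S y) \<partial>lborel) =
      (\<integral>\<^sup>+y. ?Q y * (\<integral>\<^sup>+m. ?Q (x - ?S (y + m)) \<partial>count_space int_lattice) \<partial>lborel)"
      by (intro nn_integral_unit_cube_tiling) measurable
    also have "\<dots> = (\<integral>\<^sup>+y. ?Q y * of_nat (card Box) \<partial>lborel)"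
      by (simp add: inner)
    also have "\<dots> = of_nat (card Box)"
      by (simp add: nn_integral_multc emeasure_unit_cube)
    finally show ?thesis .
  qed
  have "(\<integral>\<^sup>+y. f (?S y) \<partial>lborel) = (\<integral>\<^sup>+x. ?Q x * (\<integral>\<^sup>+y. f (?S y) \<partial>lborel) \<partial>lborel)"
    by (simp add: nn_integral_multc emeasure_unit_cube)
  also have "\<dots> = (\<integral>\<^sup>+x. (\<integral>\<^sup>+y. ?Q x * f (x + ?S y) \<partial>lborel) \<partial>lborel)"
    by (simp add: nn_integral_cmult shift)
  also have "\<dots> = (\<integral>\<^sup>+y. (\<integral>\<^sup>+x. ?Q x * f (x + ?S y) \<partial>lborel) \<partial>lborel)"
    by (intro lborel_pair.Fubini'[symmetric]) measurable
  also have "\<dots> = (\<integral>\<^sup>+y. (\<integral>\<^sup>+x. ?Q (x - ?S y) * f x \<partial>lborel) \<partial>lborel)"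
  proof (rule nn_integral_cong)
    fix y :: "real ^ 'n"
    have "(\<integral>\<^sup>+x. ?Q (x + ?S y - ?S y) * f (x + ?S y) \<partial>lborel) = (\<integral>\<^sup>+x. ?Q (x - ?S y) * f x \<partial>lborel)"
      by (intro nn_integral_lborel_translate) measurable
    then show "(\<integral>\<^sup>+x. ?Q x * f (x + ?S y) \<partial>lborel) = (\<integral>\<^sup>+x. ?Q (x - ?S y) * f x \<partial>lborel)" by simp
  qed
  also have "\<dots> = (\<integral>\<^sup>+x. (\<integral>\<^sup>+y. ?Q (x - ?S y) * f x \<partial>lborel) \<partial>lborel)"
    by (intro lborel_pair.Fubini') measurable
  also have "\<dots> = of_nat (card Box) * (\<integral>\<^sup>+x. f x \<partial>lborel)"
    by (simp add: nn_integral_multc count nn_integral_cmult)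
  finally show ?thesis .
qed

lemma integral_PiM_coordinates:
  fixes G :: "real ^ 'n \<Rightarrow> complex"
  assumes G: "G \<in> borel_measurable borel"
  shows "(LINT t|PiM I (\<lambda>_. lborel). G (\<Sum>j\<in>I. t j *\<^sub>R \<alpha> j)) = of_nat (card Box) * (LINT x|lborel. G x)"
proof -
  have "card (UNIV :: 'n set) = card I" by (simp add: card_I)
  then obtain b :: "'n \<Rightarrow> 'd" where b: "bij_betw b UNIV I"
    using finite_same_card_bij[OF finite_class.finite_UNIV finite_I] by blast
  have inI: "b i \<in> I" for i using b by (auto simp: bij_betw_def)
  have eq: "(\<lambda>t :: 'd \<Rightarrow> real. \<chi> i. t (b i)) = (\<lambda>t. \<Sum>i\<in>UNIV. t (b i) *\<^sub>R axis i 1)"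
    by (rule ext) (simp add: vec_eq_iff axis_def if_distrib cong: if_cong)
  have meas: "(\<lambda>t :: 'd \<Rightarrow> real. \<chi> i. t (b i)) \<in> measurable (PiM I (\<lambda>_. lborel)) borel"
    unfolding eq
  proof (intro borel_measurable_sum borel_measurable_scaleR)
    fix i show "(\<lambda>t :: 'd \<Rightarrow> real. t (b i)) \<in> borel_measurable (PiM I (\<lambda>_. lborel))"
      using measurable_component_singleton[OF inI[of i], of "\<lambda>_. lborel :: real measure"] by simp
  qed simp
  have GS: "(\<lambda>y. G (coord_map b y)) \<in> borel_measurable borel" using G by measurable
  have "(LINT t|PiM I (\<lambda>_. lborel). G (\<Sum>j\<in>I. t j *\<^sub>R \<alpha> j)) = (LINT t|PiM I (\<lambda>_. lborel). G (coord_map b (\<chi> i. t (b i))))"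
  proof -
    have "(\<Sum>j\<in>I. t j *\<^sub>R \<alpha> j) = (\<Sum>i\<in>UNIV. t (b i) *\<^sub>R \<alpha> (b i))" for t :: "'d \<Rightarrow> real"
      using sum.reindex_bij_betw[OF b, of "\<lambda>j. t j *\<^sub>R \<alpha> j"] by simp
    then show ?thesis by (simp add: coord_map_def)
  qed
  also have "\<dots> = (LINT y|distr (PiM I (\<lambda>_. lborel)) borel (\<lambda>t. \<chi> i. t (b i)). G (coord_map b y))"
    by (rule integral_distr[OF meas GS, symmetric])
  also have "\<dots> = (LINT y|lborel. G (coord_map b y))"
    by (simp flip: lborel_vec_eq_distr[OF b finite_I])
  also have "\<dots> = (LINT x|distr lborel borel (coord_map b). G x)"
    by (rule integral_distr[symmetric]) (use G in auto)
  also have "distr lborel borel (coord_map b) = density lborel (\<lambda>_. ennreal (real (card Box)))"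
  proof (rule measure_eqI)
    fix A assume "A \<in> sets (distr lborel borel (coord_map b))"
    then have A [measurable]: "A \<in> sets borel" by simp
    have "emeasure (distr lborel borel (coord_map b)) A = (\<integral>\<^sup>+x. indicator A x \<partial>distr lborel borel (coord_map b))"
      by simp
    also have "\<dots> = (\<integral>\<^sup>+y. indicator A (coord_map b y) \<partial>lborel)" by (rule nn_integral_distr) auto
    also have "\<dots> = of_nat (card Box) * emeasure lborel A"
      by (subst nn_integral_coord_map[OF b]) auto
    finally show "emeasure (distr lborel borel (coord_map b)) A = emeasure (density lborel (\<lambda>_. ennreal (real (card Box)))) A"
      by (simp add: emeasure_density_const ennreal_of_nat_eq_real_of_nat)
  qed simp
  also have "(LINT x|density lborel (\<lambda>_. ennreal (real (card Box))). G x) = of_nat (card Box) * (LINT x|lborel. G x)"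
    using G by (subst integral_density) (auto simp: scaleR_conv_of_real)
  finally show ?thesis .
qed

end

section \<open>Faces and normals of a simple polytope\<close>

lemma affine_hull_Int_face:
  fixes S :: "'a::euclidean_space set"
  assumes "convex S" "F face_of S"
  shows "affine hull F \<inter> S = F"
  using face_of_imp_eq_affine_Int[OF assms] by simp

text \<open>
  Two distinct facets through a vertex have different affine hulls and so together span the
  polytope; by induction on the dimension, the edges at a vertex span the polytope.
\<close>

lemma affine_hull_edges_at_vertex:
  fixes P :: "'a::euclidean_space set"
  assumes "polytope P" "v extreme_point_of P"
  shows "affine hull (insert v (\<Union>{E. E edge_of P \<and> v \<in> E})) = affine hull P"
  using assms
proof (induction "nat (aff_dim P)" arbitrary: P rule: less_induct)
  case less
  let ?X = "insert v (\<Union>{E. E edge_of P \<and> v \<in> E})"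
  have vP: "v \<in> P" using less.prems by (simp add: extreme_point_of_def)
  have vface: "{v} face_of P" using less.prems by (simp add: face_of_singleton)
  have conv: "convex P" and poly: "polyhedron P"
    using less.prems by (auto simp: polytope_imp_convex polytope_imp_polyhedron)
  have sub: "?X \<subseteq> P" using vP edge_of_imp_subset by blast
  have fin: "finite {F. F facet_of P}" using finite_polytope_facets less.prems by blast
  have dim0: "aff_dim P \<ge> 0" using vP aff_dim_negative_iff[of P] by (metis empty_iff not_le)
  consider "aff_dim P = 0" | "aff_dim P = 1" | "aff_dim P \<ge> 2" using dim0 by linarith
  then show ?case
  proof cases
    case 1
    then obtain a where "P = {a}" using aff_dim_eq_0[of P] by auto
    then have P: "P = {v}" using vP by simp
    then have "?X \<subseteq> {v}" using sub by simp
    then have "?X = {v}" by blast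
    then have "affine hull ?X = {v}" by (simp only: affine_hull_sing)
    moreover have "affine hull P = {v}" using P by simp
    ultimately show ?thesis by (rule trans[OF _ sym])
  next
    case 2
    have "P edge_of P" using 2 conv by (simp add: edge_of_def face_of_refl)
    then have "P \<subseteq> ?X" using vP by auto
    then have "?X = P" using sub by (rule subset_antisym[rotated])
    then show ?thesis by simp
  next
    case 3
    have "{v} \<noteq> P" using 3 by auto
    then have v_eq: "{v} = \<Inter>{F. F facet_of P \<and> {v} \<subseteq> F}"
      using face_of_polyhedron[OF poly vface] by blast
    obtain F where F: "F facet_of P" "v \<in> F"
      using face_of_polyhedron_subset_facet[OF poly vface] \<open>{v} \<noteq> P\<close> by blast
    have dimF: "aff_dim F = aff_dim P - 1" using F by (simp add: facet_of_def)
    have "F \<noteq> {v}" using dimF 3 by auto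
    then obtain G where G: "G facet_of P" "v \<in> G" "F \<noteq> G"
      using v_eq F by blast
    have dimG: "aff_dim G = aff_dim P - 1" using G by (simp add: facet_of_def)
    have hull: "affine hull H \<subseteq> affine hull ?X" if H: "H facet_of P" "v \<in> H" for H
    proof -
      have face: "H face_of P" using H by (simp add: facet_of_imp_face_of)
      have dimH: "aff_dim H = aff_dim P - 1" using H by (simp add: facet_of_def)
      have "affine hull (insert v (\<Union>{E. E edge_of H \<and> v \<in> E})) = affine hull H"
      proof (rule less.hyps)
        show "nat (aff_dim H) < nat (aff_dim P)" using dimH 3 by simp
        show "polytope H" using face_of_polytope_polytope less.prems face by blast
        show "v extreme_point_of H" using less.prems face H(2) extreme_point_of_face by blast
      qed
      moreover have "E edge_of P" if "E edge_of H" for E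
        using that face unfolding edge_of_def by (meson face_of_trans)
      then have "insert v (\<Union>{E. E edge_of H \<and> v \<in> E}) \<subseteq> ?X" by blast
      ultimately show ?thesis by (metis hull_mono)
    qed
    have "aff_dim ?X = aff_dim P"
    proof (rule ccontr)
      assume "aff_dim ?X \<noteq> aff_dim P"
      then have lt: "aff_dim ?X \<le> aff_dim P - 1" using aff_dim_subset[OF sub] by linarith
      have "affine hull H = affine hull ?X" if H: "H facet_of P" "v \<in> H" for H
      proof (rule affine_dim_equal)
        show "aff_dim (affine hull H) = aff_dim (affine hull ?X)"
          using lt aff_dim_subset[OF hull[OF H]] H by (simp add: facet_of_def)
        show "affine hull H \<noteq> {}" using H(2) by auto
      qed (use hull[OF H] in auto)
      then have "affine hull F = affine hull G" using F G by metis
      moreover have "H = affine hull H \<inter> P" if "H facet_of P" for H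
        using affine_hull_Int_face[OF conv facet_of_imp_face_of[OF that]] by simp
      ultimately show False using F(1) G(1,3) by metis
    qed
    then show ?thesis
      using affine_dim_equal[of "affine hull ?X" "affine hull P"] hull_mono[OF sub] by auto
  qed
qed

text \<open>Each set lies on one line through \<open>v\<close>, so it adds at most one dimension.\<close>

lemma aff_dim_union_of_segments:
  fixes \<E> :: "'a::euclidean_space set set"
  assumes fin: "finite \<E>" and E: "\<And>E. E \<in> \<E> \<Longrightarrow> v \<in> E \<and> aff_dim E \<le> 1"
  shows "aff_dim (insert v (\<Union>\<E>)) \<le> int (card \<E>)"
proof -
  have "\<exists>w. E \<subseteq> affine hull {v, w}" if "E \<in> \<E>" for E
  proof (cases "E = {v}")
    case True
    then show ?thesis by (auto intro!: exI[of _ v])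
  next
    case False
    have vE: "v \<in> E" "aff_dim E \<le> 1" using E[OF that] by auto
    then obtain w where w: "w \<in> E" "w \<noteq> v" using False by blast
    have "{v, w} \<subseteq> E" using w vE by simp
    then have sub: "affine hull {v, w} \<subseteq> affine hull E" by (rule hull_mono)
    moreover have "aff_dim (affine hull {v, w}) = aff_dim (affine hull E)"
      using aff_dim_subset[OF \<open>{v, w} \<subseteq> E\<close>] vE w by simp
    ultimately have "affine hull {v, w} = affine hull E"
      by (intro affine_dim_equal) auto
    then show ?thesis using hull_subset[of E affine] by auto
  qed
  then obtain w where w: "\<And>E. E \<in> \<E> \<Longrightarrow> E \<subseteq> affine hull {v, w E}" by metis
  have "insert v (\<Union>\<E>) \<subseteq> affine hull (insert v (w ` \<E>))"
  proof -
    have "affine hull {v, w E} \<subseteq> affine hull (insert v (w ` \<E>))" if "E \<in> \<E>" for E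
      using that by (intro hull_mono) auto
    moreover have "v \<in> affine hull (insert v (w ` \<E>))" by (simp add: hull_inc)
    ultimately show ?thesis using w by blast
  qed
  then have "aff_dim (insert v (\<Union>\<E>)) \<le> aff_dim (insert v (w ` \<E>))"
    using aff_dim_subset by (metis aff_dim_affine_hull)
  also have "\<dots> \<le> int (card (insert v (w ` \<E>))) - 1"
    using fin by (intro aff_dim_le_card) simp
  also have "\<dots> \<le> int (card \<E>)"
    using card_insert_le_m1[of "Suc (card \<E>)" "w ` \<E>" v] card_image_le[OF fin, of w] by simp
  finally show ?thesis .
qed

locale presented_polytope =
  fixes \<Delta> :: "(real ^ 'n) set" and u :: "'d::finite \<Rightarrow> real ^ 'n" and \<mu> :: "real ^ 'd"
  assumes simple: "simple_polytope \<Delta>" and presented: "facet_presentation \<Delta> u \<mu>"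
begin

abbreviation act :: "real ^ 'n \<Rightarrow> 'd set" where "act v \<equiv> facets_at u \<mu> {v}"

lemma act_iff: "i \<in> act v \<longleftrightarrow> u i \<bullet> v + \<mu> $ i = 0"
  by (auto simp: facets_at_def wall_def)

lemma Delta_iff: "x \<in> \<Delta> \<longleftrightarrow> (\<forall>i. u i \<bullet> x + \<mu> $ i \<ge> 0)"
  using presented by (auto simp: facet_presentation_def hpoly_def)

lemma polytope: "polytope \<Delta>" and aff_dim_Delta: "aff_dim \<Delta> = int CARD('n)"
  and card_edges: "v \<in> vertices \<Delta> \<Longrightarrow> card {E. E edge_of \<Delta> \<and> v \<in> E} = CARD('n)"
  using simple by (auto simp: simple_polytope_def)

lemma convex: "convex \<Delta>" and compact: "compact \<Delta>" and polyhedron: "polyhedron \<Delta>"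
  using polytope by (auto simp: polytope_imp_convex polytope_imp_compact polytope_imp_polyhedron)

lemma nonempty: "\<Delta> \<noteq> {}"
  using aff_dim_Delta by auto

lemma facet: "(\<Delta> \<inter> wall u \<mu> i) facet_of \<Delta>"
  using presented by (auto simp: facet_presentation_def bij_betw_def)

lemma facet_inj: "\<Delta> \<inter> wall u \<mu> i = \<Delta> \<inter> wall u \<mu> j \<Longrightarrow> i = j"
  using presented by (auto simp: facet_presentation_def bij_betw_def inj_on_def)

lemma facet_obtain:
  assumes "G facet_of \<Delta>"
  obtains i where "G = \<Delta> \<inter> wall u \<mu> i"
  using presented assms unfolding facet_presentation_def bij_betw_def by blast

lemma finite_vertices: "finite (vertices \<Delta>)"
  unfolding vertices_def using finite_polyhedron_extreme_points[OF polyhedron] .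

lemma vertex_in: "v \<in> vertices \<Delta> \<Longrightarrow> v \<in> \<Delta>"
  by (simp add: vertices_def extreme_point_of_def)

text \<open>
  The edges in a facet through \<open>v\<close> span the facet, so there are at least \<open>n - 1\<close> of them, and not
  all of the \<open>n\<close> edges at \<open>v\<close>, which span the polytope. Hence a facet through \<open>v\<close> contains all
  edges at \<open>v\<close> but one, and it is determined by the missing one.
\<close>

lemma card_act_le:
  assumes v: "v \<in> vertices \<Delta>"
  shows "card (act v) \<le> CARD('n)"
proof -
  define \<E> where "\<E> = {E. E edge_of \<Delta> \<and> v \<in> E}"
  have ext: "v extreme_point_of \<Delta>" using v by (simp add: vertices_def)
  have card: "card \<E> = CARD('n)" using card_edges[OF v] by (simp add: \<E>_def)
  then have fin: "finite \<E>" using card_ge_0_finite by (metis zero_less_card_finite)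
  have hull: "affine hull (insert v (\<Union>\<E>)) = affine hull \<Delta>"
    unfolding \<E>_def by (rule affine_hull_edges_at_vertex[OF polytope ext])
  define G where "G = (\<lambda>i. \<Delta> \<inter> wall u \<mu> i)"
  define \<S> where "\<S> = (\<lambda>i. {E \<in> \<E>. E \<subseteq> G i})"
  have main: "affine hull (insert v (\<Union>(\<S> i))) = affine hull (G i) \<and> (\<exists>E\<in>\<E>. \<S> i = \<E> - {E})" if i: "i \<in> act v" for i
  proof -
    have face: "G i face_of \<Delta>" and dim: "aff_dim (G i) = int CARD('n) - 1"
      using facet[of i] aff_dim_Delta by (auto simp: G_def facet_of_def)
    have vG: "v \<in> G i" using i vertex_in[OF v] by (auto simp: G_def facets_at_def)
    have "affine hull (insert v (\<Union>{E. E edge_of G i \<and> v \<in> E})) = affine hull (G i)"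
      using face_of_polytope_polytope[OF polytope face] extreme_point_of_face[OF face] ext vG
      by (intro affine_hull_edges_at_vertex) auto
    moreover have "E edge_of \<Delta>" if "E edge_of G i" for E
      using that face unfolding edge_of_def by (meson face_of_trans)
    then have "{E. E edge_of G i \<and> v \<in> E} \<subseteq> \<S> i"
      using edge_of_imp_subset by (auto simp: \<S>_def \<E>_def)
    then have "affine hull (insert v (\<Union>{E. E edge_of G i \<and> v \<in> E})) \<subseteq> affine hull (insert v (\<Union>(\<S> i)))"
      by (intro hull_mono) auto
    moreover have "affine hull (insert v (\<Union>(\<S> i))) \<subseteq> affine hull (G i)"
      using vG by (intro hull_mono) (auto simp: \<S>_def)
    ultimately have eq: "affine hull (insert v (\<Union>(\<S> i))) = affine hull (G i)" by simp
    have fS: "finite (\<S> i)" using fin by (simp add: \<S>_def)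
    have "aff_dim (insert v (\<Union>(\<S> i))) \<le> int (card (\<S> i))"
      by (rule aff_dim_union_of_segments[OF fS]) (auto simp: \<S>_def \<E>_def edge_of_def)
    moreover have "aff_dim (insert v (\<Union>(\<S> i))) = int CARD('n) - 1"
      using eq dim by (metis aff_dim_affine_hull)
    ultimately have low: "card (\<S> i) \<ge> CARD('n) - 1" by linarith
    have "\<S> i \<noteq> \<E>"
    proof
      assume "\<S> i = \<E>"
      then have "affine hull (G i) = affine hull \<Delta>" using eq hull by simp
      then have "aff_dim (G i) = aff_dim \<Delta>" by (metis aff_dim_affine_hull)
      then show False using dim aff_dim_Delta by simp
    qed
    moreover have "\<S> i \<subseteq> \<E>" by (auto simp: \<S>_def)
    ultimately obtain E where E: "E \<in> \<E>" "\<S> i \<subseteq> \<E> - {E}" by blast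
    have "card (\<E> - {E}) = CARD('n) - 1" using E fin card by simp
    then have "\<S> i = \<E> - {E}" using E fin low by (intro card_seteq) auto
    with eq E show ?thesis by blast
  qed
  have "inj_on \<S> (act v)"
  proof (rule inj_onI)
    fix i j assume "i \<in> act v" "j \<in> act v" "\<S> i = \<S> j"
    then have "affine hull (G i) = affine hull (G j)" using main by metis
    moreover have "affine hull (G l) \<inter> \<Delta> = G l" for l
      using affine_hull_Int_face[OF convex] facet[of l] by (auto simp: G_def facet_of_def)
    ultimately have "G i = G j" by metis
    then show "i = j" unfolding G_def by (rule facet_inj)
  qed
  then have "card (act v) = card (\<S> ` act v)" by (simp add: card_image)
  also have "\<dots> \<le> card ((\<lambda>E. \<E> - {E}) ` \<E>)"
  proof (rule card_mono)
    show "\<S> ` act v \<subseteq> (\<lambda>E. \<E> - {E}) ` \<E>" using main by blast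
  qed (use fin in simp)
  also have "\<dots> \<le> card \<E>" using fin by (rule card_image_le)
  finally show ?thesis using card by simp
qed

lemma direction_in_Delta:
  assumes x: "x \<in> \<Delta>" and w: "\<And>i. i \<in> act x \<Longrightarrow> u i \<bullet> w \<ge> 0"
  obtains e where "e > 0" "x + e *\<^sub>R w \<in> \<Delta>"
proof -
  have "\<exists>e>0. \<forall>t. 0 < t \<and> t \<le> e \<longrightarrow> u i \<bullet> (x + t *\<^sub>R w) + \<mu> $ i \<ge> 0" for i
  proof (cases "i \<in> act x")
    case True
    then have "u i \<bullet> (x + t *\<^sub>R w) + \<mu> $ i = t * (u i \<bullet> w)" for t
      using act_iff[of i x] by (simp add: inner_add_right)
    then show ?thesis using w[OF True] by (intro exI[of _ 1]) auto
  next
    case False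
    define s where "s = u i \<bullet> x + \<mu> $ i"
    have s: "s > 0" using False x act_iff[of i x] by (auto simp: s_def Delta_iff less_le)
    show ?thesis
    proof (intro exI[of _ "s / (1 + \<bar>u i \<bullet> w\<bar>)"] conjI allI impI)
      show "0 < s / (1 + \<bar>u i \<bullet> w\<bar>)" using s by (simp add: add_pos_nonneg)
      fix t assume t: "0 < t \<and> t \<le> s / (1 + \<bar>u i \<bullet> w\<bar>)"
      then have "t * (1 + \<bar>u i \<bullet> w\<bar>) \<le> s" by (simp add: pos_le_divide_eq add_pos_nonneg)
      moreover have "- (t * (u i \<bullet> w)) \<le> t * \<bar>u i \<bullet> w\<bar>"
        using t by (metis abs_ge_minus_self abs_mult abs_of_pos)
      ultimately show "u i \<bullet> (x + t *\<^sub>R w) + \<mu> $ i \<ge> 0"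
        using t by (simp add: inner_add_right s_def algebra_simps)
    qed
  qed
  then obtain e where e: "\<And>i. e i > 0" "\<And>i t. 0 < t \<Longrightarrow> t \<le> e i \<Longrightarrow> u i \<bullet> (x + t *\<^sub>R w) + \<mu> $ i \<ge> 0" by metis
  define m where "m = Min (range e)"
  have "m > 0" unfolding m_def using e(1) by (subst Min_gr_iff) auto
  moreover have "m \<le> e i" for i unfolding m_def by (rule Min_le) auto
  ultimately show ?thesis using e(2) by (intro that[of m]) (auto simp: Delta_iff)
qed

text \<open>
  Otherwise small steps along \<open>w\<close> and along \<open>- w\<close> stay in the polytope, and the vertex is interior
  to a segment.
\<close>

lemma orthogonal_zero:
  assumes v: "v \<in> vertices \<Delta>" and w: "\<And>i. i \<in> act v \<Longrightarrow> u i \<bullet> w = 0"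
  shows "w = 0"
proof (rule ccontr)
  assume "w \<noteq> 0"
  have vD: "v \<in> \<Delta>" by (rule vertex_in[OF v])
  obtain e where e: "e > 0" "v + e *\<^sub>R w \<in> \<Delta>"
    using direction_in_Delta[OF vD, of w] w by auto
  obtain e' where e': "e' > 0" "v + e' *\<^sub>R (- w) \<in> \<Delta>"
    using direction_in_Delta[OF vD, of "- w"] w by auto
  have "v \<in> open_segment (v + e *\<^sub>R w) (v + e' *\<^sub>R (- w))"
  proof -
    define c where "c = e / (e + e')"
    have "(1 - c) * e = c * e'" using e(1) e'(1) by (simp add: c_def field_simps)
    moreover have "(1 - c) *\<^sub>R (v + e *\<^sub>R w) + c *\<^sub>R (v + e' *\<^sub>R (- w)) = v + ((1 - c) * e - c * e') *\<^sub>R w"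
      by (simp add: algebra_simps)
    ultimately have "v = (1 - c) *\<^sub>R (v + e *\<^sub>R w) + c *\<^sub>R (v + e' *\<^sub>R (- w))" by simp
    moreover have "0 < c" "c < 1" using e(1) e'(1) by (auto simp: c_def field_simps)
    moreover have "v + e *\<^sub>R w \<noteq> v + e' *\<^sub>R (- w)"
    proof
      assume "v + e *\<^sub>R w = v + e' *\<^sub>R (- w)"
      then have "(e + e') *\<^sub>R w = 0" by (simp add: scaleR_add_left)
      with \<open>w \<noteq> 0\<close> e(1) e'(1) show False by simp
    qed
    ultimately show ?thesis unfolding in_segment by blast
  qed
  with e(2) e'(2) v show False unfolding vertices_def extreme_point_of_def by blast
qed

text \<open>
  The normals at a vertex span because no vector is orthogonal to all of them; they are at most
  \<open>n\<close> because the polytope is simple.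
\<close>

lemma normals_basis:
  assumes v: "v \<in> vertices \<Delta>"
  shows "inj_on u (act v)" "independent (u ` act v)" "span (u ` act v) = UNIV" "card (act v) = CARD('n)"
proof -
  show sp: "span (u ` act v) = UNIV"
  proof (rule ccontr)
    assume "span (u ` act v) \<noteq> UNIV"
    then have "dim (u ` act v) < DIM(real^'n)"
      by (metis dim_eq_full dim_subset_UNIV le_neq_implies_less)
    then obtain w where "w \<noteq> 0" "\<And>y. y \<in> span (u ` act v) \<Longrightarrow> orthogonal w y"
      using orthogonal_to_subspace_exists by blast
    then have "w = 0" using orthogonal_zero[OF v, of w]
      by (metis imageI inner_commute orthogonal_def span_base)
    with \<open>w \<noteq> 0\<close> show False by simp
  qed
  have dim: "dim (u ` act v) = CARD('n)"
    using sp by (metis DIM_cart DIM_real dim_UNIV dim_span mult.right_neutral)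
  have "CARD('n) \<le> card (u ` act v)"
    using dim_le_card'[of "u ` act v"] dim by simp
  moreover have "card (u ` act v) \<le> card (act v)" by (rule card_image_le) simp
  ultimately have eq: "card (u ` act v) = card (act v)" "card (act v) = CARD('n)"
    using card_act_le[OF v] by linarith+
  show "inj_on u (act v)" using eq(1) by (intro eq_card_imp_inj_on) auto
  show "card (act v) = CARD('n)" by (rule eq)
  show "independent (u ` act v)"
    using dim eq by (intro card_le_dim_spanning[of _ UNIV]) (auto simp: sp)
qed

lemma dual_basis:
  assumes v: "v \<in> vertices \<Delta>"
  shows edge_vec_dual: "i \<in> act v \<Longrightarrow> j \<in> act v \<Longrightarrow> u i \<bullet> edge_vec u \<mu> v j = (if i = j then 1 else 0)"
    and edge_vec_expand: "x = (\<Sum>j\<in>act v. (u j \<bullet> x) *\<^sub>R edge_vec u \<mu> v j)"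
proof -
  show dual: "u i \<bullet> edge_vec u \<mu> v j = (if i = j then 1 else 0)" if "i \<in> act v" "j \<in> act v" for i j
  proof -
    have "\<exists>\<alpha>. \<forall>i\<in>act v. u i \<bullet> \<alpha> = (if i = j then 1 else 0)"
    proof -
      obtain f :: "real ^ 'n \<Rightarrow> real" where f: "linear f" "\<forall>x\<in>u ` act v. f x = (if x = u j then 1 else 0)"
        using linear_independent_extend[OF normals_basis(2)[OF v], of "\<lambda>x. if x = u j then 1 else (0::real)"] by blast
      have "u i \<bullet> (adjoint f 1) = (if i = j then 1 else 0)" if "i \<in> act v" for i
        using f(2) that \<open>j \<in> act v\<close> normals_basis(1)[OF v]
        by (simp add: adjoint_works[OF f(1)] inj_on_eq_iff)
      then show ?thesis by blast
    qed
    moreover have "\<alpha> = \<beta>" if "\<forall>i\<in>act v. u i \<bullet> \<alpha> = (if i = j then 1 else 0)"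
      "\<forall>i\<in>act v. u i \<bullet> \<beta> = (if i = j then 1 else 0)" for \<alpha> \<beta>
      using orthogonal_zero[OF v, of "\<alpha> - \<beta>"] that by (simp add: inner_diff_right)
    ultimately have "\<exists>!\<alpha>. \<forall>i\<in>act v. u i \<bullet> \<alpha> = (if i = j then 1 else 0)" by blast
    from theI'[OF this] that(1) show ?thesis unfolding edge_vec_def by blast
  qed
  have "x - (\<Sum>j\<in>act v. (u j \<bullet> x) *\<^sub>R edge_vec u \<mu> v j) = 0"
  proof (rule orthogonal_zero[OF v])
    fix i assume i: "i \<in> act v"
    have "u i \<bullet> (\<Sum>j\<in>act v. (u j \<bullet> x) *\<^sub>R edge_vec u \<mu> v j) = (\<Sum>j\<in>act v. (u j \<bullet> x) * (if i = j then 1 else 0))"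
      using i dual by (simp add: inner_sum_right)
    also have "\<dots> = u i \<bullet> x" using i by (simp add: if_distrib cong: if_cong)
    finally show "u i \<bullet> (x - (\<Sum>j\<in>act v. (u j \<bullet> x) *\<^sub>R edge_vec u \<mu> v j)) = 0"
      by (simp add: inner_diff_right)
  qed
  then show "x = (\<Sum>j\<in>act v. (u j \<bullet> x) *\<^sub>R edge_vec u \<mu> v j)" by simp
qed

lemma edge_vec_outside:
  assumes v: "v \<in> vertices \<Delta>" and i: "i \<notin> act v"
  shows "edge_vec u \<mu> v i = 0"
proof -
  have "(THE \<alpha>. \<forall>j\<in>act v. u j \<bullet> \<alpha> = (if j = i then 1 else 0)) = 0"
  proof (rule the_equality)
    fix \<alpha> assume "\<forall>j\<in>act v. u j \<bullet> \<alpha> = (if j = i then 1 else 0)"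
    then show "\<alpha> = 0" using i by (intro orthogonal_zero[OF v]) auto
  qed (use i in auto)
  then show ?thesis by (simp add: edge_vec_def)
qed

end

context presented_polytope
begin

text \<open>
  For a set of facets with a common vertex, their intersection. These sets index the faces, with
  reversed inclusions.
\<close>

definition face_at :: "'d set \<Rightarrow> (real ^ 'n) set" where
  "face_at J = \<Delta> \<inter> {x. \<forall>i\<in>J. u i \<bullet> x + \<mu> $ i = 0}"

definition face_indices :: "'d set set" where
  "face_indices = {J. \<exists>v\<in>vertices \<Delta>. J \<subseteq> act v}"

lemma face_at_face: "face_at J face_of \<Delta>"
proof (cases "J = {}")
  case True
  then show ?thesis using convex by (simp add: face_at_def face_of_refl)
next
  case False
  have "(\<Inter>i\<in>J. \<Delta> \<inter> wall u \<mu> i) face_of \<Delta>"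
    using False facet by (intro face_of_Inter) (auto simp: facet_of_def)
  moreover have "face_at J = (\<Inter>i\<in>J. \<Delta> \<inter> wall u \<mu> i)"
    using False by (auto simp: face_at_def wall_def)
  ultimately show ?thesis by simp
qed

lemma vertex_of_face:
  assumes F: "F face_of \<Delta>" "F \<noteq> {}"
  obtains v where "v \<in> vertices \<Delta>" "v \<in> F"
proof -
  have "polytope F" using face_of_polytope_polytope[OF polytope F(1)] .
  then obtain v where "v extreme_point_of F"
    using extreme_point_exists_convex[of F] F(2) by (auto simp: polytope_imp_compact polytope_imp_convex)
  then show ?thesis using that[of v] extreme_point_of_face[OF F(1), of v] by (simp add: vertices_def)
qed

lemma obtain_vertex_of_active:
  assumes "x \<in> \<Delta>"
  obtains v where "v \<in> vertices \<Delta>" "act x \<subseteq> act v"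
proof -
  have "x \<in> face_at (act x)" using assms by (simp add: face_at_def act_iff)
  then obtain v where v: "v \<in> vertices \<Delta>" "v \<in> face_at (act x)"
    using vertex_of_face[OF face_at_face] by blast
  have "act x \<subseteq> act v"
  proof
    fix i assume "i \<in> act x"
    then show "i \<in> act v" using v(2) by (simp add: face_at_def act_iff[of i v])
  qed
  then show ?thesis using that v(1) by blast
qed

text \<open>A ray with this direction from a point of the polytope would stay in it.\<close>

lemma no_recession:
  assumes "\<And>i. u i \<bullet> \<eta> \<ge> 0"
  shows "\<eta> = 0"
proof (rule ccontr)
  assume nz: "\<eta> \<noteq> 0"
  obtain x where x: "x \<in> \<Delta>" using nonempty by blast
  have ray: "x + t *\<^sub>R \<eta> \<in> \<Delta>" if "t \<ge> 0" for t
    unfolding Delta_iff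
  proof
    fix i
    have "t * (u i \<bullet> \<eta>) \<ge> 0" using assms that by simp
    moreover have "u i \<bullet> x + \<mu> $ i \<ge> 0" using x by (simp add: Delta_iff)
    ultimately show "u i \<bullet> (x + t *\<^sub>R \<eta>) + \<mu> $ i \<ge> 0" by (simp add: inner_add_right)
  qed
  obtain C where C: "\<And>y. y \<in> \<Delta> \<Longrightarrow> norm y \<le> C" using compact_imp_bounded[OF compact] unfolding bounded_iff by blast
  define t where "t = (C + norm x + 1) / norm \<eta>"
  have "C \<ge> 0" using C[OF x] norm_ge_zero order_trans by blast
  then have "t \<ge> 0" by (simp add: t_def)
  then have "norm (t *\<^sub>R \<eta>) = C + norm x + 1" using nz \<open>C \<ge> 0\<close> by (simp add: t_def)
  moreover have "norm (t *\<^sub>R \<eta>) \<le> norm (x + t *\<^sub>R \<eta>) + norm x"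
    using norm_triangle_ineq4[of "x + t *\<^sub>R \<eta>" x] by simp
  ultimately show False using C[OF ray[OF \<open>t \<ge> 0\<close>]] by linarith
qed

lemma vertices_nonempty: "vertices \<Delta> \<noteq> {}"
  using vertex_of_face[OF face_of_refl[OF convex] nonempty] by blast

sublocale simple_arrangement u \<mu> "vertices \<Delta>" "edge_vec u \<mu>" act
proof
  show "finite (vertices \<Delta>)" "vertices \<Delta> \<noteq> {}" by (rule finite_vertices vertices_nonempty)+
  show "i \<in> act v \<longleftrightarrow> u i \<bullet> v + \<mu> $ i = 0" for v i by (rule act_iff)
  show "u i \<bullet> v + \<mu> $ i \<ge> 0" if "v \<in> vertices \<Delta>" for v i using vertex_in[OF that] by (simp add: Delta_iff)
  show "u i \<bullet> edge_vec u \<mu> v j = (if i = j then 1 else 0)" if "v \<in> vertices \<Delta>" "i \<in> act v" "j \<in> act v" for v i j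
    using edge_vec_dual that by blast
  show "x = (\<Sum>j\<in>act v. (u j \<bullet> x) *\<^sub>R edge_vec u \<mu> v j)" if "v \<in> vertices \<Delta>" for v x
    using edge_vec_expand[OF that] .
  show "\<exists>v\<in>vertices \<Delta>. {i. u i \<bullet> x + \<mu> $ i = 0} \<subseteq> act v" if "\<And>i. u i \<bullet> x + \<mu> $ i \<ge> 0" for x
  proof -
    have "x \<in> \<Delta>" using that by (simp add: Delta_iff)
    then obtain v where v: "v \<in> vertices \<Delta>" "act x \<subseteq> act v" by (rule obtain_vertex_of_active)
    have "{i. u i \<bullet> x + \<mu> $ i = 0} = act x" by (simp add: act_iff set_eq_iff)
    with v show ?thesis by auto
  qed
  show "\<eta> = 0" if "\<And>i. u i \<bullet> \<eta> \<ge> 0" for \<eta> using no_recession that by blast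
qed

lemma facets_at_face_at:
  assumes J: "J \<in> face_indices"
  shows "facets_at u \<mu> (face_at J) = J"
proof
  show "J \<subseteq> facets_at u \<mu> (face_at J)" by (auto simp: facets_at_def face_at_def wall_def)
  obtain v where v: "v \<in> vertices \<Delta>" "J \<subseteq> act v" using J by (auto simp: face_indices_def)
  have vF: "v \<in> face_at J" using v vertex_in[OF v(1)] by (auto simp: face_at_def act_iff)
  show "facets_at u \<mu> (face_at J) \<subseteq> J"
  proof
    fix i assume i: "i \<in> facets_at u \<mu> (face_at J)"
    then have iv: "i \<in> act v" using vF by (auto simp: facets_at_def)
    show "i \<in> J"
    proof (rule ccontr)
      assume nJ: "i \<notin> J"
      have "u j \<bullet> edge_vec u \<mu> v i \<ge> 0" if "j \<in> act v" for j
        using edge_vec_dual[OF v(1) that iv] by simp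
      then obtain e where e: "e > 0" "v + e *\<^sub>R edge_vec u \<mu> v i \<in> \<Delta>"
        using direction_in_Delta[OF vertex_in[OF v(1)]] by blast
      have slope: "u j \<bullet> (v + e *\<^sub>R edge_vec u \<mu> v i) + \<mu> $ j = (if j = i then e else 0)" if "j \<in> act v" for j
        using that edge_vec_dual[OF v(1) that iv] act_iff[of j v] act_iff[of i v] iv by (simp add: inner_add_right)
      have "v + e *\<^sub>R edge_vec u \<mu> v i \<in> face_at J"
      proof -
        have "u j \<bullet> (v + e *\<^sub>R edge_vec u \<mu> v i) + \<mu> $ j = 0" if "j \<in> J" for j
          using slope[of j] that v(2) nJ by auto
        then show ?thesis using e(2) unfolding face_at_def by blast
      qed
      then have "u i \<bullet> (v + e *\<^sub>R edge_vec u \<mu> v i) + \<mu> $ i = 0"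
        using i unfolding facets_at_def wall_def by blast
      then show False using slope[OF iv] e(1) by simp
    qed
  qed
qed

lemma face_eq_face_at:
  assumes F: "F \<in> faces \<Delta>"
  shows "F = face_at (facets_at u \<mu> F)" "facets_at u \<mu> F \<in> face_indices"
proof -
  have face: "F face_of \<Delta>" "F \<noteq> {}" using F by (auto simp: faces_def)
  obtain v where v: "v \<in> vertices \<Delta>" "v \<in> F" using vertex_of_face[OF face] by blast
  then show "facets_at u \<mu> F \<in> face_indices" by (auto simp: face_indices_def facets_at_def)
  have sub: "F \<subseteq> face_at (facets_at u \<mu> F)"
    using face_of_imp_subset[OF face(1)] by (auto simp: face_at_def facets_at_def wall_def)
  moreover have "face_at (facets_at u \<mu> F) \<subseteq> F"
  proof (cases "F = \<Delta>")
    case False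
    have eq: "F = \<Inter>{G. G facet_of \<Delta> \<and> F \<subseteq> G}"
      by (rule face_of_polyhedron[OF polyhedron face False])
    have "face_at (facets_at u \<mu> F) \<subseteq> G" if FG: "G facet_of \<Delta>" "F \<subseteq> G" for G
    proof -
      obtain i where G: "G = \<Delta> \<inter> wall u \<mu> i" using facet_obtain[OF FG(1)] by blast
      then have "i \<in> facets_at u \<mu> F" using FG(2) by (auto simp: facets_at_def)
      then show ?thesis unfolding G by (auto simp: face_at_def wall_def)
    qed
    then show ?thesis by (subst eq) blast
  qed (auto simp: face_at_def)
  ultimately show "F = face_at (facets_at u \<mu> F)" by blast
qed

lemma face_at_in_faces: "J \<in> face_indices \<Longrightarrow> face_at J \<in> faces \<Delta>"
  using face_at_face vertex_in by (fastforce simp: faces_def face_indices_def face_at_def act_iff)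

lemma faces_bij: "bij_betw face_at face_indices (faces \<Delta>)"
proof (rule bij_betw_byWitness[where f' = "facets_at u \<mu>"])
  show "\<forall>J\<in>face_indices. facets_at u \<mu> (face_at J) = J" using facets_at_face_at by blast
  show "\<forall>F\<in>faces \<Delta>. face_at (facets_at u \<mu> F) = F" using face_eq_face_at(1) by metis
  show "face_at ` face_indices \<subseteq> faces \<Delta>" using face_at_in_faces by blast
  show "facets_at u \<mu> ` faces \<Delta> \<subseteq> face_indices" using face_eq_face_at(2) by blast
qed

lemma face_at_subset_iff:
  assumes "J \<in> face_indices" "K \<in> face_indices"
  shows "face_at J \<subset> face_at K \<longleftrightarrow> K \<subset> J"
proof -
  have anti: "face_at A \<subseteq> face_at B" if "B \<subseteq> A" for A B using that by (auto simp: face_at_def)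
  have conv: "B \<subseteq> A" if "face_at A \<subseteq> face_at B" "A \<in> face_indices" "B \<in> face_indices" for A B
    using facets_at_face_at[OF that(2)] facets_at_face_at[OF that(3)] that(1) unfolding facets_at_def by blast
  show ?thesis using anti conv assms by (metis psubset_eq subset_antisym)
qed

text \<open>
  Near \<open>x\<close> the face that contains \<open>x\<close> in its relative interior is the intersection of the walls
  through \<open>x\<close>, whose normals are independent because they are among the normals at a vertex. So
  the codimension of the face is their number.
\<close>

lemma weight_eq:
  assumes x: "x \<in> \<Delta>"
  shows "weight \<Delta> x = (1 / 2) ^ card (act x)"
proof -
  define F where "F = face_at (act x)"
  define A where "A = {y. \<forall>i\<in>act x. u i \<bullet> y + \<mu> $ i = 0}"
  have xF: "x \<in> F" using x by (simp add: F_def face_at_def act_iff)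
  have FA: "F \<subseteq> A" by (auto simp: F_def A_def face_at_def)
  have affA: "affine A"
  proof -
    have "A = (\<Inter>i\<in>act x. {y. u i \<bullet> y = - \<mu> $ i})" by (auto simp: A_def eq_neg_iff_add_eq_0)
    then show ?thesis by (auto intro!: affine_Inter affine_hyperplane)
  qed
  define U where "U = (\<Inter>i\<in>- act x. {y. u i \<bullet> y > - \<mu> $ i})"
  have "open U" unfolding U_def by (intro open_INT) (auto simp: open_halfspace_gt)
  have "- \<mu> $ i < u i \<bullet> x" if "i \<notin> act x" for i
  proof -
    have "u i \<bullet> x + \<mu> $ i \<ge> 0" using x by (simp add: Delta_iff)
    moreover have "u i \<bullet> x + \<mu> $ i \<noteq> 0" using that by (simp add: act_iff)
    ultimately show ?thesis by linarith
  qed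
  then have xU: "x \<in> U" unfolding U_def by blast
  have UA: "U \<inter> A \<subseteq> F"
  proof
    fix y assume y: "y \<in> U \<inter> A"
    have "u i \<bullet> y + \<mu> $ i \<ge> 0" for i
    proof (cases "i \<in> act x")
      case False
      then have "- \<mu> $ i < u i \<bullet> y" using y unfolding U_def by blast
      then show ?thesis by linarith
    qed (use y in \<open>auto simp: A_def\<close>)
    then show "y \<in> F" using y by (auto simp: F_def face_at_def Delta_iff A_def)
  qed
  have hullF: "affine hull F \<subseteq> A" using FA affA by (rule hull_minimal)
  obtain e where e: "e > 0" "ball x e \<subseteq> U" using \<open>open U\<close> xU open_contains_ball by blast
  have rel: "x \<in> rel_interior F"
    unfolding mem_rel_interior_ball using xF e hullF UA by blast
  have face: "F face_of \<Delta>" unfolding F_def by (rule face_at_face)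
  have the: "(THE G. G face_of \<Delta> \<and> x \<in> rel_interior G) = F"
  proof (rule the_equality)
    fix G assume "G face_of \<Delta> \<and> x \<in> rel_interior G"
    then show "G = F" using face_of_eq[of G \<Delta> F] face rel by blast
  qed (use face rel in blast)
  have dimFA: "aff_dim F = aff_dim A"
  proof (rule antisym)
    show "aff_dim F \<le> aff_dim A" using FA by (rule aff_dim_subset)
    have "aff_dim A = aff_dim (A \<inter> U)"
      using affA \<open>open U\<close> xU xF FA by (intro aff_dim_convex_Int_open[symmetric] affine_imp_convex) auto
    also have "\<dots> \<le> aff_dim F" using UA by (intro aff_dim_subset) blast
    finally show "aff_dim A \<le> aff_dim F" .
  qed
  obtain v where v: "v \<in> vertices \<Delta>" "act x \<subseteq> act v" using obtain_vertex_of_active[OF x] .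
  define L where "L = {y. \<forall>i\<in>act x. u i \<bullet> y = 0}"
  have "A = (+) x ` L"
  proof (intro equalityI subsetI)
    fix y assume "y \<in> A"
    then have "y - x \<in> L" using act_iff[of _ x] by (auto simp: A_def L_def inner_diff_right)
    then show "y \<in> (+) x ` L" by (intro image_eqI[of _ _ "y - x"]) auto
  qed (use act_iff[of _ x] in \<open>auto simp: A_def L_def inner_add_right algebra_simps\<close>)
  then have "aff_dim A = aff_dim L" by (simp add: aff_dim_translation_eq)
  also have "subspace L" by (auto simp: L_def subspace_def inner_add_right)
  then have "aff_dim L = int (dim L)" by (rule aff_dim_subspace)
  also have "dim L + card (act x) = CARD('n)"
  proof -
    have ind: "independent (u ` act x)" using normals_basis(2)[OF v(1)] v(2) by (meson independent_mono image_mono)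
    have "card (u ` act x) = card (act x)"
      using normals_basis(1)[OF v(1)] v(2) by (intro card_image) (rule inj_on_subset)
    then have "dim (span (u ` act x)) = card (act x)" using ind by (simp add: dim_eq_card_independent)
    moreover have "dim {y \<in> UNIV. \<forall>z\<in>span (u ` act x). orthogonal z y} + dim (span (u ` act x)) = dim (UNIV :: (real ^ 'n) set)"
      by (rule dim_subspace_orthogonal_to_vectors) auto
    moreover have "{y \<in> UNIV. \<forall>z\<in>span (u ` act x). orthogonal z y} = L"
    proof (intro equalityI subsetI)
      fix y assume "y \<in> L"
      then have *: "orthogonal y z" if "z \<in> u ` act x" for z using that by (auto simp: L_def orthogonal_def inner_commute)
      have "orthogonal y z" if "z \<in> span (u ` act x)" for z using orthogonal_to_span[OF that *] .
      then show "y \<in> {y \<in> UNIV. \<forall>z\<in>span (u ` act x). orthogonal z y}"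
        by (auto simp: orthogonal_commute)
    qed (auto simp: L_def orthogonal_def span_base)
    ultimately show ?thesis by simp
  qed
  ultimately have "int CARD('n) - aff_dim F = int (card (act x))" using dimFA by linarith
  then show ?thesis unfolding weight_def the by simp
qed

lemma prod_heaviside_eq_weight:
  "(\<Prod>i\<in>UNIV. heaviside (slack x 0 i)) = (if x \<in> \<Delta> then weight \<Delta> x else 0)"
proof (cases "x \<in> \<Delta>")
  case True
  have "heaviside (slack x 0 i) = (if i \<in> act x then 1/2 else 1)" for i
  proof -
    have "u i \<bullet> x + \<mu> $ i \<ge> 0" using True by (simp add: Delta_iff)
    then show ?thesis by (auto simp: slack_def heaviside_def act_iff)
  qed
  then have "(\<Prod>i\<in>UNIV. heaviside (slack x 0 i)) = (1/2) ^ card (act x)"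
    by (simp add: prod.If_cases)
  with True show ?thesis by (simp add: weight_eq)
next
  case False
  then obtain i where "u i \<bullet> x + \<mu> $ i < 0" by (auto simp: Delta_iff not_le)
  then have "heaviside (slack x 0 i) = 0" by (simp add: slack_def heaviside_def)
  then have "(\<Prod>i\<in>UNIV. heaviside (slack x 0 i)) = 0" by (intro prod_zero) auto
  with False show ?thesis by simp
qed

end

section \<open>Lattice sums over simplicial cones\<close>

lemma integral_lborel_translate:
  fixes f :: "'a::euclidean_space \<Rightarrow> complex"
  assumes "f \<in> borel_measurable borel"
  shows "(LINT x|lborel. f (x + c)) = (LINT x|lborel. f x)"
proof -
  have "(LINT x|lborel. f x) = (LINT x|distr lborel borel ((+) c). f x)"
    by (simp add: lborel_distr_plus)
  also have "\<dots> = (LINT x|lborel. f (c + x))" using assms by (intro integral_distr) auto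
  finally show ?thesis by (simp add: add.commute)
qed

lemma C_class_measurable: "C_class m f \<Longrightarrow> f \<in> borel_measurable borel"
  by (intro borel_measurable_continuous_onI C_class_continuous)

lemma C_compact_measurable: "C_compact m f \<Longrightarrow> f \<in> borel_measurable borel"
  unfolding C_compact_def by (rule C_class_measurable) (rule conjunct1)

lemma C_compact_bounded:
  assumes "C_compact m f"
  shows "\<exists>C. \<forall>x. norm (f x) \<le> C"
proof -
  have "compact (f ` tsupport f)"
    using assms by (intro compact_continuous_image C_class_continuous[of m]) (auto simp: C_compact_def)
  then have "bounded (f ` tsupport f)" by (rule compact_imp_bounded)
  then obtain C where C: "\<forall>y\<in>f ` tsupport f. norm y \<le> C" unfolding bounded_iff by blast
  have "norm (f x) \<le> max C 0" for x
    using C zero_outside_tsupport[of x f] by (cases "x \<in> tsupport f") auto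
  then show ?thesis by blast
qed

lemma sum_multi_idx_le:
  fixes I :: "'d::finite set"
  assumes "a \<in> multi_idx k I"
  shows "(\<Sum>j\<in>UNIV. a j) \<le> card I * k" "\<And>j. j \<in> I \<Longrightarrow> a j < k \<Longrightarrow> Suc (\<Sum>j\<in>UNIV. a j) \<le> card I * k"
proof -
  have eq: "(\<Sum>j\<in>UNIV. a j) = (\<Sum>j\<in>I. a j)"
    using assms by (intro sum.mono_neutral_right) (auto simp: multi_idx_def)
  have le: "a j \<le> k" if "j \<in> I" for j using assms that by (auto simp: multi_idx_def)
  then have "(\<Sum>j\<in>I. a j) \<le> (\<Sum>j\<in>I. k)" by (intro sum_mono)
  then show "(\<Sum>j\<in>UNIV. a j) \<le> card I * k" unfolding eq by simp
  show "Suc (\<Sum>j\<in>UNIV. a j) \<le> card I * k" if "j \<in> I" "a j < k" for j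
  proof -
    have "(\<Sum>j\<in>I. a j) < (\<Sum>j\<in>I. k)" using le that by (intro sum_strict_mono_ex1) auto
    then show ?thesis unfolding eq by simp
  qed
qed

lemma character_sum_right: "character g (\<Sum>j\<in>A. of_nat (n j) *\<^sub>R y j) = (\<Prod>j\<in>A. character g (y j) ^ n j)"
proof (induction A rule: infinite_finite_induct)
  case (insert i A)
  have "character g (of_nat m *\<^sub>R z) = character g z ^ m" for m z
    by (induction m) (simp_all add: character_def scaleR_add_left inner_add_right distrib_left flip: cis_mult)
  with insert show ?case by (simp add: character_add_right)
qed (simp_all add: character_def)

context lattice_basis
begin

lemma coord_of_sum: "i \<in> I \<Longrightarrow> u i \<bullet> (\<Sum>j\<in>I. t j *\<^sub>R \<alpha> j) = t i"
proof -
  assume i: "i \<in> I"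
  have "u i \<bullet> (\<Sum>j\<in>I. t j *\<^sub>R \<alpha> j) = (\<Sum>j\<in>I. t j * (if i = j then 1 else 0))"
    using i dual by (simp add: inner_sum_right)
  also have "\<dots> = t i" using i finite_I by (simp add: if_distrib cong: if_cong)
  finally show ?thesis .
qed

end

text \<open>
  The lattice points of the cone have natural numbers as coordinates, but not all natural
  coordinates give a lattice point. The product of the Heaviside functions is one half to the
  number of coordinates that vanish.
\<close>

lemma (in lattice_basis) sum_cone_lattice_points:
  assumes v: "v \<in> int_lattice" and X: "finite X" "X \<subseteq> int_lattice" "\<And>x. x \<in> int_lattice \<Longrightarrow> f x \<noteq> 0 \<Longrightarrow> x \<in> X"
    and B: "\<And>x j. j \<in> I \<Longrightarrow> f x \<noteq> (0::complex) \<Longrightarrow> u j \<bullet> (x - v) \<le> real B"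
  shows "(\<Sum>n\<in>PiE I (\<lambda>_. {..B}). if (\<Sum>j\<in>I. real (n j) *\<^sub>R \<alpha> j) \<in> int_lattice
           then of_real (\<Prod>j\<in>I. if n j = 0 then 1/2 else 1) * f (v + (\<Sum>j\<in>I. real (n j) *\<^sub>R \<alpha> j)) else 0)
    = (\<Sum>x\<in>X. of_real (\<Prod>j\<in>I. heaviside (u j \<bullet> (x - v))) * f x)"
proof -
  let ?y = "\<lambda>n. \<Sum>j\<in>I. real (n j) *\<^sub>R \<alpha> j"
  let ?L = "\<lambda>n. if ?y n \<in> int_lattice then of_real (\<Prod>j\<in>I. if n j = 0 then 1/2 else 1) * f (v + ?y n) else 0"
  let ?R = "\<lambda>x. of_real (\<Prod>j\<in>I. heaviside (u j \<bullet> (x - v))) * f x"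
  define S where "S = {n \<in> PiE I (\<lambda>_. {..B}). ?y n \<in> int_lattice \<and> f (v + ?y n) \<noteq> 0}"
  define T where "T = {x \<in> X. f x \<noteq> 0 \<and> (\<forall>j\<in>I. 0 \<le> u j \<bullet> (x - v))}"
  define crd where "crd = (\<lambda>x. \<lambda>j\<in>I. nat \<lfloor>u j \<bullet> (x - v)\<rfloor>)"
  have crd: "real (crd x j) = u j \<bullet> (x - v)" if "x \<in> T" "j \<in> I" for x j
  proof -
    have "x \<in> int_lattice" using that X by (auto simp: T_def)
    then have "u j \<bullet> (x - v) \<in> \<int>" using v integral[OF that(2)] by (intro int_lattice_inner int_lattice_diff)
    then obtain z where "u j \<bullet> (x - v) = of_int z" by (auto elim: Ints_cases)
    moreover have "0 \<le> u j \<bullet> (x - v)" using that by (auto simp: T_def)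
    ultimately show ?thesis using that(2) by (simp add: crd_def)
  qed
  have y_crd: "?y (crd x) = x - v" if "x \<in> T" for x
  proof -
    have "?y (crd x) = (\<Sum>j\<in>I. (u j \<bullet> (x - v)) *\<^sub>R \<alpha> j)"
      using crd[OF that] by (intro sum.cong refl) simp
    also have "\<dots> = x - v" by (rule expand[symmetric])
    finally show ?thesis .
  qed
  have "(\<Sum>n\<in>PiE I (\<lambda>_. {..B}). ?L n) = (\<Sum>n\<in>S. ?L n)"
    using finite_I by (intro sum.mono_neutral_right) (auto simp: S_def intro!: finite_PiE)
  also have "\<dots> = (\<Sum>x\<in>T. ?R x)"
  proof (rule sum.reindex_bij_witness[where i = crd and j = "\<lambda>n. v + ?y n"])
    fix n assume n: "n \<in> S"
    have c: "u j \<bullet> (v + ?y n - v) = real (n j)" if "j \<in> I" for j using coord_of_sum[OF that] by simp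
    show "v + ?y n \<in> T" using n X(3) int_lattice_add[OF v] c by (auto simp: S_def T_def)
    show "crd (v + ?y n) = n"
    proof
      fix j show "crd (v + ?y n) j = n j"
        using n c[of j] by (cases "j \<in> I") (auto simp: crd_def S_def PiE_def extensional_def)
    qed
    have "heaviside (u j \<bullet> (v + ?y n - v)) = (if n j = 0 then 1/2 else 1)" if "j \<in> I" for j
      unfolding c[OF that] by (simp add: heaviside_def)
    then have "(\<Prod>j\<in>I. heaviside (u j \<bullet> (v + ?y n - v))) = (\<Prod>j\<in>I. if n j = 0 then 1/2 else 1)"
      by (intro prod.cong refl)
    then show "?R (v + ?y n) = ?L n" using n by (simp add: S_def)
  next
    fix x assume x: "x \<in> T"
    show "v + ?y (crd x) = x" using y_crd[OF x] by simp
    have "crd x j \<le> B" if "j \<in> I" for j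
      using B[OF that, of x] crd[OF x that] x by (simp add: T_def)
    then show "crd x \<in> S"
      using x y_crd[OF x] X(2) v by (auto simp: S_def T_def int_lattice_diff crd_def PiE_def)
  qed
  also have "\<dots> = (\<Sum>x\<in>X. ?R x)"
  proof (rule sum.mono_neutral_left)
    show "\<forall>x\<in>X - T. ?R x = 0"
    proof
      fix x assume x: "x \<in> X - T"
      show "?R x = 0"
      proof (cases "f x = 0")
        case False
        then obtain j where "j \<in> I" "u j \<bullet> (x - v) < 0" using x by (auto simp: T_def not_le)
        then have "(\<Prod>j\<in>I. heaviside (u j \<bullet> (x - v))) = 0"
          using finite_I by (intro prod_zero bexI[of _ j]) (auto simp: heaviside_def)
        then show ?thesis by simp
      qed simp
    qed
  qed (use X in \<open>auto simp: T_def\<close>)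
  finally show ?thesis .
qed

text \<open>
  The coordinates \<open>u j \<bullet> (x - v)\<close> turn the cone into an orthant and the lattice into a subset of
  the standard lattice; its indicator function is the average of the characters in \<open>G\<close>, so that
  the twisted Euler-Maclaurin formula in each coordinate applies. The Jacobian cancels the factor
  of the average. The set \<open>G\<close> is left open because for a polarized basis it will be the box of the
  original one.
\<close>

lemma cone_Euler_Maclaurin:
  fixes u \<alpha> :: "'d::finite \<Rightarrow> real ^ 'n"
  assumes basis: "lattice_basis I u \<alpha>"
    and G: "card G = card (lattice_basis.Box I \<alpha>)"
    and orth: "\<And>y. (\<And>j. j \<in> I \<Longrightarrow> u j \<bullet> y \<in> \<int>) \<Longrightarrow> (\<Sum>g\<in>G. character g y) = (if y \<in> int_lattice then of_nat (card G) else 0)"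
    and k: "k \<ge> 1" and f: "C_compact (CARD('n) * k) f"
    and v: "v \<in> int_lattice" and X: "finite X" "X \<subseteq> int_lattice" "\<And>x. x \<in> int_lattice \<Longrightarrow> f x \<noteq> 0 \<Longrightarrow> x \<in> X"
  shows "(\<Sum>x\<in>X. of_real (\<Prod>j\<in>I. heaviside (u j \<bullet> (x - v))) * f x) =
    (\<Sum>g\<in>G. (LINT x|lborel. (\<Sum>a\<in>multi_idx k I.
      (\<Prod>j\<in>I. if 0 \<le> u j \<bullet> (x - v) then EM_coeff k (character g (\<alpha> j)) (a j) (u j \<bullet> (x - v)) else 0) * multi_deriv \<alpha> a f x)))"
proof -
  interpret lattice_basis I u \<alpha> by (rule basis)
  let ?x = "\<lambda>t. v + (\<Sum>j\<in>I. t j *\<^sub>R \<alpha> j)"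
  have Cf: "C_class (CARD('n) * k) f" and cpt: "compact (tsupport f)" using f by (auto simp: C_compact_def)
  have Cord: "C_class (Suc (\<Sum>j\<in>UNIV. a j)) f" if "a \<in> multi_idx k I" "j \<in> I" "a j < k" for a j
    using sum_multi_idx_le(2)[OF that] Cf card_I by (intro C_class_mono[OF _ Cf]) simp
  have CD: "C_compact 0 (multi_deriv \<alpha> a f)" if "a \<in> multi_idx k I" for a
    using sum_multi_idx_le(1)[OF that] card_I by (intro C_compact_multi_deriv C_compact_mono[OF _ f]) simp
  obtain R where R: "\<And>x. x \<in> tsupport f \<Longrightarrow> norm x \<le> R"
    using compact_imp_bounded[OF cpt] unfolding bounded_iff by blast
  (* A bound for all coordinates on the support of f, at which the kernel can be cut off. *)
  define B where "B = nat \<lceil>(\<Sum>j\<in>I. norm (u j) * (\<bar>R\<bar> + norm v)) + 1\<rceil>"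
  have B: "u j \<bullet> (x - v) < real B" if "j \<in> I" "x \<in> tsupport f" for j x
  proof -
    have "u j \<bullet> (x - v) \<le> norm (u j) * norm (x - v)" by (rule norm_cauchy_schwarz)
    also have "\<dots> \<le> norm (u j) * (\<bar>R\<bar> + norm v)"
      using R[OF that(2)] norm_triangle_ineq4[of x v] by (intro mult_left_mono) auto
    also have "\<dots> \<le> (\<Sum>j\<in>I. norm (u j) * (\<bar>R\<bar> + norm v))"
      using that(1) finite_I by (intro member_le_sum) auto
    also have "\<dots> < real B" unfolding B_def by linarith
    finally show ?thesis .
  qed
  have vanish: "multi_deriv \<alpha> a f x = 0" if "j \<in> I" "u j \<bullet> (x - v) \<ge> real B" for a j x
    using B[OF that(1), of x] that(2) by (intro multi_deriv_zero_outside) auto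
  define D where "D = (\<lambda>a t. multi_deriv \<alpha> a f (?x t))"
  have "\<forall>a. \<exists>C. a \<in> multi_idx k I \<longrightarrow> (\<forall>x. norm (multi_deriv \<alpha> a f x) \<le> C)"
    using C_compact_bounded CD by blast
  then obtain C where C: "\<And>a x. a \<in> multi_idx k I \<Longrightarrow> norm (multi_deriv \<alpha> a f x) \<le> C a" by metis
  have meas_x: "?x \<in> measurable (PiM I (\<lambda>_. lborel)) borel"
  proof (intro borel_measurable_add borel_measurable_sum borel_measurable_scaleR)
    fix j assume "j \<in> I"
    then show "(\<lambda>t :: 'd \<Rightarrow> real. t j) \<in> borel_measurable (PiM I (\<lambda>_. lborel))"
      using measurable_component_singleton[of j I "\<lambda>_. lborel :: real measure"] by simp
  qed simp_all
  have EM: "(LINT t|PiM I (\<lambda>_. lborel). (\<Sum>a\<in>multi_idx k I. (\<Prod>j\<in>I. EM_kernel k (real B) (character g (\<alpha> j)) (a j) (t j)) * D a t)) =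
     (\<Sum>n\<in>PiE I (\<lambda>_. {..B}). (\<Prod>j\<in>I. (if n j = 0 then 1/2 else 1) * character g (\<alpha> j) ^ n j) * D (\<lambda>_. 0) (\<lambda>j\<in>I. real (n j)))" for g
  proof (rule Euler_Maclaurin_product[OF finite_I k, where C = "\<Sum>a\<in>multi_idx k I. \<bar>C a\<bar>"])
    show "norm (character g (\<alpha> j)) = 1" for j by (rule norm_character)
  next
    fix a :: "'d \<Rightarrow> nat" and t :: "'d \<Rightarrow> real" and j s
    assume a: "a \<in> multi_idx k I" "j \<in> I" "a j < k"
    have eq: "?x (t(j := s)) = ?x (t(j := 0)) + s *\<^sub>R \<alpha> j" for s
      using a(2) finite_I by (simp add: sum.remove[of I j])
    have D_eq: "D a (t(j := s)) = multi_deriv \<alpha> a f (?x (t(j := 0)) + s *\<^sub>R \<alpha> j)" for a s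
      unfolding D_def by (rule arg_cong[OF eq])
    have "C_class (Suc 0) (multi_deriv \<alpha> a f)" using Cord[OF a] by (intro C_class_multi_deriv) (simp del: C_class.simps)
    then have "multi_deriv \<alpha> a f differentiable (at y)" for y by simp
    from has_vector_derivative_dir_deriv[OF this, where x = "?x (t(j := 0))" and w = "\<alpha> j" and t = s]
    have "((\<lambda>s. multi_deriv \<alpha> a f (?x (t(j := 0)) + s *\<^sub>R \<alpha> j)) has_vector_derivative
        multi_deriv \<alpha> (a(j := Suc (a j))) f (?x (t(j := 0)) + s *\<^sub>R \<alpha> j)) (at s)"
      unfolding dir_deriv_multi_deriv[OF Cord[OF a]] .
    then show "((\<lambda>s. D a (t(j := s))) has_vector_derivative D (a(j := Suc (a j))) (t(j := s))) (at s)"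
      unfolding D_eq .
  next
    fix a :: "'d \<Rightarrow> nat" assume a: "a \<in> multi_idx k I"
    have "multi_deriv \<alpha> a f \<in> borel_measurable borel" using CD[OF a] by (rule C_compact_measurable)
    then show "D a \<in> borel_measurable (PiM I (\<lambda>_. lborel))"
      unfolding D_def by (rule measurable_compose[OF meas_x])
    show "norm (D a t) \<le> (\<Sum>a\<in>multi_idx k I. \<bar>C a\<bar>)" for t
    proof -
      have "norm (D a t) \<le> \<bar>C a\<bar>" unfolding D_def using C[OF a] by (rule order_trans) simp
      also have "\<dots> \<le> (\<Sum>a\<in>multi_idx k I. \<bar>C a\<bar>)"
        using a finite_I by (intro member_le_sum finite_multi_idx) auto
      finally show ?thesis .
    qed
    show "D a t = 0" if "j \<in> I" "t j = real B" for t j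
      unfolding D_def using that coord_of_sum[OF that(1), of t] by (intro vanish[of j]) auto
  qed
  let ?K = "\<lambda>g j m s. if 0 \<le> s then EM_coeff k (character g (\<alpha> j)) m s else 0"
  let ?\<Psi> = "\<lambda>g x. (\<Sum>a\<in>multi_idx k I. (\<Prod>j\<in>I. ?K g j (a j) (u j \<bullet> (x - v))) * multi_deriv \<alpha> a f x)"
  have lhs: "(LINT t|PiM I (\<lambda>_. lborel). (\<Sum>a\<in>multi_idx k I. (\<Prod>j\<in>I. EM_kernel k (real B) (character g (\<alpha> j)) (a j) (t j)) * D a t))
     = of_nat (card Box) * (LINT x|lborel. ?\<Psi> g x)" for g
  proof -
    let ?\<Phi> = "\<lambda>x. (\<Sum>a\<in>multi_idx k I. (\<Prod>j\<in>I. EM_kernel k (real B) (character g (\<alpha> j)) (a j) (u j \<bullet> x)) * multi_deriv \<alpha> a f (v + x))"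
    have meas: "?\<Phi> \<in> borel_measurable borel"
    proof (intro borel_measurable_sum borel_measurable_times borel_measurable_prod)
      fix a assume a: "a \<in> multi_idx k I"
      have "multi_deriv \<alpha> a f \<in> borel_measurable borel" using CD[OF a] by (rule C_compact_measurable)
      then show "(\<lambda>x. multi_deriv \<alpha> a f (v + x)) \<in> borel_measurable borel"
        by (rule measurable_compose[rotated]) simp
      show "(\<lambda>x. EM_kernel k (real B) (character g (\<alpha> j)) (a j) (u j \<bullet> x)) \<in> borel_measurable borel" for j
        by measurable
    qed
    have "(LINT t|PiM I (\<lambda>_. lborel). (\<Sum>a\<in>multi_idx k I. (\<Prod>j\<in>I. EM_kernel k (real B) (character g (\<alpha> j)) (a j) (t j)) * D a t))
      = (LINT t|PiM I (\<lambda>_. lborel). ?\<Phi> (\<Sum>j\<in>I. t j *\<^sub>R \<alpha> j))"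
      unfolding D_def
      by (rule Bochner_Integration.integral_cong[OF refl], rule sum.cong[OF refl], rule arg_cong2[of _ _ _ _ "(*)"],
          rule prod.cong[OF refl]) (simp_all add: coord_of_sum)
    also have "\<dots> = of_nat (card Box) * (LINT x|lborel. ?\<Phi> x)" by (rule integral_PiM_coordinates[OF meas])
    also have "(LINT x|lborel. ?\<Phi> x) = (LINT x|lborel. ?\<Phi> (x + (- v)))"
      by (rule integral_lborel_translate[OF meas, symmetric])
    also have "(\<lambda>x. ?\<Phi> (x + (- v))) = ?\<Psi> g"
    proof (rule ext, rule sum.cong[OF refl])
      fix x a assume "a \<in> multi_idx k I"
      show "(\<Prod>j\<in>I. EM_kernel k (real B) (character g (\<alpha> j)) (a j) (u j \<bullet> (x + - v))) * multi_deriv \<alpha> a f (v + (x + - v))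
        = (\<Prod>j\<in>I. ?K g j (a j) (u j \<bullet> (x - v))) * multi_deriv \<alpha> a f x"
      proof (cases "\<forall>j\<in>I. u j \<bullet> (x - v) \<le> real B")
        case True
        then have "(\<Prod>j\<in>I. EM_kernel k (real B) (character g (\<alpha> j)) (a j) (u j \<bullet> (x + - v))) = (\<Prod>j\<in>I. ?K g j (a j) (u j \<bullet> (x - v)))"
          by (intro prod.cong refl) (simp add: EM_kernel_def)
        then show ?thesis by simp
      next
        case False
        then obtain j where j: "j \<in> I" "u j \<bullet> (x - v) \<ge> real B" by (auto simp: not_le less_imp_le)
        then have "multi_deriv \<alpha> a f x = 0" by (rule vanish)
        then show ?thesis by simp
      qed
    qed
    finally show ?thesis .
  qed
  let ?y = "\<lambda>n. \<Sum>j\<in>I. real (n j) *\<^sub>R \<alpha> j"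
  let ?w = "\<lambda>n. \<Prod>j\<in>I. if n j = (0::nat) then 1/2 else (1::real)"
  have D0: "D (\<lambda>_. 0) (\<lambda>j\<in>I. real (n j)) = f (v + ?y n)" for n
  proof -
    have "C_class 0 f" using C_class_mono[OF _ Cf] by blast
    then have "multi_deriv \<alpha> (\<lambda>_. 0) f = f"
      using multi_deriv_eq_iter_deriv[of "[]" "\<lambda>_. 0" f \<alpha>] by simp
    then show ?thesis unfolding D_def by (simp cong: sum.cong)
  qed
  (* At the lattice points the powers of the roots of unity combine to the value of the
     character. *)
  have rhs: "(\<Sum>n\<in>PiE I (\<lambda>_. {..B}). (\<Prod>j\<in>I. (if n j = 0 then 1/2 else 1) * character g (\<alpha> j) ^ n j) * D (\<lambda>_. 0) (\<lambda>j\<in>I. real (n j)))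
     = (\<Sum>n\<in>PiE I (\<lambda>_. {..B}). of_real (?w n) * f (v + ?y n) * character g (?y n))" for g
  proof (intro sum.cong refl)
    fix n
    have "(\<Prod>j\<in>I. (if n j = 0 then 1/2 else 1) * character g (\<alpha> j) ^ n j) = of_real (?w n) * character g (?y n)"
      unfolding character_sum_right prod.distrib by (auto simp: of_real_prod intro!: prod.cong)
    then show "(\<Prod>j\<in>I. (if n j = 0 then 1/2 else 1) * character g (\<alpha> j) ^ n j) * D (\<lambda>_. 0) (\<lambda>j\<in>I. real (n j))
      = of_real (?w n) * f (v + ?y n) * character g (?y n)" unfolding D0 by simp
  qed
  have "of_nat (card Box) * (\<Sum>g\<in>G. (LINT x|lborel. ?\<Psi> g x)) =
     (\<Sum>g\<in>G. \<Sum>n\<in>PiE I (\<lambda>_. {..B}). of_real (?w n) * f (v + ?y n) * character g (?y n))"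
    unfolding sum_distrib_left lhs[symmetric] EM rhs ..
  also have "\<dots> = (\<Sum>n\<in>PiE I (\<lambda>_. {..B}). \<Sum>g\<in>G. of_real (?w n) * f (v + ?y n) * character g (?y n))" by (rule sum.swap)
  also have "\<dots> = (\<Sum>n\<in>PiE I (\<lambda>_. {..B}). of_nat (card Box) * (if ?y n \<in> int_lattice then of_real (?w n) * f (v + ?y n) else 0))"
  proof (intro sum.cong refl)
    fix n :: "'d \<Rightarrow> nat"
    have "(\<Sum>g\<in>G. character g (?y n)) = (if ?y n \<in> int_lattice then of_nat (card G) else 0)"
      by (rule orth) (simp add: coord_of_sum)
    then show "(\<Sum>g\<in>G. of_real (?w n) * f (v + ?y n) * character g (?y n))
      = of_nat (card Box) * (if ?y n \<in> int_lattice then of_real (?w n) * f (v + ?y n) else 0)"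
      unfolding sum_distrib_left[symmetric] G by simp
  qed
  also have "\<dots> = of_nat (card Box) * (\<Sum>n\<in>PiE I (\<lambda>_. {..B}). if ?y n \<in> int_lattice then of_real (?w n) * f (v + ?y n) else 0)"
    by (rule sum_distrib_left[symmetric])
  also have "(\<Sum>n\<in>PiE I (\<lambda>_. {..B}). if ?y n \<in> int_lattice then of_real (?w n) * f (v + ?y n) else 0)
     = (\<Sum>x\<in>X. of_real (\<Prod>j\<in>I. heaviside (u j \<bullet> (x - v))) * f x)"
  proof (rule sum_cone_lattice_points[OF v X])
    fix x j assume "j \<in> I" "f x \<noteq> 0"
    then show "u j \<bullet> (x - v) \<le> real B" using B[of j x] zero_outside_tsupport[of x f] by force
  qed
  finally have eq: "of_nat (card Box) * (\<Sum>g\<in>G. (LINT x|lborel. ?\<Psi> g x)) = of_nat (card Box) * (\<Sum>x\<in>X. of_real (\<Prod>j\<in>I. heaviside (u j \<bullet> (x - v))) * f x)" .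
  have "0 \<in> Box" by (simp add: Box_def int_lattice_0)
  then have "card Box \<noteq> 0" using finite_Box by auto
  then show ?thesis using eq by simp
qed

section \<open>The finite groups of the faces\<close>

context presented_polytope
begin

lemma normal_integral: "u i \<in> int_lattice"
  using presented by (auto simp: facet_presentation_def primitive_vec_def)

lemma lattice_basis_at_vertex:
  assumes v: "v \<in> vertices \<Delta>"
  shows "lattice_basis (act v) u (edge_vec u \<mu> v)"
proof
  show "card (act v) = CARD('n)" by (rule normals_basis(4)[OF v])
  show "u i \<bullet> edge_vec u \<mu> v j = (if i = j then 1 else 0)" if "i \<in> act v" "j \<in> act v" for i j
    using edge_vec_dual[OF v] that by blast
  show "x = (\<Sum>j\<in>act v. (u j \<bullet> x) *\<^sub>R edge_vec u \<mu> v j)" for x by (rule edge_vec_expand[OF v])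
qed (auto simp: normal_integral)

text \<open>
  The representatives of the group of a face in the half-open parallelepiped spanned by its normals.
  With this choice the inclusions between the groups of the faces become inclusions of sets, and the
  elements that come from no larger face are those with all coordinates positive.
\<close>

definition box_points :: "'d set \<Rightarrow> (real ^ 'n) set" where
  "box_points J = {g \<in> int_lattice. \<exists>c. g = (\<Sum>j\<in>J. c j *\<^sub>R u j) \<and> (\<forall>j\<in>J. 0 \<le> c j \<and> c j < 1)}"

definition flat_box_points :: "'d set \<Rightarrow> (real ^ 'n) set" where
  "flat_box_points J = {g \<in> int_lattice. \<exists>c. g = (\<Sum>j\<in>J. c j *\<^sub>R u j) \<and> (\<forall>j\<in>J. 0 < c j \<and> c j < 1)}"

text \<open>
  At any vertex of the face, the coefficients with respect to the normals are the inner products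
  with the edge vectors.
\<close>

lemma span_normals_iff:
  assumes v: "v \<in> vertices \<Delta>" and J: "J \<subseteq> act v"
  shows "g = (\<Sum>j\<in>J. c j *\<^sub>R u j) \<longleftrightarrow> (\<forall>j\<in>act v. g \<bullet> edge_vec u \<mu> v j = (if j \<in> J then c j else 0))"
proof
  interpret lattice_basis "act v" u "edge_vec u \<mu> v" by (rule lattice_basis_at_vertex[OF v])
  let ?c = "\<lambda>j. if j \<in> J then c j else 0"
  have eq: "(\<Sum>j\<in>J. c j *\<^sub>R u j) = (\<Sum>j\<in>act v. ?c j *\<^sub>R u j)"
    using J by (intro sum.mono_neutral_cong_left) auto
  {
    assume "g = (\<Sum>j\<in>J. c j *\<^sub>R u j)"
    then show "\<forall>j\<in>act v. g \<bullet> edge_vec u \<mu> v j = (if j \<in> J then c j else 0)"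
      unfolding eq by (simp add: inner_sum_normals)
  next
    assume *: "\<forall>j\<in>act v. g \<bullet> edge_vec u \<mu> v j = (if j \<in> J then c j else 0)"
    show "g = (\<Sum>j\<in>J. c j *\<^sub>R u j)"
      unfolding eq by (subst coexpand[of g]) (intro sum.cong refl, simp add: *)
  }
qed

lemma box_points_iff:
  assumes v: "v \<in> vertices \<Delta>" and J: "J \<subseteq> act v"
  shows "g \<in> box_points J \<longleftrightarrow> g \<in> int_lattice \<and>
    (\<forall>j\<in>act v. 0 \<le> g \<bullet> edge_vec u \<mu> v j \<and> g \<bullet> edge_vec u \<mu> v j < 1 \<and> (j \<notin> J \<longrightarrow> g \<bullet> edge_vec u \<mu> v j = 0))"
  unfolding box_points_def span_normals_iff[OF v J] mem_Collect_eq
proof (intro conj_cong refl iffI)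
  assume "\<exists>c. (\<forall>j\<in>act v. g \<bullet> edge_vec u \<mu> v j = (if j \<in> J then c j else 0)) \<and> (\<forall>j\<in>J. 0 \<le> c j \<and> c j < 1)"
  then show "\<forall>j\<in>act v. 0 \<le> g \<bullet> edge_vec u \<mu> v j \<and> g \<bullet> edge_vec u \<mu> v j < 1 \<and> (j \<notin> J \<longrightarrow> g \<bullet> edge_vec u \<mu> v j = 0)"
    by auto
next
  assume "\<forall>j\<in>act v. 0 \<le> g \<bullet> edge_vec u \<mu> v j \<and> g \<bullet> edge_vec u \<mu> v j < 1 \<and> (j \<notin> J \<longrightarrow> g \<bullet> edge_vec u \<mu> v j = 0)"
  then show "\<exists>c. (\<forall>j\<in>act v. g \<bullet> edge_vec u \<mu> v j = (if j \<in> J then c j else 0)) \<and> (\<forall>j\<in>J. 0 \<le> c j \<and> c j < 1)"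
    using J by (intro exI[of _ "\<lambda>j. g \<bullet> edge_vec u \<mu> v j"]) auto
qed

text \<open>
  An element of the box at a vertex belongs to exactly one face through the vertex in this sense,
  the one given by its non-zero coordinates.
\<close>

lemma flat_box_points_iff:
  assumes v: "v \<in> vertices \<Delta>" and J: "J \<subseteq> act v"
  shows "g \<in> flat_box_points J \<longleftrightarrow> g \<in> box_points (act v) \<and> {j \<in> act v. g \<bullet> edge_vec u \<mu> v j \<noteq> 0} = J"
proof -
  have "g \<in> flat_box_points J \<longleftrightarrow> g \<in> int_lattice \<and>
    (\<forall>j\<in>act v. if j \<in> J then 0 < g \<bullet> edge_vec u \<mu> v j \<and> g \<bullet> edge_vec u \<mu> v j < 1 else g \<bullet> edge_vec u \<mu> v j = 0)"
    unfolding flat_box_points_def span_normals_iff[OF v J] mem_Collect_eq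
  proof (intro conj_cong refl iffI)
    assume "\<exists>c. (\<forall>j\<in>act v. g \<bullet> edge_vec u \<mu> v j = (if j \<in> J then c j else 0)) \<and> (\<forall>j\<in>J. 0 < c j \<and> c j < 1)"
    then show "\<forall>j\<in>act v. if j \<in> J then 0 < g \<bullet> edge_vec u \<mu> v j \<and> g \<bullet> edge_vec u \<mu> v j < 1 else g \<bullet> edge_vec u \<mu> v j = 0"
      by auto
  next
    assume "\<forall>j\<in>act v. if j \<in> J then 0 < g \<bullet> edge_vec u \<mu> v j \<and> g \<bullet> edge_vec u \<mu> v j < 1 else g \<bullet> edge_vec u \<mu> v j = 0"
    then show "\<exists>c. (\<forall>j\<in>act v. g \<bullet> edge_vec u \<mu> v j = (if j \<in> J then c j else 0)) \<and> (\<forall>j\<in>J. 0 < c j \<and> c j < 1)"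
      using J by (intro exI[of _ "\<lambda>j. g \<bullet> edge_vec u \<mu> v j"]) (auto split: if_splits)
  qed
  also have "\<dots> \<longleftrightarrow> g \<in> box_points (act v) \<and> {j \<in> act v. g \<bullet> edge_vec u \<mu> v j \<noteq> 0} = J"
    unfolding box_points_iff[OF v order_refl]
  proof (intro iffI)
    assume *: "g \<in> int_lattice \<and>
      (\<forall>j\<in>act v. if j \<in> J then 0 < g \<bullet> edge_vec u \<mu> v j \<and> g \<bullet> edge_vec u \<mu> v j < 1 else g \<bullet> edge_vec u \<mu> v j = 0)"
    have "j \<in> J \<longleftrightarrow> j \<in> act v \<and> g \<bullet> edge_vec u \<mu> v j \<noteq> 0" for j
      using * J by (cases "j \<in> act v"; cases "j \<in> J") (auto dest: bspec[of _ _ j])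
    moreover have "0 \<le> g \<bullet> edge_vec u \<mu> v j \<and> g \<bullet> edge_vec u \<mu> v j < 1" if "j \<in> act v" for j
      using * that by (cases "j \<in> J") (auto dest: bspec[of _ _ j])
    ultimately show "(g \<in> int_lattice \<and> (\<forall>j\<in>act v. 0 \<le> g \<bullet> edge_vec u \<mu> v j \<and> g \<bullet> edge_vec u \<mu> v j < 1 \<and>
       (j \<notin> act v \<longrightarrow> g \<bullet> edge_vec u \<mu> v j = 0))) \<and> {j \<in> act v. g \<bullet> edge_vec u \<mu> v j \<noteq> 0} = J"
      using * by blast
  next
    assume *: "(g \<in> int_lattice \<and> (\<forall>j\<in>act v. 0 \<le> g \<bullet> edge_vec u \<mu> v j \<and> g \<bullet> edge_vec u \<mu> v j < 1 \<and>
       (j \<notin> act v \<longrightarrow> g \<bullet> edge_vec u \<mu> v j = 0))) \<and> {j \<in> act v. g \<bullet> edge_vec u \<mu> v j \<noteq> 0} = J"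
    have "if j \<in> J then 0 < g \<bullet> edge_vec u \<mu> v j \<and> g \<bullet> edge_vec u \<mu> v j < 1 else g \<bullet> edge_vec u \<mu> v j = 0"
      if j: "j \<in> act v" for j
    proof -
      have "0 \<le> g \<bullet> edge_vec u \<mu> v j" "g \<bullet> edge_vec u \<mu> v j < 1" using * j by blast+
      moreover have "j \<in> J \<longleftrightarrow> g \<bullet> edge_vec u \<mu> v j \<noteq> 0" using * j by blast
      ultimately show ?thesis by auto
    qed
    then show "g \<in> int_lattice \<and>
      (\<forall>j\<in>act v. if j \<in> J then 0 < g \<bullet> edge_vec u \<mu> v j \<and> g \<bullet> edge_vec u \<mu> v j < 1 else g \<bullet> edge_vec u \<mu> v j = 0)"
      using * by blast
  qed
  finally show ?thesis .
qed

lemma finite_box_points: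
  assumes "v \<in> vertices \<Delta>" "J \<subseteq> act v"
  shows "finite (box_points J)"
proof -
  interpret lattice_basis "act v" u "edge_vec u \<mu> v" by (rule lattice_basis_at_vertex[OF assms(1)])
  have "box_points J \<subseteq> Box" using box_points_iff[OF assms] by (auto simp: Box_def)
  then show ?thesis using finite_Box by (rule finite_subset)
qed

definition coset_of :: "(real ^ 'n) set \<Rightarrow> real ^ 'n \<Rightarrow> (real ^ 'n) set" where
  "coset_of F g = (\<lambda>h. h + g) ` normal_sublattice u \<mu> F"

lemma normal_lattice_comm_group: "comm_group (normal_lattice u \<mu> F)"
proof (rule comm_groupI)
  let ?N = "normal_lattice u \<mu> F"
  show "x \<otimes>\<^bsub>?N\<^esub> y \<in> carrier ?N" if "x \<in> carrier ?N" "y \<in> carrier ?N" for x y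
    using that by (auto simp: normal_lattice_def span_add int_lattice_add)
  show "\<one>\<^bsub>?N\<^esub> \<in> carrier ?N" by (simp add: normal_lattice_def span_zero int_lattice_0)
  show "\<exists>y\<in>carrier ?N. y \<otimes>\<^bsub>?N\<^esub> x = \<one>\<^bsub>?N\<^esub>" if "x \<in> carrier ?N" for x
    using that by (intro bexI[of _ "- x"]) (auto simp: normal_lattice_def span_neg int_lattice_uminus)
qed (auto simp: normal_lattice_def algebra_simps)

lemma normal_lattice_simps:
  "carrier (normal_lattice u \<mu> F) = span (u ` facets_at u \<mu> F) \<inter> int_lattice"
  "x \<otimes>\<^bsub>normal_lattice u \<mu> F\<^esub> y = x + y" "\<one>\<^bsub>normal_lattice u \<mu> F\<^esub> = 0"
  by (simp_all add: normal_lattice_def)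

lemma normal_lattice_inv:
  assumes "x \<in> carrier (normal_lattice u \<mu> F)"
  shows "inv\<^bsub>normal_lattice u \<mu> F\<^esub> x = - x"
proof -
  interpret comm_group "normal_lattice u \<mu> F" by (rule normal_lattice_comm_group)
  show ?thesis
    using assms by (intro inv_equality) (auto simp: normal_lattice_simps span_neg int_lattice_uminus)
qed

lemma normals_in_carrier: "u ` facets_at u \<mu> F \<subseteq> carrier (normal_lattice u \<mu> F)"
  by (auto simp: normal_lattice_simps span_base normal_integral)

lemma normal_sublattice_subgroup: "subgroup (normal_sublattice u \<mu> F) (normal_lattice u \<mu> F)"
proof -
  interpret comm_group "normal_lattice u \<mu> F" by (rule normal_lattice_comm_group)
  show ?thesis unfolding normal_sublattice_def by (rule generate_is_subgroup[OF normals_in_carrier])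
qed

lemma normal_sublattice_closed:
  shows normal_sublattice_0: "0 \<in> normal_sublattice u \<mu> F"
    and normal_sublattice_add: "x \<in> normal_sublattice u \<mu> F \<Longrightarrow> y \<in> normal_sublattice u \<mu> F \<Longrightarrow> x + y \<in> normal_sublattice u \<mu> F"
    and normal_sublattice_uminus: "x \<in> normal_sublattice u \<mu> F \<Longrightarrow> - x \<in> normal_sublattice u \<mu> F"
proof -
  interpret subgroup "normal_sublattice u \<mu> F" "normal_lattice u \<mu> F" by (rule normal_sublattice_subgroup)
  show "0 \<in> normal_sublattice u \<mu> F" using one_closed by (simp add: normal_lattice_simps)
  show "x + y \<in> normal_sublattice u \<mu> F" if "x \<in> normal_sublattice u \<mu> F" "y \<in> normal_sublattice u \<mu> F"
    using m_closed[OF that] by (simp add: normal_lattice_simps)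
  have sub: "x \<in> carrier (normal_lattice u \<mu> F)" if "x \<in> normal_sublattice u \<mu> F" for x using that subset by blast
  show "- x \<in> normal_sublattice u \<mu> F" if "x \<in> normal_sublattice u \<mu> F"
    using m_inv_closed[OF that] normal_lattice_inv[OF sub[OF that]] by simp
qed

lemma normal_sublattice_sum:
  assumes "\<And>j. j \<in> A \<Longrightarrow> f j \<in> normal_sublattice u \<mu> F"
  shows "(\<Sum>j\<in>A. f j) \<in> normal_sublattice u \<mu> F"
  using assms
  by (induction A rule: infinite_finite_induct) (auto intro: normal_sublattice_0 normal_sublattice_add)

lemma normal_sublattice_normal:
  assumes "j \<in> facets_at u \<mu> F"
  shows "of_int k *\<^sub>R u j \<in> normal_sublattice u \<mu> F"
proof -
  have 1: "u j \<in> normal_sublattice u \<mu> F"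
    unfolding normal_sublattice_def by (rule generate.incl) (use assms in auto)
  have nat: "real m *\<^sub>R u j \<in> normal_sublattice u \<mu> F" for m
    by (induction m) (auto simp: normal_sublattice_0 scaleR_add_left intro: normal_sublattice_add 1)
  show ?thesis
  proof (cases k)
    case (nonneg m)
    then show ?thesis using nat[of m] by simp
  next
    case (neg m)
    then have k: "(of_int k :: real) = - real (Suc m)" by simp
    show ?thesis unfolding k scaleR_minus_left by (rule normal_sublattice_uminus[OF nat])
  qed
qed

lemma normal_sublattice_mono:
  assumes "facets_at u \<mu> E \<subseteq> facets_at u \<mu> F"
  shows "normal_sublattice u \<mu> E \<subseteq> normal_sublattice u \<mu> F"
proof
  fix x assume "x \<in> normal_sublattice u \<mu> E"
  then show "x \<in> normal_sublattice u \<mu> F"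
    unfolding normal_sublattice_def[of u \<mu> E]
  proof (induction rule: generate.induct)
    case one
    then show ?case by (simp add: normal_lattice_simps normal_sublattice_0)
  next
    case (incl h)
    then obtain j where "j \<in> facets_at u \<mu> E" "h = u j" by blast
    then show ?case using normal_sublattice_normal[of j F 1] assms by auto
  next
    case (inv h)
    then obtain j where j: "j \<in> facets_at u \<mu> E" "h = u j" by blast
    have "inv\<^bsub>normal_lattice u \<mu> E\<^esub> h = - h" using inv normals_in_carrier by (intro normal_lattice_inv) blast
    then show ?case using normal_sublattice_normal[of j F "- 1"] j assms by auto
  next
    case (eng h1 h2)
    then show ?case by (simp add: normal_lattice_simps normal_sublattice_add)
  qed
qed

lemma normal_sublattice_coords:
  assumes v: "v \<in> vertices \<Delta>" and F: "facets_at u \<mu> F \<subseteq> act v" and x: "x \<in> normal_sublattice u \<mu> F" and j: "j \<in> act v"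
  shows "x \<bullet> edge_vec u \<mu> v j \<in> \<int>"
  using x unfolding normal_sublattice_def
proof (induction rule: generate.induct)
  case one
  then show ?case by (simp add: normal_lattice_simps)
next
  case (incl h)
  then show ?case using edge_vec_dual[OF v _ j] F by auto
next
  case (inv h)
  have "inv\<^bsub>normal_lattice u \<mu> F\<^esub> h = - h" using inv normals_in_carrier by (intro normal_lattice_inv) blast
  then show ?case using inv edge_vec_dual[OF v _ j] F by auto
next
  case (eng h1 h2)
  then show ?case by (simp add: normal_lattice_simps inner_add_left)
qed

lemma rcoset_eq_coset_of: "normal_sublattice u \<mu> F #>\<^bsub>normal_lattice u \<mu> F\<^esub> g = coset_of F g"
  by (auto simp: r_coset_def coset_of_def normal_lattice_simps)

lemma coset_of_eqI:
  assumes "g - g' \<in> normal_sublattice u \<mu> F"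
  shows "coset_of F g = coset_of F g'"
proof -
  have "coset_of F g \<subseteq> coset_of F g'" if "g - g' \<in> normal_sublattice u \<mu> F" for g g'
  proof
    fix x assume "x \<in> coset_of F g"
    then obtain h where h: "h \<in> normal_sublattice u \<mu> F" "x = h + g" by (auto simp: coset_of_def)
    then have "h + (g - g') \<in> normal_sublattice u \<mu> F" using that by (intro normal_sublattice_add)
    moreover have "x = (h + (g - g')) + g'" using h by simp
    ultimately show "x \<in> coset_of F g'" unfolding coset_of_def by blast
  qed
  moreover have "g' - g \<in> normal_sublattice u \<mu> F" using normal_sublattice_uminus[OF assms] by simp
  ultimately show ?thesis using assms by blast
qed

text \<open>
  Reduction modulo the normals of the vertex takes a lattice vector in the span of some of these
  normals into the box of the latter, as the other coordinates are 0 and stay so.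
\<close>

lemma Gamma_carrier:
  assumes v: "v \<in> vertices \<Delta>" and J: "facets_at u \<mu> F \<subseteq> act v"
  shows "carrier (\<Gamma> u \<mu> F) = coset_of F ` box_points (facets_at u \<mu> F)"
proof -
  let ?J = "facets_at u \<mu> F"
  interpret lattice_basis "act v" u "edge_vec u \<mu> v" by (rule lattice_basis_at_vertex[OF v])
  have car: "carrier (\<Gamma> u \<mu> F) = coset_of F ` carrier (normal_lattice u \<mu> F)"
    by (auto simp: \<Gamma>_def FactGroup_def RCOSETS_def rcoset_eq_coset_of)
  have sub: "box_points ?J \<subseteq> carrier (normal_lattice u \<mu> F)"
  proof
    fix g assume "g \<in> box_points ?J"
    then obtain c where g: "g \<in> int_lattice" "g = (\<Sum>j\<in>?J. c j *\<^sub>R u j)" by (auto simp: box_points_def)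
    have "(\<Sum>j\<in>?J. c j *\<^sub>R u j) \<in> span (u ` ?J)" by (intro span_sum span_scale span_base imageI)
    with g show "g \<in> carrier (normal_lattice u \<mu> F)" by (simp add: normal_lattice_simps)
  qed
  have "coset_of F a \<in> coset_of F ` box_points ?J" if a: "a \<in> carrier (normal_lattice u \<mu> F)" for a
  proof -
    have ai: "a \<in> int_lattice" "a \<in> span (u ` ?J)" using a by (auto simp: normal_lattice_simps)
    have zero: "a \<bullet> edge_vec u \<mu> v j = 0" if j: "j \<in> act v" "j \<notin> ?J" for j
      using ai(2)
    proof (induction rule: span_induct)
      case base
      then show ?case by (auto simp: subspace_def inner_add_left)
    next
      case (step x)
      then show ?case using edge_vec_dual[OF v _ j(1)] j(2) J by auto
    qed
    have red: "reduce a \<in> box_points ?J"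
      unfolding box_points_iff[OF v J]
      using reduce_Box[OF ai(1)] zero by (auto simp: Box_def reduce_coord)
    have "a - reduce a = (\<Sum>j\<in>act v. of_int \<lfloor>a \<bullet> edge_vec u \<mu> v j\<rfloor> *\<^sub>R u j)" by (simp add: reduce_def)
    also have "\<dots> = (\<Sum>j\<in>?J. of_int \<lfloor>a \<bullet> edge_vec u \<mu> v j\<rfloor> *\<^sub>R u j)"
      using J zero by (intro sum.mono_neutral_right) auto
    also have "\<dots> \<in> normal_sublattice u \<mu> F" by (intro normal_sublattice_sum normal_sublattice_normal)
    finally have "coset_of F a = coset_of F (reduce a)" by (rule coset_of_eqI)
    with red show ?thesis by blast
  qed
  then show ?thesis unfolding car using sub by blast
qed

lemma coset_of_inj:
  assumes v: "v \<in> vertices \<Delta>" and J: "facets_at u \<mu> F \<subseteq> act v"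
  shows "inj_on (coset_of F) (box_points (facets_at u \<mu> F))"
proof (rule inj_onI)
  let ?J = "facets_at u \<mu> F"
  interpret lattice_basis "act v" u "edge_vec u \<mu> v" by (rule lattice_basis_at_vertex[OF v])
  fix g g' assume g: "g \<in> box_points ?J" "g' \<in> box_points ?J" and eq: "coset_of F g = coset_of F g'"
  have "g \<in> coset_of F g" using normal_sublattice_0 by (auto simp: coset_of_def intro!: image_eqI[of _ _ 0])
  then obtain h where h: "h \<in> normal_sublattice u \<mu> F" "g = h + g'" using eq by (auto simp: coset_of_def)
  show "g = g'"
  proof (rule Box_unique)
    show "g \<in> Box" "g' \<in> Box" using g by (auto simp: box_points_iff[OF v J] Box_def)
    show "(g - g') \<bullet> edge_vec u \<mu> v j \<in> \<int>" if "j \<in> act v" for j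
      using normal_sublattice_coords[OF v J h(1) that] h(2) by simp
  qed
qed

lemma Gamma_incl_coset_of:
  assumes "facets_at u \<mu> E \<subseteq> facets_at u \<mu> F"
  shows "\<Gamma>_incl u \<mu> F (coset_of E g) = coset_of F g"
proof -
  have "\<Gamma>_incl u \<mu> F (coset_of E g) = {h + (k + g) | h k. h \<in> normal_sublattice u \<mu> F \<and> k \<in> normal_sublattice u \<mu> E}"
    by (auto simp: \<Gamma>_incl_def set_mult_def coset_of_def normal_lattice_simps)
  also have "\<dots> = coset_of F g"
  proof (intro equalityI subsetI)
    fix x assume "x \<in> {h + (k + g) | h k. h \<in> normal_sublattice u \<mu> F \<and> k \<in> normal_sublattice u \<mu> E}"
    then obtain h k where hk: "h \<in> normal_sublattice u \<mu> F" "k \<in> normal_sublattice u \<mu> E" "x = h + (k + g)" by blast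
    then have "h + k \<in> normal_sublattice u \<mu> F" using normal_sublattice_mono[OF assms] by (intro normal_sublattice_add) auto
    then show "x \<in> coset_of F g" unfolding coset_of_def using hk(3) by (intro image_eqI[of _ _ "h + k"]) auto
  next
    fix x assume "x \<in> coset_of F g"
    then obtain h where "h \<in> normal_sublattice u \<mu> F" "x = h + (0 + g)" by (auto simp: coset_of_def)
    then show "x \<in> {h + (k + g) | h k. h \<in> normal_sublattice u \<mu> F \<and> k \<in> normal_sublattice u \<mu> E}"
      using normal_sublattice_0 by blast
  qed
  finally show ?thesis .
qed

lemma box_points_mono:
  assumes v: "v \<in> vertices \<Delta>" and "J \<subseteq> act v" "K \<subseteq> J"
  shows "box_points K \<subseteq> box_points J"
proof -
  have K: "K \<subseteq> act v" using assms by blast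
  show ?thesis using assms(3) unfolding subset_iff box_points_iff[OF v K] box_points_iff[OF v assms(2)] by blast
qed

text \<open>
  The faces that contain \<open>face_at J\<close> strictly are given by the proper subsets of \<open>J\<close>, and the
  image of the group of such a face consists of the cosets of the elements of the box with support
  in the subset.
\<close>

lemma Gamma_flat_eq:
  assumes J: "J \<in> face_indices"
  shows "\<Gamma>_flat \<Delta> u \<mu> (face_at J) = coset_of (face_at J) ` flat_box_points J"
proof -
  let ?F = "face_at J"
  obtain v where v: "v \<in> vertices \<Delta>" "J \<subseteq> act v" using J by (auto simp: face_indices_def)
  have fJ: "facets_at u \<mu> ?F = J" by (rule facets_at_face_at[OF J])
  have larger: "{E \<in> faces \<Delta>. ?F \<subset> E} = face_at ` {K. K \<subset> J}"
  proof (intro equalityI subsetI)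
    fix E assume E: "E \<in> {E \<in> faces \<Delta>. ?F \<subset> E}"
    then have "E = face_at (facets_at u \<mu> E)" "facets_at u \<mu> E \<in> face_indices" using face_eq_face_at[of E] by auto
    moreover have "facets_at u \<mu> E \<subset> J"
      using face_at_subset_iff[OF J calculation(2)] E calculation(1) by auto
    ultimately show "E \<in> face_at ` {K. K \<subset> J}" by blast
  next
    fix E assume "E \<in> face_at ` {K. K \<subset> J}"
    then obtain K where K: "K \<subset> J" "E = face_at K" by blast
    then have "K \<in> face_indices" unfolding face_indices_def using v by blast
    then show "E \<in> {E \<in> faces \<Delta>. ?F \<subset> E}" using K face_at_in_faces face_at_subset_iff[OF J] by blast
  qed
  have incl: "\<Gamma>_incl u \<mu> ?F ` carrier (\<Gamma> u \<mu> (face_at K)) = coset_of ?F ` box_points K" if "K \<subset> J" for K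
  proof -
    have K: "K \<in> face_indices" "K \<subseteq> act v" unfolding face_indices_def using that v by blast+
    have fK: "facets_at u \<mu> (face_at K) = K" by (rule facets_at_face_at[OF K(1)])
    have "carrier (\<Gamma> u \<mu> (face_at K)) = coset_of (face_at K) ` box_points K"
      using Gamma_carrier[OF v(1), of "face_at K"] K fK by simp
    then show ?thesis using Gamma_incl_coset_of[of "face_at K" ?F] that fK fJ by (simp add: image_image less_imp_le)
  qed
  have inj: "inj_on (coset_of ?F) (box_points J)" using coset_of_inj[OF v(1), of ?F] v fJ by simp
  have "\<Gamma>_flat \<Delta> u \<mu> ?F = coset_of ?F ` box_points J - (\<Union>K\<in>{K. K \<subset> J}. coset_of ?F ` box_points K)"
    unfolding \<Gamma>_flat_def larger using Gamma_carrier[OF v(1), of ?F] v(2) fJ incl by simp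
  also have "\<dots> = coset_of ?F ` (box_points J - (\<Union>K\<in>{K. K \<subset> J}. box_points K))"
    using inj box_points_mono[OF v(1,2)] by (subst inj_on_image_set_diff[OF inj]) (auto simp: image_UN)
  also have "box_points J - (\<Union>K\<in>{K. K \<subset> J}. box_points K) = flat_box_points J"
  proof (intro equalityI subsetI)
    fix g assume g: "g \<in> box_points J - (\<Union>K\<in>{K. K \<subset> J}. box_points K)"
    define K where "K = {j \<in> act v. g \<bullet> edge_vec u \<mu> v j \<noteq> 0}"
    have gv: "g \<in> box_points (act v)" by (rule subsetD[OF box_points_mono[OF v(1) order_refl v(2)] DiffD1[OF g]])
    have gJ: "g \<in> box_points J" using g by (rule DiffD1)
    have "K \<subseteq> J"
    proof
      fix j assume "j \<in> K"
      then have j: "j \<in> act v" "g \<bullet> edge_vec u \<mu> v j \<noteq> 0" by (simp_all add: K_def)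
      show "j \<in> J"
        using bspec[OF conjunct2[OF iffD1[OF box_points_iff[OF v(1,2)] gJ]] j(1)] j(2) by argo
    qed
    have Kv: "K \<subseteq> act v" by (auto simp: K_def)
    have "g \<in> box_points K" using gv unfolding box_points_iff[OF v(1) Kv] box_points_iff[OF v(1) order_refl] by (simp add: K_def)
    have "\<not> K \<subset> J"
    proof
      assume "K \<subset> J"
      then have "g \<in> (\<Union>K\<in>{K. K \<subset> J}. box_points K)" using \<open>g \<in> box_points K\<close> by (intro UN_I[of K]) simp_all
      then show False using g by simp
    qed
    then have "K = J" using \<open>K \<subseteq> J\<close> by blast
    then show "g \<in> flat_box_points J" unfolding flat_box_points_iff[OF v(1,2)] K_def using gv by (rule conjI[rotated])
  next
    fix g assume "g \<in> flat_box_points J"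
    then have g: "g \<in> box_points (act v)" "{j \<in> act v. g \<bullet> edge_vec u \<mu> v j \<noteq> 0} = J"
      by (auto simp: flat_box_points_iff[OF v(1,2)])
    have out: "g \<bullet> edge_vec u \<mu> v j = 0" if "j \<in> act v" "j \<notin> J" for j using g(2) that by blast
    have "g \<in> box_points J"
      using g(1) out unfolding box_points_iff[OF v(1,2)] box_points_iff[OF v(1) order_refl] by simp
    moreover have "g \<notin> box_points K" if K: "K \<subset> J" for K
    proof
      assume gK: "g \<in> box_points K"
      have Kv: "K \<subseteq> act v" using K v(2) by blast
      have "J \<subseteq> K"
      proof
        fix j assume "j \<in> J"
        then have j: "j \<in> act v" "g \<bullet> edge_vec u \<mu> v j \<noteq> 0" using g(2) by blast+
        show "j \<in> K"
          using bspec[OF conjunct2[OF iffD1[OF box_points_iff[OF v(1) Kv] gK]] j(1)] j(2) by argo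
      qed
      then show False using K by blast
    qed
    ultimately show "g \<in> box_points J - (\<Union>K\<in>{K. K \<subset> J}. box_points K)"
      by (intro DiffI notI) (auto elim!: UN_E)
  qed
  finally show ?thesis .
qed

lemma root_vertex_coset_of:
  assumes v: "v \<in> vertices \<Delta>"
  shows "root_vertex u \<mu> (coset_of {v} g) j v = character g (edge_vec u \<mu> v j)"
proof (cases "j \<in> act v")
  case True
  have "g \<in> coset_of {v} g" using normal_sublattice_0 by (auto simp: coset_of_def intro!: image_eqI[of _ _ 0])
  then have "(SOME g'. g' \<in> coset_of {v} g) \<in> coset_of {v} g" by (rule someI)
  then obtain h where h: "h \<in> normal_sublattice u \<mu> {v}" "(SOME g'. g' \<in> coset_of {v} g) = h + g"
    by (auto simp: coset_of_def)
  have "character h (edge_vec u \<mu> v j) = 1"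
    using normal_sublattice_coords[OF v order_refl h(1) True] by (simp add: character_eq_1_iff)
  then have "character (h + g) (edge_vec u \<mu> v j) = character g (edge_vec u \<mu> v j)"
    by (simp add: character_add_left)
  then show ?thesis unfolding root_vertex_def h(2) by (simp add: character_def cis_conv_exp mult_ac)
next
  case False
  then show ?thesis by (simp add: root_vertex_def edge_vec_outside[OF v] character_def)
qed

text \<open>
  The coordinates of \<open>g\<close> with respect to the normals do not depend on the vertex, hence neither
  does the root. At an index outside the face the inner product is 0, in agreement with the value
  1.
\<close>

lemma root_face_coset_of:
  assumes F: "F \<in> faces \<Delta>" and g: "g \<in> box_points (facets_at u \<mu> F)"
    and w: "w \<in> vertices \<Delta>" "facets_at u \<mu> F \<subseteq> act w"
  shows "root_face \<Delta> u \<mu> (coset_of F g) j F = character g (edge_vec u \<mu> w j)"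
proof -
  let ?J = "facets_at u \<mu> F"
  obtain c where c: "g = (\<Sum>j\<in>?J. c j *\<^sub>R u j)" using g by (auto simp: box_points_def)
  have coord: "g \<bullet> edge_vec u \<mu> w j = (if j \<in> ?J then c j else 0)" if "w \<in> vertices \<Delta>" "?J \<subseteq> act w" for w
  proof (cases "j \<in> act w")
    case True
    then show ?thesis using c unfolding span_normals_iff[OF that] by blast
  next
    case False
    then show ?thesis using that by (auto simp: edge_vec_outside)
  qed
  show ?thesis
  proof (cases "j \<in> ?J")
    case True
    define v where "v = (SOME v. v \<in> vertices \<Delta> \<and> v \<in> F)"
    have "\<exists>v. v \<in> vertices \<Delta> \<and> v \<in> F" using vertex_of_face[of F] F by (auto simp: faces_def)
    then have v: "v \<in> vertices \<Delta>" "v \<in> F" unfolding v_def by (metis (mono_tags, lifting) someI_ex)+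
    then have Jv: "?J \<subseteq> act v" by (auto simp: facets_at_def)
    have "root_face \<Delta> u \<mu> (coset_of F g) j F = root_vertex u \<mu> (coset_of {v} g) j v"
      using True Gamma_incl_coset_of[of F "{v}"] Jv by (simp add: root_face_def v_def[symmetric])
    then show ?thesis using coord[OF v(1) Jv] coord[OF w] by (simp add: root_vertex_coset_of[OF v(1)] character_def)
  next
    case False
    then show ?thesis using coord[OF w] by (simp add: root_face_def character_def)
  qed
qed

end

section \<open>Differentiation under the integral sign\<close>

lemma integrable_bounded_support:
  fixes F :: "real ^ 'n \<Rightarrow> complex"
  assumes "F \<in> borel_measurable borel" "\<And>x. norm (F x) \<le> C" "\<And>x. norm x > R \<Longrightarrow> F x = 0"
  shows "integrable lborel F"
proof (rule Bochner_Integration.integrable_bound)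
  show "integrable lborel (\<lambda>x::real^'n. indicator (cball 0 R) x * C :: real)"
    using emeasure_lborel_cball_finite[of "0::real^'n" R] by (intro integrable_mult_left integrable_real_indicator) auto
  show "F \<in> borel_measurable lborel" using assms(1) by simp
  show "AE x in lborel. norm (F x) \<le> norm (indicator (cball 0 R) x * C)"
  proof (rule AE_I2)
    fix x
    show "norm (F x) \<le> norm (indicator (cball 0 R) x * C)"
      using assms(2)[of x] assms(3)[of x] by (cases "norm x > R") (auto simp: indicator_def not_less)
  qed
qed

lemma C_compact_support_bounded:
  assumes "C_compact m g"
  obtains R where "\<And>x. norm x > R \<Longrightarrow> g x = 0"
proof -
  obtain R where "\<And>x. x \<in> tsupport g \<Longrightarrow> norm x \<le> R"
    using assms compact_imp_bounded[of "tsupport g"] unfolding C_compact_def bounded_iff by blast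
  then have "g x = 0" if "norm x > R" for x
    using zero_outside_tsupport[of x g] that by force
  then show ?thesis by (rule that)
qed

lemma integrable_bounded_times_C_compact:
  fixes g :: "real ^ 'n \<Rightarrow> complex"
  assumes W: "W \<in> borel_measurable borel" "\<And>x. norm (W x) \<le> C" and g: "C_compact m g"
  shows "integrable lborel (\<lambda>x. W x * g (x + y))"
proof -
  obtain R where R: "\<And>x. norm x > R \<Longrightarrow> g x = 0" using C_compact_support_bounded[OF g] by blast
  obtain D where D: "\<And>x. norm (g x) \<le> D" using C_compact_bounded[OF g] by blast
  have "0 \<le> C" using W(2)[of 0] norm_ge_zero order_trans by blast
  show ?thesis
  proof (rule integrable_bounded_support)
    have "(\<lambda>x. g (x + y)) \<in> borel_measurable borel"
      by (rule measurable_compose[OF _ C_compact_measurable[OF g]]) simp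
    then show "(\<lambda>x. W x * g (x + y)) \<in> borel_measurable borel" using W(1) by (rule borel_measurable_times[rotated])
    show "norm (W x * g (x + y)) \<le> C * D" for x
      unfolding norm_mult using W(2) D \<open>0 \<le> C\<close> by (intro mult_mono) auto
    show "W x * g (x + y) = 0" if "norm x > R + norm y" for x
    proof -
      have "norm (x + y) > R" using that norm_triangle_ineq4[of "x + y" y] by simp
      then show ?thesis using R by simp
    qed
  qed
qed

lemma increment_le:
  fixes g :: "'a::euclidean_space \<Rightarrow> complex"
  assumes g: "C_class (Suc m) g" and C: "\<And>x. norm (dir_deriv w g x) \<le> C"
  shows "norm (g (x + t *\<^sub>R w) - g x) \<le> C * \<bar>t\<bar>"
proof -
  have "norm (g (x + t *\<^sub>R w) - g (x + 0 *\<^sub>R w)) \<le> C * norm (t - 0)"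
  proof (rule differentiable_bound[of UNIV "\<lambda>t. g (x + t *\<^sub>R w)" "\<lambda>t s. s *\<^sub>R dir_deriv w g (x + t *\<^sub>R w)"])
    fix t :: real
    have "((\<lambda>t. g (x + t *\<^sub>R w)) has_vector_derivative dir_deriv w g (x + t *\<^sub>R w)) (at t)"
      using g by (intro has_vector_derivative_dir_deriv) simp
    then show "((\<lambda>t. g (x + t *\<^sub>R w)) has_derivative (\<lambda>s. s *\<^sub>R dir_deriv w g (x + t *\<^sub>R w))) (at t within UNIV)"
      by (simp add: has_vector_derivative_def)
    show "onorm (\<lambda>s. s *\<^sub>R dir_deriv w g (x + t *\<^sub>R w)) \<le> C"
      by (rule onorm_le) (use mult_left_mono[OF C[of "x + t *\<^sub>R w"] abs_ge_zero] in \<open>simp add: mult.commute\<close>)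
  qed auto
  then show ?thesis by simp
qed

lemma has_vector_derivative_at_0_iff:
  fixes F :: "real \<Rightarrow> 'a::real_normed_vector"
  shows "(F has_vector_derivative D) (at 0) \<longleftrightarrow> ((\<lambda>t. (F t - F 0) /\<^sub>R t) \<longlongrightarrow> D) (at 0)"
proof -
  have eq: "norm ((F t - F 0) /\<^sub>R t - D) = norm (F t - F 0 - t *\<^sub>R D) / norm t" if "t \<noteq> 0" for t
  proof -
    have "(F t - F 0) /\<^sub>R t - D = (F t - F 0 - t *\<^sub>R D) /\<^sub>R t" using that by (simp add: scaleR_diff_right)
    then show ?thesis by (simp add: divide_inverse mult.commute)
  qed
  have "((\<lambda>t. (F t - F 0) /\<^sub>R t) \<longlongrightarrow> D) (at 0) \<longleftrightarrow> ((\<lambda>t. norm ((F t - F 0) /\<^sub>R t - D)) \<longlongrightarrow> 0) (at 0)"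
    by (simp add: tendsto_norm_zero_iff LIM_zero_iff)
  also have "\<dots> \<longleftrightarrow> ((\<lambda>t. norm (F t - F 0 - t *\<^sub>R D) / norm t) \<longlongrightarrow> 0) (at 0)"
    by (rule filterlim_cong[OF refl refl]) (use eq in \<open>simp add: eventually_at_filter\<close>)
  also have "\<dots> \<longleftrightarrow> (F has_vector_derivative D) (at 0)"
    unfolding has_vector_derivative_def has_derivative_iff_norm by (simp add: bounded_linear_scaleR_left)
  finally show ?thesis by simp
qed

text \<open>
  Differentiation under the integral sign, by dominated convergence of the difference quotients:
  they are bounded by the supremum of the derivative and, along a convergent sequence of
  increments, supported in a fixed ball.
\<close>

lemma has_vector_derivative_integral_translate:
  fixes g :: "real ^ 'n \<Rightarrow> complex"
  assumes W: "W \<in> borel_measurable borel" "\<And>x. norm (W x) \<le> B" and g: "C_compact (Suc 0) g"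
  shows "((\<lambda>t. LINT x|lborel. W x * g (x + y + t *\<^sub>R w)) has_vector_derivative
    (LINT x|lborel. W x * dir_deriv w g (x + y))) (at 0)"
  unfolding has_vector_derivative_at_0_iff tendsto_at_iff_sequentially comp_def
proof (intro allI impI)
  fix X :: "nat \<Rightarrow> real" assume "\<forall>i. X i \<in> UNIV - {0}" and X0: "X \<longlonglongrightarrow> 0"
  with X0 have X: "X \<longlonglongrightarrow> 0" "\<And>n. X n \<noteq> 0" by auto
  have Cg: "C_class (Suc 0) g" using g by (simp add: C_compact_def)
  have Dg: "C_compact 0 (dir_deriv w g)"
  proof -
    have "compact (tsupport g \<inter> tsupport (dir_deriv w g))"
      using g by (intro compact_Int_closed) (auto simp: C_compact_def tsupport_def)
    then show ?thesis
      using C_class_dir_deriv[OF Cg, of w] tsupport_dir_deriv[of w g] by (simp add: C_compact_def Int_absorb1)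
  qed
  obtain R where R: "\<And>x. norm x > R \<Longrightarrow> g x = 0" using C_compact_support_bounded[OF g] by blast
  obtain C where C: "\<And>x. norm (dir_deriv w g x) \<le> C" using C_compact_bounded[OF Dg] by blast
  have B0: "0 \<le> B" using W(2)[of 0] norm_ge_zero order_trans by blast
  have C0: "0 \<le> C" using C[of 0] norm_ge_zero order_trans by blast
  obtain M where M: "\<And>n. \<bar>X n\<bar> \<le> M"
    using convergent_imp_Bseq[OF convergentI[OF X(1)]] unfolding Bseq_def by (metis real_norm_def)
  have M0: "0 \<le> M" using M[of 0] by linarith
  define R' where "R' = R + norm y + M * norm w"
  let ?s = "\<lambda>n x. W x * ((g (x + y + X n *\<^sub>R w) - g (x + y)) /\<^sub>R X n)"
  have meas: "(\<lambda>x. h (x + z)) \<in> borel_measurable borel" if "C_compact m h" for h :: "real ^ 'n \<Rightarrow> complex" and m z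
    by (rule measurable_compose[OF _ C_compact_measurable[OF that]]) simp
  have s_meas: "?s n \<in> borel_measurable borel" for n
    using meas[OF g, of "y + X n *\<^sub>R w"] meas[OF g, of y] W(1) by (auto simp: add.assoc)
  have lim: "(\<lambda>n. LINT x|lborel. ?s n x) \<longlonglongrightarrow> (LINT x|lborel. W x * dir_deriv w g (x + y))"
  proof (rule integral_dominated_convergence[where w = "\<lambda>x. indicator (cball 0 R') x * (B * C)"])
    show "(\<lambda>x. W x * dir_deriv w g (x + y)) \<in> borel_measurable lborel" using meas[OF Dg] W(1) by auto
    show "?s n \<in> borel_measurable lborel" for n using s_meas by simp
    show "integrable lborel (\<lambda>x::real^'n. indicator (cball 0 R') x * (B * C) :: real)"
      using emeasure_lborel_cball_finite[of "0::real^'n" R'] by (intro integrable_mult_left integrable_real_indicator) auto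
    show "AE x in lborel. (\<lambda>n. ?s n x) \<longlonglongrightarrow> W x * dir_deriv w g (x + y)"
    proof (rule AE_I2)
      fix x
      have "((\<lambda>t. g (x + y + t *\<^sub>R w)) has_vector_derivative dir_deriv w g (x + y)) (at 0)"
        using has_vector_derivative_dir_deriv[of g "x + y" 0 w] Cg by simp
      then have "((\<lambda>t. (g (x + y + t *\<^sub>R w) - g (x + y)) /\<^sub>R t) \<longlongrightarrow> dir_deriv w g (x + y)) (at 0)"
        unfolding has_vector_derivative_at_0_iff by simp
      then have "(\<lambda>n. (g (x + y + X n *\<^sub>R w) - g (x + y)) /\<^sub>R X n) \<longlonglongrightarrow> dir_deriv w g (x + y)"
        using X unfolding tendsto_at_iff_sequentially by (auto simp: comp_def)
      then show "(\<lambda>n. ?s n x) \<longlonglongrightarrow> W x * dir_deriv w g (x + y)" by (intro tendsto_mult tendsto_const)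
    qed
    show "AE x in lborel. norm (?s n x) \<le> indicator (cball 0 R') x * (B * C)" for n
    proof (rule AE_I2)
      fix x
      show "norm (?s n x) \<le> indicator (cball 0 R') x * (B * C)"
      proof (cases "norm x \<le> R'")
        case True
        have "norm ((g (x + y + X n *\<^sub>R w) - g (x + y)) /\<^sub>R X n) \<le> C"
          using increment_le[OF Cg C, of "x + y" "X n"] X(2)[of n]
          by (simp add: divide_simps mult.commute del: scaleR_diff_right)
        then have "norm (?s n x) \<le> B * C" unfolding norm_mult using W(2) B0 by (intro mult_mono) auto
        then show ?thesis using True by simp
      next
        case False
        have "norm (X n *\<^sub>R w) \<le> M * norm w" using M[of n] by (simp add: mult_right_mono)
        moreover have "norm x \<le> norm (x + y + X n *\<^sub>R w) + norm y + norm (X n *\<^sub>R w)"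
          using norm_triangle_ineq4[of "x + y + X n *\<^sub>R w" "y + X n *\<^sub>R w"] norm_triangle_ineq[of y "X n *\<^sub>R w"] by simp
        moreover have "norm x \<le> norm (x + y) + norm y" using norm_triangle_ineq4[of "x + y" y] by simp
        moreover have "0 \<le> M * norm w" using M0 by simp
        ultimately have "norm (x + y + X n *\<^sub>R w) > R" "norm (x + y) > R" using False unfolding R'_def by linarith+
        then show ?thesis using False R by simp
      qed
    qed
  qed
  have int: "integrable lborel (\<lambda>x. W x * g (x + z))" for z by (rule integrable_bounded_times_C_compact[OF W g])
  have quotient: "(LINT x|lborel. ?s n x) = ((LINT x|lborel. W x * g (x + y + X n *\<^sub>R w)) - (LINT x|lborel. W x * g (x + y + 0 *\<^sub>R w))) /\<^sub>R X n" for n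
  proof -
    have "(LINT x|lborel. ?s n x) = (LINT x|lborel. (W x * g (x + (y + X n *\<^sub>R w)) - W x * g (x + y)) /\<^sub>R X n)"
      by (intro Bochner_Integration.integral_cong refl) (simp add: scaleR_conv_of_real algebra_simps)
    also have "\<dots> = ((LINT x|lborel. W x * g (x + (y + X n *\<^sub>R w))) - (LINT x|lborel. W x * g (x + y))) /\<^sub>R X n"
      using int by simp
    finally show ?thesis by (simp add: add.assoc)
  qed
  from lim[unfolded quotient] show "(\<lambda>n. ((LINT x|lborel. W x * g (x + y + X n *\<^sub>R w)) - (LINT x|lborel. W x * g (x + y + 0 *\<^sub>R w))) /\<^sub>R X n)
      \<longlonglongrightarrow> (LINT x|lborel. W x * dir_deriv w g (x + y))" .
qed

lemma dir_deriv_local: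
  assumes S: "open S" "x \<in> S" and eq: "\<And>y. y \<in> S \<Longrightarrow> f y = g y"
    and g: "((\<lambda>t. g (x + t *\<^sub>R w)) has_vector_derivative D) (at 0)"
  shows "dir_deriv w f x = D"
proof -
  have "((\<lambda>t. f (x + t *\<^sub>R w)) has_vector_derivative D) (at 0)"
  proof (rule has_vector_derivative_transform_within_open[OF g])
    show "open ((\<lambda>t. x + t *\<^sub>R w) -` S)" by (intro open_vimage S continuous_intros)
  qed (use S eq in auto)
  then show ?thesis by (simp add: dir_deriv_def vector_derivative_at)
qed

text \<open>
  The family \<open>K\<close> lists the iterated derivatives of each summand, so that a function which is
  locally a combination of the summands can be differentiated without discussing its own
  regularity. The predicate \<open>P\<close> restricts the orders of differentiation.
\<close>

lemma iter_deriv_local_sum: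
  fixes \<Phi> :: "'a::real_normed_vector \<Rightarrow> complex"
  assumes S: "open S" and base: "\<And>h. h \<in> S \<Longrightarrow> \<Phi> h = (\<Sum>v\<in>V. c v * K v [] h)"
    and step: "\<And>v js j h. v \<in> V \<Longrightarrow> P (j # js) \<Longrightarrow>
      ((\<lambda>t. K v js (h + t *\<^sub>R e j)) has_vector_derivative K v (j # js) h) (at 0)"
    and P: "\<And>js j. P (j # js) \<Longrightarrow> P js" "P js" and h: "h \<in> S"
  shows "iter_deriv (map e js) \<Phi> h = (\<Sum>v\<in>V. c v * K v js h)"
  using P(2) h
proof (induction js arbitrary: h)
  case (Cons j js)
  have "dir_deriv (e j) (iter_deriv (map e js) \<Phi>) h = (\<Sum>v\<in>V. c v * K v (j # js) h)"
  proof (rule dir_deriv_local[OF S Cons.prems(2), where g = "\<lambda>y. \<Sum>v\<in>V. c v * K v js y"])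
    show "((\<lambda>t. \<Sum>v\<in>V. c v * K v js (h + t *\<^sub>R e j)) has_vector_derivative (\<Sum>v\<in>V. c v * K v (j # js) h)) (at 0)"
      using step[OF _ Cons.prems(1)] by (intro has_vector_derivative_sum has_vector_derivative_mult_right)
  qed (use Cons.IH P(1)[OF Cons.prems(1)] in auto)
  then show ?case by simp
qed (use base in simp)

section \<open>Lattice sums over the polarized cones\<close>

locale polarized_polytope = presented_polytope \<Delta> u \<mu>
  for \<Delta> :: "(real ^ 'n) set" and u :: "'d::finite \<Rightarrow> real ^ 'n" and \<mu> :: "real ^ 'd" +
  fixes \<xi> :: "real ^ 'n"
  assumes integral_polytope: "integral_polytope \<Delta>" and polarizing_vector: "polarizing \<Delta> u \<mu> \<xi>"
begin

sublocale polarized_arrangement u \<mu> "vertices \<Delta>" "edge_vec u \<mu>" act \<xi>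
  by unfold_locales (use polarizing_vector in \<open>auto simp: polarizing_def\<close>)

abbreviation flip :: "real ^ 'n \<Rightarrow> 'd set" where "flip \<equiv> flipped u \<mu> \<xi>"
abbreviation normal :: "real ^ 'n \<Rightarrow> 'd \<Rightarrow> real ^ 'n" where "normal \<equiv> normal_pol u \<mu> \<xi>"
abbreviation edge :: "real ^ 'n \<Rightarrow> 'd \<Rightarrow> real ^ 'n" where "edge \<equiv> edge_vec_pol u \<mu> \<xi>"
abbreviation cone_at :: "real ^ 'n \<Rightarrow> (real ^ 'n) set" where "cone_at \<equiv> cone_pol u \<mu> \<xi>"

lemma vertex_lattice: "v \<in> vertices \<Delta> \<Longrightarrow> v \<in> int_lattice"
  using integral_polytope by (auto simp: integral_polytope_def)

lemma flip_subset: "flip v \<subseteq> act v"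
  by (auto simp: flipped_def)

lemma lattice_basis_polarized:
  assumes v: "v \<in> vertices \<Delta>"
  shows "lattice_basis (act v) (normal v) (edge v)"
proof -
  interpret lattice_basis "act v" u "edge_vec u \<mu> v" by (rule lattice_basis_at_vertex[OF v])
  show ?thesis
  proof
    show "normal v i \<in> int_lattice" for i
      by (auto simp: normal_pol_def normal_integral int_lattice_uminus)
    show "normal v i \<bullet> edge v j = (if i = j then 1 else 0)" if "i \<in> act v" "j \<in> act v" for i j
      using edge_vec_dual[OF v that] by (auto simp: normal_pol_def edge_vec_pol_def)
    fix x
    have "x = (\<Sum>j\<in>act v. (u j \<bullet> x) *\<^sub>R edge_vec u \<mu> v j)" by (rule edge_vec_expand[OF v])
    also have "\<dots> = (\<Sum>j\<in>act v. (normal v j \<bullet> x) *\<^sub>R edge v j)"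
      by (intro sum.cong refl) (auto simp: normal_pol_def edge_vec_pol_def)
    finally show "x = (\<Sum>j\<in>act v. (normal v j \<bullet> x) *\<^sub>R edge v j)" .
  qed (use card_I in auto)
qed

lemma cone_at_iff:
  assumes v: "v \<in> vertices \<Delta>"
  shows "x \<in> cone_at v \<longleftrightarrow> (\<forall>j\<in>act v. 0 \<le> normal v j \<bullet> (x - v))"
proof -
  interpret lattice_basis "act v" "normal v" "edge v" by (rule lattice_basis_polarized[OF v])
  show ?thesis
  proof
    assume "x \<in> cone_at v"
    then obtain t where t: "x = v + (\<Sum>j\<in>act v. t j *\<^sub>R edge v j)" "\<forall>j\<in>act v. 0 \<le> t j"
      by (auto simp: cone_pol_def)
    show "\<forall>j\<in>act v. 0 \<le> normal v j \<bullet> (x - v)"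
    proof
      fix j assume "j \<in> act v"
      then show "0 \<le> normal v j \<bullet> (x - v)" using t coord_of_sum[of j t] by simp
    qed
  next
    assume *: "\<forall>j\<in>act v. 0 \<le> normal v j \<bullet> (x - v)"
    have "x = v + (\<Sum>j\<in>act v. (normal v j \<bullet> (x - v)) *\<^sub>R edge v j)"
      using expand[of "x - v"] by (simp add: algebra_simps)
    with * show "x \<in> cone_at v"
      unfolding cone_pol_def mem_Collect_eq by (intro exI[of _ "\<lambda>j. normal v j \<bullet> (x - v)"] conjI)
  qed
qed

lemma cone_at_borel:
  assumes v: "v \<in> vertices \<Delta>"
  shows "cone_at v \<in> sets borel"
proof -
  have "cone_at v = (\<Inter>j\<in>act v. {x. 0 \<le> normal v j \<bullet> (x - v)})" using cone_at_iff[OF v] by auto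
  also have "closed \<dots>" by (intro closed_INT ballI closed_Collect_le continuous_intros)
  finally show ?thesis by (rule borel_closed)
qed

lemma Box_eq_box_points:
  assumes v: "v \<in> vertices \<Delta>"
  shows "lattice_basis.Box (act v) (edge_vec u \<mu> v) = box_points (act v)"
proof -
  interpret lattice_basis "act v" u "edge_vec u \<mu> v" by (rule lattice_basis_at_vertex[OF v])
  show ?thesis unfolding Box_def by (auto simp: box_points_iff[OF v order_refl])
qed

text \<open>
  Reversing some of the normals changes the parallelepiped but not the lattice generated by the
  normals, and the number of lattice points in the parallelepiped is the index of that lattice.
\<close>

lemma card_Box_polarized:
  assumes v: "v \<in> vertices \<Delta>"
  shows "card (lattice_basis.Box (act v) (edge v)) = card (box_points (act v))"
proof -
  interpret B: lattice_basis "act v" u "edge_vec u \<mu> v" by (rule lattice_basis_at_vertex[OF v])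
  interpret P: lattice_basis "act v" "normal v" "edge v" by (rule lattice_basis_polarized[OF v])
  have "normal v j \<bullet> y \<in> \<int> \<longleftrightarrow> u j \<bullet> y \<in> \<int>" for j y by (simp add: normal_pol_def)
  then have "P.dual_lattice = B.dual_lattice" by (simp add: P.dual_lattice_def B.dual_lattice_def)
  then show ?thesis
    using P.card_dual_lattice_cube(2)[of 0] B.card_dual_lattice_cube(2)[of 0] Box_eq_box_points[OF v] by simp
qed

lemma sum_character_box_points:
  assumes v: "v \<in> vertices \<Delta>" and "\<And>j. j \<in> act v \<Longrightarrow> normal v j \<bullet> y \<in> \<int>"
  shows "(\<Sum>g\<in>box_points (act v). character g y) = (if y \<in> int_lattice then of_nat (card (box_points (act v))) else 0)"
proof -
  interpret lattice_basis "act v" u "edge_vec u \<mu> v" by (rule lattice_basis_at_vertex[OF v])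
  have "u j \<bullet> y \<in> \<int>" if "j \<in> act v" for j
    using assms(2)[OF that] by (auto simp: normal_pol_def split: if_splits)
  then show ?thesis using sum_character_Box[of y] Box_eq_box_points[OF v] by simp
qed

lemma character_edge:
  "character g (edge v j) = (if j \<in> flip v then inverse (character g (edge_vec u \<mu> v j)) else character g (edge_vec u \<mu> v j))"
  by (simp add: edge_vec_pol_def character_def cis_inverse)

lemma root_pol_coset_of:
  assumes "v \<in> vertices \<Delta>"
  shows "root_pol u \<mu> \<xi> (coset_of {v} g) j v = character g (edge v j)"
  by (simp add: root_pol_def character_edge root_vertex_coset_of[OF assms])

lemma character_power: "character g y ^ m = cis (2 * pi * (real m * (g \<bullet> y)))"
  unfolding character_def Complex.DeMoivre by (rule arg_cong[of _ _ cis]) (simp add: algebra_simps)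

text \<open>
  Two of the infinitely many multiples of \<open>g\<close> have the same reduction to the finite box. Their
  difference is a multiple of \<open>g\<close> with integral coordinates, and it gives an exponent for all
  edges at once.
\<close>

lemma character_root_of_unity:
  assumes v: "v \<in> vertices \<Delta>" and g: "g \<in> int_lattice"
  obtains N where "N > 0" "\<And>j. character g (edge_vec u \<mu> v j) ^ N = 1"
    "\<And>j. character g (edge v j) ^ N = 1"
proof -
  interpret lattice_basis "act v" u "edge_vec u \<mu> v" by (rule lattice_basis_at_vertex[OF v])
  have "range (\<lambda>m::nat. reduce (real m *\<^sub>R g)) \<subseteq> Box"
  proof (rule image_subsetI)
    fix m :: nat
    show "reduce (real m *\<^sub>R g) \<in> Box" using int_lattice_scale[OF g, of "int m"] by (intro reduce_Box) simp
  qed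
  then have "\<not> inj (\<lambda>m::nat. reduce (real m *\<^sub>R g))"
    using finite_Box finite_subset range_inj_infinite by blast
  then obtain m n :: nat where mn: "m < n" "reduce (real n *\<^sub>R g) = reduce (real m *\<^sub>R g)"
    unfolding inj_def by (metis linorder_neqE_nat)
  have pow: "character g (edge_vec u \<mu> v j) ^ (n - m) = 1" for j
  proof (cases "j \<in> act v")
    case True
    have "real (n - m) * (g \<bullet> edge_vec u \<mu> v j) \<in> \<int>"
      using reduce_eq_imp[OF mn(2) True] mn(1) by (simp add: of_nat_diff inner_diff_left left_diff_distrib)
    then show ?thesis unfolding character_power cis_2pi_eq_1_iff .
  next
    case False
    then show ?thesis by (simp add: edge_vec_outside[OF v] character_def)
  qed
  show ?thesis
  proof (rule that[of "n - m"])
    show "character g (edge v j) ^ (n - m) = 1" for j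
      using pow[of j] by (simp add: character_edge power_inverse)
  qed (use mn pow in auto)
qed

lemma heaviside_minus_eps:
  assumes "j \<in> act v"
  shows "heaviside (u j \<bullet> z) - eps v j = (if j \<in> flip v then - 1 else 1) * heaviside (normal v j \<bullet> z)"
  using assms by (auto simp: eps_def normal_pol_def flipped_def heaviside_def)

lemma prod_heaviside_minus_eps:
  "(\<Prod>j\<in>act v. heaviside (u j \<bullet> z j) - eps v j) = (-1) ^ card (flip v) * (\<Prod>j\<in>act v. heaviside (normal v j \<bullet> z j))"
proof -
  have "(\<Prod>j\<in>act v. heaviside (u j \<bullet> z j) - eps v j) =
      (\<Prod>j\<in>act v. (if j \<in> flip v then - 1 else 1) * heaviside (normal v j \<bullet> z j))"
    by (intro prod.cong refl heaviside_minus_eps)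
  also have "\<dots> = (\<Prod>j\<in>act v. if j \<in> flip v then - 1 else 1) * (\<Prod>j\<in>act v. heaviside (normal v j \<bullet> z j))"
    by (rule prod.distrib)
  also have "(\<Prod>j\<in>act v. if j \<in> flip v then - 1 else (1::real)) = (\<Prod>j\<in>flip v. - 1)"
    using flip_subset by (intro prod.mono_neutral_cong_right) auto
  finally show ?thesis by simp
qed

text \<open>
  The polar decomposition without displacement, summed over the lattice points: it also counts the
  points of the cones outside the polytope, where the terms cancel.
\<close>

lemma weighted_sum_eq_cones:
  assumes X: "finite X" "X \<subseteq> int_lattice" "\<And>x. x \<in> int_lattice \<Longrightarrow> f x \<noteq> 0 \<Longrightarrow> x \<in> X"
  shows "weighted_sum \<Delta> f = (\<Sum>v\<in>vertices \<Delta>. (-1) ^ card (flip v) *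
    (\<Sum>x\<in>X. of_real (\<Prod>j\<in>act v. heaviside (normal v j \<bullet> (x - v))) * f x))"
proof -
  obtain r where r: "small r" using ex_small by blast
  have "r > 0" using r by (simp add: small_def)
  have pointwise: "(if x \<in> \<Delta> then weight \<Delta> x else 0) =
      (\<Sum>v\<in>vertices \<Delta>. (-1) ^ card (flip v) * (\<Prod>j\<in>act v. heaviside (normal v j \<bullet> (x - v))))" for x
  proof -
    have "(if x \<in> \<Delta> then weight \<Delta> x else 0) = (\<Sum>v\<in>vertices \<Delta>. \<Prod>j\<in>act v. heaviside (slack x 0 j) - eps v j)"
      using polar_decomposition[OF r, of 0 x] \<open>r > 0\<close> by (simp add: prod_heaviside_eq_weight)
    also have "\<dots> = (\<Sum>v\<in>vertices \<Delta>. \<Prod>j\<in>act v. heaviside (u j \<bullet> (x - v)) - eps v j)"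
      by (intro sum.cong prod.cong refl arg_cong2[of _ _ _ _ "(-)"] arg_cong[of _ _ heaviside])
        (auto simp: slack_def act_iff inner_diff_right)
    finally show ?thesis by (simp add: prod_heaviside_minus_eps)
  qed
  have fin: "finite (\<Delta> \<inter> int_lattice)" by (intro finite_int_lattice_bounded compact_imp_bounded compact)
  have "weighted_sum \<Delta> f = (\<Sum>x\<in>X. of_real (if x \<in> \<Delta> then weight \<Delta> x else 0) * f x)"
    unfolding weighted_sum_def
    by (rule sum.mono_neutral_cong[OF X(1) fin]) (use X(2,3) in auto)
  also have "\<dots> = (\<Sum>x\<in>X. \<Sum>v\<in>vertices \<Delta>. (-1) ^ card (flip v) * (of_real (\<Prod>j\<in>act v. heaviside (normal v j \<bullet> (x - v))) * f x))"
    unfolding pointwise by (simp add: sum_distrib_right sum_distrib_left mult_ac)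
  also have "\<dots> = (\<Sum>v\<in>vertices \<Delta>. \<Sum>x\<in>X. (-1) ^ card (flip v) * (of_real (\<Prod>j\<in>act v. heaviside (normal v j \<bullet> (x - v))) * f x))"
    by (rule sum.swap)
  finally show ?thesis by (simp add: sum_distrib_left)
qed

end

lemma set_integral_eq_LINT:
  fixes h :: "real ^ 'n \<Rightarrow> complex"
  assumes "integrable lborel (\<lambda>x. indicator S x * h x)"
  shows "integral S h = (LINT x|lborel. indicator S x * h x)"
proof -
  have eq: "(\<lambda>x. indicator S x *\<^sub>R h x) = (\<lambda>x. indicator S x * h x)" by (auto simp: indicator_def)
  have "set_integrable lborel S h" using assms unfolding set_integrable_def eq .
  from set_borel_integral_eq_integral(2)[OF this] show ?thesis unfolding set_lebesgue_integral_def eq ..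
qed

lemma diff_op_eq_sum:
  assumes "finite A" "\<And>a. c a \<noteq> 0 \<Longrightarrow> a \<in> A"
  shows "diff_op e c f x = (\<Sum>a\<in>A. c a * multi_deriv e a f x)"
  unfolding diff_op_def by (rule sum.mono_neutral_left) (use assms in auto)

context polarized_polytope
begin

text \<open>
  The periodic factor in the integrand of the remainder, for the element of the group represented
  by \<open>g\<close>.
\<close>

definition cone_kernel :: "nat \<Rightarrow> real ^ 'n \<Rightarrow> real ^ 'n \<Rightarrow> 'd set \<Rightarrow> real ^ 'n \<Rightarrow> complex" where
  "cone_kernel k v g S x = (\<Prod>j\<in>act v - S. periodic_Q (character g (edge v j)) k (normal v j \<bullet> (x - v)))"

lemma cone_kernel_measurable [measurable]: "cone_kernel k v g S \<in> borel_measurable borel"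
  unfolding cone_kernel_def by measurable

lemma cone_kernel_bounded: "\<exists>C. \<forall>x. norm (cone_kernel k v g S x) \<le> C"
proof -
  have "\<forall>j. \<exists>C. \<forall>s. norm (periodic_Q (character g (edge v j)) k s) \<le> C"
    using bounded_periodic_Q[OF norm_character] unfolding bounded_iff by (metis rangeI)
  then obtain C where C: "\<And>j s. norm (periodic_Q (character g (edge v j)) k s) \<le> C j" by metis
  have "norm (cone_kernel k v g S x) \<le> (\<Prod>j\<in>act v - S. C j)" for x
    unfolding cone_kernel_def prod_norm[symmetric] using C by (intro prod_mono) auto
  then show ?thesis by blast
qed

lemma cone_kernel_eq:
  assumes v: "v \<in> vertices \<Delta>" and g: "g \<in> box_points (act v)" and k: "k \<ge> 1"
  shows "(\<Prod>j\<in>act v - S. Q_fun k (root_pol u \<mu> \<xi> (coset_of {v} g) j v) (normal v j \<bullet> (x - v))) = cone_kernel k v g S x"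
proof -
  have gi: "g \<in> int_lattice" using g by (simp add: box_points_def)
  obtain N where N: "N > 0" "\<And>j. character g (edge_vec u \<mu> v j) ^ N = 1" "\<And>j. character g (edge v j) ^ N = 1"
    by (rule character_root_of_unity[OF v gi]) (rule that)
  show ?thesis
    unfolding cone_kernel_def root_pol_coset_of[OF v] using Q_fun_eq_periodic_Q[OF N(1) N(3) k] by (intro prod.cong refl)
qed

lemma remainder_symbol_eq:
  assumes v: "v \<in> vertices \<Delta>" and g: "g \<in> box_points (act v)" and k: "k \<ge> 1" and S: "S \<subseteq> act v"
  shows "remainder_symbol u \<mu> k \<xi> v (coset_of {v} g) S a =
    (if a \<in> multi_idx k (act v) \<and> (\<forall>j\<in>act v - S. a j = k)
     then \<Prod>j\<in>S. (-1) ^ a j * fps_nth (M_fps (character g (edge v j))) (a j) else 0)"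
proof -
  have gi: "g \<in> int_lattice" using g by (simp add: box_points_def)
  obtain N where N: "N > 0" "\<And>j. character g (edge_vec u \<mu> v j) ^ N = 1" "\<And>j. character g (edge v j) ^ N = 1"
    by (rule character_root_of_unity[OF v gi]) (rule that)
  let ?c = "\<lambda>j. coeff (if j \<in> S then pcompose (M_poly k (root_pol u \<mu> \<xi> (coset_of {v} g) j v)) [:0, -1:]
     else if j \<in> act v then monom 1 k else 1) (a j)"
  have c: "?c j = (if j \<in> S then if a j \<le> k then (-1) ^ a j * fps_nth (M_fps (character g (edge v j))) (a j) else 0
     else if j \<in> act v then if a j = k then 1 else 0 else if a j = 0 then 1 else 0)" for j
    unfolding root_pol_coset_of[OF v]
    using M_poly_coeff[OF N(1) N(3)[of j] k, of "a j"] by (auto simp: coeff_pcompose_linear)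
  have sym: "remainder_symbol u \<mu> k \<xi> v (coset_of {v} g) S a = (\<Prod>j\<in>UNIV. ?c j)"
    by (simp add: remainder_symbol_def prod_symbol_def)
  show ?thesis
  proof (cases "a \<in> multi_idx k (act v) \<and> (\<forall>j\<in>act v - S. a j = k)")
    case True
    have "(\<Prod>j\<in>UNIV. ?c j) = (\<Prod>j\<in>S. (-1) ^ a j * fps_nth (M_fps (character g (edge v j))) (a j))"
      using True S unfolding c by (intro prod.mono_neutral_cong_right) (auto simp: multi_idx_def)
    then show ?thesis using True sym by simp
  next
    case False
    then obtain j where "(j \<in> act v \<and> a j > k) \<or> (j \<notin> act v \<and> a j \<noteq> 0) \<or> (j \<in> act v - S \<and> a j \<noteq> k)"
      by (auto simp: multi_idx_def not_le)
    then have "?c j = 0" unfolding c using S by auto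
    then have "(\<Prod>j\<in>UNIV. ?c j) = 0" by (intro prod_zero bexI[of _ j]) simp_all
    then show ?thesis using False sym by auto
  qed
qed

lemma multi_idx_sum_le:
  assumes v: "v \<in> vertices \<Delta>" and "a \<in> multi_idx k (act v)"
  shows "(\<Sum>j\<in>UNIV. a j) \<le> CARD('n) * k"
  using sum_multi_idx_le(1)[OF assms(2)] normals_basis(4)[OF v] by simp

lemma integrable_cone_kernel:
  fixes f :: "real ^ 'n \<Rightarrow> complex"
  assumes v: "v \<in> vertices \<Delta>" and f: "C_compact m f"
  shows "integrable lborel (\<lambda>x. indicator (cone_at v) x * (cone_kernel k v g S x * f x))"
proof -
  obtain C where C: "\<forall>x. norm (cone_kernel k v g S x) \<le> C" using cone_kernel_bounded by blast
  have C0: "0 \<le> C" by (rule order_trans[OF norm_ge_zero C[rule_format, of 0]])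
  let ?W = "\<lambda>x. indicator (cone_at v) x * cone_kernel k v g S x"
  have "integrable lborel (\<lambda>x. ?W x * f (x + 0))"
  proof (rule integrable_bounded_times_C_compact[OF _ _ f])
    show "?W \<in> borel_measurable borel" using cone_at_borel[OF v] by measurable
    show "norm (?W x) \<le> C" for x using C C0 by (auto simp: indicator_def)
  qed
  then show ?thesis by (simp add: mult.assoc)
qed

text \<open>
  For a proper subset \<open>S\<close> of \<open>act v\<close> this is a term of the remainder; for \<open>S = act v\<close> there is no
  periodic factor, and it is a leading term.
\<close>

definition cone_term :: "nat \<Rightarrow> real ^ 'n \<Rightarrow> (real ^ 'n) set \<Rightarrow> 'd set \<Rightarrow> (real ^ 'n \<Rightarrow> complex) \<Rightarrow> complex" where
  "cone_term k v \<gamma> S f = integral (cone_at v) (\<lambda>x.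
     (\<Prod>j\<in>act v - S. Q_fun k (root_pol u \<mu> \<xi> \<gamma> j v) (normal v j \<bullet> (x - v))) *
     diff_op (edge v) (remainder_symbol u \<mu> k \<xi> v \<gamma> S) f x)"

lemma remainder_eq:
  "remainder \<Delta> u \<mu> k \<xi> f = (\<Sum>v\<in>vertices \<Delta>. (-1) ^ card (flip v) *
     (\<Sum>\<gamma>\<in>carrier (\<Gamma> u \<mu> {v}). \<Sum>S | S \<subset> act v. (-1) ^ ((k - 1) * (CARD('n) - card S)) * cone_term k v \<gamma> S f))"
  by (simp add: remainder_def cone_term_def)

lemma cone_term_expand:
  assumes v: "v \<in> vertices \<Delta>" and g: "g \<in> box_points (act v)" and k: "k \<ge> 1" and S: "S \<subseteq> act v"
    and f: "C_compact (CARD('n) * k) f"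
  defines "c \<equiv> remainder_symbol u \<mu> k \<xi> v (coset_of {v} g) S"
  shows "cone_term k v (coset_of {v} g) S f = (\<Sum>a\<in>multi_idx k (act v). c a *
      (LINT x|lborel. indicator (cone_at v) x * (cone_kernel k v g S x * multi_deriv (edge v) a f x)))"
    and "cone_term k v (coset_of {v} g) S f = (LINT x|lborel. indicator (cone_at v) x * (cone_kernel k v g S x *
      (\<Sum>a\<in>multi_idx k (act v). c a * multi_deriv (edge v) a f x)))"
    and "integrable lborel (\<lambda>x. indicator (cone_at v) x * (cone_kernel k v g S x *
      (\<Sum>a\<in>multi_idx k (act v). c a * multi_deriv (edge v) a f x)))"
proof -
  let ?A = "multi_idx k (act v)"
  let ?h = "\<lambda>a x. indicator (cone_at v) x * (cone_kernel k v g S x * multi_deriv (edge v) a f x)"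
  have fin: "finite ?A" by (simp add: finite_multi_idx)
  have c: "a \<in> ?A" if "c a \<noteq> 0" for a
    using that unfolding c_def remainder_symbol_eq[OF v g k S] by (auto split: if_splits)
  have int: "integrable lborel (?h a)" if "a \<in> ?A" for a
  proof (rule integrable_cone_kernel[OF v])
    show "C_compact 0 (multi_deriv (edge v) a f)"
      using multi_idx_sum_le[OF v that] by (intro C_compact_multi_deriv C_compact_mono[OF _ f]) simp
  qed
  have op: "(\<Prod>j\<in>act v - S. Q_fun k (root_pol u \<mu> \<xi> (coset_of {v} g) j v) (normal v j \<bullet> (x - v))) * diff_op (edge v) c f x
      = cone_kernel k v g S x * (\<Sum>a\<in>?A. c a * multi_deriv (edge v) a f x)" for x
    unfolding cone_kernel_eq[OF v g k] by (rule arg_cong[OF diff_op_eq_sum[OF fin]]) (rule c)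
  have eq: "indicator (cone_at v) x * (cone_kernel k v g S x * (\<Sum>a\<in>?A. c a * multi_deriv (edge v) a f x)) = (\<Sum>a\<in>?A. c a * ?h a x)" for x
    by (simp add: sum_distrib_left mult_ac)
  have int': "integrable lborel (\<lambda>x. \<Sum>a\<in>?A. c a * ?h a x)"
    by (intro Bochner_Integration.integrable_sum integrable_mult_right int)
  then show 3: "integrable lborel (\<lambda>x. indicator (cone_at v) x * (cone_kernel k v g S x *
      (\<Sum>a\<in>?A. c a * multi_deriv (edge v) a f x)))" unfolding eq .
  show 2: "cone_term k v (coset_of {v} g) S f = (LINT x|lborel. indicator (cone_at v) x * (cone_kernel k v g S x *
      (\<Sum>a\<in>?A. c a * multi_deriv (edge v) a f x)))"
    unfolding cone_term_def c_def[symmetric] op by (rule set_integral_eq_LINT[OF 3])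
  show "cone_term k v (coset_of {v} g) S f = (\<Sum>a\<in>?A. c a * (LINT x|lborel. ?h a x))"
    unfolding 2 eq using int by (subst Bochner_Integration.integral_sum) auto
qed

text \<open>
  Splitting each factor of the Euler-Maclaurin kernel into its constant and its periodic part, the
  product becomes a sum over the sets \<open>S\<close> of coordinates in which the constant part is taken. In
  the other coordinates only the \<open>k\<close>-th derivative occurs.
\<close>

lemma EM_kernel_split:
  assumes v: "v \<in> vertices \<Delta>" and g: "g \<in> box_points (act v)" and k: "k \<ge> 1"
  shows "(\<Sum>a\<in>multi_idx k (act v). (\<Prod>j\<in>act v. if 0 \<le> normal v j \<bullet> (x - v)
        then EM_coeff k (character g (edge v j)) (a j) (normal v j \<bullet> (x - v)) else 0) * D a)
    = (\<Sum>S\<in>Pow (act v). (-1) ^ ((k - 1) * (CARD('n) - card S)) * (indicator (cone_at v) x * (cone_kernel k v g S x *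
        (\<Sum>a\<in>multi_idx k (act v). remainder_symbol u \<mu> k \<xi> v (coset_of {v} g) S a * D a))))"
proof (cases "x \<in> cone_at v")
  case False
  then obtain j where "j \<in> act v" "\<not> 0 \<le> normal v j \<bullet> (x - v)" using cone_at_iff[OF v] by blast
  then have zero: "(\<Prod>j\<in>act v. if 0 \<le> normal v j \<bullet> (x - v)
      then EM_coeff k (character g (edge v j)) (a j) (normal v j \<bullet> (x - v)) else 0) = 0" for a
    by (intro prod_zero bexI[of _ j]) auto
  show ?thesis unfolding zero using False by simp
next
  case True
  let ?t = "\<lambda>j. normal v j \<bullet> (x - v)" and ?\<omega> = "\<lambda>j. character g (edge v j)"
  let ?p = "\<lambda>a j. (-1) ^ a j * fps_nth (M_fps (?\<omega> j)) (a j)"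
  let ?q = "\<lambda>a j. if a j = k then (-1) ^ (k - 1) * periodic_Q (?\<omega> j) k (?t j) else 0"
  let ?c = "\<lambda>S. remainder_symbol u \<mu> k \<xi> v (coset_of {v} g) S"
  have fin: "finite (act v)" by simp
  have card: "card (act v - S) = CARD('n) - card S" if "S \<subseteq> act v" for S
    using that normals_basis(4)[OF v] by (simp add: card_Diff_subset)
  have q: "(\<Prod>j\<in>S. ?p a j) * (\<Prod>j\<in>act v - S. ?q a j)
      = (-1) ^ ((k - 1) * (CARD('n) - card S)) * (cone_kernel k v g S x * ?c S a)"
    if S: "S \<subseteq> act v" and a: "a \<in> multi_idx k (act v)" for S a
  proof (cases "\<forall>j\<in>act v - S. a j = k")
    case True
    then have "(\<Prod>j\<in>act v - S. ?q a j) = (\<Prod>j\<in>act v - S. (-1) ^ (k - 1) * periodic_Q (?\<omega> j) k (?t j))"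
      by (intro prod.cong refl) simp
    also have "\<dots> = (-1) ^ ((k - 1) * (CARD('n) - card S)) * cone_kernel k v g S x"
      by (simp add: prod.distrib cone_kernel_def card[OF S, symmetric] power_mult)
    finally show ?thesis using True a remainder_symbol_eq[OF v g k S, of a] by simp
  next
    case False
    then have "(\<Prod>j\<in>act v - S. ?q a j) = 0" by (intro prod_zero) auto
    moreover have "?c S a = 0" unfolding remainder_symbol_eq[OF v g k S] using False by (rule if_not_P[OF contrapos_nn]) (rule conjunct2)
    ultimately show ?thesis by simp
  qed
  have "(\<Prod>j\<in>act v. if 0 \<le> ?t j then EM_coeff k (?\<omega> j) (a j) (?t j) else 0) * D a
      = (\<Sum>S\<in>Pow (act v). (-1) ^ ((k - 1) * (CARD('n) - card S)) * (cone_kernel k v g S x * ?c S a) * D a)"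
    if a: "a \<in> multi_idx k (act v)" for a
  proof -
    have "(\<Prod>j\<in>act v. if 0 \<le> ?t j then EM_coeff k (?\<omega> j) (a j) (?t j) else 0) = (\<Prod>j\<in>act v. ?p a j + ?q a j)"
      using True cone_at_iff[OF v] by (intro prod.cong refl) (simp add: EM_coeff_def)
    also have "\<dots> = (\<Sum>S\<in>Pow (act v). (\<Prod>j\<in>S. ?p a j) * (\<Prod>j\<in>act v - S. ?q a j))" by (rule prod_add[OF fin])
    also have "\<dots> = (\<Sum>S\<in>Pow (act v). (-1) ^ ((k - 1) * (CARD('n) - card S)) * (cone_kernel k v g S x * ?c S a))"
      using q a by (intro sum.cong refl) simp
    finally show ?thesis by (simp only: sum_distrib_right)
  qed
  then have "(\<Sum>a\<in>multi_idx k (act v). (\<Prod>j\<in>act v. if 0 \<le> ?t j then EM_coeff k (?\<omega> j) (a j) (?t j) else 0) * D a)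
    = (\<Sum>a\<in>multi_idx k (act v). \<Sum>S\<in>Pow (act v). (-1) ^ ((k - 1) * (CARD('n) - card S)) * (cone_kernel k v g S x * ?c S a) * D a)"
    by (intro sum.cong refl)
  also have "\<dots> = (\<Sum>S\<in>Pow (act v). \<Sum>a\<in>multi_idx k (act v). (-1) ^ ((k - 1) * (CARD('n) - card S)) * (cone_kernel k v g S x * ?c S a) * D a)"
    by (rule sum.swap)
  finally show ?thesis using True by (simp add: sum_distrib_left mult_ac)
qed

lemma cone_sum_eq_cone_terms:
  assumes v: "v \<in> vertices \<Delta>" and k: "k \<ge> 1" and f: "C_compact (CARD('n) * k) f"
    and X: "finite X" "X \<subseteq> int_lattice" "\<And>x. x \<in> int_lattice \<Longrightarrow> f x \<noteq> 0 \<Longrightarrow> x \<in> X"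
  shows "(\<Sum>x\<in>X. of_real (\<Prod>j\<in>act v. heaviside (normal v j \<bullet> (x - v))) * f x) =
    (\<Sum>g\<in>box_points (act v). \<Sum>S\<in>Pow (act v). (-1) ^ ((k - 1) * (CARD('n) - card S)) * cone_term k v (coset_of {v} g) S f)"
proof (rule trans[OF cone_Euler_Maclaurin[OF lattice_basis_polarized[OF v] card_Box_polarized[OF v, symmetric]
      sum_character_box_points[OF v] k f vertex_lattice[OF v] X] sum.cong[OF refl]])
  fix g assume g: "g \<in> box_points (act v)"
  let ?h = "\<lambda>S x. indicator (cone_at v) x * (cone_kernel k v g S x *
        (\<Sum>a\<in>multi_idx k (act v). remainder_symbol u \<mu> k \<xi> v (coset_of {v} g) S a * multi_deriv (edge v) a f x))"
  have int: "integrable lborel (?h S)" if "S \<in> Pow (act v)" for S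
    using cone_term_expand(3)[OF v g k _ f, of S] that by simp
  have "(LINT x|lborel. (\<Sum>S\<in>Pow (act v). (-1) ^ ((k - 1) * (CARD('n) - card S)) * ?h S x))
     = (\<Sum>S\<in>Pow (act v). LINT x|lborel. (-1) ^ ((k - 1) * (CARD('n) - card S)) * ?h S x)"
    by (intro Bochner_Integration.integral_sum integrable_mult_right int)
  also have "\<dots> = (\<Sum>S\<in>Pow (act v). (-1) ^ ((k - 1) * (CARD('n) - card S)) * cone_term k v (coset_of {v} g) S f)"
  proof (rule sum.cong[OF refl])
    fix S assume "S \<in> Pow (act v)"
    then show "(LINT x|lborel. (-1) ^ ((k - 1) * (CARD('n) - card S)) * ?h S x)
        = (-1) ^ ((k - 1) * (CARD('n) - card S)) * cone_term k v (coset_of {v} g) S f"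
      using cone_term_expand(2)[OF v g k _ f, of S] by simp
  qed
  finally show "(LINT x|lborel. (\<Sum>a\<in>multi_idx k (act v). (\<Prod>j\<in>act v. if 0 \<le> normal v j \<bullet> (x - v)
        then EM_coeff k (character g (edge v j)) (a j) (normal v j \<bullet> (x - v)) else 0) * multi_deriv (edge v) a f x))
     = (\<Sum>S\<in>Pow (act v). (-1) ^ ((k - 1) * (CARD('n) - card S)) * cone_term k v (coset_of {v} g) S f)"
    unfolding EM_kernel_split[OF v g k] .
qed

lemma sum_group_at_vertex:
  assumes v: "v \<in> vertices \<Delta>"
  shows "(\<Sum>\<gamma>\<in>carrier (\<Gamma> u \<mu> {v}). F \<gamma>) = (\<Sum>g\<in>box_points (act v). F (coset_of {v} g))"
  unfolding Gamma_carrier[OF v order_refl]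
  by (rule sum.reindex[OF coset_of_inj[OF v order_refl], unfolded comp_def])

text \<open>
  The Euler-Maclaurin formula at the level of the cones; what remains is to recognize the leading
  terms.
\<close>

lemma weighted_sum_eq_leading_plus_remainder:
  assumes k: "k \<ge> 1" and f: "C_compact (CARD('n) * k) f"
  shows "weighted_sum \<Delta> f = (\<Sum>v\<in>vertices \<Delta>. (-1) ^ card (flip v) *
      (\<Sum>g\<in>box_points (act v). cone_term k v (coset_of {v} g) (act v) f)) + remainder \<Delta> u \<mu> k \<xi> f"
proof -
  have "compact (tsupport f)" using f by (simp add: C_compact_def)
  then have "finite (tsupport f \<inter> int_lattice)" by (intro finite_int_lattice_bounded compact_imp_bounded)
  moreover have "x \<in> tsupport f \<inter> int_lattice" if "x \<in> int_lattice" "f x \<noteq> 0" for x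
    using that zero_outside_tsupport by blast
  ultimately have X: "finite (tsupport f \<inter> int_lattice)" "tsupport f \<inter> int_lattice \<subseteq> int_lattice"
    "\<And>x. x \<in> int_lattice \<Longrightarrow> f x \<noteq> 0 \<Longrightarrow> x \<in> tsupport f \<inter> int_lattice" by blast+
  have Pow: "Pow (act v) = insert (act v) {S. S \<subset> act v}" for v by blast
  have split: "(\<Sum>S\<in>Pow (act v). (-1) ^ ((k - 1) * (CARD('n) - card S)) * F S)
      = F (act v) + (\<Sum>S | S \<subset> act v. (-1) ^ ((k - 1) * (CARD('n) - card S)) * F S)"
    if "v \<in> vertices \<Delta>" for v and F :: "'d set \<Rightarrow> complex"
    unfolding Pow using normals_basis(4)[OF that] by simp
  have "weighted_sum \<Delta> f = (\<Sum>v\<in>vertices \<Delta>. (-1) ^ card (flip v) *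
      ((\<Sum>g\<in>box_points (act v). cone_term k v (coset_of {v} g) (act v) f) +
       (\<Sum>g\<in>box_points (act v). \<Sum>S | S \<subset> act v. (-1) ^ ((k - 1) * (CARD('n) - card S)) * cone_term k v (coset_of {v} g) S f)))"
  proof (rule trans[OF weighted_sum_eq_cones[OF X] sum.cong[OF refl]])
    fix v assume v: "v \<in> vertices \<Delta>"
    have eq: "(\<Sum>S\<in>Pow (act v). (-1) ^ ((k - 1) * (CARD('n) - card S)) * cone_term k v (coset_of {v} g) S f)
      = cone_term k v (coset_of {v} g) (act v) f +
        (\<Sum>S | S \<subset> act v. (-1) ^ ((k - 1) * (CARD('n) - card S)) * cone_term k v (coset_of {v} g) S f)" for g
      by (rule split[OF v])
    show "(-1) ^ card (flip v) * (\<Sum>x\<in>tsupport f \<inter> int_lattice. of_real (\<Prod>j\<in>act v. heaviside (normal v j \<bullet> (x - v))) * f x) =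
      (-1) ^ card (flip v) * ((\<Sum>g\<in>box_points (act v). cone_term k v (coset_of {v} g) (act v) f) +
       (\<Sum>g\<in>box_points (act v). \<Sum>S | S \<subset> act v. (-1) ^ ((k - 1) * (CARD('n) - card S)) * cone_term k v (coset_of {v} g) S f))"
    proof (rule arg_cong[OF trans[OF cone_sum_eq_cone_terms[OF v k f X]]])
      have "(\<Sum>g\<in>box_points (act v). \<Sum>S\<in>Pow (act v). (-1) ^ ((k - 1) * (CARD('n) - card S)) * cone_term k v (coset_of {v} g) S f)
        = (\<Sum>g\<in>box_points (act v). cone_term k v (coset_of {v} g) (act v) f +
        (\<Sum>S | S \<subset> act v. (-1) ^ ((k - 1) * (CARD('n) - card S)) * cone_term k v (coset_of {v} g) S f))"
        by (rule sum.cong[OF refl eq])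
      also have "\<dots> = (\<Sum>g\<in>box_points (act v). cone_term k v (coset_of {v} g) (act v) f) +
        (\<Sum>g\<in>box_points (act v). \<Sum>S | S \<subset> act v. (-1) ^ ((k - 1) * (CARD('n) - card S)) * cone_term k v (coset_of {v} g) S f)"
        by (rule sum.distrib)
      finally show "(\<Sum>g\<in>box_points (act v). \<Sum>S\<in>Pow (act v). (-1) ^ ((k - 1) * (CARD('n) - card S)) * cone_term k v (coset_of {v} g) S f)
        = (\<Sum>g\<in>box_points (act v). cone_term k v (coset_of {v} g) (act v) f) +
        (\<Sum>g\<in>box_points (act v). \<Sum>S | S \<subset> act v. (-1) ^ ((k - 1) * (CARD('n) - card S)) * cone_term k v (coset_of {v} g) S f)" .
    qed
  qed
  also have "\<dots> = (\<Sum>v\<in>vertices \<Delta>. (-1) ^ card (flip v) *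
      (\<Sum>g\<in>box_points (act v). cone_term k v (coset_of {v} g) (act v) f)) + remainder \<Delta> u \<mu> k \<xi> f"
    unfolding remainder_eq distrib_left sum.distrib by (simp add: sum_group_at_vertex cong: sum.cong)
  finally show ?thesis .
qed

end

section \<open>Integrals over the displaced polytope\<close>

lemma C_compact_iter_deriv:
  assumes "C_compact (m + length ws) f"
  shows "C_compact m (iter_deriv ws f)"
proof -
  have "compact (tsupport f \<inter> tsupport (iter_deriv ws f))"
    using assms by (intro compact_Int_closed) (auto simp: C_compact_def tsupport_def)
  then show ?thesis
    using assms C_class_iter_deriv tsupport_iter_deriv[of ws f] by (auto simp: C_compact_def Int_absorb1)
qed

lemma AE_not_in_hyperplane:
  fixes a :: "real ^ 'n"
  assumes "a \<noteq> 0"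
  shows "AE x in lborel. a \<bullet> x \<noteq> b"
proof -
  let ?N = "{x. a \<bullet> x = b}"
  have "closed ?N" by (intro closed_Collect_eq continuous_intros)
  moreover have "?N \<in> null_sets lebesgue"
    using negligible_hyperplane[of a b] assms by (simp add: negligible_iff_null_sets)
  ultimately have "?N \<in> null_sets lborel" by (simp add: null_sets_completion_iff borel_closed)
  then show ?thesis using AE_not_in by force
qed

text \<open>
  Operators with a root other than 1 have no constant term; so they annihilate functions that do
  not depend on the variable in question.
\<close>

lemma M_fps_0: "fps_nth (M_fps \<omega>) 0 = (if \<omega> = 1 then 1 else 0)"
proof (cases "\<omega> = 1")
  case True
  (* The constant term is found by comparing the coefficients of X. *)
  have "fps_nth (M_fps 1 * (fps_exp 1 - fps_const 1)) 1 = fps_nth (fps_const (1/2) * fps_X * (fps_exp 1 + fps_const 1)) 1"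
    by (rule arg_cong[OF M_fps_mult])
  then have "fps_nth (M_fps 1) 0 = 1"
    by (simp add: fps_mult_nth_1 mult.assoc)
  then show ?thesis using True by simp
next
  case False
  then show ?thesis using apostol_fps_1(1)[OF False] by (simp add: M_fps_def)
qed

lemma M_poly_degree_bound:
  assumes "k \<ge> 1" "coeff (M_poly k \<omega>) m \<noteq> 0"
  shows "m \<le> k"
proof (rule ccontr)
  assume "\<not> m \<le> k"
  then have "coeff (M_poly k \<omega>) m = 0"
    using assms(1) by (auto simp: M_poly_def coeff_sum coeff_truncate_fps)
  then show False using assms(2) by simp
qed

lemma order_le_each_M_symbol:
  assumes "k \<ge> 1"
  shows "order_le_each k (M_symbol \<Delta> u \<mu> k \<gamma> F)"
  unfolding order_le_each_def
proof (intro allI impI)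
  fix a j assume "M_symbol \<Delta> u \<mu> k \<gamma> F a \<noteq> 0"
  then have "coeff (M_poly k (root_face \<Delta> u \<mu> \<gamma> j F)) (a j) \<noteq> 0"
    by (auto simp: M_symbol_def prod_symbol_def)
  then show "a j \<le> k" by (rule M_poly_degree_bound[OF assms])
qed

context polarized_polytope
begin

text \<open>
  The translation that takes the cone at \<open>v\<close> to the cone bounded by the walls displaced by \<open>h\<close>.
  The other facets do not enter, as the edge vectors at their indices are 0.
\<close>

definition displacement :: "real ^ 'n \<Rightarrow> real ^ 'd \<Rightarrow> real ^ 'n" where
  "displacement v h = (\<Sum>j\<in>UNIV. (h $ j) *\<^sub>R (- edge_vec u \<mu> v j))"

lemma inner_displacement:
  fixes h :: "real ^ 'd"
  assumes v: "v \<in> vertices \<Delta>" and j: "j \<in> act v"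
  shows "u j \<bullet> displacement v h = - (h $ j)"
proof -
  have "u j \<bullet> displacement v h = (\<Sum>i\<in>UNIV. if i = j then - (h $ j) else 0)"
    unfolding displacement_def inner_sum_right
  proof (rule sum.cong[OF refl])
    fix i
    show "u j \<bullet> ((h $ i) *\<^sub>R (- edge_vec u \<mu> v i)) = (if i = j then - (h $ j) else 0)"
      using edge_vec_dual[OF v j, of i] edge_vec_outside[OF v, of i] j by (cases "i \<in> act v") auto
  qed
  then show ?thesis by simp
qed

lemma displacement_add_axis:
  fixes h :: "real ^ 'd"
  shows "displacement v (h + t *\<^sub>R unit_vec j) = displacement v h + t *\<^sub>R (- edge_vec u \<mu> v j)"
proof -
  have "displacement v (h + t *\<^sub>R unit_vec j) = (\<Sum>i\<in>UNIV. (h $ i) *\<^sub>R (- edge_vec u \<mu> v i) + (if i = j then t *\<^sub>R (- edge_vec u \<mu> v j) else 0))"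
    unfolding displacement_def by (intro sum.cong refl) (auto simp: axis_def algebra_simps)
  also have "\<dots> = displacement v h + t *\<^sub>R (- edge_vec u \<mu> v j)"
    unfolding sum.distrib displacement_def by simp
  finally show ?thesis .
qed

lemma displacement_0: "displacement v 0 = 0"
  by (simp add: displacement_def)

text \<open>
  The iterated derivatives in \<open>h\<close> of the integral over the cone at \<open>v\<close> displaced according to \<open>h\<close>:
  the translation of the cone is moved to \<open>f\<close>. A facet that does not contain \<open>v\<close> has no influence
  on the cone.
\<close>

definition cone_deriv :: "(real ^ 'n \<Rightarrow> complex) \<Rightarrow> real ^ 'n \<Rightarrow> 'd list \<Rightarrow> real ^ 'd \<Rightarrow> complex" where
  "cone_deriv f v js h = (if set js \<subseteq> act v
     then LINT x|lborel. indicator (cone_at v) x * iter_deriv (map (\<lambda>j. - edge_vec u \<mu> v j) js) f (x + displacement v h)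
     else 0)"

text \<open>
  If each index occurs at most \<open>k\<close> times and all lie in \<open>act v\<close>, the order of differentiation of
  \<open>f\<close> is at most \<open>n k\<close>; a list with an index outside of \<open>act v\<close> may be longer, but then the
  derivative is 0.
\<close>

lemma cone_deriv_step:
  fixes h :: "real ^ 'd"
  assumes v: "v \<in> vertices \<Delta>" and f: "C_compact (CARD('n) * k) f" and le: "\<forall>i. count_list (j # js) i \<le> k"
  shows "((\<lambda>t. cone_deriv f v js (h + t *\<^sub>R unit_vec j)) has_vector_derivative cone_deriv f v (j # js) h) (at 0)"
proof (cases "set js \<subseteq> act v")
  case False
  then show ?thesis by (simp add: cone_deriv_def)
next
  case js: True
  show ?thesis
  proof (cases "j \<in> act v")
    case False
    then have "cone_deriv f v js (h + t *\<^sub>R unit_vec j) = cone_deriv f v js h" for t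
      by (simp add: cone_deriv_def displacement_add_axis edge_vec_outside[OF v])
    then show ?thesis using False by (simp add: cone_deriv_def)
  next
    case True
    let ?g = "iter_deriv (map (\<lambda>j. - edge_vec u \<mu> v j) js) f"
    have "length (j # js) = (\<Sum>i\<in>UNIV. count_list (j # js) i)" by (rule length_eq_sum_count)
    also have "\<dots> = (\<Sum>i\<in>act v. count_list (j # js) i)"
    proof (rule sum.mono_neutral_right)
      show "\<forall>i\<in>UNIV - act v. count_list (j # js) i = 0"
      proof
        fix i assume "i \<in> UNIV - act v"
        then have "i \<notin> set (j # js)" using js True by auto
        then show "count_list (j # js) i = 0" by (rule count_notin)
      qed
    qed auto
    also have "\<dots> \<le> (\<Sum>i\<in>act v. k)" using le by (intro sum_mono) blast
    also have "\<dots> = CARD('n) * k" using normals_basis(4)[OF v] by simp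
    finally have len: "Suc 0 + length (map (\<lambda>j. - edge_vec u \<mu> v j) js) \<le> CARD('n) * k" by simp
    have g: "C_compact (Suc 0) ?g" by (rule C_compact_iter_deriv[OF C_compact_mono[OF len f]])
    have W: "(indicator (cone_at v) :: real ^ 'n \<Rightarrow> complex) \<in> borel_measurable borel"
      using cone_at_borel[OF v] by (rule borel_measurable_indicator)
    have bound: "norm (indicator (cone_at v) x :: complex) \<le> 1" for x by (simp add: indicator_def)
    have "((\<lambda>t. LINT x|lborel. indicator (cone_at v) x * ?g (x + displacement v h + t *\<^sub>R (- edge_vec u \<mu> v j))) has_vector_derivative
      (LINT x|lborel. indicator (cone_at v) x * dir_deriv (- edge_vec u \<mu> v j) ?g (x + displacement v h))) (at 0)"
      by (rule has_vector_derivative_integral_translate[OF W bound g])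
    then show ?thesis using js True by (simp add: cone_deriv_def displacement_add_axis add_diff_eq)
  qed
qed

text \<open>
  For small \<open>h\<close> the polytope \<open>\<Delta>(h)\<close> is, up to a null set, the signed sum of the displaced cones:
  off the walls, the products of Heaviside functions in the polar decomposition are indicator
  functions.
\<close>

lemma integral_hpoly_eq_cones:
  fixes h :: "real ^ 'd"
  assumes r: "small r" and h: "\<forall>i. \<bar>h $ i\<bar> < r" and f: "C_compact m f"
  shows "integral (hpoly u (\<mu> + h)) f = (\<Sum>v\<in>vertices \<Delta>. (-1) ^ card (flip v) * cone_deriv f v [] h)"
proof -
  have pointwise: "(\<Prod>i\<in>UNIV. heaviside (slack x h i)) =
      (\<Sum>v\<in>vertices \<Delta>. (-1) ^ card (flip v) * (\<Prod>j\<in>act v. heaviside (normal v j \<bullet> (x - displacement v h - v))))" for x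
  proof -
    have "(\<Prod>i\<in>UNIV. heaviside (slack x h i)) = (\<Sum>v\<in>vertices \<Delta>. \<Prod>j\<in>act v. heaviside (slack x h j) - eps v j)"
      by (rule polar_decomposition[OF r h])
    also have "\<dots> = (\<Sum>v\<in>vertices \<Delta>. \<Prod>j\<in>act v. heaviside (u j \<bullet> (x - displacement v h - v)) - eps v j)"
      by (intro sum.cong prod.cong refl arg_cong2[of _ _ _ _ "(-)"] arg_cong[of _ _ heaviside])
        (auto simp: slack_def act_iff inner_diff_right inner_displacement)
    finally show ?thesis by (simp add: prod_heaviside_minus_eps)
  qed
  have unz: "u i \<noteq> 0" for i using presented by (auto simp: facet_presentation_def primitive_vec_def)
  have nnz: "normal v j \<noteq> 0" for v j using unz by (simp add: normal_pol_def)
  have AE1: "AE x in lborel. \<forall>i\<in>UNIV. u i \<bullet> x \<noteq> - (\<mu> $ i) - h $ i"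
    using AE_not_in_hyperplane[OF unz] by (intro AE_finite_allI) auto
  have AE2: "AE x in lborel. \<forall>v\<in>vertices \<Delta>. \<forall>j\<in>UNIV. normal v j \<bullet> x \<noteq> normal v j \<bullet> (displacement v h + v)"
    using AE_not_in_hyperplane[OF nnz] finite_vertices by (intro AE_finite_allI) auto
  have ind: "AE x in lborel. indicator (hpoly u (\<mu> + h)) x * f x =
      (\<Sum>v\<in>vertices \<Delta>. (-1) ^ card (flip v) * (indicator (cone_at v) (x - displacement v h) * f x))"
    using AE1 AE2
  proof eventually_elim
    fix x assume 1: "\<forall>i\<in>UNIV. u i \<bullet> x \<noteq> - (\<mu> $ i) - h $ i"
      and 2: "\<forall>v\<in>vertices \<Delta>. \<forall>j\<in>UNIV. normal v j \<bullet> x \<noteq> normal v j \<bullet> (displacement v h + v)"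
    have prod_ind: "(\<Prod>j\<in>A. heaviside (c j)) = (if \<forall>j\<in>A. 0 \<le> c j then 1 else 0)"
      if "\<And>j. j \<in> A \<Longrightarrow> c j \<noteq> 0" for A :: "'d set" and c
    proof (cases "\<forall>j\<in>A. 0 \<le> c j")
      case True
      then have "(\<Prod>j\<in>A. heaviside (c j)) = (\<Prod>j\<in>A. 1)"
        using that by (intro prod.cong refl) (force simp: heaviside_def)
      then show ?thesis using True by simp
    next
      case False
      then obtain j where "j \<in> A" "c j < 0" by (auto simp: not_le)
      then have "(\<Prod>j\<in>A. heaviside (c j)) = 0" by (intro prod_zero bexI[of _ j]) (auto simp: heaviside_def)
      then show ?thesis unfolding if_not_P[OF False] .
    qed
    have P: "(\<Prod>i\<in>UNIV. heaviside (slack x h i)) = indicator (hpoly u (\<mu> + h)) x"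
    proof -
      have "slack x h i \<noteq> 0" for i using bspec[OF 1 UNIV_I[of i]] unfolding slack_def by linarith
      then show ?thesis by (subst prod_ind) (auto simp: hpoly_def slack_def add.assoc indicator_def)
    qed
    have C: "(\<Prod>j\<in>act v. heaviside (normal v j \<bullet> (x - displacement v h - v))) = indicator (cone_at v) (x - displacement v h)"
      if v: "v \<in> vertices \<Delta>" for v
    proof -
      have "normal v j \<bullet> (x - displacement v h - v) \<noteq> 0" for j
      proof -
        have "normal v j \<bullet> x \<noteq> normal v j \<bullet> (displacement v h + v)" using 2 v by blast
        moreover have "normal v j \<bullet> (x - displacement v h - v) = normal v j \<bullet> x - normal v j \<bullet> (displacement v h + v)"
          by (simp add: inner_diff_right inner_add_right)
        ultimately show ?thesis by (simp only: right_minus_eq not_False_eq_True)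
      qed
      then show ?thesis by (subst prod_ind) (auto simp: indicator_def cone_at_iff[OF v])
    qed
    have "complex_of_real (indicator (hpoly u (\<mu> + h)) x) =
      of_real (\<Sum>v\<in>vertices \<Delta>. (-1) ^ card (flip v) * indicator (cone_at v) (x - displacement v h))"
      unfolding P[symmetric] pointwise using C by (intro arg_cong[of _ _ of_real] sum.cong refl) simp
    moreover have "complex_of_real (indicator A y) = indicator A y" for A :: "(real ^ 'n) set" and y
      by (simp add: indicator_def)
    ultimately show "indicator (hpoly u (\<mu> + h)) x * f x =
      (\<Sum>v\<in>vertices \<Delta>. (-1) ^ card (flip v) * (indicator (cone_at v) (x - displacement v h) * f x))"
      by (simp add: sum_distrib_right sum_distrib_left mult_ac)
  qed
  have fm: "f \<in> borel_measurable borel" by (rule C_compact_measurable[OF f])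
  have hm: "hpoly u (\<mu> + h) \<in> sets borel"
  proof -
    have "hpoly u (\<mu> + h) = (\<Inter>i. {x. 0 \<le> u i \<bullet> x + (\<mu> + h) $ i})" by (auto simp: hpoly_def)
    also have "closed \<dots>" by (intro closed_INT ballI closed_Collect_le continuous_intros)
    finally show ?thesis by (rule borel_closed)
  qed
  have int_ind: "integrable lborel (\<lambda>x. indicator A x * f (x + y))" if "A \<in> sets borel" for A y
    by (rule integrable_bounded_times_C_compact[OF borel_measurable_indicator[OF that] _ f, where C = 1])
      (simp add: indicator_def)
  have cm: "(\<lambda>x. indicator (cone_at v) (x - y) :: complex) \<in> borel_measurable borel" if "v \<in> vertices \<Delta>" for v y
    by (rule measurable_compose[OF _ borel_measurable_indicator[OF cone_at_borel[OF that]]]) simp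
  have int: "integrable lborel (\<lambda>x. indicator (cone_at v) (x - y) * f x)" if "v \<in> vertices \<Delta>" for v y
    using integrable_bounded_times_C_compact[OF cm[OF that] _ f, where C = 1 and y = 0] by (simp add: indicator_def)
  have translate: "(LINT x|lborel. indicator (cone_at v) (x - displacement v h) * f x) = cone_deriv f v [] h"
    if v: "v \<in> vertices \<Delta>" for v
  proof -
    have "(LINT x|lborel. indicator (cone_at v) (x - displacement v h) * f x)
      = (LINT x|lborel. indicator (cone_at v) (x + displacement v h - displacement v h) * f (x + displacement v h))"
      by (rule integral_lborel_translate[symmetric]) (intro borel_measurable_times cm[OF v] fm)
    then show ?thesis by (simp add: cone_deriv_def)
  qed
  have "integral (hpoly u (\<mu> + h)) f = (LINT x|lborel. indicator (hpoly u (\<mu> + h)) x * f x)"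
    using int_ind[OF hm, of 0] by (intro set_integral_eq_LINT) simp
  also have "\<dots> = (LINT x|lborel. (\<Sum>v\<in>vertices \<Delta>. (-1) ^ card (flip v) * (indicator (cone_at v) (x - displacement v h) * f x)))"
  proof (rule integral_cong_AE[OF _ _ ind])
    show "(\<lambda>x. indicator (hpoly u (\<mu> + h)) x * f x) \<in> borel_measurable lborel"
      using int_ind[OF hm, of 0] by (simp add: borel_measurable_integrable)
    show "(\<lambda>x. \<Sum>v\<in>vertices \<Delta>. (-1) ^ card (flip v) * (indicator (cone_at v) (x - displacement v h) * f x)) \<in> borel_measurable lborel"
      by (intro borel_measurable_integrable Bochner_Integration.integrable_sum integrable_mult_right int)
  qed
  also have "\<dots> = (\<Sum>v\<in>vertices \<Delta>. LINT x|lborel. (-1) ^ card (flip v) * (indicator (cone_at v) (x - displacement v h) * f x))"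
    by (intro Bochner_Integration.integral_sum integrable_mult_right int)
  also have "\<dots> = (\<Sum>v\<in>vertices \<Delta>. (-1) ^ card (flip v) * cone_deriv f v [] h)"
    by (rule sum.cong[OF refl]) (simp add: translate)
  finally show ?thesis .
qed

end

section \<open>The sum over the faces\<close>

context polarized_polytope
begin

text \<open>
  The derivatives along the polarized edges become derivatives along the reversed original edges,
  as they arise from \<open>h\<close>. For an edge that was not flipped the two signs \<open>(-1) ^ a j\<close> cancel; for
  a flipped edge the root is inverted and the symmetry \<open>M_fps_inverse\<close> removes the sign.
\<close>

lemma leading_cone_term:
  assumes v: "v \<in> vertices \<Delta>" and g: "g \<in> box_points (act v)" and k: "k \<ge> 1" and f: "C_compact (CARD('n) * k) f"
  shows "cone_term k v (coset_of {v} g) (act v) f = (\<Sum>a\<in>multi_idx k (act v).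
    (\<Prod>j\<in>act v. coeff (M_poly k (character g (edge_vec u \<mu> v j))) (a j)) *
    (LINT x|lborel. indicator (cone_at v) x * multi_deriv (\<lambda>j. - edge_vec u \<mu> v j) a f x))"
proof -
  have gi: "g \<in> int_lattice" using g by (simp add: box_points_def)
  obtain N where N: "N > 0" "\<And>j. character g (edge_vec u \<mu> v j) ^ N = 1" "\<And>j. character g (edge v j) ^ N = 1"
    by (rule character_root_of_unity[OF v gi]) (rule that)
  define c :: "'d \<Rightarrow> real" where "c = (\<lambda>j. if j \<in> flip v then 1 else - 1)"
  have edge: "edge v = (\<lambda>j. c j *\<^sub>R (- edge_vec u \<mu> v j))"
    by (rule ext) (simp add: c_def edge_vec_pol_def)
  let ?m = "\<lambda>j. M_fps (character g (edge v j))"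
  show ?thesis
    unfolding cone_term_expand(1)[OF v g k order_refl f]
  proof (rule sum.cong[OF refl])
    fix a assume a: "a \<in> multi_idx k (act v)"
    have Cf: "C_class (\<Sum>j\<in>UNIV. a j) f"
      by (rule C_class_mono[OF multi_idx_sum_le[OF v a]]) (use f in \<open>simp add: C_compact_def\<close>)
    have factor: "(-1) ^ a j * fps_nth (?m j) (a j) * of_real (c j ^ a j) = coeff (M_poly k (character g (edge_vec u \<mu> v j))) (a j)"
      if "j \<in> act v" for j
    proof -
      have nz: "character g (edge_vec u \<mu> v j) \<noteq> 0" by (simp add: character_def)
      have sq: "(-1) ^ a j * (z * (-1) ^ a j) = (z :: complex)" for z
        by (simp add: mult.left_commute flip: power_mult_distrib)
      have "a j \<le> k" using a that by (simp add: multi_idx_def)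
      then show ?thesis
        using M_poly_coeff[OF N(1) N(2)[of j] k, of "a j"] M_fps_inverse[OF nz, of "a j"] sq
        by (simp add: c_def character_edge mult.assoc mult.left_commute flip: power_mult_distrib)
    qed
    have outside: "(\<Prod>j\<in>UNIV. c j ^ a j) = (\<Prod>j\<in>act v. c j ^ a j)"
      using a by (intro prod.mono_neutral_right) (auto simp: multi_idx_def)
    have deriv: "multi_deriv (edge v) a f x = of_real (\<Prod>j\<in>act v. c j ^ a j) * multi_deriv (\<lambda>j. - edge_vec u \<mu> v j) a f x" for x
      unfolding edge multi_deriv_scale[OF Cf] outside ..
    have kern: "cone_kernel k v g (act v) x = 1" for x by (simp add: cone_kernel_def)
    have sym: "remainder_symbol u \<mu> k \<xi> v (coset_of {v} g) (act v) a = (\<Prod>j\<in>act v. (-1) ^ a j * fps_nth (?m j) (a j))"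
      using remainder_symbol_eq[OF v g k order_refl, of a] a by simp
    let ?I = "LINT x|lborel. indicator (cone_at v) x * multi_deriv (\<lambda>j. - edge_vec u \<mu> v j) a f x"
    have "(LINT x|lborel. indicator (cone_at v) x * (cone_kernel k v g (act v) x * multi_deriv (edge v) a f x))
      = (LINT x|lborel. of_real (\<Prod>j\<in>act v. c j ^ a j) * (indicator (cone_at v) x * multi_deriv (\<lambda>j. - edge_vec u \<mu> v j) a f x))"
      unfolding deriv kern by (rule Bochner_Integration.integral_cong[OF refl]) simp
    also have "\<dots> = of_real (\<Prod>j\<in>act v. c j ^ a j) * ?I" by (rule integral_mult_right_zero)
    finally have "remainder_symbol u \<mu> k \<xi> v (coset_of {v} g) (act v) a *
        (LINT x|lborel. indicator (cone_at v) x * (cone_kernel k v g (act v) x * multi_deriv (edge v) a f x))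
      = (\<Prod>j\<in>act v. (-1) ^ a j * fps_nth (?m j) (a j)) * (of_real (\<Prod>j\<in>act v. c j ^ a j) * ?I)"
      unfolding sym by (rule arg_cong)
    also have "\<dots> = (\<Prod>j\<in>act v. (-1) ^ a j * fps_nth (?m j) (a j) * of_real (c j ^ a j)) * ?I"
      unfolding prod.distrib of_real_prod by (simp only: mult.assoc)
    also have "(\<Prod>j\<in>act v. (-1) ^ a j * fps_nth (?m j) (a j) * of_real (c j ^ a j))
      = (\<Prod>j\<in>act v. coeff (M_poly k (character g (edge_vec u \<mu> v j))) (a j))"
      by (rule prod.cong[OF refl factor])
    finally show "remainder_symbol u \<mu> k \<xi> v (coset_of {v} g) (act v) a *
        (LINT x|lborel. indicator (cone_at v) x * (cone_kernel k v g (act v) x * multi_deriv (edge v) a f x))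
      = (\<Prod>j\<in>act v. coeff (M_poly k (character g (edge_vec u \<mu> v j))) (a j)) * ?I" .
  qed
qed

lemma multi_deriv_integral_hpoly:
  assumes f: "C_compact (CARD('n) * k) f" and a: "\<And>j. a j \<le> k"
  shows "multi_deriv unit_vec a (\<lambda>h. integral (hpoly u (\<mu> + h)) f) 0 =
    (\<Sum>v\<in>vertices \<Delta>. (-1) ^ card (flip v) * (if \<forall>j. j \<notin> act v \<longrightarrow> a j = 0
       then LINT x|lborel. indicator (cone_at v) x * multi_deriv (\<lambda>j. - edge_vec u \<mu> v j) a f x else 0))"
proof -
  obtain r where r: "small r" using ex_small by blast
  have "r > 0" using r by (simp add: small_def)
  define js where "js = (SOME js. \<forall>j. count_list js j = a j)"
  have js: "count_list js j = a j" for j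
    unfolding js_def using someI_ex[OF ex_list_count[of a]] by blast
  let ?S = "{h :: real ^ 'd. \<forall>i. \<bar>h $ i\<bar> < r}"
  have openS: "open ?S"
  proof -
    have "?S = (\<Inter>i. {h. \<bar>h $ i\<bar> < r})" by auto
    also have "open \<dots>" by (intro open_INT ballI open_Collect_less continuous_intros) auto
    finally show ?thesis .
  qed
  have "iter_deriv (map unit_vec js) (\<lambda>h. integral (hpoly u (\<mu> + h)) f) 0
    = (\<Sum>v\<in>vertices \<Delta>. (-1) ^ card (flip v) * cone_deriv f v js 0)"
  proof (rule iter_deriv_local_sum[where S = ?S and P = "\<lambda>js. \<forall>i. count_list js i \<le> k"])
    show "integral (hpoly u (\<mu> + h)) f = (\<Sum>v\<in>vertices \<Delta>. (-1) ^ card (flip v) * cone_deriv f v [] h)" if "h \<in> ?S" for h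
      using integral_hpoly_eq_cones[OF r _ f] that by simp
    show "\<forall>i. count_list js i \<le> k" if "\<forall>i. count_list (j # js) i \<le> k" for j :: 'd and js
    proof
      fix i show "count_list js i \<le> k" using spec[OF that, of i] by (auto split: if_splits)
    qed
    show "\<forall>i. count_list js i \<le> k" using a js by simp
    show "0 \<in> ?S" using \<open>r > 0\<close> by simp
  qed (use openS cone_deriv_step[OF _ f] in auto)
  also have "\<dots> = (\<Sum>v\<in>vertices \<Delta>. (-1) ^ card (flip v) * (if \<forall>j. j \<notin> act v \<longrightarrow> a j = 0
       then LINT x|lborel. indicator (cone_at v) x * multi_deriv (\<lambda>j. - edge_vec u \<mu> v j) a f x else 0))"
  proof (rule sum.cong[OF refl], rule arg_cong[where f = "(*) _"])
    fix v
    have supp: "set js \<subseteq> act v \<longleftrightarrow> (\<forall>j. j \<notin> act v \<longrightarrow> a j = 0)"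
      unfolding js[symmetric] count_list_0_iff by blast
    show "cone_deriv f v js 0 = (if \<forall>j. j \<notin> act v \<longrightarrow> a j = 0
       then LINT x|lborel. indicator (cone_at v) x * multi_deriv (\<lambda>j. - edge_vec u \<mu> v j) a f x else 0)"
      unfolding cone_deriv_def multi_deriv_def js_def[symmetric] displacement_0 add_0_right
      by (rule if_cong[OF supp refl refl])
  qed
  finally show ?thesis by (simp add: multi_deriv_def js_def)
qed

text \<open>
  Only the vertices of the face contribute: at another vertex some facet of the face is missing,
  whose variable does not move the cone, whereas the operator in this variable has no constant
  term. At a vertex of the face, the variables of the facets that do not contain the vertex
  contribute the constant term 1.
\<close>

lemma M_op_eq_cone_terms:
  assumes k: "k \<ge> 1" and f: "C_compact (CARD('n) * k) f" and J: "J \<in> face_indices" and g: "g \<in> flat_box_points J"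
  shows "M_op \<Delta> u \<mu> k (coset_of (face_at J) g) (face_at J) (\<lambda>h. integral (hpoly u (\<mu> + h)) f) 0 =
    (\<Sum>v\<in>vertices \<Delta>. if J \<subseteq> act v then (-1) ^ card (flip v) * cone_term k v (coset_of {v} g) (act v) f else 0)"
proof -
  let ?\<Phi> = "\<lambda>h. integral (hpoly u (\<mu> + h)) f"
  define root where "root = (\<lambda>j. root_face \<Delta> u \<mu> (coset_of (face_at J) g) j (face_at J))"
  define sym where "sym = M_symbol \<Delta> u \<mu> k (coset_of (face_at J) g) (face_at J)"
  have sym: "sym a = (\<Prod>j\<in>UNIV. coeff (M_poly k (root j)) (a j))" for a
    by (simp add: sym_def M_symbol_def prod_symbol_def root_def)
  have fJ: "facets_at u \<mu> (face_at J) = J" by (rule facets_at_face_at[OF J])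
  have F: "face_at J \<in> faces \<Delta>" by (rule face_at_in_faces[OF J])
  have gJ: "g \<in> box_points J" using g by (auto simp: flat_box_points_def box_points_def less_imp_le)
  have root: "root j = character g (edge_vec u \<mu> v j)" if "v \<in> vertices \<Delta>" "J \<subseteq> act v" for v j
    unfolding root_def by (rule root_face_coset_of[OF F]) (use that fJ gJ in auto)
  obtain w where w: "w \<in> vertices \<Delta>" "J \<subseteq> act w" using J by (auto simp: face_indices_def)
  have gi: "g \<in> int_lattice" using g by (simp add: flat_box_points_def)
  obtain N where N: "N > 0" "\<And>j. character g (edge_vec u \<mu> w j) ^ N = 1" "\<And>j. character g (edge w j) ^ N = 1"
    by (rule character_root_of_unity[OF w(1) gi]) (rule that)
  have coeff0: "coeff (M_poly k (root j)) 0 = (if root j = 1 then 1 else 0)" for j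
    using M_poly_coeff[OF N(1) N(2)[of j] k, of 0] by (simp add: root[OF w] M_fps_0)
  have root_ne_1: "root j \<noteq> 1" if "j \<in> J" for j
  proof -
    have "0 < g \<bullet> edge_vec u \<mu> w j \<and> g \<bullet> edge_vec u \<mu> w j < 1"
    proof -
      obtain c where c: "g = (\<Sum>j\<in>J. c j *\<^sub>R u j)" "\<forall>j\<in>J. 0 < c j \<and> c j < 1" using g by (auto simp: flat_box_points_def)
      have "j \<in> act w" using that w(2) by blast
      then have "g \<bullet> edge_vec u \<mu> w j = c j"
        using iffD1[OF span_normals_iff[OF w] c(1)] that by simp
      then show ?thesis using c(2) that by simp
    qed
    then show ?thesis unfolding root[OF w] character_eq_1_iff by (auto elim!: Ints_cases)
  qed
  let ?A = "multi_idx k (UNIV :: 'd set)"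
  have fin: "finite ?A" by (simp add: finite_multi_idx)
  have le: "a j \<le> k" if "sym a \<noteq> 0" for a j
    using order_le_each_M_symbol[OF k] that unfolding sym_def order_le_each_def by blast
  have suppA: "a \<in> ?A" if "sym a \<noteq> 0" for a using le[OF that] by (simp add: multi_idx_def)
  let ?D = "\<lambda>v a. LINT x|lborel. indicator (cone_at v) x * multi_deriv (\<lambda>j. - edge_vec u \<mu> v j) a f x"
  let ?K = "\<lambda>v a. if \<forall>j. j \<notin> act v \<longrightarrow> a j = 0 then ?D v a else 0"
  have "diff_op unit_vec sym ?\<Phi> 0 = (\<Sum>a\<in>?A. sym a * multi_deriv unit_vec a ?\<Phi> 0)"
    by (rule diff_op_eq_sum[OF fin suppA])
  also have "\<dots> = (\<Sum>a\<in>?A. sym a * (\<Sum>v\<in>vertices \<Delta>. (-1) ^ card (flip v) * ?K v a))"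
  proof (rule sum.cong[OF refl], rule arg_cong[where f = "(*) _"], rule multi_deriv_integral_hpoly[OF f])
    fix a j assume "a \<in> ?A"
    then show "a j \<le> k" by (simp add: multi_idx_def)
  qed
  also have "\<dots> = (\<Sum>a\<in>?A. \<Sum>v\<in>vertices \<Delta>. (-1) ^ card (flip v) * (sym a * ?K v a))"
    by (simp only: sum_distrib_left mult.left_commute)
  also have "\<dots> = (\<Sum>v\<in>vertices \<Delta>. (-1) ^ card (flip v) * (\<Sum>a\<in>?A. sym a * ?K v a))"
    by (subst sum.swap) (simp only: sum_distrib_left)
  also have "\<dots> = (\<Sum>v\<in>vertices \<Delta>. if J \<subseteq> act v then (-1) ^ card (flip v) * cone_term k v (coset_of {v} g) (act v) f else 0)"
  proof (rule sum.cong[OF refl])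
    fix v assume v: "v \<in> vertices \<Delta>"
    show "(-1) ^ card (flip v) * (\<Sum>a\<in>?A. sym a * ?K v a)
      = (if J \<subseteq> act v then (-1) ^ card (flip v) * cone_term k v (coset_of {v} g) (act v) f else 0)"
    proof (cases "J \<subseteq> act v")
      case False
      then obtain j where j: "j \<in> J" "j \<notin> act v" by blast
      have "sym a * ?K v a = 0" for a
      proof (cases "\<forall>j. j \<notin> act v \<longrightarrow> a j = 0")
        case True
        then have "coeff (M_poly k (root j)) (a j) = 0" using j root_ne_1[OF j(1)] coeff0[of j] by simp
        then have "sym a = 0" unfolding sym by (intro prod_zero bexI[of _ j]) auto
        then show ?thesis by simp
      qed auto
      then have zero: "(\<Sum>a\<in>?A. sym a * ?K v a) = 0" by (intro sum.neutral ballI)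
      show ?thesis unfolding zero if_not_P[OF False] by simp
    next
      case True
      have gv: "g \<in> box_points (act v)" by (rule subsetD[OF box_points_mono[OF v order_refl True] gJ])
      have "(\<Sum>a\<in>?A. sym a * ?K v a) = (\<Sum>a\<in>multi_idx k (act v). sym a * ?D v a)"
      proof (rule sum.mono_neutral_cong_right[OF fin])
        show "multi_idx k (act v) \<subseteq> ?A" by (auto simp: multi_idx_def)
        show "\<forall>a\<in>?A - multi_idx k (act v). sym a * ?K v a = 0"
        proof
          fix a assume "a \<in> ?A - multi_idx k (act v)"
          then have "\<not> (\<forall>j. j \<notin> act v \<longrightarrow> a j = 0)" by (auto simp: multi_idx_def)
          then show "sym a * ?K v a = 0" by (simp only: if_False mult_zero_right)
        qed
        show "sym a * ?K v a = sym a * ?D v a" if "a \<in> multi_idx k (act v)" for a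
          using that by (simp add: multi_idx_def)
      qed
      also have "\<dots> = cone_term k v (coset_of {v} g) (act v) f"
        unfolding leading_cone_term[OF v gv k f]
      proof (rule sum.cong[OF refl], rule arg_cong[where f = "\<lambda>z. z * _"])
        fix a assume a: "a \<in> multi_idx k (act v)"
        show "sym a = (\<Prod>j\<in>act v. coeff (M_poly k (character g (edge_vec u \<mu> v j))) (a j))"
          unfolding sym root[OF v True, symmetric]
        proof (rule prod.mono_neutral_right)
          show "\<forall>j\<in>UNIV - act v. coeff (M_poly k (root j)) (a j) = 1"
          proof
            fix j assume j: "j \<in> UNIV - act v"
            then have "root j = 1" using root[OF v True, of j] edge_vec_outside[OF v, of j] by (simp add: character_def)
            then show "coeff (M_poly k (root j)) (a j) = 1" using coeff0[of j] a j by (simp add: multi_idx_def)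
          qed
        qed auto
      qed
      finally have eq: "(\<Sum>a\<in>?A. sym a * ?K v a) = cone_term k v (coset_of {v} g) (act v) f" .
      show ?thesis unfolding eq if_P[OF True] ..
    qed
  qed
  finally show ?thesis unfolding sym_def .
qed

text \<open>
  The elements of the group of a vertex are distributed among the faces through the vertex
  according to the set of their non-zero coordinates, so that the sum over faces and their flat
  elements, sorted by the vertices at which they contribute, is the sum over all elements of the
  groups of the vertices.
\<close>

lemma sum_faces_eq_sum_vertices:
  assumes k: "k \<ge> 1" and f: "C_compact (CARD('n) * k) f"
  shows "(\<Sum>F\<in>faces \<Delta>. \<Sum>\<gamma>\<in>\<Gamma>_flat \<Delta> u \<mu> F. M_op \<Delta> u \<mu> k \<gamma> F (\<lambda>h. integral (hpoly u (\<mu> + h)) f) 0) =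
    (\<Sum>v\<in>vertices \<Delta>. (-1) ^ card (flip v) * (\<Sum>g\<in>box_points (act v). cone_term k v (coset_of {v} g) (act v) f))"
proof -
  let ?M = "\<lambda>F \<gamma>. M_op \<Delta> u \<mu> k \<gamma> F (\<lambda>h. integral (hpoly u (\<mu> + h)) f) 0"
  let ?T = "\<lambda>v g. (-1) ^ card (flip v) * cone_term k v (coset_of {v} g) (act v) f"
  have face: "(\<Sum>\<gamma>\<in>\<Gamma>_flat \<Delta> u \<mu> (face_at J). ?M (face_at J) \<gamma>)
      = (\<Sum>v\<in>vertices \<Delta>. if J \<subseteq> act v then \<Sum>g\<in>flat_box_points J. ?T v g else 0)" if J: "J \<in> face_indices" for J
  proof -
    obtain w where w: "w \<in> vertices \<Delta>" "J \<subseteq> act w" using J by (auto simp: face_indices_def)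
    have fJ: "facets_at u \<mu> (face_at J) = J" by (rule facets_at_face_at[OF J])
    have "inj_on (coset_of (face_at J)) (box_points J)" using coset_of_inj[OF w(1), of "face_at J"] w(2) fJ by simp
    moreover have "flat_box_points J \<subseteq> box_points J" by (auto simp: flat_box_points_def box_points_def less_imp_le)
    ultimately have inj: "inj_on (coset_of (face_at J)) (flat_box_points J)" by (rule inj_on_subset)
    have "(\<Sum>\<gamma>\<in>\<Gamma>_flat \<Delta> u \<mu> (face_at J). ?M (face_at J) \<gamma>) = (\<Sum>g\<in>flat_box_points J. ?M (face_at J) (coset_of (face_at J) g))"
      unfolding Gamma_flat_eq[OF J] by (rule sum.reindex[OF inj, unfolded comp_def])
    also have "\<dots> = (\<Sum>g\<in>flat_box_points J. \<Sum>v\<in>vertices \<Delta>. if J \<subseteq> act v then ?T v g else 0)"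
      by (rule sum.cong[OF refl M_op_eq_cone_terms[OF k f J]])
    also have "\<dots> = (\<Sum>v\<in>vertices \<Delta>. \<Sum>g\<in>flat_box_points J. if J \<subseteq> act v then ?T v g else 0)" by (rule sum.swap)
    also have "\<dots> = (\<Sum>v\<in>vertices \<Delta>. if J \<subseteq> act v then \<Sum>g\<in>flat_box_points J. ?T v g else 0)"
      by (rule sum.cong[OF refl]) auto
    finally show ?thesis .
  qed
  have "(\<Sum>F\<in>faces \<Delta>. \<Sum>\<gamma>\<in>\<Gamma>_flat \<Delta> u \<mu> F. ?M F \<gamma>) = (\<Sum>J\<in>face_indices. \<Sum>\<gamma>\<in>\<Gamma>_flat \<Delta> u \<mu> (face_at J). ?M (face_at J) \<gamma>)"
    by (rule sum.reindex_bij_betw[OF faces_bij, symmetric])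
  also have "\<dots> = (\<Sum>J\<in>face_indices. \<Sum>v\<in>vertices \<Delta>. if J \<subseteq> act v then \<Sum>g\<in>flat_box_points J. ?T v g else 0)"
    by (rule sum.cong[OF refl face])
  also have "\<dots> = (\<Sum>v\<in>vertices \<Delta>. \<Sum>J\<in>face_indices. if J \<subseteq> act v then \<Sum>g\<in>flat_box_points J. ?T v g else 0)" by (rule sum.swap)
  also have "\<dots> = (\<Sum>v\<in>vertices \<Delta>. \<Sum>g\<in>box_points (act v). ?T v g)"
  proof (rule sum.cong[OF refl])
    fix v assume v: "v \<in> vertices \<Delta>"
    let ?s = "\<lambda>g. {j \<in> act v. g \<bullet> edge_vec u \<mu> v j \<noteq> 0}"
    have flat: "flat_box_points J = {g \<in> box_points (act v). ?s g = J}" if "J \<in> Pow (act v)" for J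
      using flat_box_points_iff[OF v, of J] that by auto
    have "(\<Sum>J\<in>face_indices. if J \<subseteq> act v then \<Sum>g\<in>flat_box_points J. ?T v g else 0) = (\<Sum>J\<in>Pow (act v). \<Sum>g\<in>flat_box_points J. ?T v g)"
      using v by (intro sum.mono_neutral_cong_right) (auto simp: face_indices_def)
    also have "\<dots> = (\<Sum>J\<in>Pow (act v). \<Sum>g\<in>{g \<in> box_points (act v). ?s g = J}. ?T v g)"
      by (rule sum.cong[OF refl]) (simp only: flat)
    also have "\<dots> = (\<Sum>g\<in>box_points (act v). ?T v g)"
      by (rule sum.group) (auto simp: finite_box_points[OF v order_refl])
    finally show "(\<Sum>J\<in>face_indices. if J \<subseteq> act v then \<Sum>g\<in>flat_box_points J. ?T v g else 0) = (\<Sum>g\<in>box_points (act v). ?T v g)" .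
  qed
  finally show ?thesis by (simp only: sum_distrib_left)
qed

theorem Euler_Maclaurin_polytope:
  assumes "k \<ge> 1" "C_compact (CARD('n) * k) f"
  shows "weighted_sum \<Delta> f =
     (\<Sum>F\<in>faces \<Delta>. \<Sum>\<gamma>\<in>\<Gamma>_flat \<Delta> u \<mu> F. M_op \<Delta> u \<mu> k \<gamma> F (\<lambda>h. integral (hpoly u (\<mu> + h)) f) 0)
     + remainder \<Delta> u \<mu> k \<xi> f"
  unfolding sum_faces_eq_sum_vertices[OF assms] by (rule weighted_sum_eq_leading_plus_remainder[OF assms])

end

section \<open>Properties of the remainder\<close>

lemma iter_deriv_lincomb:
  fixes f g :: "'a::euclidean_space \<Rightarrow> complex"
  assumes "C_class (length ws) f" "C_class (length ws) g"
  shows "iter_deriv ws (\<lambda>x. c * f x + d * g x) = (\<lambda>x. c * iter_deriv ws f x + d * iter_deriv ws g x)"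
  using assms
proof (induction ws)
  case (Cons w ws)
  have "C_class (Suc 0) (iter_deriv ws h)" if "C_class (length (w # ws)) h" for h :: "'a \<Rightarrow> complex"
    by (rule C_class_iter_deriv) (use that in \<open>simp del: C_class.simps\<close>)
  then have diff: "iter_deriv ws f differentiable (at x)" "iter_deriv ws g differentiable (at x)" for x
    using Cons.prems by (simp_all add: C_class.simps(2))
  have prev: "C_class (length ws) f" "C_class (length ws) g"
    by (rule C_class_mono[OF _ Cons.prems(1)], simp, rule C_class_mono[OF _ Cons.prems(2)], simp)
  show ?case
    unfolding iter_deriv.simps Cons.IH[OF prev] by (rule ext) (rule dir_deriv_lincomb[OF diff])
qed simp

lemma multi_deriv_lincomb:
  fixes f g :: "'a::euclidean_space \<Rightarrow> complex"
  assumes "C_class (\<Sum>j\<in>UNIV. a j) f" "C_class (\<Sum>j\<in>UNIV. a j) g"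
  shows "multi_deriv e a (\<lambda>x. c * f x + d * g x) = (\<lambda>x. c * multi_deriv e a f x + d * multi_deriv e a g x)"
proof -
  define js where "js = (SOME js. \<forall>j. count_list js j = a j)"
  have "count_list js j = a j" for j
    unfolding js_def using someI_ex[OF ex_list_count[of a]] by blast
  then have len: "length (map e js) = (\<Sum>j\<in>UNIV. a j)" by (simp add: length_eq_sum_count)
  show ?thesis
    unfolding multi_deriv_def js_def[symmetric] by (rule iter_deriv_lincomb) (simp_all only: len assms)
qed

lemma C_compact_lincomb:
  assumes "C_compact m f" "C_compact m g"
  shows "C_compact m (\<lambda>x. c * f x + d * g x)"
proof -
  have "tsupport (\<lambda>x. c * f x + d * g x) \<subseteq> tsupport f \<union> tsupport g"
    unfolding tsupport_def closure_Un[symmetric] by (rule closure_mono) auto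
  then have "tsupport (\<lambda>x. c * f x + d * g x) = (tsupport f \<union> tsupport g) \<inter> tsupport (\<lambda>x. c * f x + d * g x)" by blast
  moreover have "compact \<dots>"
    using assms by (intro compact_Int_closed compact_Un) (auto simp: C_compact_def tsupport_def)
  ultimately show ?thesis using assms C_class_lincomb by (auto simp: C_compact_def)
qed

lemma lattice_periodic_scale: "lattice_periodic p \<Longrightarrow> lattice_periodic (\<lambda>x. c * p x)"
  by (force simp: lattice_periodic_def)

lemma bounded_range_scale:
  fixes p :: "'a \<Rightarrow> complex"
  assumes "bounded (range p)"
  shows "bounded (range (\<lambda>x. c * p x))"
proof -
  obtain C where "\<And>x. norm (p x) \<le> C" using assms by (auto simp: bounded_iff)
  then have "norm (c * p x) \<le> norm c * C" for x by (simp add: norm_mult mult_left_mono)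
  then show ?thesis by (auto simp: bounded_iff)
qed

context polarized_polytope
begin

type_synonym 'm summand = "(real ^ 'm) \<times> (real ^ 'm \<Rightarrow> complex) \<times> ('m \<Rightarrow> nat)"

definition admissible :: "nat \<Rightarrow> 'n summand \<Rightarrow> bool" where
  "admissible k = (\<lambda>(w, p, a). w \<in> vertices \<Delta> \<and> bounded (range p) \<and> p \<in> borel_measurable borel \<and> lattice_periodic p \<and>
     k \<le> (\<Sum>j\<in>UNIV. a j) \<and> (\<Sum>j\<in>UNIV. a j) \<le> k * CARD('n))"

definition summand_value :: "'n summand \<Rightarrow> (real ^ 'n \<Rightarrow> complex) \<Rightarrow> complex" where
  "summand_value = (\<lambda>(w, p, a) f. integral (cone_at w) (\<lambda>x. p x * multi_deriv unit_vec a f x))"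

text \<open>
  Functionals with a representation as in the description of the remainder. Lists make the closure
  under finite sums a matter of concatenation.
\<close>

definition representable :: "nat \<Rightarrow> ((real ^ 'n \<Rightarrow> complex) \<Rightarrow> complex) \<Rightarrow> bool" where
  "representable k T \<longleftrightarrow> (\<exists>xs. (\<forall>s\<in>set xs. admissible k s) \<and>
     (\<forall>f. C_compact (CARD('n) * k) f \<longrightarrow> T f = (\<Sum>s\<leftarrow>xs. summand_value s f)))"

lemma representable_cong:
  assumes "representable k T'" "\<And>f. C_compact (CARD('n) * k) f \<Longrightarrow> T f = T' f"
  shows "representable k T"
proof -
  obtain xs where "\<forall>s\<in>set xs. admissible k s" "\<forall>f. C_compact (CARD('n) * k) f \<longrightarrow> T' f = (\<Sum>s\<leftarrow>xs. summand_value s f)"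
    using assms(1) unfolding representable_def by blast
  then show ?thesis unfolding representable_def using assms(2) by (intro exI[of _ xs]) simp
qed

lemma representable_0: "representable k (\<lambda>f. 0)"
  unfolding representable_def by (intro exI[of _ "[]"]) simp

lemma representable_add:
  assumes "representable k T" "representable k T'"
  shows "representable k (\<lambda>f. T f + T' f)"
proof -
  obtain xs where xs: "\<forall>s\<in>set xs. admissible k s" "\<forall>f. C_compact (CARD('n) * k) f \<longrightarrow> T f = (\<Sum>s\<leftarrow>xs. summand_value s f)"
    using assms(1) unfolding representable_def by blast
  obtain ys where ys: "\<forall>s\<in>set ys. admissible k s" "\<forall>f. C_compact (CARD('n) * k) f \<longrightarrow> T' f = (\<Sum>s\<leftarrow>ys. summand_value s f)"
    using assms(2) unfolding representable_def by blast
  show ?thesis unfolding representable_def using xs ys by (intro exI[of _ "xs @ ys"]) auto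
qed

lemma representable_sum:
  assumes "\<And>i. i \<in> A \<Longrightarrow> representable k (T i)"
  shows "representable k (\<lambda>f. \<Sum>i\<in>A. T i f)"
  using assms
proof (induction A rule: infinite_finite_induct)
  case (insert i A)
  then show ?case using representable_add[of k "T i" "\<lambda>f. \<Sum>i\<in>A. T i f"] by simp
qed (simp_all add: representable_0)

lemma representable_scale:
  assumes "representable k T"
  shows "representable k (\<lambda>f. c * T f)"
proof -
  obtain xs where xs: "\<forall>s\<in>set xs. admissible k s" "\<forall>f. C_compact (CARD('n) * k) f \<longrightarrow> T f = (\<Sum>s\<leftarrow>xs. summand_value s f)"
    using assms unfolding representable_def by blast
  let ?m = "\<lambda>(w, p, a). (w, (\<lambda>x. c * p x), a)"
  have val: "summand_value (?m s) f = c * summand_value s f" for s f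
    by (cases s) (simp add: summand_value_def mult.assoc)
  have adm: "admissible k (?m s)" if "admissible k s" for s
    using that by (cases s) (auto simp: admissible_def lattice_periodic_scale bounded_range_scale)
  show ?thesis unfolding representable_def
  proof (intro exI[of _ "map ?m xs"] conjI allI impI)
    show "\<forall>s\<in>set (map ?m xs). admissible k s" using xs(1) adm by auto
    fix f :: "real ^ 'n \<Rightarrow> complex" assume "C_compact (CARD('n) * k) f"
    then have "c * T f = c * (\<Sum>s\<leftarrow>xs. summand_value s f)" using xs(2) by simp
    also have "\<dots> = (\<Sum>s\<leftarrow>xs. summand_value (?m s) f)" unfolding val by (rule sum_list_const_mult[symmetric])
    finally show "c * T f = (\<Sum>s\<leftarrow>map ?m xs. summand_value s f)" by (simp add: comp_def)
  qed
qed

lemma representable_summand: "admissible k s \<Longrightarrow> representable k (summand_value s)"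
  unfolding representable_def by (intro exI[of _ "[s]"]) simp

text \<open>
  A common period of the characters that occur is a period in each coordinate of the cone, so the
  multiples of the edge vectors by this number generate a lattice of periods.
\<close>

lemma cone_kernel_periodic:
  assumes v: "v \<in> vertices \<Delta>" and g: "g \<in> box_points (act v)"
  shows "lattice_periodic (cone_kernel k v g S)"
proof -
  interpret lattice_basis "act v" "normal v" "edge v" by (rule lattice_basis_polarized[OF v])
  have gi: "g \<in> int_lattice" using g by (simp add: box_points_def)
  obtain N where N: "N > 0" "\<And>j. character g (edge_vec u \<mu> v j) ^ N = 1" "\<And>j. character g (edge v j) ^ N = 1"
    by (rule character_root_of_unity[OF v gi]) (rule that)
  let ?B = "(\<lambda>j. real N *\<^sub>R edge v j) ` act v"
  have span: "span ?B = UNIV"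
  proof (intro equalityI subsetI UNIV_I)
    fix x
    have "(\<Sum>j\<in>act v. ((normal v j \<bullet> x) / real N) *\<^sub>R (real N *\<^sub>R edge v j)) \<in> span ?B"
      by (intro span_sum span_scale span_base imageI)
    also have "(\<Sum>j\<in>act v. ((normal v j \<bullet> x) / real N) *\<^sub>R (real N *\<^sub>R edge v j)) = x"
      using N(1) expand[of x] by simp
    finally show "x \<in> span ?B" .
  qed
  have "independent ?B"
  proof (rule card_le_dim_spanning[of _ UNIV])
    have "card ?B \<le> card (act v)" by (rule card_image_le) simp
    then show "card ?B \<le> dim (UNIV :: (real ^ 'n) set)" using card_I by simp
  qed (use span in auto)
  moreover have "cone_kernel k v g S (x + b) = cone_kernel k v g S x" if b: "b \<in> ?B" for x b
  proof -
    obtain i where i: "i \<in> act v" "b = real N *\<^sub>R edge v i" using b by blast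
    have "periodic_Q (character g (edge v j)) k (normal v j \<bullet> (x + b - v)) = periodic_Q (character g (edge v j)) k (normal v j \<bullet> (x - v))"
      if "j \<in> act v" for j
    proof -
      have "normal v j \<bullet> (x + b - v) = normal v j \<bullet> (x - v) + (if j = i then real N else 0)"
        using dual[OF that i(1)] i(2) by (simp add: inner_diff_right inner_add_right)
      then show ?thesis
        using periodic_Q_add_of_nat[of "character g (edge v j)" k "normal v j \<bullet> (x - v)" N] N(3)[of j]
        by (auto simp: character_def)
    qed
    then show ?thesis unfolding cone_kernel_def by (intro prod.cong refl) auto
  qed
  ultimately show ?thesis unfolding lattice_periodic_def using span by blast
qed

text \<open>
  The derivative along the edges is expanded in partial derivatives. An index that is
  differentiated \<open>k\<close> times makes the order at least \<open>k\<close>.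
\<close>

lemma representable_cone_integral:
  assumes v: "v \<in> vertices \<Delta>" and g: "g \<in> box_points (act v)" and a: "a \<in> multi_idx k (act v)"
    and j: "j \<in> act v" "a j = k"
  shows "representable k (\<lambda>f. LINT x|lborel. indicator (cone_at v) x * (cone_kernel k v g S x * multi_deriv (edge v) a f x))"
proof -
  define js where "js = (SOME js. \<forall>j. count_list js j = a j)"
  have "count_list js j = a j" for j
    unfolding js_def using someI_ex[OF ex_list_count[of a]] by blast
  then have len: "length (map (edge v) js) = (\<Sum>j\<in>UNIV. a j)" by (simp add: length_eq_sum_count)
  obtain B :: "('n \<Rightarrow> nat) set" and c where B: "finite B" "\<forall>b\<in>B. (\<Sum>j\<in>UNIV. b j) = length (map (edge v) js)"
      "\<forall>f. C_class (length (map (edge v) js)) f \<longrightarrow>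
        iter_deriv (map (edge v) js) f = (\<lambda>x. \<Sum>b\<in>B. c b * multi_deriv unit_vec b f x)"
    using iter_deriv_expand[of "map (edge v) js"] by (elim exE conjE) (rule that)
  have le: "(\<Sum>j\<in>UNIV. a j) \<le> CARD('n) * k" by (rule multi_idx_sum_le[OF v a])
  have ge: "k \<le> (\<Sum>j\<in>UNIV. a j)" using member_le_sum[of j UNIV a] j(2) by simp
  have adm: "admissible k (v, cone_kernel k v g S, b)" if "b \<in> B" for b
  proof -
    have "(\<Sum>j\<in>UNIV. b j) = (\<Sum>j\<in>UNIV. a j)" using B(2) that len by simp
    moreover have "bounded (range (cone_kernel k v g S))" using cone_kernel_bounded by (auto simp: bounded_iff)
    ultimately show ?thesis
      using v le ge cone_kernel_periodic[OF v g] by (simp add: admissible_def mult.commute)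
  qed
  show ?thesis
  proof (rule representable_cong)
    show "representable k (\<lambda>f. \<Sum>b\<in>B. c b * summand_value (v, cone_kernel k v g S, b) f)"
      by (intro representable_sum representable_scale representable_summand adm)
  next
    fix f :: "real ^ 'n \<Rightarrow> complex" assume f: "C_compact (CARD('n) * k) f"
    let ?h = "\<lambda>b x. indicator (cone_at v) x * (cone_kernel k v g S x * multi_deriv unit_vec b f x)"
    have "C_class (length (map (edge v) js)) f"
      unfolding len by (rule C_class_mono[OF le]) (use f in \<open>simp add: C_compact_def\<close>)
    then have "iter_deriv (map (edge v) js) f = (\<lambda>x. \<Sum>b\<in>B. c b * multi_deriv unit_vec b f x)" using B(3) by blast
    then have md: "multi_deriv (edge v) a f = (\<lambda>x. \<Sum>b\<in>B. c b * multi_deriv unit_vec b f x)"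
      by (simp only: multi_deriv_def js_def)
    have int: "integrable lborel (?h b)" if "b \<in> B" for b
    proof (rule integrable_cone_kernel[OF v])
      have "(\<Sum>j\<in>UNIV. b j) = (\<Sum>j\<in>UNIV. a j)" using B(2) that len by simp
      then show "C_compact 0 (multi_deriv unit_vec b f)"
        using le by (intro C_compact_multi_deriv C_compact_mono[OF _ f]) simp
    qed
    have "(LINT x|lborel. indicator (cone_at v) x * (cone_kernel k v g S x * multi_deriv (edge v) a f x))
      = (LINT x|lborel. (\<Sum>b\<in>B. c b * ?h b x))"
      unfolding md by (rule Bochner_Integration.integral_cong[OF refl]) (simp add: sum_distrib_left mult_ac)
    also have "\<dots> = (\<Sum>b\<in>B. LINT x|lborel. c b * ?h b x)"
      by (intro Bochner_Integration.integral_sum integrable_mult_right int)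
    also have "\<dots> = (\<Sum>b\<in>B. c b * summand_value (v, cone_kernel k v g S, b) f)"
      by (rule sum.cong[OF refl]) (simp add: summand_value_def set_integral_eq_LINT[OF int])
    finally show "(LINT x|lborel. indicator (cone_at v) x * (cone_kernel k v g S x * multi_deriv (edge v) a f x))
      = (\<Sum>b\<in>B. c b * summand_value (v, cone_kernel k v g S, b) f)" .
  qed
qed

text \<open>
  Each set \<open>S\<close> in the remainder omits an index, which carries the \<open>k\<close>-th derivative.
\<close>

lemma representable_remainder:
  assumes k: "k \<ge> 1"
  shows "representable k (remainder \<Delta> u \<mu> k \<xi>)"
proof -
  have each: "representable k (cone_term k v (coset_of {v} g) S)"
    if v: "v \<in> vertices \<Delta>" and g: "g \<in> box_points (act v)" and S: "S \<subset> act v" for v g S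
  proof (rule representable_cong[OF _ cone_term_expand(1)[OF v g k]])
    let ?c = "remainder_symbol u \<mu> k \<xi> v (coset_of {v} g) S"
    show S': "S \<subseteq> act v" using S by blast
    show "representable k (\<lambda>f. \<Sum>a\<in>multi_idx k (act v). ?c a *
      (LINT x|lborel. indicator (cone_at v) x * (cone_kernel k v g S x * multi_deriv (edge v) a f x)))"
    proof (rule representable_sum)
      fix a assume a: "a \<in> multi_idx k (act v)"
      obtain j where j: "j \<in> act v" "j \<notin> S" using S by blast
      show "representable k (\<lambda>f. ?c a *
        (LINT x|lborel. indicator (cone_at v) x * (cone_kernel k v g S x * multi_deriv (edge v) a f x)))"
      proof (cases "a j = k")
        case True
        show ?thesis by (rule representable_scale[OF representable_cone_integral[OF v g a j(1) True]])
      next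
        case False
        then have "?c a = 0" unfolding remainder_symbol_eq[OF v g k S'] using j by (intro if_not_P) blast
        then show ?thesis by (simp add: representable_0)
      qed
    qed
  qed
  have eq: "remainder \<Delta> u \<mu> k \<xi> = (\<lambda>f. \<Sum>v\<in>vertices \<Delta>. (-1) ^ card (flip v) *
     (\<Sum>g\<in>box_points (act v). \<Sum>S | S \<subset> act v. (-1) ^ ((k - 1) * (CARD('n) - card S)) * cone_term k v (coset_of {v} g) S f))"
    unfolding remainder_eq by (intro ext sum.cong refl arg_cong[where f = "(*) _"] sum_group_at_vertex)
  show ?thesis
    unfolding eq by (intro representable_sum representable_scale) (simp add: each)
qed

lemma integrable_summand:
  assumes s: "admissible k (w, p, a)" and f: "C_compact (CARD('n) * k) f"
  shows "integrable lborel (\<lambda>x. indicator (cone_at w) x * (p x * multi_deriv unit_vec a f x))"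
proof -
  obtain C where C: "\<And>x. norm (p x) \<le> C" using s by (auto simp: admissible_def bounded_iff)
  have C0: "0 \<le> C" by (rule order_trans[OF norm_ge_zero C[of 0]])
  have w: "w \<in> vertices \<Delta>" and p: "p \<in> borel_measurable borel" and le: "(\<Sum>j\<in>UNIV. a j) \<le> CARD('n) * k"
    using s by (auto simp: admissible_def mult.commute)
  have D: "C_compact 0 (multi_deriv unit_vec a f)"
    using le by (intro C_compact_multi_deriv C_compact_mono[OF _ f]) simp
  have W: "(\<lambda>x. indicator (cone_at w) x * p x) \<in> borel_measurable borel"
    by (intro borel_measurable_times borel_measurable_indicator cone_at_borel[OF w] p)
  have bound: "norm (indicator (cone_at w) x * p x) \<le> C" for x using C C0 by (simp add: indicator_def)
  show ?thesis using integrable_bounded_times_C_compact[OF W bound D, of 0] by (simp add: mult.assoc)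
qed

lemma summand_value_lincomb:
  assumes s: "admissible k s" and f: "C_compact (CARD('n) * k) f" and g: "C_compact (CARD('n) * k) g"
  shows "summand_value s (\<lambda>x. c * f x + d * g x) = c * summand_value s f + d * summand_value s g"
proof -
  obtain w p a where s_eq: "s = (w, p, a)" by (cases s)
  have adm: "admissible k (w, p, a)" using s s_eq by simp
  let ?h = "\<lambda>f x. indicator (cone_at w) x * (p x * multi_deriv unit_vec a f x)"
  have val: "summand_value s f = (LINT x|lborel. ?h f x)" if "C_compact (CARD('n) * k) f" for f
    unfolding s_eq summand_value_def prod.case by (rule set_integral_eq_LINT[OF integrable_summand[OF adm that]])
  have le: "(\<Sum>j\<in>UNIV. a j) \<le> CARD('n) * k" using adm by (simp add: admissible_def mult.commute)
  have C: "C_class (\<Sum>j\<in>UNIV. a j) f" "C_class (\<Sum>j\<in>UNIV. a j) g"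
    by (rule C_class_mono[OF le], use f in \<open>simp add: C_compact_def\<close>,
        rule C_class_mono[OF le], use g in \<open>simp add: C_compact_def\<close>)
  have "?h (\<lambda>x. c * f x + d * g x) = (\<lambda>x. c * ?h f x + d * ?h g x)"
    unfolding multi_deriv_lincomb[OF C] by (rule ext) (simp add: algebra_simps)
  then have "summand_value s (\<lambda>x. c * f x + d * g x) = (LINT x|lborel. c * ?h f x + d * ?h g x)"
    unfolding val[OF C_compact_lincomb[OF f g]] by (rule arg_cong)
  also have "\<dots> = (LINT x|lborel. c * ?h f x) + (LINT x|lborel. d * ?h g x)"
    by (intro Bochner_Integration.integral_add integrable_mult_right integrable_summand[OF adm] f g)
  finally show ?thesis by (simp add: val[OF f] val[OF g])
qed

lemma summand_value_bound:
  assumes s: "admissible k (w, p, a)" and K: "compact K"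
  obtains C where "0 \<le> C" "\<And>f. C_compact (CARD('n) * k) f \<Longrightarrow> tsupport f \<subseteq> K \<Longrightarrow>
    norm (summand_value (w, p, a) f) \<le> C * (SUP x. norm (multi_deriv unit_vec a f x))"
proof -
  obtain P where P: "\<And>x. norm (p x) \<le> P" using s by (auto simp: admissible_def bounded_iff)
  have P0: "0 \<le> P" by (rule order_trans[OF norm_ge_zero P[of 0]])
  obtain R where R: "\<And>x. x \<in> K \<Longrightarrow> norm x \<le> R" using compact_imp_bounded[OF K] by (auto simp: bounded_iff)
  let ?\<beta> = "measure lborel (cball (0 :: real ^ 'n) R)"
  show ?thesis
  proof (rule that[of "?\<beta> * P"])
    show "0 \<le> ?\<beta> * P" using P0 by simp
    fix f assume f: "C_compact (CARD('n) * k) f" and supp: "tsupport f \<subseteq> K"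
    let ?D = "multi_deriv unit_vec a f"
    let ?h = "\<lambda>x. indicator (cone_at w) x * (p x * ?D x)"
    define M where "M = (SUP x. norm (?D x))"
    have "C_compact 0 ?D"
      using s by (intro C_compact_multi_deriv C_compact_mono[OF _ f]) (simp add: admissible_def mult.commute)
    then obtain B where "\<And>x. norm (?D x) \<le> B" using C_compact_bounded by blast
    then have "bdd_above (range (\<lambda>x. norm (?D x)))" by (auto simp: bdd_above_def)
    then have M: "norm (?D x) \<le> M" for x unfolding M_def by (intro cSUP_upper) auto
    have point: "norm (?h x) \<le> indicator (cball 0 R) x * (P * M)" for x
    proof (cases "x \<in> cball 0 R")
      case True
      have "norm (?h x) \<le> norm (p x) * norm (?D x)" by (simp add: indicator_def norm_mult)
      also have "\<dots> \<le> P * M" using P M P0 by (intro mult_mono) auto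
      finally show ?thesis using True by simp
    next
      case False
      then have "x \<notin> tsupport f" using R supp by auto
      then have "?D x = 0" by (rule multi_deriv_zero_outside)
      then show ?thesis using False by simp
    qed
    have int: "integrable lborel ?h" by (rule integrable_summand[OF s f])
    have intb: "integrable lborel (\<lambda>x::real ^ 'n. indicator (cball 0 R) x * (P * M) :: real)"
      using emeasure_lborel_cball_finite[of "0::real^'n" R] by (intro integrable_mult_left integrable_real_indicator) auto
    have "summand_value (w, p, a) f = (LINT x|lborel. ?h x)"
      unfolding summand_value_def prod.case by (rule set_integral_eq_LINT[OF int])
    also have "norm \<dots> \<le> (LINT x|lborel. norm (?h x))" by (rule integral_norm_bound)
    also have "\<dots> \<le> (LINT x::real ^ 'n|lborel. indicator (cball 0 R) x * (P * M))"
      by (rule Bochner_Integration.integral_mono[OF integrable_norm[OF int] intb]) (rule point)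
    also have "\<dots> = ?\<beta> * P * M" by simp
    finally show "norm (summand_value (w, p, a) f) \<le> ?\<beta> * P * (SUP x. norm (?D x))" unfolding M_def .
  qed
qed

lemma distribution_representable:
  assumes "representable k T"
  shows "distribution T"
proof -
  obtain xs where xs: "\<forall>s\<in>set xs. admissible k s" "\<forall>f. C_compact (CARD('n) * k) f \<longrightarrow> T f = (\<Sum>s\<leftarrow>xs. summand_value s f)"
    using assms unfolding representable_def by blast
  have test: "C_compact (CARD('n) * k) \<phi>" if "test_function \<phi>" for \<phi> :: "real ^ 'n \<Rightarrow> complex"
    using that unfolding test_function_def by blast
  have lin: "T (\<lambda>x. c * \<phi> x + d * \<psi> x) = c * T \<phi> + d * T \<psi>" if \<phi>: "test_function \<phi>" and \<psi>: "test_function \<psi>" for \<phi> \<psi> c d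
  proof -
    have "T (\<lambda>x. c * \<phi> x + d * \<psi> x) = (\<Sum>s\<leftarrow>xs. summand_value s (\<lambda>x. c * \<phi> x + d * \<psi> x))"
      using xs(2) C_compact_lincomb[OF test[OF \<phi>] test[OF \<psi>]] by simp
    also have "\<dots> = (\<Sum>s\<leftarrow>xs. c * summand_value s \<phi> + d * summand_value s \<psi>)"
    proof (rule arg_cong[where f = sum_list], rule map_cong[OF refl])
      fix s assume "s \<in> set xs"
      then have "admissible k s" using xs(1) by blast
      then show "summand_value s (\<lambda>x. c * \<phi> x + d * \<psi> x) = c * summand_value s \<phi> + d * summand_value s \<psi>"
        by (rule summand_value_lincomb[OF _ test[OF \<phi>] test[OF \<psi>]])
    qed
    also have "\<dots> = c * T \<phi> + d * T \<psi>"
      using xs(2) test[OF \<phi>] test[OF \<psi>] by (simp add: sum_list_addf sum_list_const_mult)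
    finally show ?thesis .
  qed
  let ?s = "\<lambda>a (\<phi> :: real ^ 'n \<Rightarrow> complex). SUP x. norm (multi_deriv unit_vec a \<phi> x)"
  let ?A = "{a :: 'n \<Rightarrow> nat. (\<Sum>i\<in>UNIV. a i) \<le> k * CARD('n)}"
  have finA: "finite ?A"
  proof (rule finite_subset)
    show "?A \<subseteq> multi_idx (k * CARD('n)) UNIV"
    proof
      fix a assume "a \<in> ?A"
      then have "a i \<le> k * CARD('n)" for i using member_le_sum[of i UNIV a] by (simp add: order_trans)
      then show "a \<in> multi_idx (k * CARD('n)) UNIV" by (simp add: multi_idx_def)
    qed
  qed (simp add: finite_multi_idx)
  have sup_nonneg: "0 \<le> ?s a \<phi>" if "test_function \<phi>" for a \<phi>
  proof -
    have "C_compact 0 (multi_deriv unit_vec a \<phi>)"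
      using that by (intro C_compact_multi_deriv) (simp add: test_function_def)
    then obtain B where "\<And>x. norm (multi_deriv unit_vec a \<phi> x) \<le> B" using C_compact_bounded by blast
    then have "bdd_above (range (\<lambda>x. norm (multi_deriv unit_vec a \<phi> x)))" by (auto simp: bdd_above_def)
    then show ?thesis by (intro cSUP_upper2[of _ _ 0]) auto
  qed
  have bound: "\<exists>C. 0 \<le> C \<and> (\<forall>\<phi>. test_function \<phi> \<longrightarrow> tsupport \<phi> \<subseteq> K \<longrightarrow>
      norm (\<Sum>s\<leftarrow>ys. summand_value s \<phi>) \<le> C * (\<Sum>a\<in>?A. ?s a \<phi>))"
    if K: "compact K" and "\<forall>s\<in>set ys. admissible k s" for K ys
    using that(2)
  proof (induction ys)
    case Nil
    then show ?case by (intro exI[of _ 0]) simp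
  next
    case (Cons s ys)
    obtain w p a where s: "s = (w, p, a)" by (cases s)
    have adm: "admissible k (w, p, a)" using Cons.prems s by simp
    obtain C where C: "0 \<le> C" "\<And>f. C_compact (CARD('n) * k) f \<Longrightarrow> tsupport f \<subseteq> K \<Longrightarrow> norm (summand_value (w, p, a) f) \<le> C * ?s a f"
      by (rule summand_value_bound[OF adm K]) (rule that)
    have "\<forall>s\<in>set ys. admissible k s" using Cons.prems by simp
    from Cons.IH[OF this] obtain C' where C': "0 \<le> C'" "\<forall>\<phi>. test_function \<phi> \<longrightarrow> tsupport \<phi> \<subseteq> K \<longrightarrow>
      norm (\<Sum>s\<leftarrow>ys. summand_value s \<phi>) \<le> C' * (\<Sum>a\<in>?A. ?s a \<phi>)" by blast
    show ?case
    proof (intro exI[of _ "C + C'"] conjI allI impI)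
      show "0 \<le> C + C'" using C(1) C'(1) by simp
      fix \<phi> assume \<phi>: "test_function \<phi>" "tsupport \<phi> \<subseteq> K"
      have "?s a \<phi> \<le> (\<Sum>a\<in>?A. ?s a \<phi>)"
      proof (rule member_le_sum)
        show "a \<in> ?A" using adm by (simp add: admissible_def)
      qed (use finA sup_nonneg[OF \<phi>(1)] in auto)
      then have "C * ?s a \<phi> \<le> C * (\<Sum>a\<in>?A. ?s a \<phi>)" using C(1) by (rule mult_left_mono)
      moreover have "norm (summand_value s \<phi>) \<le> C * ?s a \<phi>" unfolding s by (rule C(2)[OF test[OF \<phi>(1)] \<phi>(2)])
      moreover have "norm (\<Sum>s\<leftarrow>ys. summand_value s \<phi>) \<le> C' * (\<Sum>a\<in>?A. ?s a \<phi>)" using C'(2) \<phi> by blast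
      moreover have "norm (\<Sum>s\<leftarrow>s # ys. summand_value s \<phi>) \<le> norm (summand_value s \<phi>) + norm (\<Sum>s\<leftarrow>ys. summand_value s \<phi>)"
        by (simp add: norm_triangle_ineq)
      ultimately show "norm (\<Sum>s\<leftarrow>s # ys. summand_value s \<phi>) \<le> (C + C') * (\<Sum>a\<in>?A. ?s a \<phi>)"
        unfolding distrib_right by linarith
    qed
  qed
  show ?thesis
    unfolding distribution_def
  proof (intro conjI allI impI)
    show "T (\<lambda>x. \<phi> x + \<psi> x) = T \<phi> + T \<psi>" if "test_function \<phi>" "test_function \<psi>" for \<phi> \<psi>
      using lin[OF that, of 1 1] by simp
    show "T (\<lambda>x. c * \<phi> x) = c * T \<phi>" if "test_function \<phi>" for c \<phi>
      using lin[OF that that, of c 0] by simp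
    fix K :: "(real ^ 'n) set" assume K: "compact K"
    obtain C where C: "\<forall>\<phi>. test_function \<phi> \<longrightarrow> tsupport \<phi> \<subseteq> K \<longrightarrow>
      norm (\<Sum>s\<leftarrow>xs. summand_value s \<phi>) \<le> C * (\<Sum>a\<in>?A. ?s a \<phi>)" using bound[OF K xs(1)] by blast
    show "\<exists>C m. \<forall>\<phi>. test_function \<phi> \<longrightarrow> tsupport \<phi> \<subseteq> K \<longrightarrow> norm (T \<phi>) \<le> C * (\<Sum>a | (\<Sum>i\<in>UNIV. a i) \<le> m. ?s a \<phi>)"
    proof (intro exI allI impI)
      fix \<phi> assume \<phi>: "test_function \<phi>" "tsupport \<phi> \<subseteq> K"
      have "T \<phi> = (\<Sum>s\<leftarrow>xs. summand_value s \<phi>)" using xs(2) test[OF \<phi>(1)] by blast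
      then show "norm (T \<phi>) \<le> C * (\<Sum>a\<in>?A. ?s a \<phi>)" using C \<phi> by simp
    qed
  qed
qed

text \<open>
  Both other members of the Euler-Maclaurin formula vanish: by compactness the support of \<open>f\<close> also
  avoids \<open>\<Delta>(h)\<close> for all small \<open>h\<close>, so the integral is identically 0 near \<open>h = 0\<close>.
\<close>

lemma remainder_zero_off_polytope:
  assumes k: "k \<ge> 1" and f: "C_compact (CARD('n) * k) f" and disj: "tsupport f \<inter> \<Delta> = {}"
  shows "remainder \<Delta> u \<mu> k \<xi> f = 0"
proof -
  have cpt: "compact (tsupport f)" using f by (simp add: C_compact_def)
  have f0: "f x = 0" if "x \<in> \<Delta>" for x using that disj zero_outside_tsupport[of x f] by blast
  then have W: "weighted_sum \<Delta> f = 0" unfolding weighted_sum_def by (intro sum.neutral ballI) simp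
  let ?U = "\<lambda>m::nat. {x. \<exists>i. u i \<bullet> x + \<mu> $ i < - (1 / real (Suc m))}"
  have openU: "open (?U m)" for m
  proof -
    have "?U m = (\<Union>i. {x. u i \<bullet> x + \<mu> $ i < - (1 / real (Suc m))})" by auto
    also have "open \<dots>" by (intro open_UN ballI open_Collect_less continuous_intros)
    finally show ?thesis .
  qed
  have cover: "tsupport f \<subseteq> (\<Union>m\<in>UNIV. ?U m)"
  proof
    fix x assume "x \<in> tsupport f"
    then have "x \<notin> \<Delta>" using disj by blast
    then obtain i where "u i \<bullet> x + \<mu> $ i < 0" by (auto simp: Delta_iff not_le)
    then obtain m where "inverse (real (Suc m)) < - (u i \<bullet> x + \<mu> $ i)" using reals_Archimedean[of "- (u i \<bullet> x + \<mu> $ i)"] by auto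
    then have "u i \<bullet> x + \<mu> $ i < - (1 / real (Suc m))" by (simp add: divide_inverse)
    then show "x \<in> (\<Union>m\<in>UNIV. ?U m)" by blast
  qed
  obtain M where M0: "M \<subseteq> UNIV" and M: "finite M" "tsupport f \<subseteq> (\<Union>m\<in>M. ?U m)"
    by (rule compactE_image[OF cpt openU cover]) (rule that)
  (* The open sets increase with m, so the largest index of a finite subcover suffices. *)
  define m where "m = Max (insert 0 M)"
  have sub: "tsupport f \<subseteq> ?U m"
  proof
    fix x assume "x \<in> tsupport f"
    then obtain l i where l: "l \<in> M" "u i \<bullet> x + \<mu> $ i < - (1 / real (Suc l))" using M(2) by blast
    have "l \<le> m" unfolding m_def using l(1) M(1) by simp
    then have "1 / real (Suc m) \<le> 1 / real (Suc l)" by (simp add: divide_left_mono)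
    then have "u i \<bullet> x + \<mu> $ i < - (1 / real (Suc m))" using l(2) by linarith
    then show "x \<in> ?U m" by blast
  qed
  let ?r = "1 / real (Suc m)"
  have \<Phi>0: "integral (hpoly u (\<mu> + h)) f = 0" if h: "\<forall>i. \<bar>h $ i\<bar> < ?r" for h :: "real ^ 'd"
  proof -
    have "f x = 0" if x: "x \<in> hpoly u (\<mu> + h)" for x
    proof -
      have "x \<notin> ?U m"
      proof
        assume "x \<in> ?U m"
        then obtain i where "u i \<bullet> x + \<mu> $ i < - ?r" by blast
        moreover have "0 \<le> u i \<bullet> x + (\<mu> $ i + h $ i)" using x by (simp add: hpoly_def)
        moreover have "\<bar>h $ i\<bar> < ?r" using h by blast
        ultimately show False by linarith
      qed
      then show ?thesis using sub zero_outside_tsupport[of x f] by blast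
    qed
    then have "integral (hpoly u (\<mu> + h)) f = integral (hpoly u (\<mu> + h)) (\<lambda>x. 0)"
      by (rule Henstock_Kurzweil_Integration.integral_cong)
    then show ?thesis by simp
  qed
  let ?S = "{h :: real ^ 'd. \<forall>i. \<bar>h $ i\<bar> < ?r}"
  have openS: "open ?S"
  proof -
    have "?S = (\<Inter>i. {h. \<bar>h $ i\<bar> < ?r})" by auto
    also have "open \<dots>" by (intro open_INT ballI open_Collect_less continuous_intros) auto
    finally show ?thesis .
  qed
  have zero_in: "0 \<in> ?S" by simp
  have "iter_deriv (map unit_vec js) (\<lambda>h. integral (hpoly u (\<mu> + h)) f) 0 = 0" for js :: "'d list"
  proof -
    have "iter_deriv (map unit_vec js) (\<lambda>h. integral (hpoly u (\<mu> + h)) f) 0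
      = (\<Sum>v\<in>{}. 0 * (\<lambda>v js h. 0) (v :: unit) js (0 :: real ^ 'd))"
      by (rule iter_deriv_local_sum[OF openS, where P = "\<lambda>_. True"]) (use \<Phi>0 zero_in in auto)
    then show ?thesis by simp
  qed
  then have "M_op \<Delta> u \<mu> k \<gamma> F (\<lambda>h. integral (hpoly u (\<mu> + h)) f) 0 = 0" for \<gamma> F
    unfolding diff_op_def multi_deriv_def by simp
  then show ?thesis using Euler_Maclaurin_polytope[OF k f] W by simp
qed

end

lemma (in polarized_polytope) remainder_representation:
  assumes k: "k \<ge> 1"
  shows "\<exists>(m::nat) (w :: nat \<Rightarrow> real ^ 'n) (p :: nat \<Rightarrow> real ^ 'n \<Rightarrow> complex) (a :: nat \<Rightarrow> 'n \<Rightarrow> nat).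
      (\<forall>i<m. w i \<in> vertices \<Delta> \<and>
             bounded (range (p i)) \<and> p i \<in> borel_measurable borel \<and> lattice_periodic (p i) \<and>
             k \<le> (\<Sum>j\<in>UNIV. a i j) \<and> (\<Sum>j\<in>UNIV. a i j) \<le> k * CARD('n)) \<and>
      (\<forall>f. C_compact (CARD('n) * k) f \<longrightarrow>
         remainder \<Delta> u \<mu> k \<xi> f = (\<Sum>i<m. integral (cone_at (w i)) (\<lambda>x. p i x * multi_deriv unit_vec (a i) f x)))"
proof -
  obtain xs where xs: "\<forall>s\<in>set xs. admissible k s"
    "\<forall>f. C_compact (CARD('n) * k) f \<longrightarrow> remainder \<Delta> u \<mu> k \<xi> f = (\<Sum>s\<leftarrow>xs. summand_value s f)"
    using representable_remainder[OF k] unfolding representable_def by blast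
  let ?w = "\<lambda>i. fst (xs ! i)" and ?p = "\<lambda>i. fst (snd (xs ! i))" and ?a = "\<lambda>i. snd (snd (xs ! i))"
  show ?thesis
  proof (intro exI conjI allI impI)
    fix i assume "i < length xs"
    then have "admissible k (?w i, ?p i, ?a i)" using xs(1) by simp
    then show "?w i \<in> vertices \<Delta>" "bounded (range (?p i))" "?p i \<in> borel_measurable borel" "lattice_periodic (?p i)"
      "k \<le> (\<Sum>j\<in>UNIV. ?a i j)" "(\<Sum>j\<in>UNIV. ?a i j) \<le> k * CARD('n)"
      by (simp_all add: admissible_def case_prod_beta)
  next
    fix f :: "real ^ 'n \<Rightarrow> complex" assume "C_compact (CARD('n) * k) f"
    then have "remainder \<Delta> u \<mu> k \<xi> f = (\<Sum>i<length xs. summand_value (xs ! i) f)"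
      using xs(2) by (simp add: sum_list_sum_nth atLeast0LessThan)
    also have "\<dots> = (\<Sum>i<length xs. integral (cone_at (?w i)) (\<lambda>x. ?p i x * multi_deriv unit_vec (?a i) f x))"
      by (simp add: summand_value_def case_prod_beta)
    finally show "remainder \<Delta> u \<mu> k \<xi> f = (\<Sum>i<length xs. integral (cone_at (?w i)) (\<lambda>x. ?p i x * multi_deriv unit_vec (?a i) f x))" .
  qed
qed

lemma (in polarized_polytope) remainder_support:
  assumes k: "k \<ge> 1"
  shows "distribution_support (remainder \<Delta> u \<mu> k \<xi>) \<subseteq> \<Delta>"
proof -
  have "remainder \<Delta> u \<mu> k \<xi> \<phi> = 0" if "test_function \<phi>" "tsupport \<phi> \<subseteq> - \<Delta>" for \<phi>
    using that by (intro remainder_zero_off_polytope k) (auto simp: test_function_def)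
  moreover have "open (- \<Delta>)" using compact compact_imp_closed by blast
  ultimately show ?thesis unfolding distribution_support_def by blast
qed

theorem theorem2:
  fixes \<Delta> :: "(real ^ 'n) set"
    and u :: "'d::finite \<Rightarrow> real ^ 'n"
    and \<mu> :: "real ^ 'd"
    and k :: nat
    and \<xi> :: "real ^ 'n"
  assumes "simple_polytope \<Delta>"
    and "integral_polytope \<Delta>"
    and "facet_presentation \<Delta> u \<mu>"
    and "k \<ge> 1"
    and "polarizing \<Delta> u \<mu> \<xi>"
  shows "(\<forall>f. C_compact (CARD('n) * k) f \<longrightarrow>
            weighted_sum \<Delta> f =
              (\<Sum>F\<in>faces \<Delta>. \<Sum>\<gamma>\<in>\<Gamma>_flat \<Delta> u \<mu> F.
                 M_op \<Delta> u \<mu> k \<gamma> F (\<lambda>h. integral (hpoly u (\<mu> + h)) f) 0)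
              + remainder \<Delta> u \<mu> k \<xi> f)
       \<and> (\<forall>F\<in>faces \<Delta>. \<forall>\<gamma>\<in>carrier (\<Gamma> u \<mu> F). order_le_each k (M_symbol \<Delta> u \<mu> k \<gamma> F))
       \<and> (\<exists>(m::nat) (w :: nat \<Rightarrow> real ^ 'n) (p :: nat \<Rightarrow> real ^ 'n \<Rightarrow> complex) (a :: nat \<Rightarrow> 'n \<Rightarrow> nat).
            (\<forall>i<m. w i \<in> vertices \<Delta> \<and>
                   bounded (range (p i)) \<and> p i \<in> borel_measurable borel \<and> lattice_periodic (p i) \<and>
                   k \<le> (\<Sum>j\<in>UNIV. a i j) \<and> (\<Sum>j\<in>UNIV. a i j) \<le> k * CARD('n)) \<and>
            (\<forall>f. C_compact (CARD('n) * k) f \<longrightarrow>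
               remainder \<Delta> u \<mu> k \<xi> f =
                 (\<Sum>i<m. integral (cone_pol u \<mu> \<xi> (w i))
                    (\<lambda>x. p i x * multi_deriv unit_vec (a i) f x))))
       \<and> (\<forall>\<xi>'. polarizing \<Delta> u \<mu> \<xi>' \<longrightarrow>
            (\<forall>f. C_compact (CARD('n) * k) f \<longrightarrow>
               remainder \<Delta> u \<mu> k \<xi>' f = remainder \<Delta> u \<mu> k \<xi> f))
       \<and> distribution (remainder \<Delta> u \<mu> k \<xi>)
       \<and> distribution_support (remainder \<Delta> u \<mu> k \<xi>) \<subseteq> \<Delta>
       \<and> (\<forall>f. C_compact (CARD('n) * k) f \<longrightarrow> tsupport f \<inter> \<Delta> = {} \<longrightarrow>
            remainder \<Delta> u \<mu> k \<xi> f = 0)"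
proof -
  have polarized: "polarized_polytope \<Delta> u \<mu> \<xi>'" if "polarizing \<Delta> u \<mu> \<xi>'" for \<xi>'
    using assms that by unfold_locales
  interpret polarized_polytope \<Delta> u \<mu> \<xi> by (rule polarized[OF assms(5)])
  have independent: "remainder \<Delta> u \<mu> k \<xi>' f = remainder \<Delta> u \<mu> k \<xi> f"
    if \<xi>': "polarizing \<Delta> u \<mu> \<xi>'" and f: "C_compact (CARD('n) * k) f" for \<xi>' f
    using Euler_Maclaurin_polytope[OF assms(4) f]
      polarized_polytope.Euler_Maclaurin_polytope[OF polarized[OF \<xi>'] assms(4) f] by simp
  show ?thesis
    using Euler_Maclaurin_polytope[OF assms(4)] order_le_each_M_symbol[OF assms(4)]
      remainder_representation[OF assms(4)] independent distribution_representable[OF representable_remainder[OF assms(4)]]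
      remainder_support[OF assms(4)] remainder_zero_off_polytope[OF assms(4)]
    by (intro conjI allI impI ballI)
qed

end
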